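(* For given initial data, the system $$D_t r + r\,G^{ij}\partial_i v_j + r a_1 v^i\partial_i r = 0,\qquad D_t v_i + a_2\,\partial_i r = 0 \qquad \text{in } \Omega=\bigcup_{0\le t<T}\{t\}\times\Omega_t$$ admits at most one solution $(r,v)$ in the class $$ v\in C^1_x,\qquad \nabla r\in \tilde C^{\frac12}_x .$$
   Context: Fix an integer $d\ge 1$ and a real number $\kappa>0$. Latin indices run over $1,\dots,d$, are raised and lowered with the Euclidean metric $\delta$, and repeated indices are summed. For $r\ge 0$ and $v=(v^1,\dots,v^d)\in\mathbb{R}^d$ set $$\langle r\rangle = 1+\frac{\kappa r}{\kappa+1},\quad |v|^2=v^iv_i,\quad v^0=\sqrt{\langle r\rangle^{2+\frac2\kappa}+|v|^2},\quad a_0=1-\kappa r\frac{|v|^2}{(v^0)^2},$$ $$G^{ij}=\frac{\kappa\langle r\rangle}{a_0v^0}\Big(\delta^{ij}-\frac{v^iv^j}{(v^0)^2}\Big),\quad a_1=-\frac{2\kappa\langle r\rangle^{2+\frac2\kappa}}{(v^0)^3a_0},\quad a_2=\frac{\langle r\rangle^{1+\frac2\kappa}}{v^0}.$$ The material derivative is $D_t=\partial_t+\frac{v^i}{v^0}\partial_i$. The unknowns are a scalar function $r(t,x)$ and a vector field $v(t,x)\in\mathbb{R}^d$; the moving domain is $\Omega_t=\{x\in\mathbb{R}^d : r(t,x)>0\}$ with boundary $\Gamma_t$ (the free boundary). It is assumed throughout that the squared sound speed satisfies $0\le \kappa r<1$. A solution on $[0,T)$ always means a pair $(r,v)$ satisfying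 the two equations in $\Omega$ and the physical vacuum boundary condition $r(t,x)\approx \mathrm{dist}(x,\Gamma_t)$ in $\Omega_t$. The space $\tilde C^{1/2}_x$ is defined by the seminorm $$\|f\|_{\tilde C^{1/2}}=\sup_{x,y\in\Omega_t}\frac{|f(x)-f(y)|}{r(x)^{1/2}+r(y)^{1/2}+|x-y|^{1/2}} .$$ "At most one solution" means that two solutions in this class on the same time interval with the same initial data (hence the same initial domain) coincide. *)

theory Defs
  imports "HOL-Analysis.Analysis"
begin

text \<open>
  The spatial dimension \<open>d \<ge> 1\<close> is the cardinality of the finite index type \<open>'d\<close>.  Indices are
  lowered with the Euclidean metric, so \<open>v\<^sub>i\<close> and \<open>v\<^sup>i\<close> are both the component \<open>v $ i\<close>.
  In the coefficients below, \<open>r\<close> and \<open>v\<close> are the values of the unknowns at one point.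
\<close>

definition ang :: "real \<Rightarrow> real \<Rightarrow> real" where
  "ang \<kappa> r = 1 + \<kappa> * r / (\<kappa> + 1)"

text \<open>The component \<open>v\<^sup>0\<close> of the velocity.\<close>

definition vel0 :: "real \<Rightarrow> real \<Rightarrow> real ^ 'd \<Rightarrow> real" where
  "vel0 \<kappa> r v = sqrt (ang \<kappa> r powr (2 + 2 / \<kappa>) + (norm v)\<^sup>2)"

definition coeff_a0 :: "real \<Rightarrow> real \<Rightarrow> real ^ 'd \<Rightarrow> real" where
  "coeff_a0 \<kappa> r v = 1 - \<kappa> * r * ((norm v)\<^sup>2 / (vel0 \<kappa> r v)\<^sup>2)"

definition coeff_G :: "real \<Rightarrow> real \<Rightarrow> real ^ 'd \<Rightarrow> 'd \<Rightarrow> 'd \<Rightarrow> real" where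
  "coeff_G \<kappa> r v i j =
     \<kappa> * ang \<kappa> r / (coeff_a0 \<kappa> r v * vel0 \<kappa> r v)
       * ((if i = j then 1 else 0) - v $ i * v $ j / (vel0 \<kappa> r v)\<^sup>2)"

definition coeff_a1 :: "real \<Rightarrow> real \<Rightarrow> real ^ 'd \<Rightarrow> real" where
  "coeff_a1 \<kappa> r v =
     - (2 * \<kappa> * ang \<kappa> r powr (2 + 2 / \<kappa>) / ((vel0 \<kappa> r v) ^ 3 * coeff_a0 \<kappa> r v))"

definition coeff_a2 :: "real \<Rightarrow> real \<Rightarrow> real ^ 'd \<Rightarrow> real" where
  "coeff_a2 \<kappa> r v = ang \<kappa> r powr (1 + 2 / \<kappa>) / vel0 \<kappa> r v"

definition partial_deriv :: "'d \<Rightarrow> (real ^ 'd \<Rightarrow> 'b::real_normed_vector) \<Rightarrow> real ^ 'd \<Rightarrow> 'b" where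
  "partial_deriv i f x = frechet_derivative f (at x) (axis i 1)"

definition grad :: "(real ^ 'd \<Rightarrow> real) \<Rightarrow> real ^ 'd \<Rightarrow> real ^ 'd" where
  "grad f x = (\<chi> i. partial_deriv i f x)"

text \<open>The time derivative on \<open>[0,T)\<close>, which is one-sided at \<open>t = 0\<close>.\<close>

definition time_deriv ::
  "real \<Rightarrow> (real \<Rightarrow> real ^ 'd \<Rightarrow> 'b::real_normed_vector) \<Rightarrow> real \<Rightarrow> real ^ 'd \<Rightarrow> 'b" where
  "time_deriv T f t x = vector_derivative (\<lambda>s. f s x) (at t within {0..<T})"

text \<open>The material derivative \<open>D\<^sub>t f = \<partial>\<^sub>t f + (v\<^sup>i / v\<^sup>0) \<partial>\<^sub>i f\<close>, applied to \<open>v\<close> componentwise.\<close>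

definition material_deriv ::
  "real \<Rightarrow> real \<Rightarrow> (real \<Rightarrow> real ^ 'd \<Rightarrow> real) \<Rightarrow> (real \<Rightarrow> real ^ 'd \<Rightarrow> real ^ 'd)
    \<Rightarrow> (real \<Rightarrow> real ^ 'd \<Rightarrow> 'b::real_normed_vector) \<Rightarrow> real \<Rightarrow> real ^ 'd \<Rightarrow> 'b" where
  "material_deriv \<kappa> T r v f t x =
     time_deriv T f t x
       + (\<Sum>i\<in>UNIV. (v t x $ i / vel0 \<kappa> (r t x) (v t x)) *\<^sub>R partial_deriv i (f t) x)"

definition fluid_domain :: "(real \<Rightarrow> real ^ 'd \<Rightarrow> real) \<Rightarrow> real \<Rightarrow> (real ^ 'd) set" where
  "fluid_domain r t = {x. r t x > 0}"

definition free_boundary :: "(real \<Rightarrow> real ^ 'd \<Rightarrow> real) \<Rightarrow> real \<Rightarrow> (real ^ 'd) set" where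
  "free_boundary r t = frontier (fluid_domain r t)"

definition continuity_eq ::
  "real \<Rightarrow> real \<Rightarrow> (real \<Rightarrow> real ^ 'd \<Rightarrow> real) \<Rightarrow> (real \<Rightarrow> real ^ 'd \<Rightarrow> real ^ 'd)
    \<Rightarrow> real \<Rightarrow> real ^ 'd \<Rightarrow> bool" where
  "continuity_eq \<kappa> T r v t x \<longleftrightarrow>
     material_deriv \<kappa> T r v r t x
       + r t x * (\<Sum>i\<in>UNIV. \<Sum>j\<in>UNIV.
                    coeff_G \<kappa> (r t x) (v t x) i j * partial_deriv i (v t) x $ j)
       + r t x * coeff_a1 \<kappa> (r t x) (v t x)
           * (\<Sum>i\<in>UNIV. v t x $ i * partial_deriv i (r t) x) = 0"

definition momentum_eq ::
  "real \<Rightarrow> real \<Rightarrow> (real \<Rightarrow> real ^ 'd \<Rightarrow> real) \<Rightarrow> (real \<Rightarrow> real ^ 'd \<Rightarrow> real ^ 'd)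
    \<Rightarrow> real \<Rightarrow> real ^ 'd \<Rightarrow> bool" where
  "momentum_eq \<kappa> T r v t x \<longleftrightarrow>
     (\<forall>i. material_deriv \<kappa> T r v v t x $ i
            + coeff_a2 \<kappa> (r t x) (v t x) * partial_deriv i (r t) x = 0)"

text \<open>
  The condition \<open>r(t,x) \<approx> dist(x, \<Gamma>\<^sub>t)\<close>, with comparison constants uniform on compact time intervals.
  For \<open>\<Omega>\<^sub>t = \<real>\<^sup>d\<close> the boundary is empty and \<^const>\<open>infdist\<close> is \<open>0\<close>; the condition then fails,
  as it does under the convention \<open>dist(x, \<emptyset>) = \<infinity>\<close>.
\<close>

definition physical_vacuum :: "real \<Rightarrow> (real \<Rightarrow> real ^ 'd \<Rightarrow> real) \<Rightarrow> bool" where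
  "physical_vacuum T r \<longleftrightarrow>
     (\<forall>T'\<in>{0..<T}. \<exists>C>0. \<forall>t\<in>{0..T'}. \<forall>x\<in>fluid_domain r t.
        r t x \<le> C * infdist x (free_boundary r t) \<and> infdist x (free_boundary r t) \<le> C * r t x)"

text \<open>
  Solutions on \<open>[0,T)\<close> are classical.  The function \<open>r\<close> is extended by \<open>0\<close> to the vacuum region, and its
  continuity on \<open>[0,T) \<times> \<real>\<^sup>d\<close> expresses that the domain moves continuously: without it, the gas
  could disappear or appear instantaneously.  The values of \<open>v\<close> outside \<open>\<Omega>\<^sub>t\<close> are irrelevant.
\<close>

definition is_solution ::
  "real \<Rightarrow> real \<Rightarrow> (real \<Rightarrow> real ^ 'd \<Rightarrow> real) \<Rightarrow> (real \<Rightarrow> real ^ 'd \<Rightarrow> real ^ 'd) \<Rightarrow> bool" where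
  "is_solution \<kappa> T r v \<longleftrightarrow>
     (\<forall>t\<in>{0..<T}. \<forall>x. 0 \<le> \<kappa> * r t x \<and> \<kappa> * r t x < 1) \<and>
     continuous_on ({0..<T} \<times> UNIV) (\<lambda>(t, x). r t x) \<and>
     (\<forall>t\<in>{0..<T}. \<forall>x\<in>fluid_domain r t.
        r t differentiable (at x) \<and> v t differentiable (at x) \<and>
        (\<lambda>s. r s x) differentiable (at t within {0..<T}) \<and>
        (\<lambda>s. v s x) differentiable (at t within {0..<T}) \<and>
        continuity_eq \<kappa> T r v t x \<and> momentum_eq \<kappa> T r v t x) \<and>
     physical_vacuum T r"

definition has_initial_data ::
  "(real \<Rightarrow> real ^ 'd \<Rightarrow> real) \<Rightarrow> (real \<Rightarrow> real ^ 'd \<Rightarrow> real ^ 'd)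
    \<Rightarrow> (real ^ 'd \<Rightarrow> real) \<Rightarrow> (real ^ 'd \<Rightarrow> real ^ 'd) \<Rightarrow> bool" where
  "has_initial_data r v r_init v_init \<longleftrightarrow>
     (\<forall>x. r 0 x = r_init x) \<and> (\<forall>x\<in>fluid_domain r 0. v 0 x = v_init x)"

definition C1_norm :: "(real ^ 'd) set \<Rightarrow> (real ^ 'd \<Rightarrow> 'b::real_normed_vector) \<Rightarrow> ennreal" where
  "C1_norm S f =
     (SUP x\<in>S. ennreal (norm (f x))) + (\<Sum>i\<in>UNIV. SUP x\<in>S. ennreal (norm (partial_deriv i f x)))"

definition tilde_C_half_seminorm ::
  "(real ^ 'd) set \<Rightarrow> (real ^ 'd \<Rightarrow> real) \<Rightarrow> (real ^ 'd \<Rightarrow> 'b::real_normed_vector) \<Rightarrow> ennreal" where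
  "tilde_C_half_seminorm S r f =
     (SUP (x, y)\<in>S \<times> S. ennreal (norm (f x - f y) / (sqrt (r x) + sqrt (r y) + sqrt (norm (x - y)))))"

text \<open>The class \<open>v \<in> C\<^sup>1\<^sub>x\<close>, with norms bounded uniformly on compact time intervals.\<close>

definition velocity_C1 ::
  "real \<Rightarrow> (real \<Rightarrow> real ^ 'd \<Rightarrow> real) \<Rightarrow> (real \<Rightarrow> real ^ 'd \<Rightarrow> real ^ 'd) \<Rightarrow> bool" where
  "velocity_C1 T r v \<longleftrightarrow>
     (\<forall>t\<in>{0..<T}. (\<forall>x\<in>fluid_domain r t. v t differentiable (at x)) \<and>
                  (\<forall>i. continuous_on (fluid_domain r t) (partial_deriv i (v t)))) \<and>
     (\<forall>T'\<in>{0..<T}. (SUP t\<in>{0..T'}. C1_norm (fluid_domain r t) (v t)) < \<infinity>)"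

text \<open>The class \<open>\<nabla>r \<in> \<close> tilde-\<open>C\<^sup>1\<^sup>/\<^sup>2\<^sub>x\<close>, with the same uniformity in time.\<close>

definition gradient_tilde_C_half :: "real \<Rightarrow> (real \<Rightarrow> real ^ 'd \<Rightarrow> real) \<Rightarrow> bool" where
  "gradient_tilde_C_half T r \<longleftrightarrow>
     (\<forall>t\<in>{0..<T}. \<forall>x\<in>fluid_domain r t. r t differentiable (at x)) \<and>
     (\<forall>T'\<in>{0..<T}.
        (SUP t\<in>{0..T'}. tilde_C_half_seminorm (fluid_domain r t) (r t) (grad (r t))) < \<infinity>)"

end

theory Submission
  imports Defs
begin

text \<open>
The proof is a stability estimate for the distance between two solutions, with the weights that
the physical vacuum dictates: with m = 1/(2\<kappa>) the distance density is
(r1 + r2)^(2m-1) (r1 - r2)^2 + (r1 r2)^m |w|^2, where w is the difference of the velocities. Since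
r1 and r2 vanish on different sets, nothing is extended into the vacuum: every quantity carries
enough powers of r1 or r2 to make sense as a function on the whole space.

The substitution y = v / sqrt (1 + |v|^2) turns the equations into a system
  r_t + (1 + t) y.\<nabla>r + r (g div y + h y.(Dy) y) = 0,
  y_t + (1 + s) (y.\<nabla>) y + k (\<nabla>r - (y.\<nabla>r) y) = 0
whose coefficients depend only on r and |y|^2. At r = 0 they satisfy t = s = h = 0 and g = \<kappa>,
and k is positive. So near the vacuum the two flows differ from a nonrelativistic one by
coefficients that are O(r).

Put f(r) = r^m, cut off below a small scale, and let g be its primitive. The energy density is
(f(r1) - f(r2)) (g(r1) - g(r2)) + f(r1) f(r2) Q(w) / 2 with a quadratic form Q that symmetrises the
system. It is transported with the average of the two velocities, and the flux contains the pressure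
term (f(r1) + f(r2)) (g(r1) - g(r2)) / 2 times w. The homogeneity of f makes all terms of first order
in the differences cancel. The corrections of order r in the coefficients would survive at
the boundary of one fluid inside the other; they are therefore multiplied by the factor
4 r1 r2 / (r1 + r2)^2, which is 1 up to a quadratic error and vanishes on both boundaries. The
identity is remainder_identity and the resulting bound remainder_dominated.

One cubic term is not controlled by the energy: Q(w) (f'(r1) f(r2) w.\<nabla>r1 - f(r1) f'(r2) w.\<nabla>r2) / 4,
because f'(r) is of size f(r) / r. It is absorbed by adding the flux
f(r1) f(r2) |w|^3 N with a vector field N that is transversal to both free boundaries; its divergence
contains (f'(r1) f(r2) \<nabla>r1.N + f(r1) f'(r2) \<nabla>r2.N) |w|^3. A field N is obtained by averaging
differences of the initial r, which needs only the nondegeneracy of the gradient at the boundary, a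
consequence of r \<approx> dist and of the regularity of \<nabla>r. It stays transversal for a time
that depends only on the bounds of the solutions (transversal_field_exists, local_uniqueness).

With these fluxes the energy obeys a differential inequality on all of space, up to an error that
vanishes with the cut-off scale. Where one of the fluids is absent, the other one satisfies the same
inequality by itself. Integration over a backward cone and Gronwall's lemma
(energy_estimate, energy_uniqueness) show that the distance vanishes on a time interval of
uniform length, and finitely many such steps reach any time before T.
\<close>


section \<open>Cut-off powers and scalar inequalities\<close>

definition pos2 :: "real => real" where "pos2 x = (max 0 x)\<^sup>2"

lemma pos2_deriv: "(pos2 has_real_derivative 2 * max 0 x) (at x)"
proof -
 consider "x > 0" | "x < 0" | "x = 0" by linarith
 then show ?thesis
 proof cases
  case 1
  have "((%x. x\<^sup>2) has_real_derivative 2 * max 0 x) (at x)"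
   using 1 by (auto intro!: derivative_eq_intros)
  then show ?thesis
   by (rule has_field_derivative_transform_within_open[where S="{0<..}"])
    (use 1 in \<open>auto simp: pos2_def\<close>)
 next
  case 2
  have "((%x. 0) has_real_derivative 2 * max 0 x) (at x)"
   using 2 by (auto intro!: derivative_eq_intros)
  then show ?thesis
   by (rule has_field_derivative_transform_within_open[where S="{..<0}"])
    (use 2 in \<open>auto simp: pos2_def\<close>)
 next
  case 3
  have "((%h::real. max 0 h) \<longlongrightarrow> max 0 0) (at 0)" by (intro tendsto_intros)
  moreover have "\<forall>\<^sub>F h in at 0. max 0 h = (pos2 (0 + h) - pos2 0) / h"
   by (auto simp: eventually_at_filter pos2_def power2_eq_square max_def)
  ultimately have "((%h. (pos2 (0 + h) - pos2 0) / h) \<longlongrightarrow> 0) (at 0)"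
   using Lim_transform_eventually by fastforce
  then show ?thesis using 3 by (simp add: DERIV_def)
 qed
qed

lemma pos2_nonneg: "0 <= pos2 x" by (simp add: pos2_def)

lemma pos2_eq_0: "x <= 0 ==> pos2 x = 0" by (simp add: pos2_def)

text \<open>A continuously differentiable step, 0 below \<eta> and 1 above 2\<eta>, built from squared positive
parts so that its derivative is explicit.\<close>

definition cut :: "real => real => real" where
 "cut \<eta> r = 1 - pos2 (1 - pos2 (r / \<eta> - 1))"

definition dcut :: "real => real => real" where
 "dcut \<eta> r = 2 * max 0 (1 - pos2 (r / \<eta> - 1)) * (2 * max 0 (r / \<eta> - 1) / \<eta>)"

lemma cut_deriv: "(cut \<eta> has_real_derivative dcut \<eta> r) (at r)"
proof -
 have 1: "((%r. pos2 (r / \<eta> - 1)) has_real_derivative 2 * max 0 (r / \<eta> - 1) * (1 / \<eta>)) (at r)"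
  unfolding divide_inverse by (rule DERIV_chain2[OF pos2_deriv]) (auto intro!: derivative_eq_intros)
 have "((%r. pos2 (1 - pos2 (r / \<eta> - 1))) has_real_derivative
   2 * max 0 (1 - pos2 (r / \<eta> - 1)) * (0 - 2 * max 0 (r / \<eta> - 1) * (1 / \<eta>))) (at r)"
  by (rule DERIV_chain2[OF pos2_deriv]) (intro DERIV_diff DERIV_const 1)
 from DERIV_diff[OF DERIV_const[of 1] this] show ?thesis
  unfolding cut_def[abs_def] dcut_def by simp
qed

lemma cut_eq_0: "0 < \<eta> ==> r <= \<eta> ==> cut \<eta> r = 0"
 by (simp add: cut_def pos2_def)

lemma dcut_eq_0: "0 < \<eta> ==> r <= \<eta> ==> dcut \<eta> r = 0"
 by (simp add: dcut_def)

lemma pos2_ge_1: "1 <= x ==> 1 <= pos2 x"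
 using power_mono[of 1 x 2] by (simp add: pos2_def)

lemma cut_eq_1: "0 < \<eta> ==> 2 * \<eta> <= r ==> cut \<eta> r = 1"
 using pos2_ge_1[of "r / \<eta> - 1"] by (simp add: cut_def pos2_eq_0 field_simps)

lemma dcut_outside: "0 < \<eta> ==> 2 * \<eta> <= r ==> dcut \<eta> r = 0"
 using pos2_ge_1[of "r / \<eta> - 1"] by (simp add: dcut_def field_simps)

lemma cut_nonneg: "0 <= cut \<eta> r"
proof -
 have "pos2 (1 - pos2 (r / \<eta> - 1)) <= 1"
  using pos2_nonneg[of "r / \<eta> - 1"] power_mono[of "max 0 (1 - pos2 (r / \<eta> - 1))" 1 2]
  unfolding pos2_def[of "1 - pos2 (r / \<eta> - 1)"] by simp
 then show ?thesis by (simp add: cut_def)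
qed

lemma cut_le_1: "cut \<eta> r <= 1" by (simp add: cut_def pos2_nonneg)

lemma dcut_nonneg: "0 < \<eta> ==> 0 <= dcut \<eta> r" by (simp add: dcut_def)

lemma dcut_le:
 assumes "0 < \<eta>" "0 <= r"
 shows "r * dcut \<eta> r <= 8"
proof (cases "2 * \<eta> <= r")
 case True
 then show ?thesis using assms by (simp add: dcut_outside)
next
 case False
 have "max 0 (1 - pos2 (r / \<eta> - 1)) <= 1" using pos2_nonneg[of "r / \<eta> - 1"] by simp
 moreover have "r / \<eta> <= 2" using False assms by (simp add: field_simps)
 then have "r / \<eta> * max 0 (r / \<eta> - 1) <= 2 * 1"
  using assms by (intro mult_mono) linarith+
 ultimately have "max 0 (1 - pos2 (r / \<eta> - 1)) * (r / \<eta> * max 0 (r / \<eta> - 1)) <= 1 * (2 * 1)"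
  using assms by - (rule mult_mono, auto)
 moreover have "r * dcut \<eta> r = 4 * (max 0 (1 - pos2 (r / \<eta> - 1)) * (r / \<eta> * max 0 (r / \<eta> - 1)))"
  by (simp add: dcut_def)
 ultimately show ?thesis by linarith
qed

definition prof :: "real => real => real => real" where
 "prof m \<eta> r = r powr m * cut \<eta> r"

text \<open>The case distinction avoids powers of nonpositive numbers; the profile vanishes identically there.\<close>

definition dprof :: "real => real => real => real" where
 "dprof m \<eta> r = (if r <= \<eta> then 0 else m * r powr (m - 1) * cut \<eta> r + r powr m * dcut \<eta> r)"

definition prim :: "real => real => real => real" where
 "prim m \<eta> r = integral {0..r} (prof m \<eta>)"

lemma prof_eq_0: "0 < \<eta> ==> r <= \<eta> ==> prof m \<eta> r = 0"
 by (simp add: prof_def cut_eq_0)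

lemma prof_deriv:
 assumes "0 < \<eta>" shows "(prof m \<eta> has_real_derivative dprof m \<eta> r) (at r)"
proof (cases "r <= 0")
 case True
 have "((%x. 0) has_real_derivative dprof m \<eta> r) (at r)"
  using True assms by (auto simp: dprof_def)
 then show ?thesis
  by (rule has_field_derivative_transform_within_open[where S="{..<\<eta>}"])
   (use True assms in \<open>auto simp: prof_eq_0\<close>)
next
 case False
 then have "((%r. r powr m * cut \<eta> r) has_real_derivative
   m * r powr (m - 1) * cut \<eta> r + r powr m * dcut \<eta> r) (at r)"
  using DERIV_mult'[OF has_real_derivative_powr[of r m] cut_deriv[of \<eta> r]]
  by (simp add: add.commute)
 moreover have "m * r powr (m - 1) * cut \<eta> r + r powr m * dcut \<eta> r = dprof m \<eta> r"
  using assms by (auto simp: dprof_def cut_eq_0 dcut_eq_0)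
 ultimately show ?thesis by (simp add: prof_def[abs_def])
qed

lemma prof_continuous: "0 < \<eta> ==> continuous_on S (prof m \<eta>)"
 by (meson DERIV_isCont continuous_at_imp_continuous_on prof_deriv)

lemma prim_eq_0: "0 < \<eta> ==> r <= \<eta> ==> prim m \<eta> r = 0"
 unfolding prim_def by (rule integral_unique[OF has_integral_is_0]) (simp add: prof_eq_0)

lemma prim_deriv:
 assumes "0 < \<eta>" shows "(prim m \<eta> has_real_derivative prof m \<eta> r) (at r)"
proof (cases "r <= 0")
 case True
 have "((%x. 0) has_real_derivative prof m \<eta> r) (at r)"
  using True assms by (auto simp: prof_eq_0)
 then show ?thesis
  by (rule has_field_derivative_transform_within_open[where S="{..<\<eta>}"])
   (use True assms in \<open>auto simp: prim_eq_0\<close>)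
next
 case False
 have "((%x. integral {0..x} (prof m \<eta>)) has_real_derivative prof m \<eta> r) (at r within {0..r+1})"
  using False assms by (intro integral_has_real_derivative prof_continuous) auto
 then have "((%x. integral {0..x} (prof m \<eta>)) has_real_derivative prof m \<eta> r) (at r)"
  using False by (subst (asm) at_within_Icc_at) auto
 then show ?thesis by (simp add: prim_def[abs_def])
qed

lemma prof_nonneg: "0 <= prof m \<eta> r" by (simp add: prof_def cut_nonneg)

lemma prof_le: "prof m \<eta> r <= r powr m"
 using mult_left_le[OF cut_le_1, of "r powr m" \<eta> r] by (simp add: prof_def)

lemma dprof_nonneg: "0 < \<eta> ==> 0 < m ==> 0 <= dprof m \<eta> r"
 by (simp add: dprof_def cut_nonneg dcut_nonneg)

lemma dprof_le:
 assumes "0 < \<eta>" "0 < m" "0 <= r" shows "r * dprof m \<eta> r <= (m + 8) * r powr m"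
proof (cases "r <= \<eta>")
 case True
 then show ?thesis using assms by (simp add: dprof_def)
next
 case False
 then have r: "r > 0" using assms by simp
 have 1: "r * r powr (m - 1) = r powr m" using r by (simp add: powr_mult_base)
 have "r * dprof m \<eta> r = m * r powr m * cut \<eta> r + r powr m * (r * dcut \<eta> r)"
  using False by (simp add: dprof_def distrib_left 1[symmetric] mult_ac)
 also have "... <= m * r powr m * 1 + r powr m * 8"
  using assms by (intro add_mono mult_left_mono cut_le_1 dcut_le) auto
 finally show ?thesis by (simp add: algebra_simps)
qed

lemma prof_eq_powr: "0 < \<eta> ==> 2 * \<eta> <= r ==> prof m \<eta> r = r powr m"
 by (simp add: prof_def cut_eq_1)

lemma dprof_eq_powr: "0 < \<eta> ==> 2 * \<eta> <= r ==> r * dprof m \<eta> r = m * r powr m"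
 by (simp add: dprof_def cut_eq_1 dcut_outside powr_mult_base)

lemma prof_mono:
 assumes "0 < \<eta>" "0 < m" "a <= b" shows "prof m \<eta> a <= prof m \<eta> b"
 using assms(3) by (rule DERIV_nonneg_imp_nondecreasing) (use assms(1,2) prof_deriv dprof_nonneg in blast)

lemma prim_mono:
 assumes "0 < \<eta>" "a <= b" shows "prim m \<eta> a <= prim m \<eta> b"
 using assms(2) by (rule DERIV_nonneg_imp_nondecreasing) (use assms(1) prim_deriv prof_nonneg in blast)

lemma prim_diff_le:
 assumes "0 < \<eta>" "0 < m" "0 <= a" "0 <= b"
 shows "abs (prim m \<eta> a - prim m \<eta> b) <= (a + b) powr m * abs (a - b)"
proof -
 have *: "abs (prim m \<eta> a - prim m \<eta> b) <= (a + b) powr m * abs (a - b)" if hh: "a < b" "0 <= a" for a b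
 proof -
  obtain z where z: "a < z" "z < b" "prim m \<eta> b - prim m \<eta> a = (b - a) * prof m \<eta> z"
   using MVT2[OF hh(1), of "prim m \<eta>" "prof m \<eta>"] prim_deriv assms by blast
  have "prof m \<eta> z <= (a + b) powr m"
   using prof_le[of m \<eta> z] powr_mono2[of m z "a + b"] z hh assms by linarith
  then have "(b - a) * prof m \<eta> z <= (b - a) * (a + b) powr m" using hh by (intro mult_left_mono) auto
  moreover have "abs (prim m \<eta> a - prim m \<eta> b) = (b - a) * prof m \<eta> z"
   using z(3) hh prof_nonneg[of m \<eta> z] by (simp add: abs_minus_commute[of "prim m \<eta> a"] abs_mult)
  ultimately show ?thesis using hh by (simp add: mult.commute)
 qed
 show ?thesis
  using *[of a b] *[of b a] assms by (cases a b rule: linorder_cases) (auto simp: add.commute abs_minus_commute)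
qed

text \<open>When a and b are comparable this is the mean value theorem with the bound r f'(r) \<le> (m + 8)
f(r); otherwise \<bar>a - b\<bar> is comparable to a + b and both terms are estimated separately.\<close>

lemma prof_diff_le:
 assumes "0 < \<eta>" "0 < m" "0 <= a" "0 <= b"
 shows "(a + b) * abs (prof m \<eta> a - prof m \<eta> b) <= 4 * (m + 8) * ((a + b) powr m * abs (a - b))"
proof -
 have *: "(a + b) * abs (prof m \<eta> a - prof m \<eta> b) <= 4 * (m + 8) * ((a + b) powr m * abs (a - b))"
  if hh: "a < b" "0 <= a" for a b
 proof (cases "b <= 2 * a")
  case True
  obtain z where z: "a < z" "z < b" "prof m \<eta> b - prof m \<eta> a = (b - a) * dprof m \<eta> z"
   using MVT2[OF hh(1), of "prof m \<eta>" "dprof m \<eta>"] prof_deriv assms by blast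
  have "(a + b) * dprof m \<eta> z <= 4 * z * dprof m \<eta> z"
   using True z hh assms by (intro mult_right_mono dprof_nonneg) auto
  also have "... <= 4 * ((m + 8) * z powr m)"
   using dprof_le[of \<eta> m z] z hh assms by (simp add: mult.assoc)
  also have "... <= 4 * ((m + 8) * (a + b) powr m)"
   using z hh assms by (intro mult_left_mono powr_mono2) auto
  finally have "(a + b) * dprof m \<eta> z * (b - a) <= 4 * ((m + 8) * (a + b) powr m) * (b - a)"
   using hh by (intro mult_right_mono) auto
  moreover have "abs (prof m \<eta> a - prof m \<eta> b) = (b - a) * dprof m \<eta> z"
   using z(3) hh dprof_nonneg[of \<eta> m z] assms by (simp add: abs_minus_commute[of "prof m \<eta> a"] abs_mult)
  moreover have "4 * ((m + 8) * (a + b) powr m) * (b - a) = 4 * (m + 8) * ((a + b) powr m * abs (a - b))"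
   using hh by simp
  ultimately show ?thesis by (simp only: mult_ac)
 next
  case False
  have b1: "abs (prof m \<eta> a - prof m \<eta> b) <= (a + b) powr m"
   using prof_mono[of \<eta> m a b] prof_nonneg[of m \<eta> a] prof_le[of m \<eta> b]
    powr_mono2[of m b "a + b"] hh assms by linarith
  have "(a + b) * abs (prof m \<eta> a - prof m \<eta> b) <= (4 * (m + 8) * abs (a - b)) * (a + b) powr m"
  proof (intro mult_mono b1)
   have "a + b <= 4 * 8 * abs (a - b)" using False hh by simp
   also have "... <= 4 * (m + 8) * abs (a - b)" using assms by (intro mult_right_mono) auto
   finally show "a + b <= 4 * (m + 8) * abs (a - b)" .
  qed (use assms in auto)
  then show ?thesis by (simp add: mult_ac)
 qed
 show ?thesis
  using *[of a b] *[of b a] assms by (cases a b rule: linorder_cases) (auto simp: add.commute abs_minus_commute)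
qed

definition AA :: "real => real => real => real => real" where
 "AA m \<eta> r s = (prof m \<eta> r - prof m \<eta> s) * (prim m \<eta> r - prim m \<eta> s)"

text \<open>The derivative of AA in its first density.\<close>

definition AD :: "real => real => real => real => real" where
 "AD m \<eta> r s = dprof m \<eta> r * (prim m \<eta> r - prim m \<eta> s) + prof m \<eta> r * (prof m \<eta> r - prof m \<eta> s)"

definition MM :: "real => real => real => real => real" where
 "MM m \<eta> r s = (prof m \<eta> r + prof m \<eta> s) * (prim m \<eta> r - prim m \<eta> s) / 2"

definition D1 :: "real => real => real => real" where
 "D1 m r s = ((r + s) powr m)\<^sup>2 * (r - s)\<^sup>2 / (r + s)"

text \<open>The size of the distance for densities of order \<eta>: what the cut-off can destroy.\<close>

definition err :: "real => real => real" where
 "err m \<eta> = (\<eta> powr m)\<^sup>2 * \<eta>"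

lemma AD_bound:
 assumes "0 < \<eta>" "0 < m" "0 <= r" "0 <= s"
 shows "abs (r * AD m \<eta> r s) <= 5 * (m + 8) * (((r + s) powr m)\<^sup>2 * abs (r - s))"
proof -
 define q where "q = (r + s) powr m"
 have q: "0 <= q" "r powr m <= q" using assms by (auto simp: q_def powr_mono2)
 have 1: "abs (r * dprof m \<eta> r * (prim m \<eta> r - prim m \<eta> s)) <= ((m + 8) * q) * (q * abs (r - s))"
  unfolding abs_mult[of "r * dprof m \<eta> r"]
 proof (intro mult_mono)
  show "abs (r * dprof m \<eta> r) <= (m + 8) * q"
   using dprof_le[of \<eta> m r] dprof_nonneg[of \<eta> m r] assms q(2)
   by (smt (verit, best) mult_left_mono mult_nonneg_nonneg)
  show "abs (prim m \<eta> r - prim m \<eta> s) <= q * abs (r - s)" using prim_diff_le[of \<eta> m r s] assms by (simp add: q_def)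
 qed (use assms q in auto)
 have 2: "abs (prof m \<eta> r * (r * (prof m \<eta> r - prof m \<eta> s))) <= q * (4 * (m + 8) * (q * abs (r - s)))"
  unfolding abs_mult[of "prof m \<eta> r"]
 proof (intro mult_mono)
  show "abs (prof m \<eta> r) <= q" using prof_nonneg[of m \<eta> r] prof_le[of m \<eta> r] q by simp
  have "abs (r * (prof m \<eta> r - prof m \<eta> s)) <= (r + s) * abs (prof m \<eta> r - prof m \<eta> s)"
   using assms by (simp add: abs_mult mult_right_mono)
  then show "abs (r * (prof m \<eta> r - prof m \<eta> s)) <= 4 * (m + 8) * (q * abs (r - s))"
   using prof_diff_le[of \<eta> m r s] assms by (simp add: q_def)
 qed (use q in auto)
 have "r * AD m \<eta> r s = r * dprof m \<eta> r * (prim m \<eta> r - prim m \<eta> s) + prof m \<eta> r * (r * (prof m \<eta> r - prof m \<eta> s))"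
  by (simp add: AD_def algebra_simps)
 then have "abs (r * AD m \<eta> r s) <= ((m + 8) * q) * (q * abs (r - s)) + q * (4 * (m + 8) * (q * abs (r - s)))"
  using 1 2 by linarith
 also have "... = 5 * (m + 8) * (q\<^sup>2 * abs (r - s))" by (simp add: power2_eq_square algebra_simps)
 finally show ?thesis by (simp add: q_def)
qed

lemma MM_bound:
 assumes "0 < \<eta>" "0 < m" "0 <= r" "0 <= s"
 shows "abs (MM m \<eta> r s) <= ((r + s) powr m)\<^sup>2 * abs (r - s)"
proof -
 have "prof m \<eta> r <= (r + s) powr m" "prof m \<eta> s <= (r + s) powr m"
  using prof_le[of m \<eta> r] prof_le[of m \<eta> s] powr_mono2[of m r "r + s"] powr_mono2[of m s "r + s"] assms
  by linarith+
 then have "abs ((prof m \<eta> r + prof m \<eta> s) / 2) <= (r + s) powr m"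
  using prof_nonneg[of m \<eta> r] prof_nonneg[of m \<eta> s] by (simp add: abs_of_nonneg)
 then have "abs ((prof m \<eta> r + prof m \<eta> s) / 2) * abs (prim m \<eta> r - prim m \<eta> s) <= (r + s) powr m * ((r + s) powr m * abs (r - s))"
  using prim_diff_le[of \<eta> m r s] assms by (intro mult_mono) auto
 then show ?thesis by (simp add: MM_def abs_mult power2_eq_square mult_ac)
qed

lemma AA_bound:
 assumes "0 < \<eta>" "0 < m" "0 <= r" "0 <= s"
 shows "abs (AA m \<eta> r s) <= 4 * (m + 8) * D1 m r s"
proof (cases "r + s = 0")
 case True
 then have "r = 0" "s = 0" using assms by auto
 then show ?thesis by (simp add: AA_def D1_def)
next
 case False
 then have p: "r + s > 0" using assms by simp
 have "(r + s) * abs (prof m \<eta> r - prof m \<eta> s) * abs (prim m \<eta> r - prim m \<eta> s)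
   <= (4 * (m + 8) * ((r + s) powr m * abs (r - s))) * ((r + s) powr m * abs (r - s))"
  using prof_diff_le[of \<eta> m r s] prim_diff_le[of \<eta> m r s] assms by (intro mult_mono[of "_ * _"]) auto
 also have "... = (r + s) * (4 * (m + 8) * D1 m r s)"
  using p by (simp add: D1_def power2_eq_square abs_mult_self_eq mult_ac)
 finally show ?thesis using p by (simp add: AA_def abs_mult mult.assoc)
qed

lemma D1_nonneg: "0 <= r ==> 0 <= s ==> 0 <= D1 m r s" by (simp add: D1_def)

lemma D1_commute: "D1 m r s = D1 m s r" by (simp add: D1_def add.commute power2_commute)

lemma AA_commute: "AA m \<eta> r s = AA m \<eta> s r" by (simp add: AA_def algebra_simps)

lemma small_bound:
 assumes "0 < \<eta>" "0 < m" "0 <= r" "0 <= s" "r + s <= 8 * \<eta>"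
 shows "((r + s) powr m)\<^sup>2 * (r + s) <= 8 * (8 powr m)\<^sup>2 * err m \<eta>"
proof -
 have "(r + s) powr m <= 8 powr m * \<eta> powr m"
  using powr_mono2[of m "r + s" "8 * \<eta>"] assms by (simp add: powr_mult)
 then have "((r + s) powr m)\<^sup>2 <= (8 powr m * \<eta> powr m)\<^sup>2" by (intro power_mono) auto
 then have "((r + s) powr m)\<^sup>2 * (r + s) <= (8 powr m * \<eta> powr m)\<^sup>2 * (8 * \<eta>)"
  using assms by (intro mult_mono) auto
 then show ?thesis by (simp add: err_def power_mult_distrib mult_ac)
qed

lemma err_nonneg: "0 < \<eta> ==> 0 <= err m \<eta>" by (simp add: err_def)

lemma D1_le_linear:
 assumes "0 <= r" "0 <= s" shows "D1 m r s <= ((r + s) powr m)\<^sup>2 * abs (r - s)"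
proof (cases "r + s = 0")
 case False
 then have p: "r + s > 0" using assms by simp
 have "(r - s)\<^sup>2 = abs (r - s) * abs (r - s)" by (simp add: power2_eq_square)
 also have "... <= abs (r - s) * (r + s)" using assms by (intro mult_left_mono) auto
 finally have "(r - s)\<^sup>2 <= abs (r - s) * (r + s)" .
 then have "(r - s)\<^sup>2 / (r + s) <= abs (r - s)" using p by (simp add: field_simps)
 from mult_left_mono[OF this, of "((r + s) powr m)\<^sup>2"] show ?thesis by (simp add: D1_def)
qed (use assms in \<open>auto simp: D1_def\<close>)

lemma linear_le_D1:
 assumes "0 <= r" "0 <= s" "r + s <= 2 * abs (r - s)"
 shows "((r + s) powr m)\<^sup>2 * abs (r - s) <= 2 * D1 m r s"
proof (cases "r + s = 0")
 case False
 then have p: "r + s > 0" using assms by simp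
 have "abs (r - s) * (r + s) <= 2 * (r - s)\<^sup>2"
  unfolding power2_abs[symmetric, of "r - s"] power2_eq_square
  using assms mult_left_mono[OF assms(3), of "abs (r - s)"] by (simp add: mult_ac)
 then have "abs (r - s) <= 2 * ((r - s)\<^sup>2 / (r + s))" using p by (simp add: field_simps)
 from mult_left_mono[OF this, of "((r + s) powr m)\<^sup>2"] show ?thesis by (simp add: D1_def mult.left_commute)
qed (use assms in \<open>auto simp: D1_def\<close>)

text \<open>If r + s \<le> 8\<eta>, the distance is absorbed by err. Otherwise let s < r. Above max s (r/2) the
profile is the exact power, so the mean value theorem bounds the increments of f and g from below
there, and monotonicity extends the bounds to [s, r].\<close>

lemma D1_coercive:
 assumes "0 < \<eta>" "0 < m" "0 <= r" "0 <= s"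
 shows "D1 m r s <= 4 * (4 powr m)\<^sup>2 / m * AA m \<eta> r s + 8 * (8 powr m)\<^sup>2 * err m \<eta>"
proof -
 have AA0: "0 <= AA m \<eta> r s" for r s
  using prof_mono[of \<eta> m r s] prim_mono[of \<eta> r s m] prof_mono[of \<eta> m s r] prim_mono[of \<eta> s r m] assms
  by (cases "r <= s") (auto simp: AA_def mult_nonneg_nonneg mult_nonpos_nonpos)
 have *: "D1 m r s <= 4 * (4 powr m)\<^sup>2 / m * AA m \<eta> r s"
  if hh: "0 <= s" "s < r" "r + s > 8 * \<eta>" for r s
 proof -
  define t where "t = max s (r / 2)"
  have t: "t < r" "s <= t" "r / 2 <= t" "(r - s) / 2 <= r - t" "2 * \<eta> <= t" "0 < t"
   using hh assms by (auto simp: t_def max_def)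
  obtain z where z: "t < z" "z < r" "prim m \<eta> r - prim m \<eta> t = (r - t) * prof m \<eta> z"
   using MVT2[OF t(1), of "prim m \<eta>" "prof m \<eta>"] prim_deriv assms by blast
  obtain u where u: "t < u" "u < r" "prof m \<eta> r - prof m \<eta> t = (r - t) * dprof m \<eta> u"
   using MVT2[OF t(1), of "prof m \<eta>" "dprof m \<eta>"] prof_deriv assms by blast
  define q where "q = (r / 2) powr m"
  have q0: "0 <= q" by (simp add: q_def)
  have "q <= prof m \<eta> z"
   using z t hh assms prof_eq_powr[of \<eta> z m] powr_mono2[of m "r / 2" z] by (simp add: q_def)
  then have "(r - s) / 2 * q <= (r - t) * prof m \<eta> z" using t hh q0 by (intro mult_mono) auto
  then have G: "(r - s) / 2 * q <= prim m \<eta> r - prim m \<eta> s"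
   using z(3) prim_mono[of \<eta> s t m] t assms by linarith
  have "m * q <= u * dprof m \<eta> u"
   using u t hh assms dprof_eq_powr[of \<eta> u m] powr_mono2[of m "r / 2" u] by (simp add: q_def)
  also have "... <= r * dprof m \<eta> u" using u assms by (intro mult_right_mono dprof_nonneg) auto
  finally have "(r - s) / 2 * (m * q) <= (r - t) * (r * dprof m \<eta> u)"
   using t hh q0 assms by (intro mult_mono[of "_ / _"]) auto
  also have "... <= r * (prof m \<eta> r - prof m \<eta> s)"
   using u(3) prof_mono[of \<eta> m s t] t assms hh
   by (simp add: mult.left_commute)
  finally have F: "(r - s) / 2 * (m * q) <= r * (prof m \<eta> r - prof m \<eta> s)" .
  have "((r - s) / 2 * (m * q)) * ((r - s) / 2 * q) <= r * (prof m \<eta> r - prof m \<eta> s) * (prim m \<eta> r - prim m \<eta> s)"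
   using F G hh q0 assms
   by (intro mult_mono[of "_ / _ * _"]) (auto intro!: mult_nonneg_nonneg prof_mono simp: diff_ge_0_iff_ge)
  then have FG: "m * q\<^sup>2 * (r - s)\<^sup>2 / 4 <= r * AA m \<eta> r s"
   by (simp add: AA_def power2_eq_square mult_ac)
  have "(r + s) powr m <= (4 * (r / 2)) powr m" using hh assms by (intro powr_mono2) auto
  also have "... = 4 powr m * q" unfolding q_def using hh assms by (subst powr_mult) auto
  finally have "((r + s) powr m)\<^sup>2 <= (4 powr m * q)\<^sup>2" by (intro power_mono) auto
  then have "((r + s) powr m)\<^sup>2 * (r - s)\<^sup>2 / (r + s) <= (4 powr m * q)\<^sup>2 * (r - s)\<^sup>2 / r"
   using hh assms by (intro frac_le mult_right_mono) auto
  also have "... = 4 * (4 powr m)\<^sup>2 / m * ((m * q\<^sup>2 * (r - s)\<^sup>2 / 4) / r)"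
   using assms by (simp add: power_mult_distrib)
  also have "... <= 4 * (4 powr m)\<^sup>2 / m * AA m \<eta> r s"
   using FG hh assms by (intro mult_left_mono) (auto simp: field_simps)
  finally show ?thesis by (simp add: D1_def)
 qed
 have c0: "0 <= 4 * (4 powr m)\<^sup>2 / m * AA m \<eta> r s" using AA0[of r s] assms by simp
 have e0: "0 <= 8 * (8 powr m)\<^sup>2 * err m \<eta>" using err_nonneg[of \<eta> m] assms by simp
 consider "r + s <= 8 * \<eta>" | "r = s" | "r + s > 8 * \<eta>" "s < r" | "r + s > 8 * \<eta>" "r < s" by linarith
 then show ?thesis
 proof cases
  case 1
  have "D1 m r s <= ((r + s) powr m)\<^sup>2 * (r + s)"
   using D1_le_linear[of r s m] assms mult_left_mono[of "abs (r - s)" "r + s" "((r + s) powr m)\<^sup>2"] by force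
  then show ?thesis using small_bound[OF assms 1] c0 by linarith
 next
  case 2
  then show ?thesis using c0 e0 by (simp add: D1_def)
 next
  case 3
  then show ?thesis using *[of s r] assms e0 by linarith
 next
  case 4
  then have "D1 m s r <= 4 * (4 powr m)\<^sup>2 / m * AA m \<eta> s r" using *[of r s] assms by (simp add: add.commute)
  then show ?thesis using e0 unfolding D1_commute[of m r s] AA_commute[of m \<eta> r s] by linarith
 qed
qed

lemma prim_diff_powr:
 assumes "0 < \<eta>" "0 < m" "2 * \<eta> <= s" "2 * \<eta> <= r"
 shows "(m + 1) * (prim m \<eta> r - prim m \<eta> s) = r * r powr m - s * s powr m"
proof -
 have *: "(m + 1) * (prim m \<eta> r - prim m \<eta> s) = r * r powr m - s * s powr m"
  if hh: "s < r" "2 * \<eta> <= s" for r s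
 proof -
  have "\<exists>z>s. z < r & ((m + 1) * prim m \<eta> r - r * r powr m) - ((m + 1) * prim m \<eta> s - s * s powr m) = (r - s) * 0"
  proof (rule MVT2[OF hh(1)])
   fix x assume "s <= x" "x <= r"
   then have x: "2 * \<eta> <= x" "0 < x" using hh assms by auto
   show "((%x. (m + 1) * prim m \<eta> x - x * x powr m) has_real_derivative 0) (at x)"
    using x assms
    by (auto intro!: derivative_eq_intros prim_deriv simp: prof_eq_powr powr_diff field_simps)
  qed
  then show ?thesis by (auto simp: algebra_simps)
 qed
 show ?thesis using *[of s r] *[of r s] assms by (cases r s rule: linorder_cases) (auto simp: algebra_simps)
qed

text \<open>Above the cut-off AA is homogeneous of degree 2m + 1, and the first claim is Euler's relation. The
second one expresses that the pressure flux and the antisymmetric part of r AD agree to first order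
in r - s. Together they say that the divergence terms of the two flows cancel up to quadratic terms,
and this determines the exponent m = 1/(2\<kappa>).\<close>

lemma quadratic_defects_exact:
 assumes "0 < \<eta>" "0 < m" "2 * \<eta> <= s" "2 * \<eta> <= r"
 shows "r * AD m \<eta> r s + s * AD m \<eta> s r = (2 * m + 1) * AA m \<eta> r s"
  and "abs (MM m \<eta> r s - (r * AD m \<eta> r s - s * AD m \<eta> s r) / (4 * m)) <= AA m \<eta> r s / m"
proof -
 note P = prof_eq_powr[OF assms(1)] and DP = dprof_eq_powr[OF assms(1)]
 have AD': "r * AD m \<eta> r s = m * prof m \<eta> r * (prim m \<eta> r - prim m \<eta> s) + r * prof m \<eta> r * (prof m \<eta> r - prof m \<eta> s)"
  if hh: "2 * \<eta> <= r" for r s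
  using DP[OF hh, of m] P[OF hh, of m] by (simp add: AD_def distrib_left mult.assoc[symmetric])
 show "r * AD m \<eta> r s + s * AD m \<eta> s r = (2 * m + 1) * AA m \<eta> r s"
 proof -
  have "r * AD m \<eta> r s + s * AD m \<eta> s r =
   m * AA m \<eta> r s + (r * prof m \<eta> r - s * prof m \<eta> s) * (prof m \<eta> r - prof m \<eta> s)"
   unfolding AD'[OF assms(4)] AD'[OF assms(3)] by (simp add: AA_def algebra_simps)
  also have "r * prof m \<eta> r - s * prof m \<eta> s = (m + 1) * (prim m \<eta> r - prim m \<eta> s)"
   using prim_diff_powr[OF assms] P assms by simp
  finally show ?thesis by (simp add: AA_def algebra_simps)
 qed
 have *: "abs (MM m \<eta> r s - (r * AD m \<eta> r s - s * AD m \<eta> s r) / (4 * m)) <= AA m \<eta> r s / m"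
  if hh: "s < r" "2 * \<eta> <= s" for r s
 proof -
  have r: "2 * \<eta> <= r" "0 < s" using hh assms by auto
  define F where "F = prof m \<eta> r - prof m \<eta> s"
  define G where "G = prim m \<eta> r - prim m \<eta> s"
  define h where "h = prof m \<eta> s"
  have F0: "0 <= F" using prof_mono[of \<eta> m s r] hh assms by (simp add: F_def)
  have h0: "0 <= h" by (simp add: h_def prof_nonneg)
  obtain z where z: "s < z" "z < r" "(prof m \<eta> r - prof m \<eta> s) * prof m \<eta> z = (prim m \<eta> r - prim m \<eta> s) * dprof m \<eta> z"
   using GMVT'[of s r "prof m \<eta>" "prim m \<eta>" "prof m \<eta>" "dprof m \<eta>"] hh
    DERIV_isCont[OF prof_deriv[OF assms(1)]] DERIV_isCont[OF prim_deriv[OF assms(1)]]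
    prof_deriv[OF assms(1)] prim_deriv[OF assms(1)] by blast
  have "F * (z * z powr m) = G * (z * dprof m \<eta> z)"
   using z P[of z m] hh by (simp add: F_def G_def mult.left_commute)
  then have "F * z = m * G" using DP[of z m] z hh r by (simp add: mult_ac)
  then have g1: "0 <= m * G - s * F" "m * G - s * F <= (r - s) * F"
   using z F0 by (smt (verit) mult.commute mult_right_mono left_diff_distrib)+
  obtain u where u: "s < u" "u < r" "prim m \<eta> r - prim m \<eta> s = (r - s) * prof m \<eta> u"
   using MVT2[OF hh(1), of "prim m \<eta>" "prof m \<eta>"] prim_deriv assms by blast
  have g2: "h * (r - s) <= G"
   using u hh prof_mono[of \<eta> m s u] assms by (simp add: G_def h_def mult.commute)
  have "r * prof m \<eta> r = s * h + (m + 1) * G"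
   using prim_diff_powr[OF assms(1,2) hh(2) r(1)] P[of r m] P[of s m] r hh by (simp add: h_def G_def)
  then have e: "4 * m * (MM m \<eta> r s - (r * AD m \<eta> r s - s * AD m \<eta> s r) / (4 * m)) = 2 * h * (m * G - s * F) - F * G"
  proof -
   assume a: "r * prof m \<eta> r = s * h + (m + 1) * G"
   have fr: "prof m \<eta> r = h + F" by (simp add: F_def h_def)
   have m1: "MM m \<eta> r s = (2 * h + F) * G / 2" by (simp add: MM_def fr G_def h_def)
   have m2: "r * AD m \<eta> r s = m * (h + F) * G + (s * h + (m + 1) * G) * F"
    using AD'[OF r(1), of s] a by (simp add: fr G_def h_def)
   have m3: "s * AD m \<eta> s r = - (m * h * G + s * h * F)"
    using AD'[OF hh(2), of r] by (simp add: F_def G_def h_def algebra_simps)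
   show ?thesis unfolding m1 m2 m3 using assms by (simp add: field_simps)
  qed
  have "0 <= 2 * h * (m * G - s * F)" using g1 h0 by simp
  moreover have "2 * h * (m * G - s * F) <= 2 * h * ((r - s) * F)" using g1 h0 by (intro mult_left_mono) auto
  moreover have "h * ((r - s) * F) <= F * G" using mult_right_mono[OF g2 F0] by (simp add: mult_ac)
  moreover have "0 <= h * ((r - s) * F)" using h0 F0 hh by simp
  ultimately have "abs (2 * h * (m * G - s * F) - F * G) <= 4 * (F * G)" by linarith
  then have "abs (4 * m * (MM m \<eta> r s - (r * AD m \<eta> r s - s * AD m \<eta> s r) / (4 * m))) <= 4 * AA m \<eta> r s"
   unfolding e by (simp add: AA_def F_def G_def)
  then have "4 * m * abs (MM m \<eta> r s - (r * AD m \<eta> r s - s * AD m \<eta> s r) / (4 * m)) <= 4 * AA m \<eta> r s"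
   using assms by (simp add: abs_mult)
  then show ?thesis using assms by (simp add: field_simps)
 qed
 show "abs (MM m \<eta> r s - (r * AD m \<eta> r s - s * AD m \<eta> s r) / (4 * m)) <= AA m \<eta> r s / m"
 proof (cases r s rule: linorder_cases)
  case less
  have "MM m \<eta> r s - (r * AD m \<eta> r s - s * AD m \<eta> s r) / (4 * m)
    = - (MM m \<eta> s r - (s * AD m \<eta> s r - r * AD m \<eta> r s) / (4 * m))"
   by (simp add: MM_def algebra_simps diff_divide_distrib add_divide_distrib)
  then show ?thesis using *[OF less assms(4)] AA_commute[of m \<eta> r s] by simp
 next
  case equal
  then show ?thesis by (simp add: MM_def AD_def AA_def)
 next
  case greater
  then show ?thesis using * assms by simp
 qed
qed

text \<open>The relations for exact powers persist, with an error of the size of the cut-off, for all densities.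
There are three regimes: both densities are of order \<eta>, which err absorbs; the difference is
comparable to the sum, so that linear bounds suffice; or both lie above 2\<eta>, where the relations
are exact. The estimates for lam below follow the same pattern.\<close>

lemma quadratic_defects:
 assumes "0 < m"
 shows "\<exists>c\<ge>0. \<forall>\<eta> r s. 0 < \<eta> & 0 <= r & 0 <= s -->
   abs (r * AD m \<eta> r s + s * AD m \<eta> s r) <= c * (D1 m r s + err m \<eta>) &
   abs (MM m \<eta> r s - (r * AD m \<eta> r s - s * AD m \<eta> s r) / (4 * m)) <= c * (D1 m r s + err m \<eta>)"
proof -
 define l where "l = 10 * (m + 8) + 1 + 10 * (m + 8) / (4 * m)"
 have l0: "0 <= l" using assms by (simp add: l_def)
 define k where "k = 4 * (m + 8)"
 have k0: "0 <= k" using assms by (simp add: k_def)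
 define c where "c = l * (8 * (8 powr m)\<^sup>2) + 2 * l + (2 * m + 1) * k + k / m"
 have c: "0 <= c" "l * (8 * (8 powr m)\<^sup>2) <= c" "2 * l <= c" "(2 * m + 1) * k <= c" "k / m <= c"
  using l0 k0 assms by (auto simp: c_def)
 have "abs (r * AD m \<eta> r s + s * AD m \<eta> s r) <= c * (D1 m r s + err m \<eta>) &
   abs (MM m \<eta> r s - (r * AD m \<eta> r s - s * AD m \<eta> s r) / (4 * m)) <= c * (D1 m r s + err m \<eta>)"
  (is "abs (?X) <= _ & abs (?Y) <= _")
  if h: "0 < \<eta>" "0 <= r" "0 <= s" for \<eta> r s
 proof -
  define q where "q = ((r + s) powr m)\<^sup>2 * abs (r - s)"
  have q0: "0 <= q" by (simp add: q_def)
  have d0: "0 <= D1 m r s" "0 <= err m \<eta>" using D1_nonneg err_nonneg h by auto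
  have a: "abs (r * AD m \<eta> r s) <= 5 * (m + 8) * q" "abs (s * AD m \<eta> s r) <= 5 * (m + 8) * q" "abs (MM m \<eta> r s) <= q"
   using AD_bound[of \<eta> m r s] AD_bound[of \<eta> m s r] MM_bound[of \<eta> m r s] h assms
   by (auto simp: q_def add.commute abs_minus_commute)
  have "abs (?X) <= 10 * (m + 8) * q" using a by linarith
  also have "... <= l * q" using q0 assms by (intro mult_right_mono) (auto simp: l_def)
  finally have X: "abs (?X) <= l * q" .
  have "abs (r * AD m \<eta> r s - s * AD m \<eta> s r) <= 10 * (m + 8) * q" using a by linarith
  then have "abs ((r * AD m \<eta> r s - s * AD m \<eta> s r) / (4 * m)) <= 10 * (m + 8) * q / (4 * m)"
   using assms by (simp add: abs_divide divide_right_mono)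
  then have "abs (?Y) <= q + 10 * (m + 8) * q / (4 * m)" using a by linarith
  also have "... = (1 + 10 * (m + 8) / (4 * m)) * q" by (simp add: algebra_simps)
  also have "... <= l * q" using q0 assms by (intro mult_right_mono) (auto simp: l_def)
  finally have Y: "abs (?Y) <= l * q" .
  have "r + s <= 8 * \<eta> \<or> r + s <= 2 * abs (r - s) \<or> (2 * \<eta> <= r & 2 * \<eta> <= s)" using h by (smt (verit))
  then consider "r + s <= 8 * \<eta>" | "r + s <= 2 * abs (r - s)" | "2 * \<eta> <= r" "2 * \<eta> <= s" by blast
  then show ?thesis
  proof cases
   case 1
   have "q <= ((r + s) powr m)\<^sup>2 * (r + s)" unfolding q_def using h by (intro mult_left_mono) auto
   then have "l * q <= l * (8 * (8 powr m)\<^sup>2 * err m \<eta>)"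
    using small_bound[OF h(1) assms h(2,3) 1] l0 by (intro mult_left_mono) auto
   also have "... = (l * (8 * (8 powr m)\<^sup>2)) * err m \<eta>" by simp
   also have "... <= c * (D1 m r s + err m \<eta>)" using c d0 l0 by (intro mult_mono) auto
   finally show ?thesis using X Y by simp
  next
   case 2
   have "l * q <= l * (2 * D1 m r s)" using linear_le_D1[OF h(2,3) 2, of m] l0 by (intro mult_left_mono) (auto simp: q_def)
   also have "... = (2 * l) * D1 m r s" by simp
   also have "... <= c * (D1 m r s + err m \<eta>)" using c d0 by (intro mult_mono) auto
   finally show ?thesis using X Y by simp
  next
   case 3
   have A: "abs (AA m \<eta> r s) <= k * D1 m r s" using AA_bound[of \<eta> m r s] h assms by (simp add: k_def)
   have "abs (?X) = (2 * m + 1) * abs (AA m \<eta> r s)"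
    using quadratic_defects_exact(1)[OF h(1) assms 3(2,1)] assms by (simp add: abs_mult)
   also have "... <= (2 * m + 1) * (k * D1 m r s)" using A assms by (intro mult_left_mono) auto
   also have "... = ((2 * m + 1) * k) * D1 m r s" by simp
   also have "... <= c * (D1 m r s + err m \<eta>)" using c d0 by (intro mult_mono) auto
   finally have X': "abs (?X) <= c * (D1 m r s + err m \<eta>)" .
   have "abs (?Y) <= AA m \<eta> r s / m" using quadratic_defects_exact(2)[OF h(1) assms 3(2,1)] .
   also have "... <= (k * D1 m r s) / m" using A assms by (intro divide_right_mono) auto
   also have "... = (k / m) * D1 m r s" by simp
   also have "... <= c * (D1 m r s + err m \<eta>)" using c d0 by (intro mult_mono) auto
   finally show ?thesis using X' by simp
  qed
 qed
 with c(1) show ?thesis by blast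
qed

section \<open>The comparison distance and the interpolation factor\<close>

definition Pm :: "real => real => real => real" where "Pm m r s = r powr m * s powr m"

text \<open>The comparison distance; w stands for the length of the velocity difference.\<close>

definition DD :: "real => real => real => real => real" where
 "DD m r s w = D1 m r s + Pm m r s * w\<^sup>2"

lemma Pm_nonneg: "0 <= Pm m r s" by (simp add: Pm_def)

lemma DD_nonneg: "0 <= r ==> 0 <= s ==> 0 <= DD m r s w"
 by (simp add: DD_def D1_nonneg Pm_nonneg)

lemma D1_le_DD: "D1 m r s <= DD m r s w" by (simp add: DD_def Pm_nonneg)

lemma Pm_le_DD: "0 <= r ==> 0 <= s ==> Pm m r s * w\<^sup>2 <= DD m r s w"
 by (simp add: DD_def D1_nonneg)

lemma prof_prod_le: "prof m \<eta> r * prof m \<eta> s <= Pm m r s"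
 unfolding Pm_def by (intro mult_mono prof_le prof_nonneg) auto

lemma Pm_le:
 assumes "0 < m" "0 <= r" "0 <= s" shows "Pm m r s <= ((r + s) powr m)\<^sup>2"
 unfolding Pm_def power2_eq_square using assms by (intro mult_mono powr_mono2) auto

lemma D1_times: "0 <= r ==> 0 <= s ==> ((r + s) powr m)\<^sup>2 * (r - s)\<^sup>2 = (r + s) * D1 m r s"
 by (cases "r + s = 0") (auto simp: D1_def add_nonneg_eq_0_iff)

text \<open>Products of the two differences are not covered by Young's inequality when one density is much
smaller than the other, since then Pm is small; in that case \<bar>r - s\<bar> is comparable to r +
s and the bound on w suffices.\<close>

lemma mixed_bound:
 assumes "0 < m" "0 <= W"
 shows "\<exists>c\<ge>0. \<forall>r s w. 0 <= r & 0 <= s & r <= B & s <= B & 0 <= w & w <= W -->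
  ((r + s) powr m)\<^sup>2 * abs (r - s) * w <= c * DD m r s w"
proof -
 define c where "c = 2 * W + abs B + (4 powr m)\<^sup>2"
 have c0: "0 <= c" "2 * W <= c" "abs B <= c" "(4 powr m)\<^sup>2 <= c" using assms by (auto simp: c_def)
 have "((r + s) powr m)\<^sup>2 * abs (r - s) * w <= c * DD m r s w"
  if h: "0 <= r" "0 <= s" "r <= B" "s <= B" "0 <= w" "w <= W" for r s w
 proof (cases "r + s <= 2 * abs (r - s)")
  case True
  have "((r + s) powr m)\<^sup>2 * abs (r - s) * w <= (2 * D1 m r s) * W"
   using linear_le_D1[OF h(1,2) True, of m] h D1_nonneg[of r s m] by (intro mult_mono[of "_ * _"]) auto
  also have "... = 2 * W * D1 m r s" by simp
  also have "... <= c * DD m r s w" using c0 D1_le_DD D1_nonneg[of r s m] h by (intro mult_mono[of "_ * _"]) auto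
  finally show ?thesis .
 next
  case False
  define q where "q = ((r + s) powr m)\<^sup>2"
  have q0: "0 <= q" by (simp add: q_def)
  have rs: "(r + s) <= 4 * r" "(r + s) <= 4 * s" using False h by (smt (verit))+
  have "(r + s) powr m <= 4 powr m * r powr m" "(r + s) powr m <= 4 powr m * s powr m"
   using powr_mono2[OF _ _ rs(1), of m] powr_mono2[OF _ _ rs(2), of m] h assms by (auto simp: powr_mult)
  then have "(r + s) powr m * (r + s) powr m <= (4 powr m * r powr m) * (4 powr m * s powr m)"
   by (intro mult_mono) auto
  then have "q <= (4 powr m)\<^sup>2 * Pm m r s" by (simp add: q_def Pm_def power2_eq_square mult_ac)
  then have q: "q * w\<^sup>2 <= (4 powr m)\<^sup>2 * Pm m r s * w\<^sup>2" by (intro mult_right_mono) auto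
  have "2 * (abs (r - s) * w) <= (r - s)\<^sup>2 + w\<^sup>2"
   using sum_squares_bound[of "abs (r - s)" w] by simp
  from mult_left_mono[OF this q0] have "2 * (q * abs (r - s) * w) <= q * (r - s)\<^sup>2 + q * w\<^sup>2"
   by (simp add: algebra_simps)
  also have "q * (r - s)\<^sup>2 = (r + s) * D1 m r s" using D1_times[OF h(1,2)] by (simp add: q_def)
  also have "(r + s) * D1 m r s <= 2 * abs B * D1 m r s" using h D1_nonneg[of r s m] by (intro mult_right_mono) auto
  finally have 1: "2 * (q * abs (r - s) * w) <= 2 * (abs B * D1 m r s) + q * w\<^sup>2" by (simp add: mult.assoc)
  have 2: "0 <= (4 powr m)\<^sup>2 * (Pm m r s * w\<^sup>2)" using Pm_nonneg[of m r s] by simp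
  have 3: "q * w\<^sup>2 <= (4 powr m)\<^sup>2 * (Pm m r s * w\<^sup>2)" using q by (simp add: mult.assoc)
  have "q * abs (r - s) * w <= abs B * D1 m r s + (4 powr m)\<^sup>2 * (Pm m r s * w\<^sup>2)"
  proof -
   have "x <= y + d" if "2 * x <= 2 * y + e" "e <= d" "0 <= d" for x y d e :: real using that by linarith
   from this[OF 1 3 2] show ?thesis .
  qed
  also have "... <= c * D1 m r s + c * (Pm m r s * w\<^sup>2)"
   using c0 D1_nonneg[of r s m] Pm_nonneg[of m r s] h by (intro add_mono mult_right_mono) auto
  finally show ?thesis by (simp add: q_def DD_def algebra_simps)
 qed
 with c0(1) show ?thesis by blast
qed

lemma product_bound:
 assumes "0 < m" "0 <= r" "0 <= s" "r <= B" "s <= B" "0 <= w"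
 shows "Pm m r s * abs (r - s) * w <= (1 + B) * DD m r s w"
proof -
 have "2 * (abs (r - s) * w) <= (r - s)\<^sup>2 + w\<^sup>2" using sum_squares_bound[of "abs (r - s)" w] by simp
 from mult_left_mono[OF this Pm_nonneg[of m r s]]
 have 1: "2 * (Pm m r s * abs (r - s) * w) <= Pm m r s * (r - s)\<^sup>2 + Pm m r s * w\<^sup>2"
  by (simp add: algebra_simps)
 have "Pm m r s * (r - s)\<^sup>2 <= ((r + s) powr m)\<^sup>2 * (r - s)\<^sup>2"
  using Pm_le[of m r s] assms by (intro mult_right_mono) auto
 also have "... = (r + s) * D1 m r s" using D1_times assms by simp
 also have "... <= 2 * B * D1 m r s" using assms D1_nonneg[of r s m] by (intro mult_right_mono) auto
 finally have 2: "Pm m r s * (r - s)\<^sup>2 <= 2 * (B * D1 m r s)" by (simp add: mult.assoc)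
 have "Pm m r s * abs (r - s) * w <= B * D1 m r s + Pm m r s * w\<^sup>2"
 proof -
  have "x <= y + d" if "2 * x <= e + d" "e <= 2 * y" "0 <= d" for x y d e :: real using that by linarith
  from this[OF 1 2] Pm_nonneg[of m r s] show ?thesis by simp
 qed
 also have "... <= (1 + B) * DD m r s w"
  using assms D1_nonneg[of r s m] Pm_nonneg[of m r s] by (auto simp: DD_def algebra_simps)
 finally show ?thesis .
qed

lemma Pm_le_prof:
 assumes "0 < m" "0 < \<eta>" "0 <= r" "0 <= s" "r <= B" "s <= B"
 shows "Pm m r s <= prof m \<eta> r * prof m \<eta> s + 2 powr m * B powr m * \<eta> powr m"
proof -
 have *: "r powr m * s powr m <= 2 powr m * B powr m * \<eta> powr m"
  if "r < 2 * \<eta>" "0 <= r" "0 <= s" "s <= B" for r s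
 proof -
  have "r powr m <= 2 powr m * \<eta> powr m" using powr_mono2[of m r "2 * \<eta>"] that assms by (simp add: powr_mult)
  moreover have "s powr m <= B powr m" using powr_mono2[of m s B] that assms by simp
  ultimately have "r powr m * s powr m <= (2 powr m * \<eta> powr m) * B powr m" by (intro mult_mono) auto
  then show ?thesis by (simp add: mult_ac)
 qed
 have p: "0 <= prof m \<eta> r * prof m \<eta> s" by (simp add: prof_nonneg)
 show ?thesis
 proof (cases "2 * \<eta> <= r & 2 * \<eta> <= s")
  case True
  then show ?thesis using assms by (simp add: Pm_def prof_eq_powr)
 next
  case False
  then have "Pm m r s <= 2 powr m * B powr m * \<eta> powr m"
   using *[of r s] *[of s r] assms by (force simp: Pm_def mult.commute)
  then show ?thesis using p by linarith
 qed
qed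

text \<open>Equal to 1 - ((r - s) / (r + s))^2 away from the cut-off, hence 1 up to a quadratic error, but 0 as
soon as one of the densities vanishes.\<close>

definition lam :: "real => real => real => real" where
 "lam \<eta> r s = 4 * (r * cut \<eta> r) * (s * cut \<eta> s) / (r + s)\<^sup>2"

lemma lam_bounds:
 assumes "0 <= r" "0 <= s"
 shows "0 <= lam \<eta> r s" "lam \<eta> r s <= 1" "r * lam \<eta> r s <= 4 * s"
proof -
 have k: "0 <= r * cut \<eta> r" "r * cut \<eta> r <= r" "0 <= s * cut \<eta> s" "s * cut \<eta> s <= s"
  using assms cut_nonneg cut_le_1 by (auto simp: mult_left_le)
 show "0 <= lam \<eta> r s" using k by (simp add: lam_def)
 have kk: "(r * cut \<eta> r) * (s * cut \<eta> s) <= r * s" using k by (intro mult_mono) auto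
 show "lam \<eta> r s <= 1"
 proof (cases "r + s = 0")
  case False
  have "4 * (r * s) <= (r + s)\<^sup>2" using zero_le_power2[of "r - s"] by (simp add: power2_eq_square algebra_simps)
  then have "4 * (r * cut \<eta> r) * (s * cut \<eta> s) <= (r + s)\<^sup>2" using kk by linarith
  then show ?thesis using False by (simp add: lam_def)
 qed (simp add: lam_def)
 show "r * lam \<eta> r s <= 4 * s"
 proof (cases "r + s = 0")
  case False
  have "r * ((r * cut \<eta> r) * (s * cut \<eta> s)) <= r * (r * s)" using kk assms by (intro mult_left_mono)
  also have "... <= (r + s)\<^sup>2 * s" using assms by (auto simp: power2_eq_square algebra_simps)
  finally show ?thesis using False by (simp add: lam_def field_simps)
 qed (use assms in \<open>simp add: lam_def\<close>)
qed

lemma lam_eq_0: "0 < \<eta> ==> r <= \<eta> \<or> s <= \<eta> ==> lam \<eta> r s = 0"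
 by (auto simp: lam_def cut_eq_0)

lemma lam_defect:
 assumes "0 < m"
 shows "\<exists>c\<ge>0. \<forall>\<eta> r s. 0 < \<eta> & 0 <= r & 0 <= s -->
  ((r + s) powr m)\<^sup>2 * abs (r - s) * (1 - lam \<eta> r s) <= c * (D1 m r s + err m \<eta>)"
proof -
 define c where "c = 2 + 8 * (8 powr m)\<^sup>2"
 have "((r + s) powr m)\<^sup>2 * abs (r - s) * (1 - lam \<eta> r s) <= c * (D1 m r s + err m \<eta>)"
  if h: "0 < \<eta>" "0 <= r" "0 <= s" for \<eta> r s
 proof -
  define q where "q = ((r + s) powr m)\<^sup>2"
  have q0: "0 <= q" by (simp add: q_def)
  have l: "0 <= 1 - lam \<eta> r s" "1 - lam \<eta> r s <= 1" using lam_bounds[OF h(2,3), of \<eta>] by auto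
  have d0: "0 <= D1 m r s" "0 <= err m \<eta>" using D1_nonneg err_nonneg h by auto
  have ql: "q * abs (r - s) * (1 - lam \<eta> r s) <= q * abs (r - s)" using mult_left_mono[OF l(2), of "q * abs (r - s)"] q0 by simp
  have "r + s <= 8 * \<eta> \<or> r + s <= 2 * abs (r - s) \<or> (2 * \<eta> <= r & 2 * \<eta> <= s)" using h by (smt (verit))
  then consider "r + s <= 8 * \<eta>" | "r + s <= 2 * abs (r - s)" | "2 * \<eta> <= r" "2 * \<eta> <= s" by blast
  then have "q * abs (r - s) * (1 - lam \<eta> r s) <= 2 * D1 m r s + 8 * (8 powr m)\<^sup>2 * err m \<eta>"
  proof cases
   case 1
   have "q * abs (r - s) <= q * (r + s)" using h q0 by (intro mult_left_mono) auto
   then show ?thesis using ql small_bound[OF h(1) assms h(2,3) 1] d0 by (simp add: q_def)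
  next
   case 2
   then have "q * abs (r - s) <= 2 * D1 m r s" using linear_le_D1[OF h(2,3) 2, of m] by (simp add: q_def)
   moreover have "0 <= 8 * (8 powr m)\<^sup>2 * err m \<eta>" using d0 by simp
   ultimately show ?thesis using ql by linarith
  next
   case 3
   have p: "0 < r + s" using 3 h by linarith
   have "1 - lam \<eta> r s = ((r + s)\<^sup>2 - 4 * r * s) / (r + s)\<^sup>2"
    using p h 3 by (simp add: lam_def cut_eq_1 diff_divide_distrib)
   also have "... = (r - s)\<^sup>2 / (r + s)\<^sup>2"
    by (rule arg_cong[where f="%x. x / (r + s)\<^sup>2"]) (simp add: power2_eq_square algebra_simps)
   also have "... <= abs (r - s) / (r + s)"
   proof -
    have "(r - s)\<^sup>2 = abs (r - s) * abs (r - s)" by (simp add: power2_eq_square)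
    also have "... <= abs (r - s) * (r + s)" using h by (intro mult_left_mono) auto
    finally have "(r - s)\<^sup>2 / (r + s)\<^sup>2 <= (abs (r - s) * (r + s)) / (r + s)\<^sup>2" by (intro divide_right_mono) auto
    then show ?thesis using p by (simp add: power2_eq_square)
   qed
   finally have "q * abs (r - s) * (1 - lam \<eta> r s) <= q * abs (r - s) * (abs (r - s) / (r + s))"
    using q0 by (intro mult_left_mono) auto
   also have "... = D1 m r s" by (simp add: D1_def q_def power2_eq_square)
   finally have "q * abs (r - s) * (1 - lam \<eta> r s) <= D1 m r s" .
   moreover have "0 <= 8 * (8 powr m)\<^sup>2 * err m \<eta>" using d0 by simp
   ultimately show ?thesis using d0 by linarith
  qed
  also have "... <= c * D1 m r s + c * err m \<eta>" unfolding c_def using d0 by (intro add_mono mult_right_mono) auto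
  finally show ?thesis by (simp add: q_def distrib_left)
 qed
 moreover have "0 <= c" by (simp add: c_def)
 ultimately show ?thesis by blast
qed

lemma lam_defect_product:
 assumes "0 < m" "0 <= B" "0 <= W"
 shows "\<exists>c\<ge>0. \<forall>\<eta> r s w. 0 < \<eta> & 0 <= r & 0 <= s & r <= B & s <= B & 0 <= w & w <= W -->
  Pm m r s * (r + s) * (1 - lam \<eta> r s) * w <= c * (DD m r s w + err m \<eta>)"
proof -
 define c where "c = 4 * W + 8 * (8 powr m)\<^sup>2 * W + (1 + B)"
 have c: "0 <= c" "4 * W <= c" "8 * (8 powr m)\<^sup>2 * W <= c" "1 + B <= c" using assms by (auto simp: c_def)
 have "Pm m r s * (r + s) * (1 - lam \<eta> r s) * w <= c * (DD m r s w + err m \<eta>)"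
  if h: "0 < \<eta>" "0 <= r" "0 <= s" "r <= B" "s <= B" "0 <= w" "w <= W" for \<eta> r s w
 proof -
  have l: "0 <= 1 - lam \<eta> r s" "1 - lam \<eta> r s <= 1" using lam_bounds[OF h(2,3), of \<eta>] by auto
  have d0: "0 <= D1 m r s" "0 <= err m \<eta>" "0 <= DD m r s w" using D1_nonneg err_nonneg DD_nonneg h by auto
  have P: "Pm m r s * (r + s) <= ((r + s) powr m)\<^sup>2 * (r + s)" "0 <= Pm m r s * (r + s)"
   using Pm_le[of m r s] Pm_nonneg[of m r s] h assms by (auto intro: mult_right_mono)
  have "Pm m r s * (r + s) * (1 - lam \<eta> r s) <= Pm m r s * (r + s)" using mult_left_mono[OF l(2) P(2)] by simp
  then have "Pm m r s * (r + s) * (1 - lam \<eta> r s) * w <= (((r + s) powr m)\<^sup>2 * (r + s)) * W"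
   using P l h by - (rule mult_mono; (linarith | auto))
  then have crude: "Pm m r s * (r + s) * (1 - lam \<eta> r s) * w <= W * (((r + s) powr m)\<^sup>2 * (r + s))" by (simp add: mult.commute)
  have "r + s <= 8 * \<eta> \<or> r + s <= 2 * abs (r - s) \<or> (2 * \<eta> <= r & 2 * \<eta> <= s)" using h by (smt (verit))
  then consider "r + s <= 8 * \<eta>" | "r + s <= 2 * abs (r - s)" | "2 * \<eta> <= r" "2 * \<eta> <= s" by blast
  then show ?thesis
  proof cases
   case 1
   have "W * (((r + s) powr m)\<^sup>2 * (r + s)) <= W * (8 * (8 powr m)\<^sup>2 * err m \<eta>)"
    using small_bound[OF h(1) assms(1) h(2,3) 1] assms by (intro mult_left_mono) auto
   also have "... = 8 * (8 powr m)\<^sup>2 * W * err m \<eta>" by simp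
   also have "... <= c * (DD m r s w + err m \<eta>)" using c d0 assms by (intro mult_mono[of "_ * W"]) auto
   finally show ?thesis using crude by linarith
  next
   case 2
   have "((r + s) powr m)\<^sup>2 * (r + s) <= ((r + s) powr m)\<^sup>2 * (2 * abs (r - s))" using 2 by (intro mult_left_mono) auto
   also have "... <= 4 * D1 m r s" using linear_le_D1[OF h(2,3) 2, of m] by (simp add: mult.commute)
   finally have "W * (((r + s) powr m)\<^sup>2 * (r + s)) <= W * (4 * D1 m r s)" using assms by (intro mult_left_mono) auto
   also have "... = 4 * W * D1 m r s" by simp
   also have "... <= c * (DD m r s w + err m \<eta>)"
    using c d0 assms D1_le_DD[of m r s w] by (intro mult_mono[of "_ * W"]) auto
   finally show ?thesis using crude by linarith
  next
   case 3
   have p: "0 < r + s" using 3 h by linarith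
   have "1 - lam \<eta> r s = ((r + s)\<^sup>2 - 4 * r * s) / (r + s)\<^sup>2"
    using p h 3 by (simp add: lam_def cut_eq_1 diff_divide_distrib)
   also have "... = (r - s)\<^sup>2 / (r + s)\<^sup>2"
    by (rule arg_cong[where f="%x. x / (r + s)\<^sup>2"]) (simp add: power2_eq_square algebra_simps)
   finally have "(r + s) * (1 - lam \<eta> r s) = (r - s)\<^sup>2 / (r + s)" using p by (simp add: power2_eq_square)
   also have "... <= abs (r - s)"
   proof -
    have "(r - s)\<^sup>2 = abs (r - s) * abs (r - s)" by (simp add: power2_eq_square)
    also have "... <= abs (r - s) * (r + s)" using h by (intro mult_left_mono) auto
    finally show ?thesis using p by (simp add: pos_divide_le_eq)
   qed
   finally have "Pm m r s * ((r + s) * (1 - lam \<eta> r s)) * w <= Pm m r s * abs (r - s) * w"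
    using h Pm_nonneg[of m r s] by (intro mult_right_mono mult_left_mono) auto
   also have "... <= (1 + B) * DD m r s w" using product_bound[of m r s B w] h assms by simp
   also have "... <= c * (DD m r s w + err m \<eta>)" using c d0 assms by (intro mult_mono) auto
   finally show ?thesis by (simp add: mult.assoc)
  qed
 qed
 with c(1) show ?thesis by blast
qed

lemma lam_deriv:
 assumes "0 < \<eta>" "0 < r s0" "0 < s s0"
  and r: "(r has_real_derivative r') (at s0 within S)"
  and s: "(s has_real_derivative s') (at s0 within S)"
 shows "\<exists>l'. ((%x. lam \<eta> (r x) (s x)) has_real_derivative l') (at s0 within S) &
  (r s0 + s s0) * abs l' <= 44 * (abs r' + abs s')"
proof -
 define k where "k x = x * cut \<eta> x" for x
 define dk where "dk x = cut \<eta> x + x * dcut \<eta> x" for x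
 have kd: "(k has_real_derivative dk x) (at x)" for x
  unfolding k_def[abs_def] dk_def using DERIV_mult[OF DERIV_ident cut_deriv[of \<eta> x]] by (simp add: mult.commute)
 have dk: "abs (dk x) <= 9" if "0 < x" for x
  using cut_nonneg[of \<eta> x] cut_le_1[of \<eta> x] dcut_le[of \<eta> x] dcut_nonneg[of \<eta> x] that assms
  by (auto simp: dk_def)
 have k: "0 <= k x" "k x <= x" if "0 < x" for x
  using that cut_nonneg cut_le_1 by (auto simp: k_def mult_left_le)
 define a where "a = r s0" define b where "b = s s0"
 have ab: "0 < a" "0 < b" using assms by (auto simp: a_def b_def)
 define i where "i = inverse (a + b)"
 have i: "0 < i" "(a + b) * i = 1" using ab by (auto simp: i_def)
 define X where "X = 4 * (dk a * r' * k b + k a * (dk b * s'))"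
 define Y where "Y = 4 * (k a * k b) * (r' + s')"
 define l' where "l' = X * i\<^sup>2 - 2 * Y * i ^ 3"
 have d1: "((%x. k (r x)) has_real_derivative dk a * r') (at s0 within S)"
  unfolding a_def by (rule DERIV_chain2[OF kd r])
 have d2: "((%x. k (s x)) has_real_derivative dk b * s') (at s0 within S)"
  unfolding b_def by (rule DERIV_chain2[OF kd s])
 have d3: "((%x. inverse (r x + s x)) has_real_derivative - ((r' + s') * i\<^sup>2)) (at s0 within S)"
  using DERIV_inverse_fun[OF DERIV_add[OF r s]] ab
  by (simp add: i_def a_def b_def power2_eq_square mult_ac)
 have "((%x. 4 * (k (r x) * k (s x)) * (inverse (r x + s x))\<^sup>2) has_real_derivative l') (at s0 within S)"
  by (rule DERIV_cong[OF DERIV_mult[OF DERIV_cmult[OF DERIV_mult[OF d1 d2], of 4] DERIV_power[OF d3, of 2]]])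
   (simp add: l'_def X_def Y_def a_def[symmetric] b_def[symmetric] i_def[symmetric]
    power2_eq_square power3_eq_cube algebra_simps)
 then have 1: "((%x. lam \<eta> (r x) (s x)) has_real_derivative l') (at s0 within S)"
  by (simp add: lam_def k_def divide_inverse power_inverse mult.assoc)
 have t1: "abs (dk a * r' * k b) <= 9 * abs r' * (a + b)"
  unfolding abs_mult using dk[OF ab(1)] k[OF ab(2)] ab by (intro mult_mono) auto
 have t2: "abs (k a * (dk b * s')) <= (a + b) * (9 * abs s')"
  unfolding abs_mult using dk[OF ab(2)] k[OF ab(1)] ab by (intro mult_mono) auto
 have t3: "abs ((k a * k b) * (r' + s')) <= ((a + b) * (a + b)) * (abs r' + abs s')"
  unfolding abs_mult using k[OF ab(1)] k[OF ab(2)] ab by (intro mult_mono) auto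
 have aux: "abs (4 * (x + y)) <= 4 * (u + v)" if "abs x <= u" "abs y <= v" for x y u v :: real
  using that by (smt (verit))
 have "abs X <= 4 * (9 * abs r' * (a + b) + (a + b) * (9 * abs s'))"
  unfolding X_def by (rule aux[OF t1 t2])
 then have X: "abs X <= 36 * (abs r' + abs s') * (a + b)" by (simp add: algebra_simps)
 have Y: "abs Y <= 4 * (abs r' + abs s') * (a + b)\<^sup>2"
 proof -
  have "abs Y = 4 * abs ((k a * k b) * (r' + s'))" unfolding Y_def mult.assoc[of 4] abs_mult[of 4] by simp
  also have "... <= 4 * (((a + b) * (a + b)) * (abs r' + abs s'))" using t3 by simp
  finally show ?thesis by (simp add: power2_eq_square mult_ac)
 qed
 have "(a + b) * l' = X * i * ((a + b) * i) - 2 * Y * i\<^sup>2 * ((a + b) * i)"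
  by (simp add: l'_def power2_eq_square power3_eq_cube algebra_simps)
 then have e: "(a + b) * l' = X * i - 2 * (Y * i\<^sup>2)" unfolding i(2) by simp
 have "abs (X * i) <= 36 * (abs r' + abs s') * (a + b) * i"
  using X i(1) by (simp add: abs_mult mult_right_mono)
 then have "abs (X * i) <= 36 * (abs r' + abs s')" using i(2) by (simp add: mult.assoc)
 moreover have "abs (Y * i\<^sup>2) <= 4 * (abs r' + abs s') * (a + b)\<^sup>2 * i\<^sup>2"
  using Y i(1) by (simp add: abs_mult mult_right_mono)
 then have "abs (Y * i\<^sup>2) <= 4 * (abs r' + abs s')"
  using i(2) by (simp add: mult.assoc power_mult_distrib[symmetric])
 ultimately have "abs ((a + b) * l') <= 44 * (abs r' + abs s')" unfolding e by linarith
 then have "(a + b) * abs l' <= 44 * (abs r' + abs s')" using ab by (simp add: abs_mult)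
 with 1 show ?thesis unfolding a_def b_def by blast
qed

section \<open>Domination up to constants and the divergence identity\<close>

text \<open>Inequalities up to a constant that is uniform over an index set, with closure properties that allow
long sums of products to be estimated term by term.\<close>

definition dominated :: "'i set => ('i => real) => ('i => real) => bool" where
 "dominated S f g \<longleftrightarrow> (\<exists>c\<ge>0. \<forall>i\<in>S. abs (f i) <= c * g i)"
abbreviation bounded_on where "bounded_on S f \<equiv> dominated S f (%i. 1)"

lemma domI: "0 <= c ==> (!!i. i \<in> S ==> abs (f i) <= c * g i) ==> dominated S f g"
 unfolding dominated_def by blast

lemma dom_add: assumes "dominated S f h" "dominated S g h" shows "dominated S (%i. f i + g i) h"
proof -
 obtain c d where "0 <= c" "\<forall>i\<in>S. abs (f i) <= c * h i" "0 <= d" "\<forall>i\<in>S. abs (g i) <= d * h i"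
  using assms unfolding dominated_def by blast
 then show ?thesis
  by (intro domI[of "c + d"]) (auto simp: distrib_right intro: order_trans[OF abs_triangle_ineq add_mono])
qed

lemma dom_minus: "dominated S f h ==> dominated S (%i. - f i) h" by (simp add: dominated_def)

lemma dom_diff: "dominated S f h ==> dominated S g h ==> dominated S (%i. f i - g i) h"
 using dom_add[OF _ dom_minus, of S f h g] by simp

lemma dom_mult: assumes "dominated S f F" "dominated S g G" shows "dominated S (%i. f i * g i) (%i. F i * G i)"
proof -
 obtain c d where cd: "0 <= c" "!!i. i \<in> S ==> abs (f i) <= c * F i" "0 <= d" "!!i. i \<in> S ==> abs (g i) <= d * G i"
  using assms unfolding dominated_def by blast
 show ?thesis
 proof (rule domI[of "c * d"])
  fix i assume i: "i \<in> S"
  have "abs (f i * g i) <= (c * F i) * (d * G i)"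
   unfolding abs_mult using cd(2,4)[OF i] by (intro mult_mono) (auto intro: order_trans[OF abs_ge_zero])
  then show "abs (f i * g i) <= c * d * (F i * G i)" by (simp add: mult_ac)
 qed (use cd in simp)
qed

lemma dom_trans: assumes "dominated S f g" "dominated S g h" shows "dominated S f h"
proof -
 obtain c d where cd: "0 <= c" "!!i. i \<in> S ==> abs (f i) <= c * g i" "0 <= d" "!!i. i \<in> S ==> abs (g i) <= d * h i"
  using assms unfolding dominated_def by blast
 show ?thesis
 proof (rule domI[of "c * d"])
  fix i assume i: "i \<in> S"
  have "abs (f i) <= c * g i" using cd(2)[OF i] .
  also have "... <= c * (d * h i)" using cd(1) cd(4)[OF i] by (intro mult_left_mono) auto
  finally show "abs (f i) <= c * d * h i" by (simp add: mult.assoc)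
 qed (use cd in simp)
qed

lemma dom_le: "dominated S g h ==> (!!i. i \<in> S ==> abs (f i) <= abs (g i)) ==> dominated S f h"
 unfolding dominated_def by (meson order_trans)

lemma dom_cong: "dominated S g h ==> (!!i. i \<in> S ==> f i = g i) ==> dominated S f h"
 by (erule dom_le) simp

lemma dom_bdd: "bounded_on S f ==> dominated S g G ==> dominated S (%i. f i * g i) G"
 using dom_mult[of S f "%i. 1" g G] by simp

lemma dom_bdd2: "dominated S g G ==> bounded_on S f ==> dominated S (%i. g i * f i) G"
 using dom_mult[of S g G f "%i. 1"] by simp

lemma dom_const: "bounded_on S (%i. k)" by (rule domI[of "abs k"]) auto

lemma dom_zero: "dominated S (%i. 0) h" by (rule domI[of 0]) auto

lemma dom_sum: "finite A ==> (!!j. j \<in> A ==> dominated S (f j) h) ==> dominated S (%i. \<Sum>j\<in>A. f j i) h"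
 by (induction A rule: finite_induct) (auto intro: dom_add dom_zero)

lemma dom_refl: "(!!i. i \<in> S ==> 0 <= f i) ==> dominated S f f" by (rule domI[of 1]) auto

lemma dom_norm_add: "dominated S (%i. norm (u i)) h ==> dominated S (%i. norm (v i)) h ==> dominated S (%i. norm (u i + v i)) h"
 by (rule dom_le[OF dom_add[of S "%i. norm (u i)" h "%i. norm (v i)"]]) (auto simp: norm_triangle_ineq)

lemma dom_norm_diff: "dominated S (%i. norm (u i)) h ==> dominated S (%i. norm (v i)) h ==> dominated S (%i. norm (u i - v i)) h"
 by (rule dom_le[OF dom_add[of S "%i. norm (u i)" h "%i. norm (v i)"]]) (auto simp: norm_triangle_ineq4)

lemma dom_norm_scale: "dominated S f F ==> dominated S (%i. norm (u i)) G ==> dominated S (%i. norm (f i *\<^sub>R u i)) (%i. F i * G i)"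
 using dom_mult[of S f F "%i. norm (u i)" G] by (rule dom_le) (auto simp: abs_mult)

lemma dom_inner: "dominated S (%i. norm (u i)) F ==> dominated S (%i. norm (v i)) G ==> dominated S (%i. u i \<bullet> v i) (%i. F i * G i)"
 using dom_mult[of S "%i. norm (u i)" F "%i. norm (v i)" G]
 by (rule dom_le) (auto simp: abs_mult Cauchy_Schwarz_ineq2)

lemma dom_nth: "dominated S (%i. norm (u i)) F ==> dominated S (%i. (u i :: real ^ 'd) $ j) F"
 by (erule dom_le) (auto simp: component_le_norm_cart)

lemma dom_norm_sum:
 "finite A ==> (!!j. j \<in> A ==> dominated S (%i. norm (f j i)) h) ==> dominated S (%i. norm (\<Sum>j\<in>A. f j i)) h"
 by (rule dom_le[OF dom_sum[of A S "%j i. norm (f j i)"]]) (auto intro: order_trans[OF norm_sum])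

text \<open>Both sides are polynomial in the pointwise data of two states: a, b, p, q, Y, Z are velocities,
density gradients and velocity derivatives, rt, st, ya, yb the time derivatives given by the
equations. On the left stands the time derivative of the energy plus the divergence of the flux,
with the cubic term moved over. On the right every line contains a small factor: a difference, a
coefficient that vanishes at the boundary, or a defect of the exact homogeneity. The hypothesis on z
is what makes the pressure gradient terms of the two equations cancel.\<close>

lemma remainder_identity:
 fixes a b p q z cw w U :: "real ^ 'd" and Y Z :: "'d => real ^ 'd"
  and A1 A2 AA MM M1 M2 f12 fp fq Q RQt r s t1 t2 s1 s2 g1 g2 h1 h2 n1 n2 \<kappa> \<alpha> \<beta> \<theta> \<xi> rt st :: real
  and Ra Rc RQ Rs :: "'d => real" and ya yb :: "real ^ 'd"
 assumes w: "w = a - b" and U: "U = (1 / 2) *\<^sub>R (a + b)"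
  and cw: "cw = (1 + \<alpha>) *\<^sub>R w + (\<beta> * (a \<bullet> w)) *\<^sub>R a"
  and zc: "!!P. n1 * (z \<bullet> P - (z \<bullet> a) * (a \<bullet> P)) = cw \<bullet> P"
  and rt: "rt = - (1 + t1) * (a \<bullet> p) - r * (g1 * (\<Sum>j\<in>UNIV. Y j $ j) + h1 * (\<Sum>j\<in>UNIV. a $ j * (Y j \<bullet> a)))"
  and st: "st = - (1 + t2) * (b \<bullet> q) - s * (g2 * (\<Sum>j\<in>UNIV. Z j $ j) + h2 * (\<Sum>j\<in>UNIV. b $ j * (Z j \<bullet> b)))"
  and ya: "ya = - ((1 + s1) *\<^sub>R (\<Sum>j\<in>UNIV. a $ j *\<^sub>R Y j)) - n1 *\<^sub>R (p - (a \<bullet> p) *\<^sub>R a)"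
  and yb: "yb = - ((1 + s2) *\<^sub>R (\<Sum>j\<in>UNIV. b $ j *\<^sub>R Z j)) - n2 *\<^sub>R (q - (b \<bullet> q) *\<^sub>R b)"
  and M1: "M1 = A1 / 2 + f12" and M2: "M2 = - A2 / 2 - f12"
 defines "F \<equiv> %j. (U $ j + \<theta> * a $ j) * (A1 * p $ j + A2 * q $ j) + AA * Ra j
   + (M1 * p $ j + M2 * q $ j) * cw $ j
   + MM * ((1 + \<alpha>) * (Y j - Z j) $ j + \<beta> * (a \<bullet> (Y j - Z j)) * a $ j + Rc j)
   + (1 / 2) * (fp * p $ j + fq * q $ j) * Q * (U $ j + \<xi> * a $ j)
   + (1 / 2) * f12 * (2 * (z \<bullet> (Y j - Z j)) + RQ j) * (U $ j + \<xi> * a $ j) + (1 / 2) * f12 * Q * Rs j"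
  and "Et \<equiv> A1 * rt + A2 * st + (1 / 2) * (fp * rt + fq * st) * Q + (1 / 2) * f12 * (2 * (z \<bullet> (ya - yb)) + RQt)"
  and "x1 \<equiv> (1 + \<alpha>) * (\<Sum>j\<in>UNIV. Y j $ j) + \<beta> * (\<Sum>j\<in>UNIV. a $ j * (Y j \<bullet> a))"
  and "x2 \<equiv> (1 + \<alpha>) * (\<Sum>j\<in>UNIV. Z j $ j) + \<beta> * (\<Sum>j\<in>UNIV. a $ j * (Z j \<bullet> a))"
  and "K \<equiv> (\<Sum>j\<in>UNIV. (- (1 / 2) * w $ j + (\<xi> - s1) * a $ j) *\<^sub>R Y j) + (\<Sum>j\<in>UNIV. (- (1 / 2) * w $ j + (s2 * b $ j - \<xi> * a $ j)) *\<^sub>R Z j)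
   - (n1 - n2) *\<^sub>R (q - (a \<bullet> q) *\<^sub>R a) + n2 *\<^sub>R ((a \<bullet> q) *\<^sub>R a - (b \<bullet> q) *\<^sub>R b)"
 shows "Et + (\<Sum>j\<in>UNIV. F j) + Q / 4 * (fp * (w \<bullet> p) - fq * (w \<bullet> q)) =
   ((1 / 2) * (A1 * ((cw - w) \<bullet> p)) - (1 / 2) * (A2 * ((cw - w) \<bullet> q)))
   + (A1 * (\<theta> - t1) * (a \<bullet> p) + A2 * ((\<theta> - t2) * (a \<bullet> q) + t2 * (w \<bullet> q)))
   + ((MM - \<kappa> / 2 * (r * A1 - s * A2)) * (x1 - x2) - \<kappa> / 2 * (r * A1 + s * A2) * (x1 + x2))
   - (r * A1) * ((g1 - \<kappa> * (1 + \<alpha>)) * (\<Sum>j\<in>UNIV. Y j $ j) + (h1 - \<kappa> * \<beta>) * (\<Sum>j\<in>UNIV. a $ j * (Y j \<bullet> a)))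
   - (s * A2) * ((g2 - \<kappa> * (1 + \<alpha>)) * (\<Sum>j\<in>UNIV. Z j $ j) + (h2 - \<kappa> * \<beta>) * (\<Sum>j\<in>UNIV. b $ j * (Z j \<bullet> b))
     + \<kappa> * \<beta> * ((\<Sum>j\<in>UNIV. b $ j * (Z j \<bullet> b)) - (\<Sum>j\<in>UNIV. a $ j * (Z j \<bullet> a))))
   + (AA * (\<Sum>j\<in>UNIV. Ra j) + MM * (\<Sum>j\<in>UNIV. Rc j)
    + (1 / 2) * f12 * ((\<Sum>j\<in>UNIV. RQ j * (U $ j + \<xi> * a $ j)) + Q * (\<Sum>j\<in>UNIV. Rs j) + RQt))
   + (1 / 2) * Q * (fp * ((\<xi> - t1) * (a \<bullet> p)) + fq * (\<xi> * (a \<bullet> q) - t2 * (b \<bullet> q)))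
   - (1 / 2) * Q * ((r * fp) * (g1 * (\<Sum>j\<in>UNIV. Y j $ j) + h1 * (\<Sum>j\<in>UNIV. a $ j * (Y j \<bullet> a)))
     + (s * fq) * (g2 * (\<Sum>j\<in>UNIV. Z j $ j) + h2 * (\<Sum>j\<in>UNIV. b $ j * (Z j \<bullet> b))))
   + f12 * (z \<bullet> K)"
proof -
 have in_sum: "x \<bullet> y = (\<Sum>j\<in>UNIV. x $ j * y $ j)" for x y :: "real ^ 'd" by (simp add: inner_vec_def)
 define V where "V = (\<Sum>j\<in>UNIV. (U $ j + \<xi> * a $ j) *\<^sub>R (Y j - Z j))"
 have SF: "(\<Sum>j\<in>UNIV. F j) = A1 * (U \<bullet> p + \<theta> * (a \<bullet> p)) + A2 * (U \<bullet> q + \<theta> * (a \<bullet> q)) + AA * (\<Sum>j\<in>UNIV. Ra j)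
   + (M1 * (cw \<bullet> p) + M2 * (cw \<bullet> q)) + MM * ((x1 - x2) + (\<Sum>j\<in>UNIV. Rc j))
   + (1 / 2) * Q * (fp * (U \<bullet> p + \<xi> * (a \<bullet> p)) + fq * (U \<bullet> q + \<xi> * (a \<bullet> q)))
   + f12 * (z \<bullet> V) + (1 / 2) * f12 * ((\<Sum>j\<in>UNIV. RQ j * (U $ j + \<xi> * a $ j)) + Q * (\<Sum>j\<in>UNIV. Rs j))"
  unfolding F_def x1_def x2_def V_def
  by (simp add: inner_sum_right in_sum[of U] in_sum[of a p] in_sum[of a q] in_sum[of cw] inner_commute[of _ a]
    sum.distrib sum_subtractf sum_distrib_left inner_diff_right algebra_simps add_divide_distrib)
 have Kz: "z \<bullet> (ya - yb) + z \<bullet> V + cw \<bullet> (p - q) = z \<bullet> K"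
 proof -
  have halves: "2 * (\<Sum>j\<in>UNIV. (c $ j / 2) *\<^sub>R X j) = (\<Sum>j\<in>UNIV. c $ j *\<^sub>R X j)"
   for c :: "real ^ 'd" and X :: "'d => real ^ 'd"
   by (simp add: vec_eq_iff sum_distrib_left)
  have v: "ya - yb + V + n1 *\<^sub>R ((p - q) - (a \<bullet> (p - q)) *\<^sub>R a) = K"
   unfolding ya yb V_def K_def w U
   by (simp add: algebra_simps sum.distrib sum_subtractf scaleR_sum_right inner_diff_right
    scaleR_right.sum[symmetric] sum_negf halves)
  have "cw \<bullet> (p - q) = z \<bullet> (n1 *\<^sub>R ((p - q) - (a \<bullet> (p - q)) *\<^sub>R a))"
   unfolding zc[symmetric] by (simp add: algebra_simps inner_diff_right)
  then show ?thesis unfolding v[symmetric] by (simp add: inner_add_right inner_diff_right)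
 qed
 have Up: "U \<bullet> p = a \<bullet> p - (w \<bullet> p) / 2" "U \<bullet> q = b \<bullet> q + (w \<bullet> q) / 2" "a \<bullet> q = b \<bullet> q + w \<bullet> q"
  unfolding U w by (simp_all add: inner_diff_left inner_add_left field_simps)
 have zz: "f12 * (z \<bullet> (ya - yb)) + f12 * (z \<bullet> V) = f12 * (z \<bullet> K) - f12 * (cw \<bullet> p) + f12 * (cw \<bullet> q)"
  unfolding Kz[symmetric] by (simp add: algebra_simps inner_diff_right)
 define dY dZ eY eZ eZ' where "dY = (\<Sum>j\<in>UNIV. Y j $ j)" and "dZ = (\<Sum>j\<in>UNIV. Z j $ j)"
  and "eY = (\<Sum>j\<in>UNIV. a $ j * (Y j \<bullet> a))" and "eZ = (\<Sum>j\<in>UNIV. b $ j * (Z j \<bullet> b))"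
  and "eZ' = (\<Sum>j\<in>UNIV. a $ j * (Z j \<bullet> a))"
 note abbr = dY_def[symmetric] dZ_def[symmetric] eY_def[symmetric] eZ_def[symmetric] eZ'_def[symmetric]
 have x12: "x1 = (1 + \<alpha>) * dY + \<beta> * eY" "x2 = (1 + \<alpha>) * dZ + \<beta> * eZ'"
  by (simp_all add: x1_def x2_def abbr)
 show ?thesis
  unfolding SF Et_def abbr M1 M2 x12 inner_diff_left[of cw w] Up rt st
  using zz by (simp add: algebra_simps add_divide_distrib diff_divide_distrib)
qed

section \<open>The remainder of the energy balance\<close>

abbreviation (input) tr_jac where "tr_jac Y i \<equiv> \<Sum>j\<in>UNIV. Y i j $ j"
abbreviation (input) quad_jac where "quad_jac a Y i \<equiv> \<Sum>j\<in>UNIV. a i $ j * (Y i j \<bullet> a i)"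

text \<open>A family of pairs of states, indexed abstractly so that all constants are uniform in the point, the
time and the cut-off scale. The coefficients occur only through their sizes, their vanishing at zero
density, and their Lipschitz bounds.\<close>

locale two_states =
 fixes S :: "'i set" and m B \<kappa> :: real and \<eta> r s :: "'i => real"
  and a b p q z :: "'i => real ^ 'd" and Y Z :: "'i => 'd => real ^ 'd"
  and t1 t2 s1 s2 g1 g2 h1 h2 n1 n2 :: "'i => real"
 assumes m: "0 < m" and \<kappa>: "\<kappa> = 1 / (2 * m)" and B: "0 <= B"
  and pos: "!!i. i \<in> S ==> 0 < \<eta> i & 0 < r i & r i <= B & 0 < s i & s i <= B"
  and vec_bounds: "bounded_on S (%i. norm (a i))" "bounded_on S (%i. norm (b i))"
   "bounded_on S (%i. norm (p i))" "bounded_on S (%i. norm (q i))"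
  and jac_bounds: "!!j. bounded_on S (%i. norm (Y i j))" "!!j. bounded_on S (%i. norm (Z i j))"
  and small: "dominated S t1 r" "dominated S t2 s" "dominated S s1 r" "dominated S s2 s"
   "dominated S (%i. g1 i - \<kappa>) r" "dominated S h1 r"
   "dominated S (%i. g2 i - \<kappa>) s" "dominated S h2 s"
  and n_bounds: "bounded_on S n1" "bounded_on S n2"
  and t_lip: "dominated S (%i. t1 i - t2 i) (%i. abs (r i - s i) + s i * norm (a i - b i))"
  and lip: "dominated S (%i. s1 i - s2 i) (%i. abs (r i - s i) + norm (a i - b i))"
   "dominated S (%i. g1 i - g2 i) (%i. abs (r i - s i) + norm (a i - b i))"
   "dominated S (%i. h1 i - h2 i) (%i. abs (r i - s i) + norm (a i - b i))"
   "dominated S (%i. n1 i - n2 i) (%i. abs (r i - s i) + norm (a i - b i))"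
  and z: "dominated S (%i. norm (z i)) (%i. norm (a i - b i))"
begin

definition w where "w i = a i - b i"
definition W where "W i = norm (w i)"
definition la where "la i = lam (\<eta> i) (r i) (s i)"
definition Lq where "Lq i = ((r i + s i) powr m)\<^sup>2 * abs (r i - s i)"
definition om where "om i = abs (r i - s i) / (r i + s i) + W i + (1 - la i)"
definition Er where "Er i = DD m (r i) (s i) (W i) + err m (\<eta> i)"
definition A1 where "A1 i = AD m (\<eta> i) (r i) (s i)"
definition A2 where "A2 i = AD m (\<eta> i) (s i) (r i)"
definition Mi where "Mi i = MM m (\<eta> i) (r i) (s i)"
definition f12 where "f12 i = prof m (\<eta> i) (r i) * prof m (\<eta> i) (s i)"
definition fp where "fp i = dprof m (\<eta> i) (r i) * prof m (\<eta> i) (s i)"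
definition fq where "fq i = prof m (\<eta> i) (r i) * dprof m (\<eta> i) (s i)"
definition al where "al i = la i * (g1 i / \<kappa> - 1)"
definition be where "be i = la i * h1 i / \<kappa>"
definition cw where "cw i = (1 + al i) *\<^sub>R w i + (be i * (a i \<bullet> w i)) *\<^sub>R a i"

lemma W_nonneg: "0 <= W i" by (simp add: W_def)
lemma \<kappa>_pos: "0 < \<kappa>" using m \<kappa> by simp
lemma la_bounds: "i \<in> S ==> 0 <= la i" "i \<in> S ==> la i <= 1" "i \<in> S ==> r i * la i <= 4 * s i"
 using lam_bounds[of "r i" "s i" "\<eta> i"] pos[of i] by (auto simp: la_def)
lemma om_nonneg: "i \<in> S ==> 0 <= om i"
 using la_bounds[of i] pos[of i] W_nonneg[of i] by (auto simp: om_def intro!: add_nonneg_nonneg)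
lemma Er_nonneg: "i \<in> S ==> 0 <= Er i"
 using DD_nonneg[of "r i" "s i" m "W i"] err_nonneg[of "\<eta> i" m] pos[of i] by (simp add: Er_def)
lemma DD_Er: "dominated S (%i. DD m (r i) (s i) (W i)) Er"
proof (rule domI[of 1])
 fix i assume i: "i \<in> S"
 show "abs (DD m (r i) (s i) (W i)) <= 1 * Er i"
  using DD_nonneg[of "r i" "s i" m "W i"] err_nonneg[of "\<eta> i" m] pos[OF i] by (simp add: Er_def)
qed simp

lemma w_bdd: "bounded_on S (%i. norm (w i))"
 unfolding w_def by (intro dom_norm_diff vec_bounds)
lemma w_W: "dominated S (%i. norm (w i)) W" by (rule domI[of 1]) (auto simp: W_def)
lemma W_bdd: "bounded_on S W" using w_bdd by (simp add: W_def[abs_def])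
lemma W_om: "dominated S W om"
proof (rule domI[of 1])
 fix i assume i: "i \<in> S"
 have "0 <= abs (r i - s i) / (r i + s i)" using pos[OF i] by simp
 then show "abs (W i) <= 1 * om i" using la_bounds[OF i] W_nonneg[of i] by (simp add: om_def)
qed simp
lemma nu_om: "dominated S (%i. r i - s i) om"
proof (rule domI[of "2 * B"])
 fix i assume i: "i \<in> S"
 have "abs (r i - s i) = (r i + s i) * (abs (r i - s i) / (r i + s i))" using pos[OF i] by simp
 also have "... <= (2 * B) * om i"
  using pos[OF i] la_bounds[OF i] W_nonneg[of i] by (intro mult_mono) (auto simp: om_def intro!: divide_nonneg_pos)
 finally show "abs (r i - s i) <= 2 * B * om i" .
qed (use B in simp)
lemma la_om: "dominated S (%i. 1 - la i) om"
proof (rule domI[of 1])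
 fix i assume i: "i \<in> S"
 have "0 <= abs (r i - s i) / (r i + s i)" using pos[OF i] by simp
 then show "abs (1 - la i) <= 1 * om i" using la_bounds[OF i] W_nonneg[of i] by (simp add: om_def)
qed simp
lemma la_bdd: "bounded_on S la" by (rule domI[of 1]) (use la_bounds in auto)
lemma r_bdd: "bounded_on S r" by (rule domI[of B]) (use pos B in \<open>auto simp: less_imp_le\<close>)
lemma s_bdd: "bounded_on S s" by (rule domI[of B]) (use pos B in \<open>auto simp: less_imp_le\<close>)
lemma lip_om: "dominated S f (%i. abs (r i - s i) + norm (a i - b i)) ==> dominated S f om"
proof (erule dom_trans)
 show "dominated S (%i. abs (r i - s i) + norm (a i - b i)) om"
  using dom_add[OF dom_le[OF nu_om] W_om, of "%i. abs (r i - s i)"] by (simp add: W_def w_def)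
qed

lemma Lq_D: "dominated S (%i. Lq i * W i) (%i. DD m (r i) (s i) (W i))"
proof -
 obtain c where c: "0 <= c" "\<forall>i\<in>S. abs (W i) <= c * 1" using W_bdd unfolding dominated_def by blast
 obtain k where k: "0 <= k" "\<forall>r s w. 0 <= r & 0 <= s & r <= B & s <= B & 0 <= w & w <= c -->
  ((r + s) powr m)\<^sup>2 * abs (r - s) * w <= k * DD m r s w" using mixed_bound[OF m c(1), of B] by blast
 show ?thesis
 proof (rule domI[OF k(1)])
  fix i assume i: "i \<in> S"
  have "0 <= Lq i * W i" using W_nonneg by (simp add: Lq_def)
  then show "abs (Lq i * W i) <= k * DD m (r i) (s i) (W i)"
   using k(2)[rule_format, of "r i" "s i" "W i"] c(2) pos[OF i] W_nonneg[of i] i by (auto simp: Lq_def)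
 qed
qed

lemma Lq_om: "dominated S (%i. Lq i * om i) Er"
proof -
 have 1: "dominated S (%i. Lq i * (abs (r i - s i) / (r i + s i))) Er"
 proof (rule dom_trans[OF _ DD_Er], rule domI[of 1])
  fix i assume i: "i \<in> S"
  have "Lq i * (abs (r i - s i) / (r i + s i)) = D1 m (r i) (s i)" by (simp add: Lq_def D1_def power2_eq_square)
  then show "abs (Lq i * (abs (r i - s i) / (r i + s i))) <= 1 * DD m (r i) (s i) (W i)"
   using D1_nonneg[of "r i" "s i" m] D1_le_DD[of m "r i" "s i" "W i"] pos[OF i] by simp
 qed simp
 have 2: "dominated S (%i. Lq i * W i) Er" by (rule dom_trans[OF Lq_D DD_Er])
 obtain c where c: "0 <= c" "\<forall>\<eta> r s. 0 < \<eta> & 0 <= r & 0 <= s -->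
  ((r + s) powr m)\<^sup>2 * abs (r - s) * (1 - lam \<eta> r s) <= c * (D1 m r s + err m \<eta>)" using lam_defect[OF m] by blast
 have 3: "dominated S (%i. Lq i * (1 - la i)) Er"
 proof (rule domI[OF c(1)])
  fix i assume i: "i \<in> S"
  have "0 <= Lq i * (1 - la i)" using la_bounds[OF i] by (simp add: Lq_def)
  moreover have "Lq i * (1 - la i) <= c * (D1 m (r i) (s i) + err m (\<eta> i))"
   using c(2)[rule_format, of "\<eta> i" "r i" "s i"] pos[OF i] by (simp add: Lq_def la_def)
  moreover have "... <= c * Er i" unfolding Er_def using c(1) D1_le_DD by (intro mult_left_mono) auto
  ultimately show "abs (Lq i * (1 - la i)) <= c * Er i" by linarith
 qed
 show ?thesis unfolding om_def distrib_left using dom_add[OF dom_add[OF 1 2] 3] .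
qed

text \<open>The quantity Lq is linear in r - s and om is linear in all differences, so their product is
quadratic and bounded by the distance.\<close>

lemma key: "dominated S X Lq ==> dominated S y om ==> dominated S (%i. X i * y i) Er"
 by (rule dom_trans[OF dom_mult Lq_om])

lemma rA1: "dominated S (%i. r i * A1 i) Lq"
 by (rule domI[of "5 * (m + 8)"]) (use AD_bound pos m in \<open>auto simp: A1_def Lq_def less_imp_le\<close>)

lemma sA2: "dominated S (%i. s i * A2 i) Lq"
proof (rule domI[of "5 * (m + 8)"])
 fix i assume "i \<in> S"
 then show "abs (s i * A2 i) <= 5 * (m + 8) * Lq i"
  using AD_bound[of "\<eta> i" m "s i" "r i"] pos[of i] m by (auto simp: A2_def Lq_def add.commute abs_minus_commute)
qed (use m in simp)

lemma M_Lq: "dominated S Mi Lq"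
 by (rule domI[of 1]) (use MM_bound pos m in \<open>auto simp: Mi_def Lq_def less_imp_le\<close>)

lemma A_mult:
 assumes A: "dominated S (%i. \<rho> i * A i) Lq" and x: "dominated S x (%i. \<rho> i * y i)" and y: "dominated S y om" and \<rho>: "!!i. i \<in> S ==> 0 < \<rho> i"
 shows "dominated S (%i. A i * x i) Er"
proof -
 obtain c where c: "0 <= c" "\<forall>i\<in>S. abs (x i) <= c * (\<rho> i * y i)" using x unfolding dominated_def by blast
 have "dominated S (%i. A i * x i) (%i. abs (\<rho> i * A i) * y i)"
 proof (rule domI[OF c(1)])
  fix i assume i: "i \<in> S"
  have "abs (A i * x i) <= abs (A i) * (c * (\<rho> i * y i))" unfolding abs_mult using c(2) i by (intro mult_left_mono) auto
  then show "abs (A i * x i) <= c * (abs (\<rho> i * A i) * y i)" using \<rho>[OF i] by (simp add: abs_mult mult_ac)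
 qed
 moreover have "dominated S (%i. abs (\<rho> i * A i)) Lq" by (rule dom_le[OF A]) auto
 ultimately show ?thesis using key[of "%i. abs (\<rho> i * A i)" y] y dom_trans by blast
qed

lemma A1_mult: "dominated S x (%i. r i * y i) ==> dominated S y om ==> dominated S (%i. A1 i * x i) Er"
 and A2_mult: "dominated S x (%i. s i * y i) ==> dominated S y om ==> dominated S (%i. A2 i * x i) Er"
 using A_mult[OF rA1] A_mult[OF sA2] pos by blast+

lemma defects:
 "dominated S (%i. r i * A1 i + s i * A2 i) Er"
 "dominated S (%i. Mi i - \<kappa> / 2 * (r i * A1 i - s i * A2 i)) Er"
proof -
 obtain c where c: "0 <= c" "\<forall>\<eta> r s. 0 < \<eta> & 0 <= r & 0 <= s -->
   abs (r * AD m \<eta> r s + s * AD m \<eta> s r) <= c * (D1 m r s + err m \<eta>) &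
   abs (MM m \<eta> r s - (r * AD m \<eta> r s - s * AD m \<eta> s r) / (4 * m)) <= c * (D1 m r s + err m \<eta>)"
  using quadratic_defects[OF m] by blast
 have le: "c * (D1 m (r i) (s i) + err m (\<eta> i)) <= c * Er i" for i
  unfolding Er_def using c(1) D1_le_DD by (intro mult_left_mono) auto
 have k2: "\<kappa> / 2 * x = x / (4 * m)" for x using m by (simp add: \<kappa>)
 show "dominated S (%i. r i * A1 i + s i * A2 i) Er"
 proof (rule domI[OF c(1)])
  fix i assume i: "i \<in> S"
  show "abs (r i * A1 i + s i * A2 i) <= c * Er i"
   using c(2)[rule_format, of "\<eta> i" "r i" "s i"] le[of i] pos[OF i] unfolding A1_def A2_def by linarith
 qed
 show "dominated S (%i. Mi i - \<kappa> / 2 * (r i * A1 i - s i * A2 i)) Er"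
 proof (rule domI[OF c(1)])
  fix i assume i: "i \<in> S"
  show "abs (Mi i - \<kappa> / 2 * (r i * A1 i - s i * A2 i)) <= c * Er i"
   using c(2)[rule_format, of "\<eta> i" "r i" "s i"] le[of i] pos[OF i] unfolding A1_def A2_def Mi_def k2 by linarith
 qed
qed

lemma AA_Er: "dominated S (%i. AA m (\<eta> i) (r i) (s i)) Er"
proof (rule dom_trans[OF _ DD_Er], rule domI[of "4 * (m + 8)"])
 fix i assume i: "i \<in> S"
 have "abs (AA m (\<eta> i) (r i) (s i)) <= 4 * (m + 8) * D1 m (r i) (s i)" using AA_bound[of "\<eta> i" m "r i" "s i"] pos[OF i] m by simp
 also have "... <= 4 * (m + 8) * DD m (r i) (s i) (W i)" using m D1_le_DD by (intro mult_left_mono) auto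
 finally show "abs (AA m (\<eta> i) (r i) (s i)) <= 4 * (m + 8) * DD m (r i) (s i) (W i)" .
qed (use m in simp)

lemma f12_Pm: "dominated S f12 (%i. Pm m (r i) (s i))"
 by (rule domI[of 1]) (auto simp: f12_def prof_nonneg prof_prod_le)

lemma Pm_W2: "dominated S (%i. Pm m (r i) (s i) * (W i)\<^sup>2) Er"
 by (rule dom_trans[OF _ DD_Er], rule domI[of 1]) (use Pm_le_DD pos Pm_nonneg in \<open>auto simp: less_imp_le\<close>)

lemma f12_W2: "dominated S x (%i. (W i)\<^sup>2) ==> dominated S (%i. f12 i * x i) Er"
 by (rule dom_trans[OF dom_mult[OF f12_Pm] Pm_W2])

lemma Pm_cross: "dominated S (%i. Pm m (r i) (s i) * (W i * (abs (r i - s i) + W i + (r i + s i) * (1 - la i)))) Er"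
proof -
 have 1: "dominated S (%i. Pm m (r i) (s i) * abs (r i - s i) * W i) Er"
 proof (rule dom_trans[OF _ DD_Er], rule domI[of "1 + B"])
  fix i assume i: "i \<in> S"
  have "0 <= Pm m (r i) (s i) * abs (r i - s i) * W i" using Pm_nonneg W_nonneg by simp
  then show "abs (Pm m (r i) (s i) * abs (r i - s i) * W i) <= (1 + B) * DD m (r i) (s i) (W i)"
   using product_bound[of m "r i" "s i" B "W i"] pos[OF i] m W_nonneg[of i] by simp
 qed (use B in simp)
 obtain d where d: "0 <= d" "\<forall>i\<in>S. abs (W i) <= d * 1" using W_bdd unfolding dominated_def by blast
 obtain c where c: "0 <= c" "\<forall>\<eta> r s w. 0 < \<eta> & 0 <= r & 0 <= s & r <= B & s <= B & 0 <= w & w <= d -->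
  Pm m r s * (r + s) * (1 - lam \<eta> r s) * w <= c * (DD m r s w + err m \<eta>)" using lam_defect_product[OF m B d(1)] by blast
 have 2: "dominated S (%i. Pm m (r i) (s i) * (r i + s i) * (1 - la i) * W i) Er"
 proof (rule domI[OF c(1)])
  fix i assume i: "i \<in> S"
  have "0 <= Pm m (r i) (s i) * (r i + s i) * (1 - la i) * W i"
   using Pm_nonneg W_nonneg la_bounds[OF i] pos[OF i] by (intro mult_nonneg_nonneg) auto
  then show "abs (Pm m (r i) (s i) * (r i + s i) * (1 - la i) * W i) <= c * Er i"
   using c(2)[rule_format, of "\<eta> i" "r i" "s i" "W i"] pos[OF i] W_nonneg[of i] d(2) i by (auto simp: la_def Er_def)
 qed
 have "dominated S (%i. Pm m (r i) (s i) * abs (r i - s i) * W i + Pm m (r i) (s i) * (W i)\<^sup>2 + Pm m (r i) (s i) * (r i + s i) * (1 - la i) * W i) Er"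
  by (intro dom_add 1 2 Pm_W2)
 then show ?thesis by (rule dom_cong) (simp add: power2_eq_square algebra_simps)
qed

lemma f12_cross:
 assumes "dominated S x W" "dominated S y (%i. abs (r i - s i) + W i + (r i + s i) * (1 - la i))"
 shows "dominated S (%i. f12 i * (x i * y i)) Er"
 by (rule dom_trans[OF dom_mult[OF f12_Pm dom_mult[OF assms]] Pm_cross])

lemma dprof_mult:
 assumes "dominated S x \<rho>" "!!i. i \<in> S ==> 0 < \<rho> i" "!!i. i \<in> S ==> 0 < \<sigma> i"
 shows "dominated S (%i. (dprof m (\<eta> i) (\<rho> i) * prof m (\<eta> i) (\<sigma> i)) * x i) (%i. Pm m (\<rho> i) (\<sigma> i))"
proof -
 obtain c where c: "0 <= c" "\<forall>i\<in>S. abs (x i) <= c * \<rho> i" using assms(1) unfolding dominated_def by blast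
 show ?thesis
 proof (rule domI[of "c * (m + 8)"])
  fix i assume i: "i \<in> S"
  let ?f = "dprof m (\<eta> i) (\<rho> i) * prof m (\<eta> i) (\<sigma> i)"
  have f: "0 <= ?f" using dprof_nonneg[of "\<eta> i" m "\<rho> i"] prof_nonneg[of m "\<eta> i" "\<sigma> i"] pos[OF i] m by simp
  have "abs (?f * x i) <= ?f * (c * \<rho> i)"
   unfolding abs_mult[of ?f "x i"] abs_of_nonneg[OF f] using c(2) i by (intro mult_left_mono[OF _ f]) auto
  also have "... = c * ((\<rho> i * dprof m (\<eta> i) (\<rho> i)) * prof m (\<eta> i) (\<sigma> i))" by simp
  also have "... <= c * (((m + 8) * \<rho> i powr m) * \<sigma> i powr m)"
   using dprof_le[of "\<eta> i" m "\<rho> i"] prof_le[of m "\<eta> i" "\<sigma> i"] prof_nonneg[of m "\<eta> i" "\<sigma> i"] pos[OF i] m c(1) assms(2,3)[OF i]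
   by (intro mult_left_mono mult_mono[of "_ * _" "_ * _ powr _"]) auto
  finally show "abs (?f * x i) <= c * (m + 8) * Pm m (\<rho> i) (\<sigma> i)" by (simp add: Pm_def mult_ac)
 qed (use c m in simp)
qed

lemma fp_mult: "dominated S x r ==> dominated S (%i. fp i * x i) (%i. Pm m (r i) (s i))"
 and fq_mult: "dominated S x s ==> dominated S (%i. fq i * x i) (%i. Pm m (r i) (s i))"
 using dprof_mult[of x r s] dprof_mult[of x s r] pos by (simp_all add: fp_def fq_def Pm_def mult.commute)

lemma Q_mult: "dominated S Q (%i. (W i)\<^sup>2) ==> dominated S x (%i. Pm m (r i) (s i)) ==> dominated S (%i. Q i * x i) Er"
proof -
 assume "dominated S Q (%i. (W i)\<^sup>2)" "dominated S x (%i. Pm m (r i) (s i))"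
 from dom_mult[OF this] show ?thesis by (rule dom_trans) (use Pm_W2 in \<open>simp add: mult.commute\<close>)
qed

lemma la_r_s: "dominated S x r ==> dominated S (%i. la i * x i) s"
proof -
 assume "dominated S x r"
 then obtain c where c: "0 <= c" "\<forall>i\<in>S. abs (x i) <= c * r i" unfolding dominated_def by blast
 show ?thesis
 proof (rule domI[of "4 * c"])
  fix i assume i: "i \<in> S"
  have "abs (la i * x i) <= la i * (c * r i)" unfolding abs_mult using c(2) i la_bounds[OF i] by (auto intro: mult_left_mono)
  also have "... = c * (r i * la i)" by simp
  also have "... <= c * (4 * s i)" using la_bounds[OF i] c(1) by (intro mult_left_mono) auto
  finally show "abs (la i * x i) <= 4 * c * s i" by simp
 qed (use c in simp)
qed

lemma la_r_r: "dominated S x r ==> dominated S (%i. la i * x i) r" by (rule dom_bdd[OF la_bdd])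

lemma sums_bdd:
 "bounded_on S (%i. \<Sum>j\<in>UNIV. Y i j $ j)" "bounded_on S (%i. \<Sum>j\<in>UNIV. Z i j $ j)"
 "bounded_on S (%i. \<Sum>j\<in>UNIV. a i $ j * (Y i j \<bullet> a i))"
 "bounded_on S (%i. \<Sum>j\<in>UNIV. a i $ j * (Z i j \<bullet> a i))"
 "bounded_on S (%i. \<Sum>j\<in>UNIV. b i $ j * (Z i j \<bullet> b i))"
 using jac_bounds vec_bounds dom_inner[OF jac_bounds(1) vec_bounds(1)] dom_inner[OF jac_bounds(2) vec_bounds(1)]
  dom_inner[OF jac_bounds(2) vec_bounds(2)]
 by (auto intro!: dom_sum dom_nth dom_bdd)

lemma inner_bdd:
 "bounded_on S (%i. a i \<bullet> p i)" "bounded_on S (%i. a i \<bullet> q i)" "bounded_on S (%i. b i \<bullet> q i)"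
 using dom_inner[OF vec_bounds(1) vec_bounds(3)] dom_inner[OF vec_bounds(1) vec_bounds(4)] dom_inner[OF vec_bounds(2) vec_bounds(4)] by auto

lemma w_inner:
 "bounded_on S (%i. norm (v i)) ==> dominated S (%i. w i \<bullet> v i) W"
 "bounded_on S (%i. norm (v i)) ==> dominated S (%i. v i \<bullet> w i) W"
 using dom_inner[OF w_W, of v "%i. 1"] dom_inner[OF _ w_W, of v "%i. 1"] by auto

lemma alpha_beta:
 "dominated S al r" "dominated S al s" "dominated S be r" "dominated S be s"
 "bounded_on S al" "bounded_on S be"
proof -
 have g: "dominated S (%i. g1 i / \<kappa> - 1) r"
  by (rule dom_cong[OF dom_bdd[OF dom_const[of _ "1 / \<kappa>"] small(5)]]) (use \<kappa>_pos in \<open>simp add: field_simps\<close>)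
 have h: "dominated S (%i. h1 i / \<kappa>) r"
  by (rule dom_cong[OF dom_bdd[OF dom_const[of _ "1 / \<kappa>"] small(6)]]) simp
 show 1: "dominated S al r" "dominated S al s" "dominated S be r" "dominated S be s"
  using la_r_r[OF g] la_r_s[OF g] la_r_r[OF h] la_r_s[OF h] by (auto simp: al_def[abs_def] be_def[abs_def])
 show "bounded_on S al" "bounded_on S be" using 1 dom_trans[OF _ r_bdd] by auto
qed

lemma ka: "\<kappa> * (1 + al i) = \<kappa> + la i * (g1 i - \<kappa>)" "\<kappa> * be i = la i * h1 i"
 using \<kappa>_pos by (auto simp: al_def be_def field_simps)

lemma cw_w:
 assumes "bounded_on S (%i. norm (v i))"
 shows "dominated S (%i. (cw i - w i) \<bullet> v i) (%i. r i * W i)" "dominated S (%i. (cw i - w i) \<bullet> v i) (%i. s i * W i)"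
proof -
 have e: "(cw i - w i) \<bullet> v i = al i * (w i \<bullet> v i) + be i * ((a i \<bullet> w i) * (a i \<bullet> v i))" for i
  by (simp add: cw_def inner_add_left inner_diff_left algebra_simps)
 have av: "bounded_on S (%i. a i \<bullet> v i)" using dom_inner[OF vec_bounds(1) assms] by simp
 have aw: "dominated S (%i. (a i \<bullet> w i) * (a i \<bullet> v i)) W" by (rule dom_bdd2[OF w_inner(2)[OF vec_bounds(1)] av])
 show "dominated S (%i. (cw i - w i) \<bullet> v i) (%i. r i * W i)" "dominated S (%i. (cw i - w i) \<bullet> v i) (%i. s i * W i)"
  unfolding e using alpha_beta w_inner(1)[OF assms] aw by (auto intro!: dom_add dom_mult)
qed

text \<open>The transport coefficient of the second density equation must be compared with the interpolated
coefficient of the first flow, and the error has to be small relative to s, the density of the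
second flow. If r \<le> 2 s this is the Lipschitz bound; otherwise the densities are so far apart
that om is bounded below, and the factor la turns O(r) into O(s).\<close>

lemma t2_defect: "dominated S (%i. la i * t1 i - t2 i) (%i. s i * om i)"
proof -
 obtain c1 where c1: "0 <= c1" "\<forall>i\<in>S. abs (t1 i) <= c1 * r i" using small(1) unfolding dominated_def by blast
 obtain c2 where c2: "0 <= c2" "\<forall>i\<in>S. abs (t2 i) <= c2 * s i" using small(2) unfolding dominated_def by blast
 obtain k where k: "0 <= k" "\<forall>i\<in>S. abs (t1 i - t2 i) <= k * (abs (r i - s i) + s i * norm (a i - b i))"
  using t_lip unfolding dominated_def by blast
 define c where "c = 3 * (4 * c1 + c2) + 3 * k + 2 * c1"
 show ?thesis
 proof (rule domI[of c])
  fix i assume i: "i \<in> S"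
  note P = pos[OF i] and l = la_bounds[OF i]
  define R where "R = abs (r i - s i) / (r i + s i)"
  have R0: "0 <= R" using P by (simp add: R_def)
  have om: "om i = R + W i + (1 - la i)" by (simp add: om_def R_def)
  have o0: "0 <= om i" "R <= om i" "W i <= om i" "1 - la i <= om i" using om R0 W_nonneg[of i] l by auto
  show "abs (la i * t1 i - t2 i) <= c * (s i * om i)"
  proof (cases "r i <= 2 * s i")
   case True
   have nu: "abs (r i - s i) <= 3 * s i * R"
   proof -
    have "abs (r i - s i) = (r i + s i) * R" using P by (simp add: R_def)
    also have "... <= 3 * s i * R" using True R0 by (intro mult_right_mono) auto
    finally show ?thesis .
   qed
   have "abs (t1 i - t2 i) <= k * (abs (r i - s i) + s i * W i)" using k(2) i by (simp add: W_def w_def)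
   also have "... <= k * (3 * s i * om i)"
   proof (rule mult_left_mono[OF _ k(1)])
    have "abs (r i - s i) + s i * W i <= 3 * s i * R + 3 * s i * W i" using nu P W_nonneg[of i] by (intro add_mono) auto
    also have "... <= 3 * s i * om i" unfolding distrib_left[symmetric] om using P l by (intro mult_left_mono) auto
    finally show "abs (r i - s i) + s i * W i <= 3 * s i * om i" .
   qed
   finally have A: "abs (t1 i - t2 i) <= 3 * k * (s i * om i)" by (simp add: mult_ac)
   have "abs ((1 - la i) * t1 i) <= om i * (c1 * r i)" unfolding abs_mult using o0 l c1 i by (intro mult_mono) auto
   also have "... <= om i * (c1 * (2 * s i))" using True o0 c1(1) by (intro mult_left_mono) auto
   finally have B': "abs ((1 - la i) * t1 i) <= 2 * c1 * (s i * om i)" by (simp add: mult_ac)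
   have "la i * t1 i - t2 i = (t1 i - t2 i) - (1 - la i) * t1 i" by (simp add: algebra_simps)
   then have "abs (la i * t1 i - t2 i) <= 3 * k * (s i * om i) + 2 * c1 * (s i * om i)" using A B' by linarith
   also have "... = (3 * k + 2 * c1) * (s i * om i)" by (simp add: distrib_right)
   also have "... <= c * (s i * om i)" unfolding c_def using c1(1) c2(1) P o0 by (intro mult_right_mono) auto
   finally show ?thesis .
  next
   case False
   have R: "1 <= 3 * R"
   proof -
    have "r i + s i <= 3 * abs (r i - s i)" using False P by (smt (verit))
    then show ?thesis using P by (simp add: R_def pos_le_divide_eq)
   qed
   have "abs (la i * t1 i) <= la i * (c1 * r i)" unfolding abs_mult using c1 i l by (auto intro: mult_left_mono)
   also have "... = c1 * (r i * la i)" by simp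
   also have "... <= c1 * (4 * s i)" using l c1(1) by (intro mult_left_mono) auto
   finally have x: "abs (la i * t1 i) <= c1 * (4 * s i)" .
   have y: "abs (t2 i) <= c2 * s i" using c2(2) i by blast
   have "abs (la i * t1 i - t2 i) <= c1 * (4 * s i) + c2 * s i" using abs_triangle_ineq4[of "la i * t1 i" "t2 i"] x y by linarith
   also have "... = (4 * c1 + c2) * s i" by (simp add: distrib_right)
   also have "... <= (4 * c1 + c2) * s i * (3 * om i)"
   proof -
    have "1 <= 3 * om i" using R o0 by linarith
    from mult_left_mono[OF this, of "(4 * c1 + c2) * s i"] show ?thesis using c1(1) c2(1) P by simp
   qed
   also have "... = 3 * (4 * c1 + c2) * (s i * om i)" by simp
   also have "... <= c * (s i * om i)" unfolding c_def using c1(1) k(1) P o0 by (intro mult_right_mono) auto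
   finally show ?thesis .
  qed
 qed (use c1 c2 k in \<open>simp add: c_def\<close>)
qed

text \<open>Each of the terms of the identity is a product of a factor of size Lq with one of size om, or
carries f12 and two differences of velocities; both kinds are bounded by the distance.\<close>

theorem remainder_dominated:
 fixes rt st Q RQt :: "'i => real" and ya yb :: "'i => real ^ 'd" and Ra Rc RQ Rs :: "'i => 'd => real"
 assumes zc: "!!i P. i \<in> S ==> n1 i * (z i \<bullet> P - (z i \<bullet> a i) * (a i \<bullet> P)) = cw i \<bullet> P"
  and rt: "!!i. i \<in> S ==> rt i = - (1 + t1 i) * (a i \<bullet> p i)
    - r i * (g1 i * tr_jac Y i + h1 i * quad_jac a Y i)"
  and st: "!!i. i \<in> S ==> st i = - (1 + t2 i) * (b i \<bullet> q i)
    - s i * (g2 i * tr_jac Z i + h2 i * quad_jac b Z i)"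
  and ya: "!!i. i \<in> S ==> ya i = - ((1 + s1 i) *\<^sub>R (\<Sum>j\<in>UNIV. a i $ j *\<^sub>R Y i j)) - n1 i *\<^sub>R (p i - (a i \<bullet> p i) *\<^sub>R a i)"
  and yb: "!!i. i \<in> S ==> yb i = - ((1 + s2 i) *\<^sub>R (\<Sum>j\<in>UNIV. b i $ j *\<^sub>R Z i j)) - n2 i *\<^sub>R (q i - (b i \<bullet> q i) *\<^sub>R b i)"
  and Q: "dominated S Q (%i. (W i)\<^sup>2)" and RQt: "dominated S RQt (%i. (W i)\<^sup>2)"
  and RQ: "!!j. dominated S (%i. RQ i j) (%i. (W i)\<^sup>2)" and Rc: "!!j. dominated S (%i. Rc i j) W"
  and Ra: "!!j. bounded_on S (%i. Ra i j)" and Rs: "!!j. bounded_on S (%i. Rs i j)"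
 shows "dominated S (%i.
   (A1 i * rt i + A2 i * st i + (1 / 2) * (fp i * rt i + fq i * st i) * Q i
    + (1 / 2) * f12 i * (2 * (z i \<bullet> (ya i - yb i)) + RQt i))
   + (\<Sum>j\<in>UNIV. (((1 / 2) *\<^sub>R (a i + b i)) $ j + la i * t1 i * a i $ j) * (A1 i * p i $ j + A2 i * q i $ j)
     + AA m (\<eta> i) (r i) (s i) * Ra i j
     + ((A1 i / 2 + f12 i) * p i $ j + (- A2 i / 2 - f12 i) * q i $ j) * cw i $ j
     + Mi i * ((1 + al i) * (Y i j - Z i j) $ j + be i * (a i \<bullet> (Y i j - Z i j)) * a i $ j + Rc i j)
     + (1 / 2) * (fp i * p i $ j + fq i * q i $ j) * Q i * (((1 / 2) *\<^sub>R (a i + b i)) $ j + la i * s1 i * a i $ j)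
     + (1 / 2) * f12 i * (2 * (z i \<bullet> (Y i j - Z i j)) + RQ i j) * (((1 / 2) *\<^sub>R (a i + b i)) $ j + la i * s1 i * a i $ j)
     + (1 / 2) * f12 i * Q i * Rs i j)
   + Q i / 4 * (fp i * (w i \<bullet> p i) - fq i * (w i \<bullet> q i))) Er"
proof -
 define x1 where "x1 i = (1 + al i) * tr_jac Y i + be i * quad_jac a Y i" for i
 define x2 where "x2 i = (1 + al i) * tr_jac Z i + be i * quad_jac a Z i" for i
 define K where "K i = (\<Sum>j\<in>UNIV. (- (1 / 2) * w i $ j + (la i * s1 i - s1 i) * a i $ j) *\<^sub>R Y i j)
   + (\<Sum>j\<in>UNIV. (- (1 / 2) * w i $ j + (s2 i * b i $ j - la i * s1 i * a i $ j)) *\<^sub>R Z i j)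
   - (n1 i - n2 i) *\<^sub>R (q i - (a i \<bullet> q i) *\<^sub>R a i) + n2 i *\<^sub>R ((a i \<bullet> q i) *\<^sub>R a i - (b i \<bullet> q i) *\<^sub>R b i)" for i
 have one_al: "bounded_on S (%i. 1 + al i)" by (intro dom_add dom_const alpha_beta)
 have x_bdd: "bounded_on S x1" "bounded_on S x2"
  unfolding x1_def[abs_def] x2_def[abs_def] by (intro dom_add dom_bdd one_al sums_bdd alpha_beta)+
 have U_bdd: "bounded_on S (%i. ((1 / 2) *\<^sub>R (a i + b i)) $ j)" for j
  by (rule dom_cong[OF dom_bdd[OF dom_const[of _ "1 / 2"] dom_nth[OF dom_norm_add[OF vec_bounds(1,2)], of j]]]) simp
 have ls1: "bounded_on S (%i. la i * s1 i)" by (rule dom_trans[OF la_r_r[OF small(3)] r_bdd])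
 have Uxi: "bounded_on S (%i. ((1 / 2) *\<^sub>R (a i + b i)) $ j + la i * s1 i * a i $ j)" for j
  by (intro dom_add U_bdd dom_bdd ls1 dom_nth vec_bounds)
 have T1: "dominated S (%i. (1 / 2) * (A1 i * ((cw i - w i) \<bullet> p i)) - (1 / 2) * (A2 i * ((cw i - w i) \<bullet> q i))) Er"
  by (intro dom_diff dom_bdd[OF dom_const] A1_mult[OF cw_w(1) W_om] A2_mult[OF cw_w(2) W_om] vec_bounds)
 have "dominated S (%i. (la i * t1 i - t1 i) * (a i \<bullet> p i)) (%i. r i * (1 - la i))"
  by (rule dom_cong[OF dom_bdd2[OF dom_mult[OF dom_minus[OF small(1)] dom_refl[of S "%i. 1 - la i"]] inner_bdd(1)]])
   (use la_bounds in \<open>auto simp: algebra_simps\<close>)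
 from A1_mult[OF this la_om] have T2a: "dominated S (%i. A1 i * (la i * t1 i - t1 i) * (a i \<bullet> p i)) Er"
  by (simp add: mult.assoc)
 have "dominated S (%i. (la i * t1 i - t2 i) * (a i \<bullet> q i) + t2 i * (w i \<bullet> q i)) (%i. s i * om i)"
  by (intro dom_add dom_bdd2[OF t2_defect inner_bdd(2)] dom_mult[OF small(2) dom_trans[OF w_inner(1)[OF vec_bounds(4)] W_om]])
 from A2_mult[OF this dom_refl] have T2b: "dominated S (%i. A2 i * ((la i * t1 i - t2 i) * (a i \<bullet> q i) + t2 i * (w i \<bullet> q i))) Er"
  using om_nonneg by blast
 have T3: "dominated S (%i. (Mi i - \<kappa> / 2 * (r i * A1 i - s i * A2 i)) * (x1 i - x2 i) - \<kappa> / 2 * (r i * A1 i + s i * A2 i) * (x1 i + x2 i)) Er"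
  by (intro dom_diff dom_bdd2[OF defects(2)] dom_bdd2[OF dom_bdd[OF dom_const defects(1)]] dom_add x_bdd)
 have G1a: "dominated S (%i. g1 i - \<kappa> * (1 + al i)) om"
  unfolding ka by (rule dom_cong[OF dom_bdd[OF dom_trans[OF small(5) r_bdd] la_om]]) (simp add: algebra_simps)
 have "dominated S (%i. h1 i - \<kappa> * be i) om"
  unfolding ka by (rule dom_cong[OF dom_bdd[OF dom_trans[OF small(6) r_bdd] la_om]]) (simp add: algebra_simps)
 note G1 = G1a this
 have G2: "dominated S (%i. g2 i - \<kappa> * (1 + al i)) om" "dominated S (%i. h2 i - \<kappa> * be i) om"
  using dom_diff[OF G1(1) lip_om[OF lip(2)]] dom_diff[OF G1(2) lip_om[OF lip(3)]] by (auto elim!: dom_cong)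
 have T4: "dominated S (%i. (r i * A1 i) * ((g1 i - \<kappa> * (1 + al i)) * tr_jac Y i + (h1 i - \<kappa> * be i) * quad_jac a Y i)) Er"
  by (intro key[OF rA1] dom_add dom_bdd2[OF G1(1)] dom_bdd2[OF G1(2)] sums_bdd)
 have eZ: "dominated S (%i. quad_jac b Z i - quad_jac a Z i) om"
 proof (rule dom_trans[OF _ W_om], rule dom_cong)
  show "dominated S (%i. \<Sum>j\<in>UNIV. - (w i $ j * (Z i j \<bullet> b i) + a i $ j * (Z i j \<bullet> w i))) W"
  proof -
   have zb: "bounded_on S (%i. Z i j \<bullet> b i)" for j using dom_inner[OF jac_bounds(2) vec_bounds(2)] by simp
   show ?thesis
    by (intro dom_sum finite dom_minus dom_add dom_bdd2[OF dom_nth[OF w_W] zb]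
      dom_bdd[OF dom_nth[OF vec_bounds(1)] w_inner(2)[OF jac_bounds(2)]])
  qed
  show "quad_jac b Z i - quad_jac a Z i
    = (\<Sum>j\<in>UNIV. - (w i $ j * (Z i j \<bullet> b i) + a i $ j * (Z i j \<bullet> w i)))" for i
   unfolding sum_subtractf[symmetric] by (rule sum.cong) (auto simp: w_def inner_diff_right algebra_simps)
 qed
 have T5: "dominated S (%i. (s i * A2 i) * ((g2 i - \<kappa> * (1 + al i)) * tr_jac Z i + (h2 i - \<kappa> * be i) * quad_jac b Z i
     + \<kappa> * be i * (quad_jac b Z i - quad_jac a Z i))) Er"
  by (intro key[OF sA2] dom_add dom_bdd2[OF G2(1)] dom_bdd2[OF G2(2)] sums_bdd dom_bdd[OF _ eZ] dom_bdd[OF dom_const alpha_beta(6)])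
 have T6: "dominated S (%i. AA m (\<eta> i) (r i) (s i) * (\<Sum>j\<in>UNIV. Ra i j) + Mi i * (\<Sum>j\<in>UNIV. Rc i j)
    + (1 / 2) * f12 i * ((\<Sum>j\<in>UNIV. RQ i j * (((1 / 2) *\<^sub>R (a i + b i)) $ j + la i * s1 i * a i $ j)) + Q i * (\<Sum>j\<in>UNIV. Rs i j) + RQt i)) Er"
  unfolding mult.assoc[of "1 / 2"]
  by (intro dom_add dom_bdd2[OF AA_Er] key[OF M_Lq dom_trans[OF _ W_om]] dom_bdd[OF dom_const] f12_W2 dom_sum finite Ra Rc
    dom_bdd2[OF RQ Uxi] dom_bdd2[OF Q] Rs RQt)
 have T7: "dominated S (%i. (1 / 2) * Q i * (fp i * ((la i * s1 i - t1 i) * (a i \<bullet> p i)) + fq i * (la i * s1 i * (a i \<bullet> q i) - t2 i * (b i \<bullet> q i)))) Er"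
  unfolding mult.assoc[of "1 / 2"]
  by (intro dom_bdd[OF dom_const] Q_mult[OF Q] dom_add fp_mult fq_mult dom_bdd2[OF _ inner_bdd(1)] dom_diff
    dom_bdd2[OF _ inner_bdd(2)] dom_bdd2[OF _ inner_bdd(3)] la_r_r la_r_s small)
 have g_bdd: "bounded_on S g1" "bounded_on S g2"
  using dom_add[OF dom_trans[OF small(5) r_bdd] dom_const[of _ \<kappa>]] dom_add[OF dom_trans[OF small(7) s_bdd] dom_const[of _ \<kappa>]] by auto
 have h_bdd: "bounded_on S h1" "bounded_on S h2" using dom_trans[OF small(6) r_bdd] dom_trans[OF small(8) s_bdd] by auto
 have fr: "dominated S (%i. r i * fp i) (%i. Pm m (r i) (s i))" "dominated S (%i. s i * fq i) (%i. Pm m (r i) (s i))"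
  using fp_mult[OF dom_refl] fq_mult[OF dom_refl] pos by (auto simp: mult.commute less_imp_le)
 have T8: "dominated S (%i. (1 / 2) * Q i * ((r i * fp i) * (g1 i * tr_jac Y i + h1 i * quad_jac a Y i)
     + (s i * fq i) * (g2 i * tr_jac Z i + h2 i * quad_jac b Z i))) Er"
  unfolding mult.assoc[of "1 / 2"]
  by (intro dom_bdd[OF dom_const] Q_mult[OF Q] dom_add dom_bdd2[OF fr(1)] dom_bdd2[OF fr(2)] dom_bdd g_bdd h_bdd sums_bdd)
 let ?R = "%i. abs (r i - s i) + W i + (r i + s i) * (1 - la i)"
 have R0: "0 <= (r i + s i) * (1 - la i)" if "i \<in> S" for i using that pos[of i] la_bounds[of i] by (intro mult_nonneg_nonneg) auto
 have WR: "dominated S W ?R" by (rule domI[of 1]) (use R0 W_nonneg in \<open>auto intro!: add_nonneg_nonneg\<close>)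
 have lR: "dominated S f ?R" if "dominated S f (%i. abs (r i - s i) + norm (a i - b i))" for f
  by (rule dom_trans[OF that], rule domI[of 1]) (use R0 W_nonneg in \<open>auto simp: W_def w_def\<close>)
 have cR: "dominated S (%i. (1 - la i) * f i) ?R" if f: "dominated S f r" for f
 proof -
  obtain c where c: "0 <= c" "\<forall>i\<in>S. abs (f i) <= c * r i" using f unfolding dominated_def by blast
  show ?thesis
  proof (rule domI[OF c(1)])
   fix i assume i: "i \<in> S"
   have "abs ((1 - la i) * f i) <= (1 - la i) * (c * r i)" unfolding abs_mult using c(2) i la_bounds[OF i] by (auto intro: mult_left_mono)
   also have "... <= (1 - la i) * (c * (r i + s i))" using c(1) la_bounds[OF i] pos[OF i] by (intro mult_left_mono) auto
   also have "... = c * ((r i + s i) * (1 - la i))" by simp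
   also have "... <= c * ?R i" using c(1) W_nonneg[of i] by (intro mult_left_mono) auto
   finally show "abs ((1 - la i) * f i) <= c * ?R i" .
  qed
 qed
 have s_bdds: "bounded_on S s1" "bounded_on S s2" using dom_trans[OF small(3) r_bdd] dom_trans[OF small(4) s_bdd] by auto
 have wR: "dominated S (%i. - (1 / 2) * w i $ j) ?R" for j
  by (intro dom_bdd[OF dom_const] dom_trans[OF dom_nth[OF w_W] WR])
 have k1: "dominated S (%i. (la i * s1 i - s1 i) * a i $ j) ?R" for j
  by (rule dom_cong[OF dom_bdd2[OF dom_minus[OF cR[OF small(3)]] dom_nth[OF vec_bounds(1)]]]) (simp add: algebra_simps)
 have k2: "dominated S (%i. s2 i * b i $ j - la i * s1 i * a i $ j) ?R" for j
 proof (rule dom_cong)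
  show "dominated S (%i. (1 - la i) * s1 i * a i $ j - (s1 i - s2 i) * a i $ j - s2 i * w i $ j) ?R"
   by (intro dom_diff dom_bdd2[OF cR[OF small(3)]] dom_bdd2[OF lR[OF lip(1)]] dom_bdd[OF s_bdds(2)] dom_nth vec_bounds dom_trans[OF dom_nth[OF w_W] WR])
  show "s2 i * b i $ j - la i * s1 i * a i $ j = (1 - la i) * s1 i * a i $ j - (s1 i - s2 i) * a i $ j - s2 i * w i $ j" for i
   by (simp add: w_def algebra_simps)
 qed
 have sc: "dominated S (%i. norm (f i *\<^sub>R v i)) ?R" if "dominated S f ?R" "bounded_on S (%i. norm (v i))" for f and v :: "'i => real ^ 'd"
  using dom_norm_scale[OF that] by simp
 have sc1: "bounded_on S (%i. norm (f i *\<^sub>R v i))" if "bounded_on S f" "bounded_on S (%i. norm (v i))" for f and v :: "'i => real ^ 'd"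
  using dom_norm_scale[OF that] by simp
 have k3: "dominated S (%i. norm (n2 i *\<^sub>R ((a i \<bullet> q i) *\<^sub>R a i - (b i \<bullet> q i) *\<^sub>R b i))) ?R"
 proof -
  have e: "n2 i *\<^sub>R ((a i \<bullet> q i) *\<^sub>R a i - (b i \<bullet> q i) *\<^sub>R b i) = (n2 i * (w i \<bullet> q i)) *\<^sub>R a i + (n2 i * (b i \<bullet> q i)) *\<^sub>R w i" for i
   by (simp add: w_def inner_diff_left algebra_simps)
  have "dominated S (%i. norm ((n2 i * (b i \<bullet> q i)) *\<^sub>R w i)) ?R"
   using dom_norm_scale[OF dom_bdd[OF n_bounds(2) inner_bdd(3)] dom_trans[OF w_W WR]] by simp
  then show ?thesis unfolding e
   by (rule dom_norm_add[OF sc[OF dom_bdd[OF n_bounds(2) dom_trans[OF w_inner(1)[OF vec_bounds(4)] WR]] vec_bounds(1)]])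
 qed
 have KR: "dominated S (%i. norm (K i)) ?R"
  unfolding K_def
  by (intro dom_norm_add dom_norm_diff dom_norm_sum finite k3 sc dom_add wR k1 k2 jac_bounds lR[OF lip(4)] sc1 inner_bdd(2) vec_bounds)
 have "dominated S (%i. norm (z i)) W" using z by (simp add: W_def[abs_def] w_def[abs_def])
 from f12_cross[OF this KR] have "dominated S (%i. f12 i * (norm (z i) * norm (K i))) Er" .
 then have T9: "dominated S (%i. f12 i * (z i \<bullet> K i)) Er"
  by (rule dom_le) (auto simp: abs_mult Cauchy_Schwarz_ineq2 mult_left_mono)
 note sum = dom_add[OF dom_diff[OF dom_add[OF dom_add[OF dom_diff[OF dom_diff[OF dom_add[OF dom_add[OF T1 dom_add[OF T2a T2b]] T3] T4] T5] T6] T7] T8] T9]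
 show ?thesis
  by (rule dom_cong[OF sum[unfolded x1_def x2_def K_def]])
   (rule remainder_identity[where \<kappa>=\<kappa>, OF w_def refl cw_def zc rt st ya yb refl refl])
qed

end

section \<open>Integration by parts, differentiation under the integral, Gronwall\<close>

lemma integrable_bounded_support:
 fixes h :: "'a::euclidean_space => real"
 assumes "h \<in> borel_measurable lborel" "!!x. abs (h x) <= K" "!!x. norm x > R ==> h x = 0"
 shows "integrable lborel h"
proof (rule Bochner_Integration.integrable_bound)
 show "integrable lborel (%x. K * indicator (cball 0 R) x :: real)"
  using emeasure_bounded_finite[OF bounded_cball, of 0 R]
   by (intro integrable_mult_right integrable_real_indicator) auto
 show "AE x in lborel. norm (h x) <= norm (K * indicator (cball 0 R) x :: real)"
 proof (intro AE_I2)
  fix x show "norm (h x) <= norm (K * indicator (cball 0 R) x :: real)"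
   using assms(2)[of x] assms(3)[of x] by (cases "norm x <= R") (auto simp: indicator_def)
 qed
qed fact

lemma leibniz_rule_bounded:
 fixes h :: "real => 'a::euclidean_space => real"
 assumes ab: "a < b" and t: "t \<in> {a..b}"
  and meas: "!!s. s \<in> {a..b} ==> h s \<in> borel_measurable lborel"
  and der: "!!s x. s \<in> {a..b} ==> ((%s. h s x) has_real_derivative h' s x) (at s within {a..b})"
  and bd: "!!s x. s \<in> {a..b} ==> abs (h s x) <= K" "!!s x. s \<in> {a..b} ==> abs (h' s x) <= K"
  and supp: "!!s x. s \<in> {a..b} ==> norm x > R ==> h s x = 0"
 shows "((%s. \<integral>x. h s x \<partial>lborel) has_real_derivative (\<integral>x. h' t x \<partial>lborel)) (at t within {a..b})"
  and "integrable lborel (h' t)"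
proof -
 have int: "integrable lborel (h s)" if "s \<in> {a..b}" for s
  using integrable_bounded_support[OF meas bd(1) supp] that by blast
 have w: "integrable lborel (%x. K * indicator (cball 0 R) x :: real)"
  using emeasure_bounded_finite[OF bounded_cball, of 0 R]
   by (intro integrable_mult_right integrable_real_indicator) auto
 have lip: "abs (h s x - h t x) <= K * abs (s - t)" if "s \<in> {a..b}" for s x
  using field_differentiable_bound[of "{a..b}" "%s. h s x" "%s. h' s x" K s t] der bd(2) that t by simp
 have quot: "abs ((h s x - h t x) / (s - t)) <= K * indicator (cball 0 R) x" if "s \<in> {a..b}" "s \<noteq> t" for s x
  using lip[OF that(1), of x] that supp[OF that(1), of x] supp[OF t, of x]
  by (cases "norm x <= R") (auto simp: indicator_def divide_le_eq)
 have key: "(%n. \<integral>x. (h (X n) x - h t x) / (X n - t) \<partial>lborel) \<longlonglongrightarrow> (\<integral>x. h' t x \<partial>lborel)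
   & integrable lborel (h' t)"
  if X: "!!n. X n \<in> {a..b} - {t}" "X \<longlonglongrightarrow> t" for X :: "nat => real"
 proof -
  have lim: "(%n. (h (X n) x - h t x) / (X n - t)) \<longlonglongrightarrow> h' t x" for x
   using der[OF t, of x] X unfolding has_field_derivative_iff tendsto_at_iff_sequentially comp_def by blast
  have m: "(%x. (h (X n) x - h t x) / (X n - t)) \<in> borel_measurable lborel" for n
   using meas[of "X n"] meas[OF t] X(1)[of n] by (intro borel_measurable_divide borel_measurable_diff) auto
  have m': "h' t \<in> borel_measurable lborel"
   by (rule borel_measurable_LIMSEQ_real[OF lim m])
  have b: "AE x in lborel. norm ((h (X n) x - h t x) / (X n - t)) <= K * indicator (cball 0 R) x" for n
   using quot X(1)[of n] by auto
  show ?thesis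
   using integral_dominated_convergence[OF m' m w AE_I2[OF lim] b]
    integrable_dominated_convergence[OF m' m w AE_I2[OF lim] b] by blast
 qed
 have "t islimpt {a..b}" using ab t by (simp add: islimpt_Icc)
 then obtain X where "!!n. X n \<in> {a..b} - {t}" "X \<longlonglongrightarrow> t"
  unfolding islimpt_sequential by blast
 from key[OF this] show "integrable lborel (h' t)" by blast
 show "((%s. \<integral>x. h s x \<partial>lborel) has_real_derivative (\<integral>x. h' t x \<partial>lborel)) (at t within {a..b})"
  unfolding has_field_derivative_iff tendsto_at_iff_sequentially comp_def
 proof (intro allI impI)
  fix X :: "nat => real" assume X: "\<forall>i. X i \<in> {a..b} - {t}" "X \<longlonglongrightarrow> t"
  have "(\<integral>x. (h (X n) x - h t x) / (X n - t) \<partial>lborel)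
    = ((\<integral>x. h (X n) x \<partial>lborel) - (\<integral>x. h t x \<partial>lborel)) / (X n - t)" for n
   using int[of "X n"] int[OF t] X(1) by simp
  then show "(%n. ((\<integral>x. h (X n) x \<partial>lborel) - (\<integral>x. h t x \<partial>lborel)) / (X n - t)) \<longlonglongrightarrow> (\<integral>x. h' t x \<partial>lborel)"
   using key[of X] X by simp
 qed
qed

lemma integral_directional_derivative_eq_0:
 fixes F :: "'a::euclidean_space => real"
 assumes meas: "F \<in> borel_measurable lborel"
  and der: "!!x. ((%s. F (x + s *\<^sub>R e)) has_real_derivative F' x) (at 0)"
  and bd: "!!x. abs (F x) <= K" "!!x. abs (F' x) <= K"
  and supp: "!!x. norm x > R ==> F x = 0"
 shows "integrable lborel F'" and "(\<integral>x. F' x \<partial>lborel) = 0"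
proof -
 define S where "S = R + norm e"
 define X :: "nat => real" where "X n = 1 / (real n + 1)" for n
 have X: "0 < X n" "X n <= 1" for n by (auto simp: X_def)
 have X0: "X \<longlonglongrightarrow> 0" unfolding X_def using LIMSEQ_inverse_real_of_nat by (simp add: inverse_eq_divide add.commute)
 have intF: "integrable lborel F" by (rule integrable_bounded_support[OF meas bd(1) supp])
 have derat: "((%s. F (x + s *\<^sub>R e)) has_real_derivative F' (x + u *\<^sub>R e)) (at u)" for x u
 proof -
  have "((%s. F ((x + u *\<^sub>R e) + s *\<^sub>R e)) has_real_derivative F' (x + u *\<^sub>R e)) (at 0)" by (rule der)
  then have "((%s. F (x + (s + u) *\<^sub>R e)) has_real_derivative F' (x + u *\<^sub>R e)) (at 0)"
   by (simp add: algebra_simps)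
  then show ?thesis using DERIV_shift[of "%s. F (x + s *\<^sub>R e)" "F' (x + u *\<^sub>R e)" 0 u] by simp
 qed
 have lip: "abs (F (x + s *\<^sub>R e) - F x) <= K * abs s" for x s
  using field_differentiable_bound[of UNIV "%s. F (x + s *\<^sub>R e)" "%u. F' (x + u *\<^sub>R e)" K s 0]
   derat bd(2) by simp
 have quot: "abs ((F (x + X n *\<^sub>R e) - F x) / X n) <= K * indicator (cball 0 S) x" for x n
 proof (cases "norm x <= S")
  case True
  then show ?thesis using lip[of x "X n"] X[of n] by (simp add: divide_le_eq)
 next
  case False
  have "norm x <= norm (x + X n *\<^sub>R e) + norm (X n *\<^sub>R e)" using norm_triangle_ineq4[of "x + X n *\<^sub>R e" "X n *\<^sub>R e"] by simp
  also have "norm (X n *\<^sub>R e) <= norm e" using X[of n] by (simp add: mult_left_le_one_le)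
  finally have "norm (x + X n *\<^sub>R e) > R" using False by (simp add: S_def)
  moreover have "norm x > R" using False norm_ge_zero[of e] by (simp add: S_def) (smt (verit) norm_ge_zero)
  ultimately show ?thesis using supp False by simp
 qed
 have w: "integrable lborel (%x. K * indicator (cball 0 S) x :: real)"
  using emeasure_bounded_finite[OF bounded_cball, of 0 S]
   by (intro integrable_mult_right integrable_real_indicator) auto
 have meas_b: "F \<in> borel_measurable borel" using meas by simp
 have mt: "(%x. F (x + c)) \<in> borel_measurable lborel" for c
  using measurable_compose[OF _ meas_b, of "%x. x + c" borel] by simp
 have m: "(%x. (F (x + X n *\<^sub>R e) - F x) / X n) \<in> borel_measurable lborel" for n
  using mt[of "X n *\<^sub>R e"] meas by (intro borel_measurable_divide borel_measurable_diff) auto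
 have lim: "(%n. (F (x + X n *\<^sub>R e) - F x) / X n) \<longlonglongrightarrow> F' x" for x
 proof -
  have "(\<forall>n. X n \<in> UNIV - {0})" using X(1) by (auto simp: less_imp_neq[symmetric])
  then show ?thesis
   using der[of x] X0 unfolding has_field_derivative_iff tendsto_at_iff_sequentially comp_def by force
 qed
 have m': "F' \<in> borel_measurable lborel" by (rule borel_measurable_LIMSEQ_real[OF lim m])
 have b: "AE x in lborel. norm ((F (x + X n *\<^sub>R e) - F x) / X n) <= K * indicator (cball 0 S) x" for n
  using quot by auto
 note dct = integral_dominated_convergence[OF m' m w AE_I2[OF lim] b]
 show "integrable lborel F'" by (rule integrable_dominated_convergence[OF m' m w AE_I2[OF lim] b])
 have tr: "integrable lborel (%x. F (x + c)) & (\<integral>x. F (x + c) \<partial>lborel) = (\<integral>x. F x \<partial>lborel)" for c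
 proof -
  have "(\<integral>x. F x \<partial>distr lborel borel ((+) c)) = (\<integral>x. F (c + x) \<partial>lborel)"
   by (rule integral_distr) (use meas in auto)
  moreover have "integrable (distr lborel borel ((+) c)) F \<longleftrightarrow> integrable lborel (%x. F (c + x))"
   by (rule integrable_distr_eq) (use meas in auto)
  ultimately show ?thesis using intF by (simp add: lborel_distr_plus add.commute)
 qed
 have z: "(\<integral>x. (F (x + X n *\<^sub>R e) - F x) / X n \<partial>lborel) = 0" for n
  using tr[of "X n *\<^sub>R e"] intF by simp
 from dct have "(%n. 0::real) \<longlonglongrightarrow> (\<integral>x. F' x \<partial>lborel)" unfolding z .
 then show "(\<integral>x. F' x \<partial>lborel) = 0" by (simp add: LIMSEQ_const_iff)
qed

lemma gronwall_linear:
 fixes u :: "real => real"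
 assumes "a <= t" "t <= b" "0 <= k" "0 <= c" "u a <= 0"
  and der: "!!s. s \<in> {a..b} ==> (u has_real_derivative u' s) (at s within {a..b})"
  and le: "!!s. s \<in> {a..b} ==> u' s <= k * u s + c"
 shows "u t <= c * (t - a) * exp (k * (t - a))"
proof -
 define \<phi> where "\<phi> s = u s * exp (- (k * (s - a))) - c * (s - a)" for s
 define \<phi>' where "\<phi>' s = (u' s - k * u s) * exp (- (k * (s - a))) - c" for s
 have d: "(\<phi> has_real_derivative \<phi>' s) (at s within {a..b})" if "s \<in> {a..b}" for s
  unfolding \<phi>_def \<phi>'_def by (auto intro!: derivative_eq_intros der[OF that] simp: algebra_simps)
 have n: "\<phi>' s <= 0" if "s \<in> {a..b}" for s
 proof -
  have "(u' s - k * u s) * exp (- (k * (s - a))) <= c * exp (- (k * (s - a)))"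
   using le[OF that] by (intro mult_right_mono) auto
  also have "... <= c" using that assms by (intro mult_left_le) auto
  finally show ?thesis by (simp add: \<phi>'_def)
 qed
 have "\<phi> a \<ge> \<phi> t"
 proof (rule DERIV_nonpos_imp_decreasing_open[where f=\<phi> and a=a and b=t])
  show "a <= t" by fact
  show "\<exists>y. (\<phi> has_real_derivative y) (at x) & y <= 0" if "a < x" "x < t" for x
   using d[of x] n[of x] that assms by (auto simp: at_within_Icc_at)
  show "continuous_on {a..t} \<phi>"
   using DERIV_continuous_on[of "{a..b}" \<phi> \<phi>'] d assms by (metis atLeastatMost_subset_iff continuous_on_subset order_refl)
 qed
 then have "u t * exp (- (k * (t - a))) <= c * (t - a)" using assms(5) by (simp add: \<phi>_def)
 then have "u t * exp (- (k * (t - a))) * exp (k * (t - a)) <= c * (t - a) * exp (k * (t - a))"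
  by (intro mult_right_mono) auto
 then show ?thesis by (simp add: mult.assoc exp_minus_inverse mult.commute[of "exp (- _)"])
qed

section \<open>Coefficients of the reduced system\<close>

text \<open>A function on states is tame with respect to a set of test curves if it is bounded along them and
has derivatives bounded by the speed N of the curve. Testing along curves that are differentiable at
a single time, possibly one-sided, is exactly what the solutions provide, and no partial derivatives
of the coefficients have to be computed.\<close>

definition tame :: "(real set \<times> real \<times> (real => 'a) \<times> real) set => ('a => real) => bool" where
 "tame \<C> c \<longleftrightarrow> (\<exists>K\<ge>0. \<forall>(S, s, \<gamma>, N)\<in>\<C>. abs (c (\<gamma> s)) <= K &
  (\<exists>D. ((%s. c (\<gamma> s)) has_real_derivative D) (at s within S) & abs D <= K * abs N))"

lemma tameI:
 assumes "0 <= K" "!!S s \<gamma> N. (S, s, \<gamma>, N) \<in> \<C> ==> \<exists>D. ((%s. c (\<gamma> s)) has_real_derivative D) (at s within S) & abs (c (\<gamma> s)) <= K & abs D <= K * abs N"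
 shows "tame \<C> c"
 unfolding tame_def using assms by (intro exI[of _ K]) fast

lemma tameE:
 assumes "tame \<C> c"
 obtains K where "0 <= K" "!!S s \<gamma> N. (S, s, \<gamma>, N) \<in> \<C> ==> \<exists>D. ((%s. c (\<gamma> s)) has_real_derivative D) (at s within S) & abs (c (\<gamma> s)) <= K & abs D <= K * abs N"
 using assms unfolding tame_def by (elim exE conjE) (rule that, assumption, fast)

lemma tame_const: "tame \<C> (%_. k)"
 by (rule tameI[of "abs k"]) (auto intro!: exI[of _ 0])

lemma tame_add: assumes "tame \<C> c" "tame \<C> d" shows "tame \<C> (%x. c x + d x)"
proof (rule tameE[OF assms(1)], rule tameE[OF assms(2)])
 fix K L assume K: "0 <= K" "!!S s \<gamma> N. (S, s, \<gamma>, N) \<in> \<C> ==> \<exists>D. ((%s. c (\<gamma> s)) has_real_derivative D) (at s within S) & abs (c (\<gamma> s)) <= K & abs D <= K * abs N"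
  and L: "0 <= L" "!!S s \<gamma> N. (S, s, \<gamma>, N) \<in> \<C> ==> \<exists>D. ((%s. d (\<gamma> s)) has_real_derivative D) (at s within S) & abs (d (\<gamma> s)) <= L & abs D <= L * abs N"
 show ?thesis
 proof (rule tameI[of "K + L"])
  fix S s \<gamma> N assume h: "(S, s, \<gamma>, N) \<in> \<C>"
  obtain D where D: "((%s. c (\<gamma> s)) has_real_derivative D) (at s within S)" "abs (c (\<gamma> s)) <= K" "abs D <= K * abs N" using K(2)[OF h] by blast
  obtain E where E: "((%s. d (\<gamma> s)) has_real_derivative E) (at s within S)" "abs (d (\<gamma> s)) <= L" "abs E <= L * abs N" using L(2)[OF h] by blast
  have "abs (c (\<gamma> s) + d (\<gamma> s)) <= K + L" "abs (D + E) <= (K + L) * abs N" using D(2,3) E(2,3) unfolding distrib_right by linarith+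
  then show "\<exists>D. ((%s. c (\<gamma> s) + d (\<gamma> s)) has_real_derivative D) (at s within S) & abs (c (\<gamma> s) + d (\<gamma> s)) <= K + L & abs D <= (K + L) * abs N"
   using DERIV_add[OF D(1) E(1)] by blast
 qed (use K L in auto)
qed

lemma tame_mult: assumes "tame \<C> c" "tame \<C> d" shows "tame \<C> (%x. c x * d x)"
proof (rule tameE[OF assms(1)], rule tameE[OF assms(2)])
 fix K L assume K: "0 <= K" "!!S s \<gamma> N. (S, s, \<gamma>, N) \<in> \<C> ==> \<exists>D. ((%s. c (\<gamma> s)) has_real_derivative D) (at s within S) & abs (c (\<gamma> s)) <= K & abs D <= K * abs N"
  and L: "0 <= L" "!!S s \<gamma> N. (S, s, \<gamma>, N) \<in> \<C> ==> \<exists>D. ((%s. d (\<gamma> s)) has_real_derivative D) (at s within S) & abs (d (\<gamma> s)) <= L & abs D <= L * abs N"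
 show ?thesis
 proof (rule tameI[of "2 * (K * L)"])
  fix S s \<gamma> N assume h: "(S, s, \<gamma>, N) \<in> \<C>"
  obtain D where D: "((%s. c (\<gamma> s)) has_real_derivative D) (at s within S)" "abs (c (\<gamma> s)) <= K" "abs D <= K * abs N" using K(2)[OF h] by blast
  obtain E where E: "((%s. d (\<gamma> s)) has_real_derivative E) (at s within S)" "abs (d (\<gamma> s)) <= L" "abs E <= L * abs N" using L(2)[OF h] by blast
  have "abs (c (\<gamma> s) * d (\<gamma> s)) <= K * L" "abs (D * d (\<gamma> s)) <= (K * abs N) * L" "abs (E * c (\<gamma> s)) <= (L * abs N) * K"
   unfolding abs_mult using D(2,3) E(2,3) K(1) L(1) by (auto intro!: mult_mono)
  moreover have "0 <= K * L" using K(1) L(1) by simp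
  ultimately have "abs (c (\<gamma> s) * d (\<gamma> s)) <= 2 * (K * L)" "abs (D * d (\<gamma> s) + E * c (\<gamma> s)) <= 2 * (K * L) * abs N"
   by (auto simp: algebra_simps)
  then show "\<exists>D. ((%s. c (\<gamma> s) * d (\<gamma> s)) has_real_derivative D) (at s within S) & abs (c (\<gamma> s) * d (\<gamma> s)) <= 2 * (K * L) & abs D <= 2 * (K * L) * abs N"
   using DERIV_mult[OF D(1) E(1)] by blast
 qed (use K L in auto)
qed

lemma tame_compose:
 assumes c: "tame \<C> c" and J: "!!S s \<gamma> N. (S, s, \<gamma>, N) \<in> \<C> ==> l <= c (\<gamma> s)"
  and h: "!!x. l <= x ==> (h has_real_derivative h' x) (at x)" and h': "continuous_on {l..} h'"
 shows "tame \<C> (%x. h (c x))"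
proof (rule tameE[OF c])
 fix K assume K: "0 <= K" "!!S s \<gamma> N. (S, s, \<gamma>, N) \<in> \<C> ==> \<exists>D. ((%s. c (\<gamma> s)) has_real_derivative D) (at s within S) & abs (c (\<gamma> s)) <= K & abs D <= K * abs N"
 have bd: "\<exists>M. \<forall>x\<in>{l..K}. abs (g x) <= M" if "continuous_on {l..} g" for g :: "real => real"
 proof -
  have "compact (g ` {l..K})" using continuous_on_subset[OF that, of "{l..K}"] by (intro compact_continuous_image) auto
  then have "bounded (g ` {l..K})" by (rule compact_imp_bounded)
  then show ?thesis unfolding bounded_iff by (metis imageI real_norm_def)
 qed
 obtain M1 where M1: "!!x. x \<in> {l..K} ==> abs (h' x) <= M1" using bd[OF h'] by blast
 have "continuous_on {l..} h" by (rule continuous_at_imp_continuous_on) (metis DERIV_isCont atLeast_iff h)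
 then obtain M2 where M2: "!!x. x \<in> {l..K} ==> abs (h x) <= M2" using bd by blast
 define M where "M = max 0 M1 * K + max 0 M2"
 have M: "max 0 M1 * K <= M" "max 0 M2 <= M" using K(1) by (auto simp: M_def)
 show ?thesis
 proof (rule tameI[of M])
  fix S s \<gamma> N assume g: "(S, s, \<gamma>, N) \<in> \<C>"
  obtain D where D: "((%s. c (\<gamma> s)) has_real_derivative D) (at s within S)" "abs (c (\<gamma> s)) <= K" "abs D <= K * abs N" using K(2)[OF g] by blast
  have x: "c (\<gamma> s) \<in> {l..K}" using J[OF g] D(2) by auto
  have "abs (h' (c (\<gamma> s)) * D) <= max 0 M1 * (K * abs N)"
   unfolding abs_mult using D(3) M1[OF x] by (intro mult_mono) auto
  also have "... <= M * abs N" using mult_right_mono[OF M(1), of "abs N"] by (simp add: mult.assoc)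
  finally have 1: "abs (h' (c (\<gamma> s)) * D) <= M * abs N" .
  have "abs (h (c (\<gamma> s))) <= M" using M2[OF x] M(2) by linarith
  then show "\<exists>D. ((%s. h (c (\<gamma> s))) has_real_derivative D) (at s within S) & abs (h (c (\<gamma> s))) <= M & abs D <= M * abs N"
   using DERIV_chain2[OF h[of "c (\<gamma> s)"] D(1)] x 1 by auto
 qed (use K in \<open>auto simp: M_def\<close>)
qed

text \<open>The range of density and of squared reduced velocity on which the coefficients are controlled.\<close>

definition in_range :: "real => real => real => real => bool" where
 "in_range \<kappa> b r e \<longleftrightarrow> 0 <= r & r <= 1 / \<kappa> & 0 <= e & e <= b"

definition scalar_curves :: "real => real => (real set \<times> real \<times> (real => real \<times> real) \<times> real) set" where
 "scalar_curves \<kappa> b = {(S, s, \<gamma>, N). in_range \<kappa> b (fst (\<gamma> s)) (snd (\<gamma> s)) &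
  (\<exists>r' e'. ((%s. fst (\<gamma> s)) has_real_derivative r') (at s within S) & ((%s. snd (\<gamma> s)) has_real_derivative e') (at s within S) & N = abs r' + abs e')}"

definition nice :: "real => real => (real => real => real) => bool" where
 "nice \<kappa> b c \<longleftrightarrow> tame (scalar_curves \<kappa> b) (%x. c (fst x) (snd x))"

lemma niceE:
 assumes "nice \<kappa> b c"
 obtains K where "0 <= K" "!!r e. in_range \<kappa> b r e ==> abs (c r e) <= K"
  "!!(r::real=>real) e r' e' s S. in_range \<kappa> b (r s) (e s) ==> (r has_real_derivative r') (at s within S) ==> (e has_real_derivative e') (at s within S) ==>
   \<exists>D. ((%s. c (r s) (e s)) has_real_derivative D) (at s within S) & abs D <= K * (abs r' + abs e')"
proof (rule tameE[OF assms[unfolded nice_def]])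
 fix K assume K: "0 <= K" "!!S s \<gamma> N. (S, s, \<gamma>, N) \<in> scalar_curves \<kappa> b ==>
  \<exists>D. ((%s. c (fst (\<gamma> s)) (snd (\<gamma> s))) has_real_derivative D) (at s within S) & abs (c (fst (\<gamma> s)) (snd (\<gamma> s))) <= K & abs D <= K * abs N"
 have d: "\<exists>D. ((%s. c (r s) (e s)) has_real_derivative D) (at s within S) & abs (c (r s) (e s)) <= K & abs D <= K * (abs r' + abs e')"
  if "in_range \<kappa> b (r s) (e s)" "(r has_real_derivative r') (at s within S)" "(e has_real_derivative e') (at s within S)" for r e :: "real => real" and r' e' s S
  using K(2)[of S s "%s. (r s, e s)" "abs r' + abs e'"] that by (auto simp: scalar_curves_def)
 have "abs (c r e) <= K" if "in_range \<kappa> b r e" for r e using d[of "%_. r" 0 "%_. e" 0 UNIV 0] that by simp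
 then show thesis by (rule that[OF K(1)]) (use d in blast)+
qed

lemma nice_const: "nice \<kappa> b (%r e. k)" unfolding nice_def by (rule tame_const)
lemma nice_add: "nice \<kappa> b c ==> nice \<kappa> b d ==> nice \<kappa> b (%r e. c r e + d r e)" unfolding nice_def by (rule tame_add)
lemma nice_mult: "nice \<kappa> b c ==> nice \<kappa> b d ==> nice \<kappa> b (%r e. c r e * d r e)" unfolding nice_def by (rule tame_mult)

lemma nice_fst: "nice \<kappa> b (%r e. r)" and nice_snd: "nice \<kappa> b (%r e. e)"
proof -
 define K where "K = abs (1 / \<kappa>) + abs b + 1"
 have K: "x <= K * (x + y)" "y <= K * (x + y)" if "0 <= x" "0 <= y" for x y
  using that mult_right_mono[of 1 K "x + y"] by (auto simp: K_def)
 have "(\<exists>D. ((%s. fst (\<gamma> s)) has_real_derivative D) (at s within S) & abs (fst (\<gamma> s)) <= K & abs D <= K * abs N) &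
   (\<exists>D. ((%s. snd (\<gamma> s)) has_real_derivative D) (at s within S) & abs (snd (\<gamma> s)) <= K & abs D <= K * abs N)"
  if hh: "(S, s, \<gamma>, N) \<in> scalar_curves \<kappa> b" for S s \<gamma> N
 proof -
  obtain r' e' where h: "in_range \<kappa> b (fst (\<gamma> s)) (snd (\<gamma> s))" "((%s. fst (\<gamma> s)) has_real_derivative r') (at s within S)"
   "((%s. snd (\<gamma> s)) has_real_derivative e') (at s within S)" "N = abs r' + abs e'"
   using hh unfolding scalar_curves_def mem_Collect_eq split_conv by blast
  have "1 / \<kappa> <= K" "b <= K" unfolding K_def by linarith+
  then have "abs (fst (\<gamma> s)) <= K" "abs (snd (\<gamma> s)) <= K" "abs r' <= K * abs N" "abs e' <= K * abs N"
   using h K[of "abs r'" "abs e'"] by (auto simp: in_range_def)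
  then show ?thesis using h(2,3) by blast
 qed
 then show "nice \<kappa> b (%r e. r)" "nice \<kappa> b (%r e. e)" unfolding nice_def
  by (auto intro!: tameI[of K] simp: K_def)
qed

lemma nice_compose:
 assumes "nice \<kappa> b c" "!!r e. in_range \<kappa> b r e ==> l <= c r e"
  "!!x. l <= x ==> (h has_real_derivative h' x) (at x)" "continuous_on {l..} h'"
 shows "nice \<kappa> b (%r e. h (c r e))"
 unfolding nice_def by (rule tame_compose[OF assms(1)[unfolded nice_def] _ assms(3,4)]) (use assms(2) in \<open>auto simp: scalar_curves_def\<close>)

declare in_range_def [simp]

lemma nice_minus: "nice \<kappa> b c ==> nice \<kappa> b (%r e. - c r e)"
 using nice_mult[OF nice_const[of \<kappa> b "-1"], of c] by simp

lemma nice_diff: "nice \<kappa> b c ==> nice \<kappa> b d ==> nice \<kappa> b (%r e. c r e - d r e)"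
 using nice_add[OF _ nice_minus, of \<kappa> b c d] by simp

lemma nice_power: "nice \<kappa> b c ==> nice \<kappa> b (%r e. c r e ^ n)"
 by (induction n) (auto intro: nice_const nice_mult)

lemma nice_inverse:
 assumes "nice \<kappa> b c" "0 < l" "!!r e. in_range \<kappa> b r e ==> l <= c r e"
 shows "nice \<kappa> b (%r e. inverse (c r e))"
proof (rule nice_compose[OF assms(1,3)])
 show "(inverse has_real_derivative - (inverse (x ^ Suc (Suc 0)))) (at x)" if "l <= x" for x
  using DERIV_inverse[of x UNIV] that assms(2) by auto
 show "continuous_on {l..} (%x. - inverse (x ^ Suc (Suc 0)))"
  using assms(2) by (intro continuous_intros) auto
qed

lemma nice_divide:
 assumes "nice \<kappa> b d" "nice \<kappa> b c" "0 < l" "!!r e. in_range \<kappa> b r e ==> l <= c r e"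
 shows "nice \<kappa> b (%r e. d r e / c r e)"
 unfolding divide_inverse using assms by (intro nice_mult nice_inverse)

lemma nice_sqrt:
 assumes "nice \<kappa> b c" "0 < l" "!!r e. in_range \<kappa> b r e ==> l <= c r e"
 shows "nice \<kappa> b (%r e. sqrt (c r e))"
proof (rule nice_compose[OF assms(1,3)])
 show "(sqrt has_real_derivative inverse (sqrt x) / 2) (at x)" if "l <= x" for x
  using DERIV_real_sqrt[of x] that assms(2) by simp
 show "continuous_on {l..} (%x. inverse (sqrt x) / 2)"
  using assms(2) by (intro continuous_intros) auto
qed

lemma nice_powr:
 assumes "nice \<kappa> b c" "0 < l" "!!r e. in_range \<kappa> b r e ==> l <= c r e"
 shows "nice \<kappa> b (%r e. c r e powr p)"
proof (rule nice_compose[OF assms(1,3)])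
 show "((%x. x powr p) has_real_derivative p * x powr (p - 1)) (at x)" if "l <= x" for x
  using has_real_derivative_powr[of x p] that assms(2) by simp
 show "continuous_on {l..} (%x. p * x powr (p - 1))"
  using assms(2) by (intro continuous_intros) auto
qed

lemma nice_bounded: "nice \<kappa> b c ==> \<exists>K\<ge>0. \<forall>r e. in_range \<kappa> b r e --> abs (c r e) <= K"
 by (erule niceE) blast

lemma nice_lipschitz:
 assumes "nice \<kappa> b c"
 shows "\<exists>K\<ge>0. \<forall>r1 e1 r2 e2. in_range \<kappa> b r1 e1 & in_range \<kappa> b r2 e2 --> abs (c r1 e1 - c r2 e2) <= K * (abs (r1 - r2) + abs (e1 - e2))"
proof (rule niceE[OF assms])
 fix K assume K: "0 <= K" "!!(r::real=>real) e r' e' s S. in_range \<kappa> b (r s) (e s) ==> (r has_real_derivative r') (at s within S) ==> (e has_real_derivative e') (at s within S) ==>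
   \<exists>D. ((%s. c (r s) (e s)) has_real_derivative D) (at s within S) & abs D <= K * (abs r' + abs e')"
 have "abs (c r1 e1 - c r2 e2) <= K * (abs (r1 - r2) + abs (e1 - e2))" if h: "in_range \<kappa> b r1 e1" "in_range \<kappa> b r2 e2" for r1 e1 r2 e2
 proof -
  define r where "r s = r1 + s * (r2 - r1)" for s
  define e where "e s = e1 + s * (e2 - e1)" for s
  have conv: "0 <= x1 + s * (x2 - x1) & x1 + s * (x2 - x1) <= M" if "s \<in> {0..1}" "0 <= x1" "x1 <= M" "0 <= x2" "x2 <= M" for s x1 x2 M :: real
  proof -
   have e: "x1 + s * (x2 - x1) = (1 - s) * x1 + s * x2" by (simp add: algebra_simps)
   show ?thesis unfolding e using that convex_bound_le[of x1 M x2 "1 - s" s] by auto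
  qed
  have d: "(r has_real_derivative (r2 - r1)) (at s within {0..1})" "(e has_real_derivative (e2 - e1)) (at s within {0..1})" for s
   unfolding r_def e_def by (auto intro!: derivative_eq_intros)
  have "in_range \<kappa> b (r s) (e s)" if "s \<in> {0..1}" for s
   using conv[OF that, of r1 "1 / \<kappa>" r2] conv[OF that, of e1 b e2] h by (simp add: r_def e_def)
  then obtain D where D: "!!s. s \<in> {0..1} ==> ((%s. c (r s) (e s)) has_real_derivative D s) (at s within {0..1})"
   "!!s. s \<in> {0..1} ==> abs (D s) <= K * (abs (r2 - r1) + abs (e2 - e1))" using K(2)[OF _ d] by metis
  have "norm (c (r 0) (e 0) - c (r 1) (e 1)) <= K * (abs (r2 - r1) + abs (e2 - e1)) * norm (0 - 1 :: real)"
   by (rule field_differentiable_bound[of "{0..1}" "%s. c (r s) (e s)" D]) (use D in auto)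
  then show ?thesis by (simp add: r_def e_def abs_minus_commute)
 qed
 with K(1) show ?thesis by blast
qed

text \<open>The coefficients as functions of the density r and of e = |y|^2. The quantity e / (1 - e) is |v|^2,
so sc_gam is sqrt (1 + |v|^2), and sc_v0, sc_a0, sc_a1 are v^0, a_0, a_1; the others are the
coefficients of the reduced system.\<close>

definition sc_gam :: "real => real" where "sc_gam e = 1 / sqrt (1 - e)"
definition sc_v0 :: "real => real => real => real" where
 "sc_v0 \<kappa> r e = sqrt (ang \<kappa> r powr (2 + 2 / \<kappa>) + e / (1 - e))"
definition sc_a0 :: "real => real => real => real" where
 "sc_a0 \<kappa> r e = 1 - \<kappa> * r * ((e / (1 - e)) / (sc_v0 \<kappa> r e)\<^sup>2)"
definition sc_a1 :: "real => real => real => real" where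
 "sc_a1 \<kappa> r e = - (2 * \<kappa> * ang \<kappa> r powr (2 + 2 / \<kappa>) / ((sc_v0 \<kappa> r e) ^ 3 * sc_a0 \<kappa> r e))"
definition sc_g :: "real => real => real => real" where
 "sc_g \<kappa> r e = \<kappa> * ang \<kappa> r * sc_gam e / (sc_a0 \<kappa> r e * sc_v0 \<kappa> r e)"
definition sc_h :: "real => real => real => real" where
 "sc_h \<kappa> r e = sc_g \<kappa> r e * (sc_gam e)\<^sup>2 * (ang \<kappa> r powr (2 + 2 / \<kappa>) - 1) / (sc_v0 \<kappa> r e)\<^sup>2"
definition sc_s :: "real => real => real => real" where
 "sc_s \<kappa> r e = sc_gam e / sc_v0 \<kappa> r e - 1"
definition sc_t :: "real => real => real => real" where
 "sc_t \<kappa> r e = sc_s \<kappa> r e + r * (sc_a1 \<kappa> r e * sc_gam e)"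
definition sc_eta :: "real => real => real => real" where
 "sc_eta \<kappa> r e = ang \<kappa> r powr (1 + 2 / \<kappa>) / (sc_v0 \<kappa> r e * sc_gam e)"

context
 fixes \<kappa> b :: real
 assumes k: "0 < \<kappa>" and b: "0 <= b" "b < 1"
begin

lemma ang_ge: "0 <= r ==> 1 <= ang \<kappa> r" using k by (simp add: ang_def)

lemma angp_ge: "0 <= r ==> 0 <= p ==> 1 <= ang \<kappa> r powr p" using ang_ge[of r] by (simp add: ge_one_powr_ge_zero)

lemma e_ge: "0 <= e ==> e <= b ==> 0 <= e / (1 - e)" using b by simp

lemma v0sq_ge:
 assumes "0 <= r" "0 <= e" "e <= b"
 shows "1 / (1 - e) <= ang \<kappa> r powr (2 + 2 / \<kappa>) + e / (1 - e)" "1 <= 1 / (1 - e)"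
proof -
 have "1 / (1 - e) = 1 + e / (1 - e)" using assms b by (simp add: field_simps)
 then show "1 / (1 - e) <= ang \<kappa> r powr (2 + 2 / \<kappa>) + e / (1 - e)" "1 <= 1 / (1 - e)"
  using angp_ge[of r "2 + 2 / \<kappa>"] assms k e_ge[of e] by auto
qed

lemma v0_ge: assumes "0 <= r" "0 <= e" "e <= b" shows "1 <= sc_v0 \<kappa> r e"
 using v0sq_ge[OF assms] unfolding sc_v0_def by (simp add: real_le_rsqrt)

lemma v0_sq: assumes "0 <= r" "0 <= e" "e <= b" shows "(sc_v0 \<kappa> r e)\<^sup>2 = ang \<kappa> r powr (2 + 2 / \<kappa>) + e / (1 - e)"
 using v0sq_ge[OF assms] unfolding sc_v0_def by (simp add: real_sqrt_pow2)

lemma a0_ge: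
 assumes "in_range \<kappa> b r e" shows "1 - b <= sc_a0 \<kappa> r e"
proof -
 have v: "1 / (1 - e) <= (sc_v0 \<kappa> r e)\<^sup>2" using v0sq_ge[of r e] v0_sq[of r e] assms by simp
 have p: "0 < (sc_v0 \<kappa> r e)\<^sup>2" using v0_ge[of r e] assms by (simp add: zero_less_power)
 have "e / (1 - e) = e * (1 / (1 - e))" by simp
 also have "... <= e * (sc_v0 \<kappa> r e)\<^sup>2" using v assms by (intro mult_left_mono) auto
 finally have "(e / (1 - e)) / (sc_v0 \<kappa> r e)\<^sup>2 <= e" by (subst pos_divide_le_eq[OF p])
 then have "(e / (1 - e)) / (sc_v0 \<kappa> r e)\<^sup>2 <= b" using assms by simp
 moreover have "0 <= (e / (1 - e)) / (sc_v0 \<kappa> r e)\<^sup>2" using e_ge[of e] assms p by (intro divide_nonneg_pos[OF _ p]) auto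
 moreover have "\<kappa> * r <= 1" "0 <= \<kappa> * r" using assms k by (auto simp: field_simps)
 ultimately have "\<kappa> * r * ((e / (1 - e)) / (sc_v0 \<kappa> r e)\<^sup>2) <= 1 * b" by (intro mult_mono) auto
 then show ?thesis by (simp add: sc_a0_def)
qed

lemma gam_ge: "0 <= e ==> e <= b ==> 1 <= sc_gam e"
 using b by (simp add: sc_gam_def)

lemma nice_ang: "nice \<kappa> b (%r e. ang \<kappa> r)"
proof -
 have "nice \<kappa> b (%r e. 1 + \<kappa> / (\<kappa> + 1) * r)" by (intro nice_add nice_mult nice_const nice_fst)
 then show ?thesis by (simp add: ang_def)
qed

lemma nice_angp: "nice \<kappa> b (%r e. ang \<kappa> r powr p)"
 by (rule nice_powr[OF nice_ang, of 1]) (auto simp: ang_ge)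

lemma nice_ee: "nice \<kappa> b (%r e. e / (1 - e))"
 by (rule nice_divide[where l="1 - b"]) (use b in \<open>auto intro!: nice_snd nice_diff nice_const\<close>)

lemma nice_gam: "nice \<kappa> b (%r e. sc_gam e)"
 unfolding sc_gam_def
proof (rule nice_divide[where l="sqrt (1 - b)"])
 show "nice \<kappa> b (%r e. sqrt (1 - e))"
  by (rule nice_sqrt[where l="1 - b"]) (use b in \<open>auto intro!: nice_snd nice_diff nice_const\<close>)
qed (use b in \<open>auto intro!: nice_const\<close>)

lemma nice_v0: "nice \<kappa> b (sc_v0 \<kappa>)"
 unfolding sc_v0_def[abs_def]
proof (rule nice_sqrt[where l=1])
 show "nice \<kappa> b (%r e. ang \<kappa> r powr (2 + 2 / \<kappa>) + e / (1 - e))"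
  by (intro nice_add nice_angp nice_ee)
 show "1 <= ang \<kappa> r powr (2 + 2 / \<kappa>) + e / (1 - e)" if "in_range \<kappa> b r e" for r e
  by (rule order_trans[OF v0sq_ge(2,1)]) (use that in auto)
qed simp

lemma nice_a0: "nice \<kappa> b (sc_a0 \<kappa>)"
 unfolding sc_a0_def[abs_def]
proof (intro nice_diff nice_mult nice_const nice_fst)
 show "nice \<kappa> b (%r e. e / (1 - e) / (sc_v0 \<kappa> r e)\<^sup>2)"
  by (rule nice_divide[where l=1, OF nice_ee nice_power[OF nice_v0]]) (auto simp: v0_ge one_le_power)
qed

lemma nice_a1: "nice \<kappa> b (sc_a1 \<kappa>)"
 unfolding sc_a1_def[abs_def]
proof (rule nice_minus, rule nice_divide[where l="1 - b"])
 show "nice \<kappa> b (%r e. 2 * \<kappa> * ang \<kappa> r powr (2 + 2 / \<kappa>))" by (intro nice_mult nice_const nice_angp)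
 show "nice \<kappa> b (%r e. sc_v0 \<kappa> r e ^ 3 * sc_a0 \<kappa> r e)" by (intro nice_mult nice_power nice_v0 nice_a0)
 show "1 - b <= sc_v0 \<kappa> r e ^ 3 * sc_a0 \<kappa> r e" if "in_range \<kappa> b r e" for r e
  using mult_mono[OF one_le_power[OF v0_ge[of r e], of 3] a0_ge[of r e]] v0_ge[of r e] that b by simp
qed (use b in simp)

lemma a0v0_ge:
 assumes "in_range \<kappa> b r e" shows "1 - b <= sc_a0 \<kappa> r e * sc_v0 \<kappa> r e"
 using mult_mono[OF a0_ge[of r e] v0_ge[of r e]] a0_ge[of r e] assms b by simp

lemma nice_g: "nice \<kappa> b (sc_g \<kappa>)"
 unfolding sc_g_def[abs_def]
proof (rule nice_divide[where l="1 - b"])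
 show "nice \<kappa> b (%r e. \<kappa> * ang \<kappa> r * sc_gam e)" by (intro nice_mult nice_const nice_ang nice_gam)
 show "nice \<kappa> b (%r e. sc_a0 \<kappa> r e * sc_v0 \<kappa> r e)" by (intro nice_mult nice_v0 nice_a0)
qed (use b a0v0_ge in auto)

lemma nice_inv_g: "nice \<kappa> b (%r e. 1 / sc_g \<kappa> r e)"
proof -
 have "nice \<kappa> b (%r e. (sc_a0 \<kappa> r e * sc_v0 \<kappa> r e) / (\<kappa> * (ang \<kappa> r * sc_gam e)))"
 proof (rule nice_divide[where l=\<kappa>])
  show "nice \<kappa> b (%r e. \<kappa> * (ang \<kappa> r * sc_gam e))" by (intro nice_mult nice_const nice_ang nice_gam)
  show "nice \<kappa> b (%r e. sc_a0 \<kappa> r e * sc_v0 \<kappa> r e)" by (intro nice_mult nice_v0 nice_a0)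
  show "\<kappa> <= \<kappa> * (ang \<kappa> r * sc_gam e)" if "in_range \<kappa> b r e" for r e
   using mult_mono[OF ang_ge[of r] gam_ge[of e]] ang_ge[of r] that k by simp
 qed (rule k)
 then show ?thesis by (simp add: sc_g_def mult.assoc)
qed

lemma nice_h: "nice \<kappa> b (sc_h \<kappa>)"
 unfolding sc_h_def[abs_def]
 by (rule nice_divide[where l=1]; (intro nice_mult nice_power nice_diff nice_const nice_angp nice_gam nice_g nice_v0)?)
  (auto simp: v0_ge one_le_power)

lemma nice_s: "nice \<kappa> b (sc_s \<kappa>)"
 unfolding sc_s_def[abs_def]
 by (intro nice_diff nice_const nice_divide[where l=1, OF nice_gam nice_v0]) (auto simp: v0_ge)

lemma nice_t: "nice \<kappa> b (sc_t \<kappa>)"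
 unfolding sc_t_def[abs_def] by (intro nice_add nice_mult nice_s nice_fst nice_a1 nice_gam)

lemma nice_eta: "nice \<kappa> b (sc_eta \<kappa>)"
 unfolding sc_eta_def[abs_def]
proof (rule nice_divide[where l=1])
 show "nice \<kappa> b (%r e. sc_v0 \<kappa> r e * sc_gam e)" by (intro nice_mult nice_v0 nice_gam)
 show "1 <= sc_v0 \<kappa> r e * sc_gam e" if "in_range \<kappa> b r e" for r e
  using mult_mono[OF v0_ge[of r e] gam_ge[of e]] v0_ge[of r e] that by simp
qed (auto intro: nice_angp)

lemma nice_inv_eta: "nice \<kappa> b (%r e. 1 / sc_eta \<kappa> r e)"
proof -
 have "nice \<kappa> b (%r e. (sc_v0 \<kappa> r e * sc_gam e) / ang \<kappa> r powr (1 + 2 / \<kappa>))"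
  by (rule nice_divide[where l=1, OF nice_mult[OF nice_v0 nice_gam] nice_angp]) (use k in \<open>auto simp: angp_ge\<close>)
 then show ?thesis by (simp add: sc_eta_def)
qed

lemma g_pos: "in_range \<kappa> b r e ==> 0 < sc_g \<kappa> r e"
 unfolding sc_g_def using k b a0v0_ge[of r e] ang_ge[of r] gam_ge[of e]
 by (intro divide_pos_pos mult_pos_pos[of "_ * _"] mult_pos_pos[of \<kappa>]) auto

lemma eta_pos: "in_range \<kappa> b r e ==> 0 < sc_eta \<kappa> r e"
 unfolding sc_eta_def using ang_ge[of r] v0_ge[of r e] gam_ge[of e] by (intro divide_pos_pos mult_pos_pos) auto

lemma h_nonneg: "in_range \<kappa> b r e ==> 0 <= sc_h \<kappa> r e"
 unfolding sc_h_def using g_pos[of r e] angp_ge[of r "2 + 2 / \<kappa>"] k by (intro divide_nonneg_nonneg mult_nonneg_nonneg) auto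

text \<open>At zero density the relativistic weight is 1, so v^0 = sqrt (1 + |v|^2) and all deviations from the
nonrelativistic form disappear.\<close>

lemma at_vacuum:
 assumes "0 <= e" "e <= b"
 shows "sc_g \<kappa> 0 e = \<kappa>" "sc_h \<kappa> 0 e = 0" "sc_s \<kappa> 0 e = 0" "sc_t \<kappa> 0 e = 0"
proof -
 have a: "ang \<kappa> 0 = 1" by (simp add: ang_def)
 have "1 + e / (1 - e) = 1 / (1 - e)" using assms b by (simp add: field_simps)
 then have v: "sc_v0 \<kappa> 0 e = sc_gam e" by (simp add: sc_v0_def sc_gam_def a real_sqrt_divide)
 have g: "sc_gam e \<noteq> 0" using gam_ge[OF assms] by simp
 show "sc_g \<kappa> 0 e = \<kappa>" "sc_h \<kappa> 0 e = 0" "sc_s \<kappa> 0 e = 0" "sc_t \<kappa> 0 e = 0"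
  using g by (simp_all add: sc_g_def sc_h_def sc_s_def sc_t_def sc_a0_def a v)
qed

lemma vanishing_product:
 assumes "nice \<kappa> b (%r e. f r)" "f 0 = 0" "nice \<kappa> b Z"
 shows "\<exists>K\<ge>0. \<forall>r1 e1 r2 e2. in_range \<kappa> b r1 e1 & in_range \<kappa> b r2 e2 --> abs (f r1 * Z r1 e1 - f r2 * Z r2 e2) <= K * (abs (r1 - r2) + r2 * abs (e1 - e2))"
proof -
 obtain K where K: "K \<ge> 0" "\<forall>r1 e1 r2 e2. in_range \<kappa> b r1 e1 & in_range \<kappa> b r2 e2 --> abs (f r1 - f r2) <= K * (abs (r1 - r2) + abs (e1 - e2))"
  using nice_lipschitz[OF assms(1)] by blast
 obtain L where L: "L \<ge> 0" "\<forall>r1 e1 r2 e2. in_range \<kappa> b r1 e1 & in_range \<kappa> b r2 e2 --> abs (Z r1 e1 - Z r2 e2) <= L * (abs (r1 - r2) + abs (e1 - e2))"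
  using nice_lipschitz[OF assms(3)] by blast
 obtain M where M: "M \<ge> 0" "\<forall>r e. in_range \<kappa> b r e --> abs (Z r e) <= M"
  using nice_bounded[OF assms(3)] by blast
 define C where "C = K * M + K * L * (1 / \<kappa>) + K * L"
 have "abs (f r1 * Z r1 e1 - f r2 * Z r2 e2) <= C * (abs (r1 - r2) + r2 * abs (e1 - e2))"
  if h: "in_range \<kappa> b r1 e1" "in_range \<kappa> b r2 e2" for r1 e1 r2 e2
 proof -
  have f1: "abs (f r1 - f r2) <= K * abs (r1 - r2)" using K(2)[rule_format, of r1 e1 r2 e1] h by simp
  have f2: "abs (f r2) <= K * r2" using K(2)[rule_format, of r2 e1 0 e1] h assms(2) k by simp
  have a: "abs ((f r1 - f r2) * Z r1 e1) <= (K * abs (r1 - r2)) * M"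
   unfolding abs_mult using f1 M h K(1) by (intro mult_mono) auto
  have c: "abs (f r2 * (Z r1 e1 - Z r2 e2)) <= (K * r2) * (L * (abs (r1 - r2) + abs (e1 - e2)))"
   unfolding abs_mult using f2 L h K(1) by (intro mult_mono) auto
  also have "... = K * L * r2 * abs (r1 - r2) + K * L * (r2 * abs (e1 - e2))" by (simp add: algebra_simps)
  also have "... <= K * L * (1 / \<kappa>) * abs (r1 - r2) + K * L * (r2 * abs (e1 - e2))"
   using h K(1) L(1) by (intro add_right_mono mult_right_mono mult_left_mono) auto
  finally have d: "abs (f r2 * (Z r1 e1 - Z r2 e2)) <= K * L * (1 / \<kappa>) * abs (r1 - r2) + K * L * (r2 * abs (e1 - e2))" .
  have "f r1 * Z r1 e1 - f r2 * Z r2 e2 = (f r1 - f r2) * Z r1 e1 + f r2 * (Z r1 e1 - Z r2 e2)" by (simp add: algebra_simps)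
  then have "abs (f r1 * Z r1 e1 - f r2 * Z r2 e2) <= K * M * abs (r1 - r2) + (K * L * (1 / \<kappa>) * abs (r1 - r2) + K * L * (r2 * abs (e1 - e2)))"
   using a d by (simp add: mult_ac)
  also have "... <= C * abs (r1 - r2) + C * (r2 * abs (e1 - e2))"
  proof -
   have "K * M + K * L * (1 / \<kappa>) <= C" "K * L <= C" using K(1) L(1) M(1) k by (auto simp: C_def)
   then have "(K * M + K * L * (1 / \<kappa>)) * abs (r1 - r2) <= C * abs (r1 - r2)" "K * L * (r2 * abs (e1 - e2)) <= C * (r2 * abs (e1 - e2))"
    using h by (auto intro!: mult_right_mono)
   then show ?thesis by (simp add: distrib_right)
  qed
  finally show ?thesis by (simp add: distrib_left)
 qed
 moreover have "0 <= C" using K(1) L(1) M(1) k by (simp add: C_def)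
 ultimately show ?thesis by blast
qed

text \<open>The dependence on the velocity carries a factor r because the coefficient vanishes at r = 0 for
every velocity. This is stronger than the Lipschitz bound for the other coefficients and is needed
in the density equation, which has no factor r in front of its transport term.\<close>

lemma t_lipschitz:
 "\<exists>K\<ge>0. \<forall>r1 e1 r2 e2. in_range \<kappa> b r1 e1 & in_range \<kappa> b r2 e2 --> abs (sc_t \<kappa> r1 e1 - sc_t \<kappa> r2 e2) <= K * (abs (r1 - r2) + r2 * abs (e1 - e2))"
proof -
 define f where "f r = ang \<kappa> r powr (2 + 2 / \<kappa>) - 1" for r
 define Z where "Z r e = - (1 / (sc_v0 \<kappa> r e * (sc_gam e + sc_v0 \<kappa> r e)))" for r e
 have s: "sc_s \<kappa> r e = f r * Z r e" if "0 <= r" "0 <= e" "e <= b" for r e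
 proof -
  have p: "1 <= sc_v0 \<kappa> r e" "1 <= sc_gam e" using v0_ge gam_ge that by auto
  have "(sc_gam e)\<^sup>2 = 1 + e / (1 - e)" using that b by (simp add: sc_gam_def power_divide field_simps)
  then have "f r = (sc_v0 \<kappa> r e)\<^sup>2 - (sc_gam e)\<^sup>2" using v0_sq[OF that] by (simp add: f_def)
  also have "... = (sc_v0 \<kappa> r e - sc_gam e) * (sc_gam e + sc_v0 \<kappa> r e)" by (simp add: power2_eq_square algebra_simps)
  finally have "f r * Z r e = (sc_v0 \<kappa> r e - sc_gam e) * (sc_gam e + sc_v0 \<kappa> r e) * Z r e" by simp
  also have "... = sc_s \<kappa> r e"
   using p by (simp add: Z_def sc_s_def diff_divide_distrib)
  finally show ?thesis by simp
 qed
 have nf: "nice \<kappa> b (%r e. f r)" unfolding f_def by (intro nice_diff nice_angp nice_const)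
 have nZ: "nice \<kappa> b Z" unfolding Z_def[abs_def]
 proof (rule nice_minus, rule nice_divide[where l=1, OF nice_const])
  show "nice \<kappa> b (%r e. sc_v0 \<kappa> r e * (sc_gam e + sc_v0 \<kappa> r e))" by (intro nice_mult nice_add nice_v0 nice_gam)
  show "1 <= sc_v0 \<kappa> r e * (sc_gam e + sc_v0 \<kappa> r e)" if "in_range \<kappa> b r e" for r e
   using mult_mono[of 1 "sc_v0 \<kappa> r e" 1 "sc_gam e + sc_v0 \<kappa> r e"] v0_ge[of r e] gam_ge[of e] that by simp
 qed simp
 have f0: "f 0 = 0" by (simp add: f_def ang_def)
 obtain K where K: "K \<ge> 0" "\<forall>r1 e1 r2 e2. in_range \<kappa> b r1 e1 & in_range \<kappa> b r2 e2 --> abs (f r1 * Z r1 e1 - f r2 * Z r2 e2) <= K * (abs (r1 - r2) + r2 * abs (e1 - e2))"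
  using vanishing_product[OF nf f0 nZ] by blast
 obtain L where L: "L \<ge> 0" "\<forall>r1 e1 r2 e2. in_range \<kappa> b r1 e1 & in_range \<kappa> b r2 e2 --> abs (r1 * (sc_a1 \<kappa> r1 e1 * sc_gam e1) - r2 * (sc_a1 \<kappa> r2 e2 * sc_gam e2)) <= L * (abs (r1 - r2) + r2 * abs (e1 - e2))"
  using vanishing_product[OF nice_fst _ nice_mult[OF nice_a1 nice_gam]] by auto
 have "abs (sc_t \<kappa> r1 e1 - sc_t \<kappa> r2 e2) <= (K + L) * (abs (r1 - r2) + r2 * abs (e1 - e2))"
  if h: "in_range \<kappa> b r1 e1" "in_range \<kappa> b r2 e2" for r1 e1 r2 e2
 proof -
  have "abs (a + c - (b + d)) <= x + y" if "abs (a - b) <= x" "abs (c - d) <= y" for a b c d x y :: real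
   using that by linarith
  from this[OF K(2)[rule_format, of r1 e1 r2 e2] L(2)[rule_format, of r1 e1 r2 e2]]
  show ?thesis using h s[of r1 e1] s[of r2 e2] by (simp add: sc_t_def distrib_right[of K L])
 qed
 with K(1) L(1) show ?thesis by (intro exI[of _ "K + L"]) auto
qed

end

section \<open>Geometry of the free boundary\<close>

lemma mvt_bounds:
 fixes \<phi> :: "real => real"
 assumes "c <= b" "continuous_on {c..b} \<phi>"
  and "!!s. c < s ==> s < b ==> \<exists>D. (\<phi> has_real_derivative D) (at s) & l <= D & D <= u"
 shows "l * (b - c) <= \<phi> b - \<phi> c" "\<phi> b - \<phi> c <= u * (b - c)"
proof -
 have "l * (b - c) <= \<phi> b - \<phi> c & \<phi> b - \<phi> c <= u * (b - c)"
 proof (cases "c = b")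
  case False
  then have cb: "c < b" using assms by simp
  obtain D z where z: "c < z" "z < b" "(\<phi> has_real_derivative D) (at z)" "\<phi> b - \<phi> c = (b - c) * D"
   using MVT[OF cb assms(2)] assms(3) real_differentiable_def by metis
  then have "l <= D" "D <= u" using assms(3)[OF z(1,2)] DERIV_unique by blast+
  then show ?thesis using z(4) cb by (auto simp: mult.commute intro!: mult_left_mono)
 qed simp
 then show "l * (b - c) <= \<phi> b - \<phi> c" "\<phi> b - \<phi> c <= u * (b - c)" by auto
qed

lemma zero_set_compact:
 fixes \<phi> :: "real => real"
 assumes "continuous_on {a..b} \<phi>" shows "compact {s \<in> {a..b}. \<phi> s = 0}"
proof -
 have "closedin (top_of_set {a..b}) {s \<in> {a..b}. \<phi> s = 0}"
  using continuous_closedin_preimage_constant[OF assms] by simp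
 then show ?thesis using closedin_compact compact_Icc by blast
qed

text \<open>A nonnegative function whose slope lies in [l, u] where it is positive, and which vanishes
somewhere, is compared with the straight lines that start at its last zero.\<close>

lemma last_zero:
 fixes \<phi> :: "real => real"
 assumes cont: "continuous_on {a..b} \<phi>" and nn: "!!s. s \<in> {a..b} ==> 0 <= \<phi> s"
  and der: "!!s. a < s ==> s < b ==> 0 < \<phi> s ==> \<exists>D. (\<phi> has_real_derivative D) (at s) & l <= D & D <= u"
  and z: "z \<in> {a..b}" "\<phi> z = 0"
 shows "\<exists>c\<in>{a..b}. l * (b - c) <= \<phi> b & \<phi> b <= u * (b - c)"
proof -
 obtain c where c: "c \<in> {a..b}" "\<phi> c = 0" "!!s. s \<in> {a..b} ==> \<phi> s = 0 ==> s <= c"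
  using compact_attains_sup[OF zero_set_compact[OF cont]] z by blast
 have "\<phi> s > 0" if "c < s" "s < b" for s
  using nn[of s] c(3)[of s] c(1) that by (cases "\<phi> s = 0") auto
 then have "l * (b - c) <= \<phi> b - \<phi> c" "\<phi> b - \<phi> c <= u * (b - c)"
  using c(1) der by (intro mvt_bounds[where l=l and u=u] continuous_on_subset[OF cont]; force)+
 then show ?thesis using c by auto
qed

lemma first_zero:
 fixes \<phi> :: "real => real"
 assumes cont: "continuous_on {a..b} \<phi>" and nn: "!!s. s \<in> {a..b} ==> 0 <= \<phi> s"
  and der: "!!s. a < s ==> s < b ==> 0 < \<phi> s ==> \<exists>D. (\<phi> has_real_derivative D) (at s) & l <= D & D <= u"
  and z: "z \<in> {a..b}" "\<phi> z = 0"
 shows "\<exists>c\<in>{a..b}. l * (c - a) <= - \<phi> a & - \<phi> a <= u * (c - a)"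
proof -
 obtain c where c: "c \<in> {a..b}" "\<phi> c = 0" "!!s. s \<in> {a..b} ==> \<phi> s = 0 ==> c <= s"
  using compact_attains_inf[OF zero_set_compact[OF cont]] z by blast
 have "\<phi> s > 0" if "a < s" "s < c" for s
  using nn[of s] c(3)[of s] c(1) that by (cases "\<phi> s = 0") auto
 then have "l * (c - a) <= \<phi> c - \<phi> a" "\<phi> c - \<phi> a <= u * (c - a)"
  using c(1) der by (intro mvt_bounds[where l=l and u=u] continuous_on_subset[OF cont]; force)+
 then show ?thesis using c by auto
qed

lemma lipschitz_of_positive_part:
 fixes \<phi> :: "real => real"
 assumes ab: "a <= b" and L: "0 <= L" and cont: "continuous_on {a..b} \<phi>" and nn: "!!s. s \<in> {a..b} ==> 0 <= \<phi> s"
  and der: "!!s. a < s ==> s < b ==> 0 < \<phi> s ==> \<exists>D. (\<phi> has_real_derivative D) (at s) & abs D <= L"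
 shows "abs (\<phi> b - \<phi> a) <= L * (b - a)"
proof (cases "\<exists>z\<in>{a..b}. \<phi> z = 0")
 case True
 then obtain z where z: "z \<in> {a..b}" "\<phi> z = 0" by blast
 have der': "\<exists>D. (\<phi> has_real_derivative D) (at s) & - L <= D & D <= L" if "a < s" "s < b" "0 < \<phi> s" for s
  using der[OF that] by (auto simp: abs_le_iff)
 obtain c where c: "c \<in> {a..b}" "\<phi> b <= L * (b - c)" using last_zero[OF cont nn der' z] by blast
 obtain d where d: "d \<in> {a..b}" "- L * (d - a) <= - \<phi> a" using first_zero[OF cont nn der' z] by blast
 have "L * (b - c) <= L * (b - a)" "L * (d - a) <= L * (b - a)" using c d L by (auto intro!: mult_left_mono)
 then show ?thesis using c d nn[of a] nn[of b] ab by auto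
next
 case False
 then have pos: "0 < \<phi> s" if "s \<in> {a..b}" for s using nn[OF that] that by (metis less_eq_real_def)
 have "\<exists>D. (\<phi> has_real_derivative D) (at s) & - L <= D & D <= L" if "a < s" "s < b" for s
  using der[OF that pos] that by (auto simp: abs_le_iff)
 from mvt_bounds[OF ab cont this] show ?thesis by (auto simp: abs_le_iff)
qed

text \<open>A nonnegative function that is affine up to \<omega> where positive agrees with the positive part of
the affine function: if it vanishes on the way, the comparison on both sides of its last zero leaves
an error of at most 2\<omega>.\<close>

lemma taylor_of_positive_part:
 fixes \<phi> :: "real => real"
 assumes cont: "continuous_on {0..1} \<phi>" and nn: "!!s. s \<in> {0..1} ==> 0 <= \<phi> s" and pos: "0 < \<phi> 0" and \<omega>: "0 <= \<omega>"
  and der: "!!s. 0 < s ==> s < 1 ==> 0 < \<phi> s ==> \<exists>D. (\<phi> has_real_derivative D) (at s) & abs (D - \<beta>) <= \<omega>"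
 shows "abs (\<phi> 1 - max 0 (\<phi> 0 + \<beta>)) <= 2 * \<omega>"
proof (cases "\<exists>z\<in>{0..1}. \<phi> z = 0")
 case True
 then obtain z where z: "z \<in> {0..1}" "\<phi> z = 0" by blast
 have der': "\<exists>D. (\<phi> has_real_derivative D) (at s) & \<beta> - \<omega> <= D & D <= \<beta> + \<omega>" if "0 < s" "s < 1" "0 < \<phi> s" for s
  using der[OF that] by (smt (verit, best))
 obtain c where c: "c \<in> {0..1}" "\<phi> 1 <= (\<beta> + \<omega>) * (1 - c)" using last_zero[OF cont nn der' z] by blast
 obtain d where d: "d \<in> {0..1}" "(\<beta> - \<omega>) * (d - 0) <= - \<phi> 0" using first_zero[OF cont nn der' z] by blast
 have "\<phi> 0 <= (\<omega> - \<beta>) * d" using d(2) by (simp add: algebra_simps)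
 moreover have "\<omega> - \<beta> > 0" using calculation pos d(1) by (smt (verit) atLeastAtMost_iff mult_nonneg_nonneg mult_nonpos_nonneg)
 ultimately have a: "\<phi> 0 <= \<omega> - \<beta>" using d(1) by (smt (verit) atLeastAtMost_iff mult_left_le)
 have "\<phi> 1 <= 2 * \<omega>"
 proof (cases "\<beta> + \<omega> \<ge> 0")
  case True
  then have "(\<beta> + \<omega>) * (1 - c) <= \<beta> + \<omega>" using c(1) by (intro mult_left_le) auto
  then show ?thesis using c a pos by linarith
 next
  case False
  then have "(\<beta> + \<omega>) * (1 - c) <= 0" using c(1) by (intro mult_nonpos_nonneg) auto
  then show ?thesis using c \<omega> by linarith
 qed
 then show ?thesis using nn[of 1] a \<omega> by auto
next
 case False
 then have pos': "0 < \<phi> s" if "s \<in> {0..1}" for s using nn[OF that] that by (metis less_eq_real_def)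
 have "\<exists>D. (\<phi> has_real_derivative D) (at s) & \<beta> - \<omega> <= D & D <= \<beta> + \<omega>" if "0 < s" "s < 1" for s
  using der[OF that pos'] that by (smt (verit, best) atLeastAtMost_iff)
 from mvt_bounds[OF _ cont this] have "\<beta> - \<omega> <= \<phi> 1 - \<phi> 0" "\<phi> 1 - \<phi> 0 <= \<beta> + \<omega>" by auto
 then show ?thesis using pos'[of 1] \<omega> by auto
qed

text \<open>The regularity of a solution at one time: r is comparable to the distance to the free boundary and
p, its gradient, is of the weighted Hoelder class. The function r is extended by 0.\<close>

definition vacuum_profile :: "real => real => real => ('a::euclidean_space => real) => ('a => 'a) => bool" where
 "vacuum_profile C K B r p \<longleftrightarrow> continuous_on UNIV r & (\<forall>x. 0 <= r x & r x <= B) &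
  (\<forall>x. 0 < r x --> (r has_derivative (%h. p x \<bullet> h)) (at x) &
    r x <= C * infdist x (frontier {x. 0 < r x}) & infdist x (frontier {x. 0 < r x}) <= C * r x) &
  (\<forall>x y. 0 < r x & 0 < r y --> norm (p x - p y) <= K * (sqrt (r x) + sqrt (r y) + sqrt (norm (x - y))))"

text \<open>A Steklov average of differences of r. It is defined on the whole space and continuously
differentiable in the direction e although r is only Lipschitz across the boundary.\<close>

definition stek :: "real => ('a::euclidean_space => real) => 'a => 'a => real" where
 "stek h r e x = integral {0..h} (%s. r (x + s *\<^sub>R e) - r (x - s *\<^sub>R e))"

definition grad_bound :: "real => real => real => real" where
 "grad_bound C K B = 3 * C + K * (2 * sqrt B + sqrt (C * B))"

context
 fixes C K B :: real and r :: "'a::euclidean_space => real" and p :: "'a => 'a"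
 assumes vp: "vacuum_profile C K B r p" and C: "1 <= C" and K: "0 <= K" and B: "0 <= B"
begin

lemma r_cont: "continuous_on S r" using vp continuous_on_subset unfolding vacuum_profile_def by blast

lemma r_nonneg: "0 <= r x" and r_le: "r x <= B" using vp unfolding vacuum_profile_def by auto

lemma r_line_deriv:
 assumes "0 < r (x + s *\<^sub>R z)"
 shows "((%s. r (x + s *\<^sub>R z)) has_real_derivative p (x + s *\<^sub>R z) \<bullet> z) (at s)"
proof -
 have d: "(r has_derivative (%h. p (x + s *\<^sub>R z) \<bullet> h)) (at (x + s *\<^sub>R z))"
  using vp assms unfolding vacuum_profile_def by blast
 have "((%s. x + s *\<^sub>R z) has_derivative (%u. u *\<^sub>R z)) (at s)" by (auto intro!: derivative_eq_intros)
 from has_derivative_compose[OF this d]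
 have "((%s. r (x + s *\<^sub>R z)) has_derivative (%u. p (x + s *\<^sub>R z) \<bullet> (u *\<^sub>R z))) (at s)" .
 moreover have "(%u. p (x + s *\<^sub>R z) \<bullet> (u *\<^sub>R z)) = (*) (p (x + s *\<^sub>R z) \<bullet> z)" by (auto simp: fun_eq_iff)
 ultimately show ?thesis by (simp add: has_field_derivative_def)
qed

lemma r_line_cont: "continuous_on S (%s. r (x + s *\<^sub>R z))"
 by (rule continuous_on_compose2[OF r_cont[of UNIV]]) (auto intro!: continuous_intros)

lemma p_holder: "0 < r x ==> 0 < r y ==> norm (p x - p y) <= K * (sqrt (r x) + sqrt (r y) + sqrt (norm (x - y)))"
 using vp unfolding vacuum_profile_def by blast

lemma dist_bounds:
 assumes "0 < r x"
 shows "r x <= C * infdist x (frontier {x. 0 < r x})" "infdist x (frontier {x. 0 < r x}) <= C * r x"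
  "0 < infdist x (frontier {x. 0 < r x})"
proof -
 show 1: "r x <= C * infdist x (frontier {x. 0 < r x})" "infdist x (frontier {x. 0 < r x}) <= C * r x"
  using vp assms unfolding vacuum_profile_def by blast+
 show "0 < infdist x (frontier {x. 0 < r x})"
  using 1 assms C by (smt (verit) mult_nonneg_nonpos infdist_nonneg)
qed

lemma open_pos: "open {x. 0 < r x}"
 using open_Collect_less[OF continuous_on_const[of UNIV 0] r_cont[of UNIV]] by simp

lemma ball_pos:
 assumes "0 < r x" "norm (y - x) < infdist x (frontier {x. 0 < r x})"
 shows "0 < r y"
proof (rule ccontr)
 assume "\<not> 0 < r y"
 then have "closed_segment x y - {x. 0 < r x} \<noteq> {}" "closed_segment x y \<inter> {x. 0 < r x} \<noteq> {}"
  using assms(1) by auto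
 then obtain z where z: "z \<in> closed_segment x y" "z \<in> frontier {x. 0 < r x}"
  using connected_Int_frontier[of "closed_segment x y" "{x. 0 < r x}"] connected_segment by blast
 have "infdist x (frontier {x. 0 < r x}) <= dist x z" by (rule infdist_le[OF z(2)])
 also have "... <= dist x y" using segment_bound(1)[OF z(1)] by (simp add: dist_norm norm_minus_commute)
 finally show False using assms(2) by (simp add: dist_norm norm_minus_commute)
qed

text \<open>Follow the direction of the gradient for half the distance d to the boundary: there r is at most a
multiple of d, so its slope is bounded at some point on the way. The weighted Hoelder condition
transfers the bound to x.\<close>

lemma gradient_bounded:
 assumes "0 < r x" shows "norm (p x) <= grad_bound C K B"
proof (cases "p x = 0")
 case True
 then show ?thesis using C K B by (simp add: grad_bound_def)
next
 case False
 define d where "d = infdist x (frontier {x. 0 < r x})"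
 define e where "e = p x /\<^sub>R norm (p x)"
 have e: "norm e = 1" using False by (simp add: e_def)
 have d: "0 < d" "d <= C * r x" using dist_bounds[OF assms] by (auto simp: d_def)
 have dB: "d <= C * B" using d(2) r_le[of x] C by (smt (verit) mult_left_mono)
 have pos: "0 < r (x + s *\<^sub>R e)" if "0 <= s" "s < d" for s
  using ball_pos[OF assms, of "x + s *\<^sub>R e"] that e by (simp add: d_def)
 obtain s where s: "0 < s" "s < d / 2" "r (x + (d / 2) *\<^sub>R e) - r (x + 0 *\<^sub>R e) = (d / 2 - 0) * (p (x + s *\<^sub>R e) \<bullet> e)"
  using MVT2[of 0 "d / 2" "%s. r (x + s *\<^sub>R e)" "%s. p (x + s *\<^sub>R e) \<bullet> e"] r_line_deriv pos d by auto
 have "r (x + (d / 2) *\<^sub>R e) <= C * infdist (x + (d / 2) *\<^sub>R e) (frontier {x. 0 < r x})"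
  using dist_bounds(1)[OF pos[of "d / 2"]] d by simp
 also have "infdist (x + (d / 2) *\<^sub>R e) (frontier {x. 0 < r x}) <= d + d / 2"
  using infdist_triangle[of "x + (d / 2) *\<^sub>R e" "frontier {x. 0 < r x}" x] e d by (simp add: d_def dist_norm)
 finally have "(d / 2) * (p (x + s *\<^sub>R e) \<bullet> e) <= C * (d + d / 2)" using s(3) r_nonneg[of x] C by (simp add: mult_left_mono)
 then have a: "p (x + s *\<^sub>R e) \<bullet> e <= 3 * C" using d(1) by (simp add: field_simps)
 have "(p x - p (x + s *\<^sub>R e)) \<bullet> e <= norm (p x - p (x + s *\<^sub>R e))"
  using norm_cauchy_schwarz[of "p x - p (x + s *\<^sub>R e)" e] e by simp
 also have "... <= K * (sqrt (r x) + sqrt (r (x + s *\<^sub>R e)) + sqrt (norm (x - (x + s *\<^sub>R e))))"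
  using p_holder[OF assms pos[of s]] s d by simp
 also have "... <= K * (2 * sqrt B + sqrt (C * B))"
 proof (intro mult_left_mono K)
  have "sqrt (norm (x - (x + s *\<^sub>R e))) <= sqrt (C * B)" using s e dB d by (simp add: real_sqrt_le_iff)
  moreover have "sqrt (r x) <= sqrt B" "sqrt (r (x + s *\<^sub>R e)) <= sqrt B" using r_le by (auto simp: real_sqrt_le_iff)
  ultimately show "sqrt (r x) + sqrt (r (x + s *\<^sub>R e)) + sqrt (norm (x - (x + s *\<^sub>R e))) <= 2 * sqrt B + sqrt (C * B)" by linarith
 qed
 finally have "p x \<bullet> e <= grad_bound C K B" using a by (simp add: grad_bound_def inner_diff_left)
 moreover have "p x \<bullet> e = norm (p x)" using False by (simp add: e_def dot_square_norm power2_eq_square)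
 ultimately show ?thesis by simp
qed

lemma grad_bound_nonneg: "0 <= grad_bound C K B" using C K B by (simp add: grad_bound_def)

lemma r_lipschitz: "abs (r y - r x) <= grad_bound C K B * norm (y - x)"
proof -
 have "abs (r (x + 1 *\<^sub>R (y - x)) - r (x + 0 *\<^sub>R (y - x))) <= grad_bound C K B * norm (y - x) * (1 - 0)"
 proof (rule lipschitz_of_positive_part)
  show "0 <= grad_bound C K B * norm (y - x)" using grad_bound_nonneg by simp
  show "continuous_on {0..1} (%s. r (x + s *\<^sub>R (y - x)))" by (rule r_line_cont)
  fix s assume "0 < r (x + s *\<^sub>R (y - x))"
  then have "((%s. r (x + s *\<^sub>R (y - x))) has_real_derivative p (x + s *\<^sub>R (y - x)) \<bullet> (y - x)) (at s)"
   "abs (p (x + s *\<^sub>R (y - x)) \<bullet> (y - x)) <= grad_bound C K B * norm (y - x)"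
   using r_line_deriv gradient_bounded Cauchy_Schwarz_ineq2 by (blast, meson mult_right_mono norm_ge_zero order_trans)
  then show "\<exists>D. ((%s. r (x + s *\<^sub>R (y - x))) has_real_derivative D) (at s) & abs D <= grad_bound C K B * norm (y - x)"
   by blast
 qed (auto simp: r_nonneg)
 then show ?thesis by simp
qed

text \<open>On the segment to a nearest boundary point, r decreases from r x to 0 over a length of at most C r
x, so its slope is at least 1/C somewhere. Near the boundary the weighted Hoelder condition makes
the gradient almost constant on the segment.\<close>

lemma gradient_lower_bound:
 assumes "0 < r x" "8 * (K + 1) * C\<^sup>2 * sqrt (r x) <= 1"
 shows "1 / (2 * C) <= norm (p x)"
proof -
 define F where "F = frontier {x. 0 < r x}"
 have d: "0 < infdist x F" "infdist x F <= C * r x" using dist_bounds[OF assms(1)] by (auto simp: F_def)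
 then have "F \<noteq> {}" by (auto simp: infdist_def)
 then obtain q where q: "q \<in> F" "infdist x F = dist x q"
  using infdist_attains_inf[of F x] unfolding F_def by auto
 have "r q = 0"
  using q(1) open_pos r_nonneg[of q] unfolding F_def frontier_def by (auto simp: interior_open)
 define z where "z = q - x"
 have nz: "norm z = infdist x F" using q by (simp add: z_def dist_norm norm_minus_commute)
 have pos: "0 < r (x + s *\<^sub>R z)" if "0 <= s" "s < 1" for s
  using ball_pos[OF assms(1), of "x + s *\<^sub>R z"] that d(1) nz by (simp add: F_def)
 have "\<exists>l s. 0 < s & s < 1 & ((%s. r (x + s *\<^sub>R z)) has_real_derivative l) (at s) &
   r (x + 1 *\<^sub>R z) - r (x + 0 *\<^sub>R z) = (1 - 0) * l"
 proof (rule MVT)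
  show "(%s. r (x + s *\<^sub>R z)) differentiable (at s)" if "0 < s" "s < 1" for s
   using r_line_deriv[OF pos[of s]] that unfolding real_differentiable_def by auto
 qed (use r_line_cont in auto)
 then obtain s l where s: "0 < s" "s < 1" "((%s. r (x + s *\<^sub>R z)) has_real_derivative l) (at s)" "- r x = l"
  using \<open>r q = 0\<close> by (auto simp: z_def)
 have sp: "0 < r (x + s *\<^sub>R z)" using pos s by simp
 have "l = p (x + s *\<^sub>R z) \<bullet> z" using DERIV_unique[OF s(3) r_line_deriv[OF sp]] .
 then have "r x <= norm (p (x + s *\<^sub>R z)) * norm z"
  using Cauchy_Schwarz_ineq2[of "p (x + s *\<^sub>R z)" z] s(4) by simp
 also have "... <= norm (p (x + s *\<^sub>R z)) * (C * r x)" using d nz by (intro mult_left_mono) auto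
 finally have a: "1 / C <= norm (p (x + s *\<^sub>R z))" using assms(1) C by (simp add: field_simps)
 have "r (x + s *\<^sub>R z) <= C * infdist (x + s *\<^sub>R z) F" using dist_bounds(1)[OF sp] by (simp add: F_def)
 also have "infdist (x + s *\<^sub>R z) F <= infdist x F + dist (x + s *\<^sub>R z) x" by (rule infdist_triangle)
 also have "dist (x + s *\<^sub>R z) x <= infdist x F" using s nz d(1) by (simp add: dist_norm mult_le_cancel_right2)
 finally have "r (x + s *\<^sub>R z) <= C * (2 * (C * r x))" using d C by (simp add: mult_left_mono) (smt (verit) mult_left_mono)
 also have "... <= (2 * C)\<^sup>2 * r x" using C assms by (simp add: power2_eq_square)
 finally have "sqrt (r (x + s *\<^sub>R z)) <= sqrt ((2 * C)\<^sup>2 * r x)" by (simp add: real_sqrt_le_iff)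
 then have b: "sqrt (r (x + s *\<^sub>R z)) <= 2 * C * sqrt (r x)" using C by (simp add: real_sqrt_mult)
 have "norm (x - (x + s *\<^sub>R z)) <= norm z" using s by (simp add: mult_left_le_one_le)
 also have "... <= C\<^sup>2 * r x" using d nz C assms by (smt (verit) mult_right_mono power2_eq_square mult_le_cancel_left1)
 finally have "sqrt (norm (x - (x + s *\<^sub>R z))) <= sqrt (C\<^sup>2 * r x)" by (simp only: real_sqrt_le_iff)
 then have c: "sqrt (norm (x - (x + s *\<^sub>R z))) <= C * sqrt (r x)" using C by (simp add: real_sqrt_mult)
 have "sqrt (r x) <= C * sqrt (r x)" using C assms by simp
 then have "sqrt (r x) + sqrt (r (x + s *\<^sub>R z)) + sqrt (norm (x - (x + s *\<^sub>R z))) <= 4 * C * sqrt (r x)"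
  using b c by linarith
 then have "norm (p x - p (x + s *\<^sub>R z)) <= K * (4 * C * sqrt (r x))"
  using p_holder[OF assms(1) sp] K by (smt (verit) mult_left_mono)
 also have "... <= (K + 1) * (4 * C * sqrt (r x))" using C assms by (intro mult_right_mono) auto
 also have "... <= 1 / (2 * C)" using assms(2) C by (simp add: field_simps power2_eq_square)
 finally have "norm (p x - p (x + s *\<^sub>R z)) <= 1 / (2 * C)" .
 moreover have "norm (p (x + s *\<^sub>R z)) <= norm (p x) + norm (p x - p (x + s *\<^sub>R z))"
  using norm_triangle_ineq4[of "p x" "p x - p (x + s *\<^sub>R z)"] by simp
 moreover have "1 / C = 1 / (2 * C) + 1 / (2 * C)" using C by (simp add: field_simps)
 ultimately show ?thesis using a by linarith
qed

text \<open>At scale h near the boundary, the extension of r by zero is the positive part of its linearisation,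
up to an error of order h^(3/2).\<close>

lemma r_taylor:
 assumes "0 < r x" "r x <= h" "0 < h" "norm z <= h"
 shows "abs (r (x + z) - max 0 (r x + p x \<bullet> z)) <= 2 * (h * K * ((2 + sqrt (1 + grad_bound C K B)) * sqrt h))"
proof -
 define \<omega> where "\<omega> = h * K * ((2 + sqrt (1 + grad_bound C K B)) * sqrt h)"
 have "abs (r (x + 1 *\<^sub>R z) - max 0 (r (x + 0 *\<^sub>R z) + p x \<bullet> z)) <= 2 * \<omega>"
 proof (rule taylor_of_positive_part[where \<phi>="%s. r (x + s *\<^sub>R z)"])
  show "continuous_on {0..1} (%s. r (x + s *\<^sub>R z))" by (rule r_line_cont)
  show "0 <= \<omega>" using assms K grad_bound_nonneg by (simp add: \<omega>_def)
  fix s :: real assume s: "0 < s" "s < 1" "0 < r (x + s *\<^sub>R z)"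
  have nz: "norm (s *\<^sub>R z) <= h" using s assms(4) by (simp add: mult_left_le_one_le) (smt (verit) mult_left_le_one_le norm_ge_zero)
  have "r (x + s *\<^sub>R z) <= r x + grad_bound C K B * norm (s *\<^sub>R z)" using r_lipschitz[of "x + s *\<^sub>R z" x] by simp
  also have "... <= h + grad_bound C K B * h" using assms nz grad_bound_nonneg by (intro add_mono mult_left_mono) auto
  finally have "r (x + s *\<^sub>R z) <= (1 + grad_bound C K B) * h" by (simp add: algebra_simps)
  then have "sqrt (r (x + s *\<^sub>R z)) <= sqrt ((1 + grad_bound C K B) * h)" by (simp only: real_sqrt_le_iff)
  then have a: "sqrt (r (x + s *\<^sub>R z)) <= sqrt (1 + grad_bound C K B) * sqrt h" by (simp add: real_sqrt_mult)
  have b: "sqrt (r x) <= sqrt h" "sqrt (norm ((x + s *\<^sub>R z) - x)) <= sqrt h" using assms nz by (simp_all only: real_sqrt_le_iff add_diff_cancel_left')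
  have "abs (p (x + s *\<^sub>R z) \<bullet> z - p x \<bullet> z) <= norm (p (x + s *\<^sub>R z) - p x) * norm z"
   using Cauchy_Schwarz_ineq2[of "p (x + s *\<^sub>R z) - p x" z] by (simp add: inner_diff_left)
  also have "... <= (K * (sqrt (r (x + s *\<^sub>R z)) + sqrt (r x) + sqrt (norm ((x + s *\<^sub>R z) - x)))) * h"
   using p_holder[OF s(3) assms(1)] assms(4) by (intro mult_mono) (auto intro: order_trans[OF norm_ge_zero])
  also have "... <= (K * ((2 + sqrt (1 + grad_bound C K B)) * sqrt h)) * h"
  proof (intro mult_right_mono mult_left_mono K)
   show "sqrt (r (x + s *\<^sub>R z)) + sqrt (r x) + sqrt (norm ((x + s *\<^sub>R z) - x)) <= (2 + sqrt (1 + grad_bound C K B)) * sqrt h"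
    using a b unfolding distrib_right by linarith
  qed (use assms in simp)
  finally have "abs (p (x + s *\<^sub>R z) \<bullet> z - p x \<bullet> z) <= \<omega>" by (simp add: \<omega>_def mult_ac)
  then show "\<exists>D. ((%s. r (x + s *\<^sub>R z)) has_real_derivative D) (at s) & abs (D - p x \<bullet> z) <= \<omega>"
   using r_line_deriv[OF s(3)] by blast
 qed (use assms in \<open>auto simp: r_nonneg\<close>)
 then show ?thesis by (simp add: \<omega>_def)
qed

text \<open>For the positive part of an affine function with slope \<beta> the averaged difference has the sign
of \<beta> and at least half of the size for the affine function itself, because one of the two
sides does not meet the vacuum.\<close>

lemma stek_lower:
 assumes x: "0 < r x" "r x <= h" "0 < h" and e: "norm e = 1"
 shows "(p x \<bullet> e)\<^sup>2 * (h\<^sup>2 / 2) - 4 * (h * K * ((2 + sqrt (1 + grad_bound C K B)) * sqrt h)) * grad_bound C K B * h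
   <= (p x \<bullet> e) * stek h r e x"
proof -
 define \<omega> where "\<omega> = h * K * ((2 + sqrt (1 + grad_bound C K B)) * sqrt h)"
 define L where "L = grad_bound C K B"
 define q where "q = p x \<bullet> e"
 have w0: "0 <= \<omega>" using x K grad_bound_nonneg by (simp add: \<omega>_def)
 have q: "abs q <= L" using Cauchy_Schwarz_ineq2[of "p x" e] gradient_bounded[OF x(1)] e by (simp add: q_def L_def)
 have i: "(%s. r (x + s *\<^sub>R e) - r (x - s *\<^sub>R e)) integrable_on {0..h}"
  by (intro integrable_continuous_real continuous_intros continuous_on_compose2[OF r_cont[of UNIV]]) auto
 have pw: "q\<^sup>2 * s - 4 * \<omega> * L <= q * (r (x + s *\<^sub>R e) - r (x - s *\<^sub>R e))" if s: "s \<in> {0..h}" for s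
 proof -
  have t: "abs (r (x + s *\<^sub>R e) - max 0 (r x + s * q)) <= 2 * \<omega>" "abs (r (x - s *\<^sub>R e) - max 0 (r x - s * q)) <= 2 * \<omega>"
   using r_taylor[OF x, of "s *\<^sub>R e"] r_taylor[OF x, of "- (s *\<^sub>R e)"] e s by (auto simp: \<omega>_def q_def)
  have m: "q * (s * q) <= q * (max 0 (r x + s * q) - max 0 (r x - s * q))"
  proof (cases "0 <= q")
   case True
   then have "0 <= s * q" using s by simp
   then show ?thesis using True x(1) by (intro mult_left_mono) auto
  next
   case False
   then have "s * q <= 0" using s by (simp add: mult_nonneg_nonpos)
   then show ?thesis using False x(1) by (intro mult_left_mono_neg) auto
  qed
  have "abs ((r (x + s *\<^sub>R e) - r (x - s *\<^sub>R e)) - (max 0 (r x + s * q) - max 0 (r x - s * q))) <= 4 * \<omega>"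
   using t by linarith
  then have "abs (q * ((r (x + s *\<^sub>R e) - r (x - s *\<^sub>R e)) - (max 0 (r x + s * q) - max 0 (r x - s * q)))) <= L * (4 * \<omega>)"
   unfolding abs_mult using q by (intro mult_mono) auto
  then have "q * (max 0 (r x + s * q) - max 0 (r x - s * q)) - L * (4 * \<omega>) <= q * (r (x + s *\<^sub>R e) - r (x - s *\<^sub>R e))"
   by (simp add: right_diff_distrib abs_le_iff)
  then show ?thesis using m by (simp add: power2_eq_square mult_ac)
 qed
 have I: "((%s. q\<^sup>2 * s - 4 * \<omega> * L) has_integral (q\<^sup>2 * (h\<^sup>2 / 2) - 4 * \<omega> * L * h)) {0..h}"
 proof -
  have "((%s. q\<^sup>2 * s - 4 * \<omega> * L) has_integral ((q\<^sup>2 * (h\<^sup>2 / 2) - 4 * \<omega> * L * h) - (q\<^sup>2 * (0\<^sup>2 / 2) - 4 * \<omega> * L * 0))) {0..h}"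
   by (rule fundamental_theorem_of_calculus[where f="%s. q\<^sup>2 * (s\<^sup>2 / 2) - 4 * \<omega> * L * s"])
    (use x in \<open>auto intro!: derivative_eq_intros simp: has_real_derivative_iff_has_vector_derivative[symmetric]\<close>)
  then show ?thesis by simp
 qed
 have J: "((%s. q * (r (x + s *\<^sub>R e) - r (x - s *\<^sub>R e))) has_integral (q * stek h r e x)) {0..h}"
  unfolding stek_def using has_integral_mult_right[OF integrable_integral[OF i], of q] by simp
 from has_integral_le[OF I J pw] show ?thesis by (simp add: q_def \<omega>_def L_def)
qed

end

text \<open>Summing over the coordinate directions gives |p|^2 h^2 / 2, which dominates the Taylor error of
order h^(5/2) for small h because |p| is bounded below near the boundary.\<close>

lemma transversal_field_exists:
 assumes C: "1 <= C" and K: "0 <= K" and B: "0 <= B"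
 shows "\<exists>h>0. \<exists>\<rho>>0. \<exists>c>0. \<forall>(r::'a::euclidean_space => real) p x. vacuum_profile C K B r p & 0 < r x & r x <= \<rho> -->
   c <= (\<Sum>e\<in>Basis. (p x \<bullet> e) * stek h r e x)"
proof -
 define L where "L = grad_bound C K B"
 have L0: "0 <= L" using C K B by (simp add: L_def grad_bound_def)
 define N where "N = real DIM('a)"
 define X where "X = 4 * N * (L + 1) * (K + 1) * (2 + sqrt (1 + L))"
 define Q where "Q = 64 * C\<^sup>2 * X"
 have N: "1 <= N" by (simp add: N_def DIM_positive Suc_leI)
 have "1 <= C\<^sup>2" using C by simp
 have X0: "0 < X" unfolding X_def using N L0 K by (intro mult_pos_pos) (auto intro: add_pos_nonneg)
 have Q0: "0 < Q" unfolding Q_def using C X0 by (intro mult_pos_pos) auto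
 define h where "h = (1 / Q)\<^sup>2"
 have h: "0 < h" "sqrt h = 1 / Q" using Q0 by (auto simp: h_def real_sqrt_divide)
 define \<rho> where "\<rho> = min h ((1 / (8 * (K + 1) * C\<^sup>2))\<^sup>2)"
 have \<rho>: "0 < \<rho>" using h C K by (auto simp: \<rho>_def)
 have "h\<^sup>2 / (16 * C\<^sup>2) <= (\<Sum>e\<in>Basis. (p x \<bullet> e) * stek h r e x)"
  if vp: "vacuum_profile C K B r p" and x: "0 < r x" "r x <= \<rho>" for r :: "'a => real" and p x
 proof -
  have xh: "r x <= h" using x by (simp add: \<rho>_def)
  have "r x <= (1 / (8 * (K + 1) * C\<^sup>2))\<^sup>2" using x unfolding \<rho>_def by linarith
  then have "sqrt (r x) <= 1 / (8 * (K + 1) * C\<^sup>2)" using K by (intro real_le_lsqrt) auto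
  moreover have "0 < 8 * (K + 1) * C\<^sup>2" using C K by (intro mult_pos_pos) auto
  ultimately have "8 * (K + 1) * C\<^sup>2 * sqrt (r x) <= 1" by (simp only: pos_le_divide_eq mult.commute)
  then have "1 / (2 * C) <= norm (p x)" using gradient_lower_bound[OF vp C K B x(1)] by simp
  then have "(1 / (2 * C))\<^sup>2 <= (norm (p x))\<^sup>2" using C by (intro power_mono) auto
  then have np: "1 / (4 * C\<^sup>2) <= (norm (p x))\<^sup>2" by (simp add: power_divide power_mult_distrib)
  define \<omega> where "\<omega> = 4 * (h * K * ((2 + sqrt (1 + L)) * sqrt h)) * L * h"
  have "(\<Sum>e\<in>Basis. (p x \<bullet> e)\<^sup>2 * (h\<^sup>2 / 2) - \<omega>) <= (\<Sum>e\<in>Basis. (p x \<bullet> e) * stek h r e x)"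
   using stek_lower[OF vp C K B x(1) xh h(1)] by (intro sum_mono) (simp add: \<omega>_def L_def)
  moreover have "(\<Sum>e\<in>Basis. (p x \<bullet> e)\<^sup>2 * (h\<^sup>2 / 2) - \<omega>) = (norm (p x))\<^sup>2 * (h\<^sup>2 / 2) - N * \<omega>"
  proof -
   have "(norm (p x))\<^sup>2 = (\<Sum>e\<in>Basis. (p x \<bullet> e)\<^sup>2)"
    unfolding power2_norm_eq_inner euclidean_inner[of "p x" "p x"] by (simp add: power2_eq_square)
   then show ?thesis by (simp only: sum_subtractf sum_distrib_right) (simp add: N_def)
  qed
  moreover have "1 / (4 * C\<^sup>2) * (h\<^sup>2 / 2) <= (norm (p x))\<^sup>2 * (h\<^sup>2 / 2)" using np by (intro mult_right_mono) auto
  moreover have "N * \<omega> <= h\<^sup>2 / (16 * C\<^sup>2)"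
  proof -
   have "N * \<omega> = h\<^sup>2 * ((4 * N * L * K * (2 + sqrt (1 + L))) * sqrt h)" by (simp add: \<omega>_def power2_eq_square mult_ac)
   also have "... <= h\<^sup>2 * (X * sqrt h)"
    unfolding X_def using N L0 K h(1) by (intro mult_left_mono mult_right_mono mult_mono) auto
   also have "X * sqrt h = 1 / (64 * C\<^sup>2)" unfolding h(2) Q_def using X0 by simp
   also have "h\<^sup>2 * (1 / (64 * C\<^sup>2)) <= h\<^sup>2 * (1 / (16 * C\<^sup>2))" using C by (intro mult_left_mono) (auto simp: field_simps)
   finally show ?thesis by simp
  qed
  moreover have "1 / (4 * C\<^sup>2) * (h\<^sup>2 / 2) = h\<^sup>2 / (16 * C\<^sup>2) + h\<^sup>2 / (16 * C\<^sup>2)" using C by (simp add: field_simps)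
  ultimately show ?thesis by linarith
 qed
 moreover have "0 < h\<^sup>2 / (16 * C\<^sup>2)" using h C by simp
 ultimately show ?thesis using h(1) \<rho> by blast
qed

lemma stek_bound:
 assumes "continuous_on UNIV r" "!!x. abs (r x) <= B" "0 <= h"
 shows "abs (stek h r e x) <= 2 * B * h"
proof -
 have "norm (integral {0..h} (%s. r (x + s *\<^sub>R e) - r (x - s *\<^sub>R e))) <= 2 * B * (h - 0)"
 proof (rule integral_bound)
  show "continuous_on {0..h} (%s. r (x + s *\<^sub>R e) - r (x - s *\<^sub>R e))"
   by (intro continuous_intros continuous_on_compose2[OF assms(1)]) auto
  show "norm (r (x + s *\<^sub>R e) - r (x - s *\<^sub>R e)) <= 2 * B" for s
   using assms(2)[of "x + s *\<^sub>R e"] assms(2)[of "x - s *\<^sub>R e"] by (simp add: abs_le_iff)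
 qed (use assms in simp)
 then show ?thesis by (simp add: stek_def)
qed

lemma stek_diff:
 assumes "continuous_on UNIV r" "continuous_on UNIV r'" "0 <= h"
  and "!!s. s \<in> {0..h} ==> abs (r (x + s *\<^sub>R e) - r' (x' + s *\<^sub>R e)) <= \<delta> & abs (r (x - s *\<^sub>R e) - r' (x' - s *\<^sub>R e)) <= \<delta>"
 shows "abs (stek h r e x - stek h r' e x') <= 2 * \<delta> * h"
proof -
 have i: "(%s. r (x + s *\<^sub>R e) - r (x - s *\<^sub>R e)) integrable_on {0..h}"
  "(%s. r' (x' + s *\<^sub>R e) - r' (x' - s *\<^sub>R e)) integrable_on {0..h}"
  by (intro integrable_continuous_real continuous_intros continuous_on_compose2[OF assms(1)] continuous_on_compose2[OF assms(2)]; simp)+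
 have "norm (integral {0..h} (%s. (r (x + s *\<^sub>R e) - r (x - s *\<^sub>R e)) - (r' (x' + s *\<^sub>R e) - r' (x' - s *\<^sub>R e)))) <= 2 * \<delta> * (h - 0)"
 proof (rule integral_bound)
  show "continuous_on {0..h} (%s. (r (x + s *\<^sub>R e) - r (x - s *\<^sub>R e)) - (r' (x' + s *\<^sub>R e) - r' (x' - s *\<^sub>R e)))"
   by (intro continuous_intros continuous_on_compose2[OF assms(1)] continuous_on_compose2[OF assms(2)]) auto
  fix s assume "s \<in> {0..h}"
  from assms(4)[OF this] show "norm ((r (x + s *\<^sub>R e) - r (x - s *\<^sub>R e)) - (r' (x' + s *\<^sub>R e) - r' (x' - s *\<^sub>R e))) <= 2 * \<delta>"
   by (auto simp: abs_le_iff)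
 qed (use assms in simp)
 then show ?thesis using integral_diff[OF i] by (simp add: stek_def)
qed

lemma stek_deriv:
 fixes r :: "'a::euclidean_space => real"
 assumes r: "continuous_on UNIV r" and h: "0 < h"
 shows "((%\<sigma>. stek h r e (x + \<sigma> *\<^sub>R e)) has_real_derivative (r (x + h *\<^sub>R e) + r (x - h *\<^sub>R e) - 2 * r x)) (at 0)"
proof -
 define f where "f u = r (x + u *\<^sub>R e)" for u
 have fc: "continuous_on S f" for S
  unfolding f_def by (rule continuous_on_compose2[OF r]) (auto intro!: continuous_intros)
 define G where "G u = integral {- (h + 2)..u} f" for u
 have G: "(G has_real_derivative f u) (at u)" if "- (h + 2) < u" "u < h + 2" for u
 proof -
  have "(G has_real_derivative f u) (at u within {- (h + 2)..h + 2})"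
   unfolding G_def by (rule integral_has_real_derivative[OF fc]) (use that in auto)
  then show ?thesis using that by (simp add: at_within_Icc_at)
 qed
 have s: "stek h r e (x + \<sigma> *\<^sub>R e) = G (\<sigma> + h) + G (\<sigma> - h) - 2 * G \<sigma>" if \<sigma>: "abs \<sigma> < 1" for \<sigma>
 proof -
  have "((%s. f (\<sigma> + s) - f (\<sigma> - s)) has_integral ((G (\<sigma> + h) + G (\<sigma> - h)) - (G (\<sigma> + 0) + G (\<sigma> - 0)))) {0..h}"
  proof (rule fundamental_theorem_of_calculus)
   fix s assume s: "s \<in> {0..h}"
   have 1: "((%s. \<sigma> + s) has_real_derivative 1) (at s)" "((%s. \<sigma> - s) has_real_derivative -1) (at s)"
    by (auto intro!: derivative_eq_intros)
   have "((%s. G (\<sigma> + s) + G (\<sigma> - s)) has_real_derivative f (\<sigma> + s) * 1 + f (\<sigma> - s) * -1) (at s)"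
    using s \<sigma> by (intro DERIV_add DERIV_chain2[OF G 1(1)] DERIV_chain2[OF G 1(2)]) auto
   then show "((%s. G (\<sigma> + s) + G (\<sigma> - s)) has_vector_derivative f (\<sigma> + s) - f (\<sigma> - s)) (at s within {0..h})"
    by (auto intro!: has_field_derivative_at_within simp: has_real_derivative_iff_has_vector_derivative[symmetric])
  qed (use h in simp)
  then have "integral {0..h} (%s. f (\<sigma> + s) - f (\<sigma> - s)) = G (\<sigma> + h) + G (\<sigma> - h) - 2 * G \<sigma>"
   by (simp add: integral_unique)
  then show ?thesis by (simp add: stek_def f_def algebra_simps)
 qed
 have "((%\<sigma>. G (\<sigma> + h) + G (\<sigma> - h) - 2 * G \<sigma>) has_real_derivative (f h + f (- h) - 2 * f 0)) (at 0)"
 proof -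
  have "((%\<sigma>. G (\<sigma> + h)) has_real_derivative f (0 + h)) (at 0)" "((%\<sigma>. G (\<sigma> + (- h))) has_real_derivative f (0 + (- h))) (at 0)"
   using G[of "0 + h"] G[of "0 + (- h)"] h unfolding DERIV_shift by auto
  from DERIV_diff[OF DERIV_add[OF this] DERIV_cmult[OF G[of 0], of 2]] show ?thesis using h by simp
 qed
 then have "((%\<sigma>. stek h r e (x + \<sigma> *\<^sub>R e)) has_real_derivative (f h + f (- h) - 2 * f 0)) (at 0)"
  by (rule has_field_derivative_transform_within_open[where S="{-1<..<1}"]) (auto simp: s)
 then show ?thesis by (simp add: f_def)
qed

section \<open>Derivatives of the energy and of the flux\<close>

text \<open>The coefficients of the energy and of the flux. The first four are the deviations of the
coefficients of the first flow from their vacuum values, multiplied by lam; fza and fzb are the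
coefficients of the quadratic form fQ in the difference a - b, and fz is half of its gradient. Apart
from the factor lam only the first state enters; the resulting asymmetry is of higher order.\<close>

definition fal :: "real => real => real => real ^ 'd => real => real" where
 "fal \<kappa> \<eta> r a s = lam \<eta> r s * (sc_g \<kappa> r (a \<bullet> a) / \<kappa> - 1)"
definition fbe :: "real => real => real => real ^ 'd => real => real" where
 "fbe \<kappa> \<eta> r a s = lam \<eta> r s * (sc_h \<kappa> r (a \<bullet> a) / \<kappa>)"
definition fth :: "real => real => real => real ^ 'd => real => real" where
 "fth \<kappa> \<eta> r a s = lam \<eta> r s * sc_t \<kappa> r (a \<bullet> a)"
definition fxi :: "real => real => real => real ^ 'd => real => real" where
 "fxi \<kappa> \<eta> r a s = lam \<eta> r s * sc_s \<kappa> r (a \<bullet> a)"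
definition fza :: "real => real => real => real ^ 'd => real => real" where
 "fza \<kappa> \<eta> r a s = (1 + fal \<kappa> \<eta> r a s) * (1 / sc_eta \<kappa> r (a \<bullet> a))"
definition fzb :: "real => real => real => real ^ 'd => real => real" where
 "fzb \<kappa> \<eta> r a s = (fbe \<kappa> \<eta> r a s + (1 + fal \<kappa> \<eta> r a s)) * (1 / sc_eta \<kappa> r (a \<bullet> a)) * (1 / (1 - a \<bullet> a))"
definition fz :: "real => real => real => real ^ 'd => real => real ^ 'd => real ^ 'd" where
 "fz \<kappa> \<eta> r a s b = fza \<kappa> \<eta> r a s *\<^sub>R (a - b) + (fzb \<kappa> \<eta> r a s * (a \<bullet> (a - b))) *\<^sub>R a"
definition fQ :: "real => real => real => real ^ 'd => real => real ^ 'd => real" where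
 "fQ \<kappa> \<eta> r a s b = fza \<kappa> \<eta> r a s * ((a - b) \<bullet> (a - b)) + fzb \<kappa> \<eta> r a s * (a \<bullet> (a - b))\<^sup>2"
definition fc :: "real => real => real => real ^ 'd => real => real ^ 'd => real ^ 'd" where
 "fc \<kappa> \<eta> r a s b = (1 + fal \<kappa> \<eta> r a s) *\<^sub>R (a - b) + (fbe \<kappa> \<eta> r a s * (a \<bullet> (a - b))) *\<^sub>R a"
definition energy :: "real => real => real => real => real ^ 'd => real => real ^ 'd => real" where
 "energy \<kappa> m \<eta> r a s b = AA m \<eta> r s + (1 / 2) * (prof m \<eta> r * prof m \<eta> s) * fQ \<kappa> \<eta> r a s b"
definition flux :: "real => real => real => real => real ^ 'd => real => real ^ 'd => 'd => real" where
 "flux \<kappa> m \<eta> r a s b j = (((1 / 2) *\<^sub>R (a + b)) $ j + fth \<kappa> \<eta> r a s * a $ j) * AA m \<eta> r s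
  + MM m \<eta> r s * fc \<kappa> \<eta> r a s b $ j
  + (1 / 2) * (prof m \<eta> r * prof m \<eta> s) * fQ \<kappa> \<eta> r a s b * (((1 / 2) *\<^sub>R (a + b)) $ j + fxi \<kappa> \<eta> r a s * a $ j)"

definition energy_rate :: "real => real => real => real => real ^ 'd => real => real ^ 'd => real => real => real ^ 'd => real => real" where
 "energy_rate \<kappa> m \<eta> r a s b \<rho>' \<sigma>' w' RQ = AD m \<eta> r s * \<rho>' + AD m \<eta> s r * \<sigma>'
  + (1 / 2) * ((dprof m \<eta> r * prof m \<eta> s) * \<rho>' + (prof m \<eta> r * dprof m \<eta> s) * \<sigma>') * fQ \<kappa> \<eta> r a s b
  + (1 / 2) * (prof m \<eta> r * prof m \<eta> s) * (2 * (fz \<kappa> \<eta> r a s b \<bullet> w') + RQ)"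
definition flux_rate :: "real => real => real => real => real ^ 'd => real => real ^ 'd => 'd => real => real => real ^ 'd => real => real => real => real => real" where
 "flux_rate \<kappa> m \<eta> r a s b j \<rho>' \<sigma>' w' RQ Ra Rc Rs =
  (((1 / 2) *\<^sub>R (a + b)) $ j + fth \<kappa> \<eta> r a s * a $ j) * (AD m \<eta> r s * \<rho>' + AD m \<eta> s r * \<sigma>') + AA m \<eta> r s * Ra
  + ((AD m \<eta> r s / 2 + prof m \<eta> r * prof m \<eta> s) * \<rho>' + (- AD m \<eta> s r / 2 - prof m \<eta> r * prof m \<eta> s) * \<sigma>') * fc \<kappa> \<eta> r a s b $ j
  + MM m \<eta> r s * ((1 + fal \<kappa> \<eta> r a s) * w' $ j + fbe \<kappa> \<eta> r a s * (a \<bullet> w') * a $ j + Rc)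
  + (1 / 2) * ((dprof m \<eta> r * prof m \<eta> s) * \<rho>' + (prof m \<eta> r * dprof m \<eta> s) * \<sigma>') * fQ \<kappa> \<eta> r a s b * (((1 / 2) *\<^sub>R (a + b)) $ j + fxi \<kappa> \<eta> r a s * a $ j)
  + (1 / 2) * (prof m \<eta> r * prof m \<eta> s) * (2 * (fz \<kappa> \<eta> r a s b \<bullet> w') + RQ) * (((1 / 2) *\<^sub>R (a + b)) $ j + fxi \<kappa> \<eta> r a s * a $ j)
  + (1 / 2) * (prof m \<eta> r * prof m \<eta> s) * fQ \<kappa> \<eta> r a s b * Rs"

lemma abs_mult_le: "abs x <= X ==> abs y <= Y ==> abs (x * y) <= X * Y" for x y X Y :: real
 unfolding abs_mult by (rule mult_mono) auto

text \<open>A pair of differentiable curves of states; it is applied to curves in time and along the coordinate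
directions.\<close>

definition admissible :: "real => real => real => real set => real => (real => real) => (real => real) =>
  (real => real ^ 'd) => (real => real ^ 'd) => real => real => real ^ 'd => real ^ 'd => bool" where
 "admissible \<kappa> e L S s0 \<rho> \<sigma> u v \<rho>' \<sigma>' u' v' \<longleftrightarrow>
  0 < \<rho> s0 & \<rho> s0 <= 1 / \<kappa> & 0 < \<sigma> s0 & \<sigma> s0 <= 1 / \<kappa> & u s0 \<bullet> u s0 <= e & v s0 \<bullet> v s0 <= e &
  (\<rho> has_real_derivative \<rho>') (at s0 within S) & (\<sigma> has_real_derivative \<sigma>') (at s0 within S) &
  (u has_vector_derivative u') (at s0 within S) & (v has_vector_derivative v') (at s0 within S) &
  abs \<rho>' <= L & abs \<sigma>' <= L & norm u' <= L & norm v' <= L"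

lemma inner_has_real_derivative:
 fixes u v :: "real => 'a::real_inner"
 assumes "(u has_vector_derivative u') (at s within S)" "(v has_vector_derivative v') (at s within S)"
 shows "((%x. u x \<bullet> v x) has_real_derivative (u s \<bullet> v' + u' \<bullet> v s)) (at s within S)"
proof -
 have "((%x. u x \<bullet> v x) has_derivative (%h. u s \<bullet> (h *\<^sub>R v') + (h *\<^sub>R u') \<bullet> v s)) (at s within S)"
  using assms unfolding has_vector_derivative_def by (rule has_derivative_inner)
 moreover have "(%h. u s \<bullet> (h *\<^sub>R v') + (h *\<^sub>R u') \<bullet> v s) = (*) (u s \<bullet> v' + u' \<bullet> v s)"
  by (auto simp: fun_eq_iff algebra_simps)
 ultimately show ?thesis by (simp add: has_field_derivative_def)
qed

lemma nth_has_real_derivative: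
 fixes u :: "real => real ^ 'd"
 assumes "(u has_vector_derivative u') (at s within S)"
 shows "((%x. u x $ j) has_real_derivative u' $ j) (at s within S)"
 using inner_has_real_derivative[OF assms has_vector_derivative_const[of "axis j 1"]]
 by (simp add: inner_axis)

context
 fixes \<kappa> e L m :: real
 assumes \<kappa>: "0 < \<kappa>" and e: "0 <= e" "e < 1" and L: "0 <= L" and m: "0 < m"
begin

lemma small_norm: "(a::real^'d) \<bullet> a <= e ==> norm a <= 1"
 using e by (metis less_imp_le norm_eq_sqrt_inner order_trans real_sqrt_le_1_iff)

lemma vanishing_bound:
 assumes "nice \<kappa> e c" "!!f. 0 <= f ==> f <= e ==> c 0 f = 0"
 shows "\<exists>C\<ge>0. \<forall>r f. in_range \<kappa> e r f --> abs (c r f) <= C * r"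
proof -
 obtain K where K: "K \<ge> 0" "\<forall>r1 e1 r2 e2. in_range \<kappa> e r1 e1 & in_range \<kappa> e r2 e2 --> abs (c r1 e1 - c r2 e2) <= K * (abs (r1 - r2) + abs (e1 - e2))"
  using nice_lipschitz[OF assms(1)] by blast
 have "abs (c r f) <= K * r" if "in_range \<kappa> e r f" for r f
  using K(2)[rule_format, of r f 0 f] assms(2)[of f] that \<kappa> by auto
 with K(1) show ?thesis by blast
qed

definition state_curves :: "(real set \<times> real \<times> (real => real \<times> real \<times> (real ^ 'd) \<times> real) \<times> real) set" where
 "state_curves = {(S, s0, \<gamma>, N). N = 1 & (\<exists>\<eta> \<rho> \<sigma> u v \<rho>' \<sigma>' u' v'. \<gamma> = (%s. (\<eta>, \<rho> s, u s, \<sigma> s)) & 0 < \<eta> & admissible \<kappa> e L S s0 \<rho> \<sigma> u v \<rho>' \<sigma>' u' v')}"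

abbreviation (input) fld where "fld F \<equiv> (%x. F (fst x) (fst (snd x)) (fst (snd (snd x))) (snd (snd (snd x))))"

lemma nice_tame: assumes "nice \<kappa> e c" shows "tame (state_curves :: (real set \<times> real \<times> (real => real \<times> real \<times> (real ^ 'd) \<times> real) \<times> real) set) (fld (%\<eta> r a s. c r (a \<bullet> a)))"
proof (rule niceE[OF assms])
 fix K assume K: "0 <= K" "!!r f. in_range \<kappa> e r f ==> abs (c r f) <= K"
  "!!(r::real=>real) f r' f' s S. in_range \<kappa> e (r s) (f s) ==> (r has_real_derivative r') (at s within S) ==> (f has_real_derivative f') (at s within S) ==>
   \<exists>D. ((%s. c (r s) (f s)) has_real_derivative D) (at s within S) & abs D <= K * (abs r' + abs f')"
 show ?thesis
 proof (rule tameI[of "K * (3 * L) + K"])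
  fix S s0 N and \<gamma> :: "real => real \<times> real \<times> (real ^ 'd) \<times> real" assume "(S, s0, \<gamma>, N) \<in> state_curves"
  then obtain \<eta> \<rho> \<sigma> u v \<rho>' \<sigma>' u' v' where \<gamma>: "\<gamma> = (%s. (\<eta>, \<rho> s, u s, \<sigma> s))" "N = 1" and A: "admissible \<kappa> e L S s0 \<rho> \<sigma> u v \<rho>' \<sigma>' u' v'"
   unfolding state_curves_def by blast
  note A' = A[unfolded admissible_def]
  have R: "in_range \<kappa> e (\<rho> s0) (u s0 \<bullet> u s0)" using A' by simp
  have d: "((%s. u s \<bullet> u s) has_real_derivative (u s0 \<bullet> u' + u' \<bullet> u s0)) (at s0 within S)"
   using A' by (intro inner_has_real_derivative) auto
  have "norm (u s0) * norm u' <= 1 * L" using small_norm[of "u s0"] A' by (intro mult_mono) auto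
  then have "abs (u s0 \<bullet> u') <= L" using Cauchy_Schwarz_ineq2[of "u s0" u'] by simp
  then have "abs (2 * (u s0 \<bullet> u')) <= 2 * L" by (simp add: abs_mult)
  moreover have "abs \<rho>' <= L" using A' by simp
  ultimately have b: "abs \<rho>' + abs (u s0 \<bullet> u' + u' \<bullet> u s0) <= 3 * L" by (simp add: inner_commute[of u'])
  obtain D where D: "((%s. c (\<rho> s) (u s \<bullet> u s)) has_real_derivative D) (at s0 within S)" "abs D <= K * (abs \<rho>' + abs (u s0 \<bullet> u' + u' \<bullet> u s0))"
   using K(3)[of \<rho> s0 "%s. u s \<bullet> u s" \<rho>' S, OF R _ d] A' by blast
  have "abs D <= K * (3 * L) + K" "abs (c (\<rho> s0) (u s0 \<bullet> u s0)) <= K * (3 * L) + K"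
   using D(2) mult_left_mono[OF b K(1)] K(2)[OF R] K(1) mult_nonneg_nonneg[OF K(1), of "3 * L"] L by linarith+
  then show "\<exists>D. ((%s. fld (%\<eta> r a s. c r (a \<bullet> a)) (\<gamma> s)) has_real_derivative D) (at s0 within S) &
    abs (fld (%\<eta> r a s. c r (a \<bullet> a)) (\<gamma> s0)) <= K * (3 * L) + K & abs D <= (K * (3 * L) + K) * abs N"
   using D(1) by (auto simp: \<gamma>)
 qed (use K L in simp)
qed

text \<open>The factor lam has derivatives of size 1/(r + s), which is compensated by a coefficient that
vanishes like r.\<close>

lemma lam_tame:
 assumes "nice \<kappa> e c" "!!f. 0 <= f ==> f <= e ==> c 0 f = 0"
 shows "tame (state_curves :: (real set \<times> real \<times> (real => real \<times> real \<times> (real ^ 'd) \<times> real) \<times> real) set) (fld (%\<eta> r a s. lam \<eta> r s * c r (a \<bullet> a)))"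
proof (rule tameE[OF nice_tame[OF assms(1)]])
 fix C assume C: "0 <= C" "!!S s (\<gamma> :: real => real \<times> real \<times> (real ^ 'd) \<times> real) N. (S, s, \<gamma>, N) \<in> state_curves ==>
  \<exists>D. ((%s. fld (%\<eta> r a s. c r (a \<bullet> a)) (\<gamma> s)) has_real_derivative D) (at s within S) & abs (fld (%\<eta> r a s. c r (a \<bullet> a)) (\<gamma> s)) <= C & abs D <= C * abs N"
 obtain K where K: "K \<ge> 0" "\<forall>r f. in_range \<kappa> e r f --> abs (c r f) <= K * r" using vanishing_bound[OF assms] by blast
 show ?thesis
 proof (rule tameI[of "88 * L * K + C"])
  fix S s0 N and \<gamma> :: "real => real \<times> real \<times> (real ^ 'd) \<times> real" assume g: "(S, s0, \<gamma>, N) \<in> state_curves"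
  then obtain \<eta> \<rho> \<sigma> u v \<rho>' \<sigma>' u' v' where \<gamma>: "\<gamma> = (%s. (\<eta>, \<rho> s, u s, \<sigma> s))" "N = 1" and eps: "0 < \<eta>" and A: "admissible \<kappa> e L S s0 \<rho> \<sigma> u v \<rho>' \<sigma>' u' v'"
   unfolding state_curves_def by blast
  note A' = A[unfolded admissible_def]
  obtain l where l: "((%x. lam \<eta> (\<rho> x) (\<sigma> x)) has_real_derivative l) (at s0 within S)" "(\<rho> s0 + \<sigma> s0) * abs l <= 44 * (abs \<rho>' + abs \<sigma>')"
   using lam_deriv[OF eps, of \<rho> s0 \<sigma> \<rho>' S \<sigma>'] A' by blast
  obtain D where D: "((%s. c (\<rho> s) (u s \<bullet> u s)) has_real_derivative D) (at s0 within S)" "abs (c (\<rho> s0) (u s0 \<bullet> u s0)) <= C" "abs D <= C"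
   using C(2)[OF g] by (auto simp: \<gamma>)
  have c: "abs (c (\<rho> s0) (u s0 \<bullet> u s0)) <= K * \<rho> s0" using K(2) A' by simp
  have la: "abs (lam \<eta> (\<rho> s0) (\<sigma> s0)) <= 1" using lam_bounds[of "\<rho> s0" "\<sigma> s0" \<eta>] A' by auto
  have "abs (l * c (\<rho> s0) (u s0 \<bullet> u s0)) <= abs l * (K * \<rho> s0)" unfolding abs_mult using c by (intro mult_left_mono) auto
  also have "... <= K * ((\<rho> s0 + \<sigma> s0) * abs l)" using K(1) A' by (simp add: algebra_simps)
  also have "... <= K * (44 * (2 * L))" using l(2) A' K(1) by (intro mult_left_mono) auto
  finally have 1: "abs (l * c (\<rho> s0) (u s0 \<bullet> u s0)) <= 88 * L * K" by (simp add: mult_ac)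
  have 2: "abs (D * lam \<eta> (\<rho> s0) (\<sigma> s0)) <= C * 1" by (rule abs_mult_le[OF D(3) la])
  have 3: "abs (lam \<eta> (\<rho> s0) (\<sigma> s0) * c (\<rho> s0) (u s0 \<bullet> u s0)) <= 1 * C" by (rule abs_mult_le[OF la D(2)])
  have LK: "0 <= 88 * L * K" using L K(1) by simp
  have "abs (l * c (\<rho> s0) (u s0 \<bullet> u s0) + D * lam \<eta> (\<rho> s0) (\<sigma> s0)) <= 88 * L * K + C" "abs (lam \<eta> (\<rho> s0) (\<sigma> s0) * c (\<rho> s0) (u s0 \<bullet> u s0)) <= 88 * L * K + C"
   using 1 2 3 LK by linarith+
  then show "\<exists>D. ((%s. fld (%\<eta> r a s. lam \<eta> r s * c r (a \<bullet> a)) (\<gamma> s)) has_real_derivative D) (at s0 within S) &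
    abs (fld (%\<eta> r a s. lam \<eta> r s * c r (a \<bullet> a)) (\<gamma> s0)) <= 88 * L * K + C & abs D <= (88 * L * K + C) * abs N"
   using DERIV_mult[OF l(1) D(1)] by (auto simp: \<gamma>)
 qed (use L K C in auto)
qed

definition fields :: "(real => real => real ^ 'd => real => real) set" where
 "fields = {fal \<kappa>, fbe \<kappa>, fth \<kappa>, fxi \<kappa>, fza \<kappa>, fzb \<kappa>}"

lemma fields_tame: assumes "F \<in> fields" shows "tame state_curves (fld F)"
proof -
 note cf = \<kappa> e
 have al: "tame state_curves (fld (fal \<kappa>))" unfolding fal_def
  by (rule lam_tame[of "%r f. sc_g \<kappa> r f / \<kappa> - 1"], intro nice_diff nice_divide[where l=\<kappa>] nice_const nice_g[OF cf]) (use \<kappa> in \<open>auto simp: at_vacuum[OF cf]\<close>)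
 have be: "tame state_curves (fld (fbe \<kappa>))" unfolding fbe_def
  by (rule lam_tame[of "%r f. sc_h \<kappa> r f / \<kappa>"], intro nice_divide[where l=\<kappa>] nice_const nice_h[OF cf]) (use \<kappa> in \<open>auto simp: at_vacuum[OF cf]\<close>)
 have th: "tame state_curves (fld (fth \<kappa>))" unfolding fth_def by (rule lam_tame[OF nice_t[OF cf]]) (auto simp: at_vacuum[OF cf])
 have xi: "tame state_curves (fld (fxi \<kappa>))" unfolding fxi_def by (rule lam_tame[OF nice_s[OF cf]]) (auto simp: at_vacuum[OF cf])
 have ae: "nice \<kappa> e (%r f. 1 / (1 - f))" by (rule nice_divide[where l="1 - e"]) (use e in \<open>auto intro!: nice_const nice_diff nice_snd\<close>)
 have za: "tame state_curves (fld (fza \<kappa>))" unfolding fza_def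
  by (intro tame_mult tame_add tame_const al nice_tame[OF nice_inv_eta[OF cf]])
 have zb: "tame state_curves (fld (fzb \<kappa>))" unfolding fzb_def
  by (intro tame_mult tame_add tame_const al be nice_tame[OF nice_inv_eta[OF cf]] nice_tame[OF ae])
 show ?thesis using assms al be th xi za zb unfolding fields_def by auto
qed

lemma field_derivs:
 "\<exists>C\<ge>0. \<forall>\<eta> S s0 \<rho> \<sigma> (u :: real => real ^ 'd) v \<rho>' \<sigma>' u' v'. 0 < \<eta> & admissible \<kappa> e L S s0 \<rho> \<sigma> u v \<rho>' \<sigma>' u' v' -->
  (\<forall>F\<in>fields. abs (F \<eta> (\<rho> s0) (u s0) (\<sigma> s0)) <= C & (\<exists>D. ((%s. F \<eta> (\<rho> s) (u s) (\<sigma> s)) has_real_derivative D) (at s0 within S) & abs D <= C))"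
proof -
 define ok where "ok F C \<longleftrightarrow> 0 <= C & (\<forall>\<eta> S s0 \<rho> \<sigma> (u :: real => real ^ 'd) v \<rho>' \<sigma>' u' v'. 0 < \<eta> & admissible \<kappa> e L S s0 \<rho> \<sigma> u v \<rho>' \<sigma>' u' v' -->
  abs (F \<eta> (\<rho> s0) (u s0) (\<sigma> s0)) <= C & (\<exists>D. ((%s. F \<eta> (\<rho> s) (u s) (\<sigma> s)) has_real_derivative D) (at s0 within S) & abs D <= C))"
  for F :: "real => real => real ^ 'd => real => real" and C
 have "\<exists>C. ok F C" if F: "F \<in> fields" for F
 proof (rule tameE[OF fields_tame[OF F]])
  fix C assume C: "0 <= C" "!!S s (\<gamma> :: real => real \<times> real \<times> (real ^ 'd) \<times> real) N. (S, s, \<gamma>, N) \<in> state_curves ==>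
   \<exists>D. ((%s. fld F (\<gamma> s)) has_real_derivative D) (at s within S) & abs (fld F (\<gamma> s)) <= C & abs D <= C * abs N"
  have "ok F C" unfolding ok_def
  proof (intro conjI allI impI C(1); elim conjE)
   fix \<eta> s0 :: real and S and \<rho> \<sigma> :: "real => real" and u v :: "real => real ^ 'd" and \<rho>' \<sigma>' u' v'
   assume A: "0 < \<eta>" "admissible \<kappa> e L S s0 \<rho> \<sigma> u v \<rho>' \<sigma>' u' v'"
   have "(S, s0, %s. (\<eta>, \<rho> s, u s, \<sigma> s), 1) \<in> state_curves" unfolding state_curves_def using A by blast
   from C(2)[OF this] show "abs (F \<eta> (\<rho> s0) (u s0) (\<sigma> s0)) <= C" "\<exists>D. ((%s. F \<eta> (\<rho> s) (u s) (\<sigma> s)) has_real_derivative D) (at s0 within S) & abs D <= C" by auto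
  qed
  then show ?thesis ..
 qed
 then obtain c where c: "!!F. F \<in> fields ==> ok F (c F)" by metis
 define C where "C = (\<Sum>F\<in>fields. c F)"
 have fin: "finite (fields :: (real => real => real ^ 'd => real => real) set)" by (simp add: fields_def)
 have c0: "0 <= c F" if "F \<in> fields" for F using c[OF that] by (simp add: ok_def)
 have C: "0 <= C" "!!F. F \<in> fields ==> c F <= C" using c0 fin by (auto simp: C_def intro!: sum_nonneg member_le_sum)
 have "ok F C" if "F \<in> fields" for F
  unfolding ok_def using c[OF that, unfolded ok_def] C(1) order_trans[OF _ C(2)[OF that]] by blast
 then show ?thesis using C(1) unfolding ok_def by (intro exI[of _ C]) blast
qed

text \<open>Leading terms are kept exactly; the derivatives of the coefficients are collected in remainders,
whose sizes are all that matters later.\<close>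

lemma energy_flux_derivs:
 "\<exists>C\<ge>0. \<forall>\<eta> S s0 \<rho> \<sigma> (u :: real => real ^ 'd) v \<rho>' \<sigma>' u' v'. 0 < \<eta> & admissible \<kappa> e L S s0 \<rho> \<sigma> u v \<rho>' \<sigma>' u' v' -->
  (\<exists>RQ Ra Rc Rs. abs RQ <= C * (norm (u s0 - v s0))\<^sup>2 & (\<forall>j. abs (Ra j) <= C & abs (Rc j) <= C * norm (u s0 - v s0) & abs (Rs j) <= C) &
   ((%s. energy \<kappa> m \<eta> (\<rho> s) (u s) (\<sigma> s) (v s)) has_real_derivative energy_rate \<kappa> m \<eta> (\<rho> s0) (u s0) (\<sigma> s0) (v s0) \<rho>' \<sigma>' (u' - v') RQ) (at s0 within S) &
   (\<forall>j. ((%s. flux \<kappa> m \<eta> (\<rho> s) (u s) (\<sigma> s) (v s) j) has_real_derivative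
    flux_rate \<kappa> m \<eta> (\<rho> s0) (u s0) (\<sigma> s0) (v s0) j \<rho>' \<sigma>' (u' - v') RQ (Ra j) (Rc j) (Rs j)) (at s0 within S)))"
proof -
 obtain C where C0: "C \<ge> 0" and C: "\<forall>\<eta> S s0 \<rho> \<sigma> (u :: real => real ^ 'd) v \<rho>' \<sigma>' u' v'. 0 < \<eta> & admissible \<kappa> e L S s0 \<rho> \<sigma> u v \<rho>' \<sigma>' u' v' -->
  (\<forall>F\<in>fields. abs (F \<eta> (\<rho> s0) (u s0) (\<sigma> s0)) <= C & (\<exists>D. ((%s. F \<eta> (\<rho> s) (u s) (\<sigma> s)) has_real_derivative D) (at s0 within S) & abs D <= C))"
  using field_derivs by blast
 define H where "H = 2 * C + 2 * C * L + L + 2 * C + 2 * C * L"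
 show ?thesis
 proof (rule exI[of _ H], intro conjI allI impI)
  show "0 <= H" using C0 L by (simp add: H_def)
  fix \<eta> s0 :: real and S and \<rho> \<sigma> :: "real => real" and u v :: "real => real ^ 'd" and \<rho>' \<sigma>' u' v'
  assume A0: "0 < \<eta> & admissible \<kappa> e L S s0 \<rho> \<sigma> u v \<rho>' \<sigma>' u' v'"
  then have eps: "0 < \<eta>" and A: "admissible \<kappa> e L S s0 \<rho> \<sigma> u v \<rho>' \<sigma>' u' v'" by auto
  note A' = A[unfolded admissible_def]
  note CA = C[rule_format, OF A0]
  define al be th xi za zb where "al s = fal \<kappa> \<eta> (\<rho> s) (u s) (\<sigma> s)" and "be s = fbe \<kappa> \<eta> (\<rho> s) (u s) (\<sigma> s)"
   and "th s = fth \<kappa> \<eta> (\<rho> s) (u s) (\<sigma> s)" and "xi s = fxi \<kappa> \<eta> (\<rho> s) (u s) (\<sigma> s)"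
   and "za s = fza \<kappa> \<eta> (\<rho> s) (u s) (\<sigma> s)" and "zb s = fzb \<kappa> \<eta> (\<rho> s) (u s) (\<sigma> s)" for s
  note fd = al_def be_def th_def xi_def za_def zb_def
  note FC = CA[rule_format, unfolded fields_def]
  have bd: "abs (al s0) <= C" "abs (be s0) <= C" "abs (th s0) <= C" "abs (xi s0) <= C" "abs (za s0) <= C" "abs (zb s0) <= C"
   unfolding fd by (simp_all add: FC)
  have der: "\<exists>D. (F has_real_derivative D) (at s0 within S) & abs D <= C" if "F \<in> {al, be, th, xi, za, zb}" for F
   using that CA unfolding fd[abs_def] fields_def by auto
  obtain al' be' th' xi' za' zb' where al: "(al has_real_derivative al') (at s0 within S)" "abs al' <= C"
   and be: "(be has_real_derivative be') (at s0 within S)" "abs be' <= C" and th: "(th has_real_derivative th') (at s0 within S)" "abs th' <= C"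
   and xi: "(xi has_real_derivative xi') (at s0 within S)" "abs xi' <= C" and za: "(za has_real_derivative za') (at s0 within S)" "abs za' <= C"
   and zb: "(zb has_real_derivative zb') (at s0 within S)" "abs zb' <= C"
   using der[of al] der[of be] der[of th] der[of xi] der[of za] der[of zb] by blast
  define w where "w s = u s - v s" for s
  define w' where "w' = u' - v'"
  have ud: "(u has_vector_derivative u') (at s0 within S)" and vd: "(v has_vector_derivative v') (at s0 within S)" using A' by auto
  have wd: "(w has_vector_derivative w') (at s0 within S)" unfolding w_def w'_def by (intro has_vector_derivative_diff ud vd)
  note uw = inner_has_real_derivative[OF ud wd] and ww = inner_has_real_derivative[OF wd wd]
  note uj = nth_has_real_derivative[OF ud] and vj = nth_has_real_derivative[OF vd] and wj = nth_has_real_derivative[OF wd]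
  define N where "N = norm (w s0)"
  have n1: "norm (u s0) <= 1" "norm (v s0) <= 1" using small_norm A' by auto
  have cs: "abs (u s0 \<bullet> w s0) <= N" using Cauchy_Schwarz_ineq2[of "u s0" "w s0"] mult_right_mono[OF n1(1), of N] by (simp add: N_def)
  have cs2: "abs (u' \<bullet> w s0) <= L * N" using Cauchy_Schwarz_ineq2[of u' "w s0"] mult_right_mono[of "norm u'" L N] A' by (simp add: N_def)
  have uj1: "abs (u s0 $ j) <= 1" "abs (u' $ j) <= L" "abs (v' $ j) <= L" "abs (w s0 $ j) <= N" for j
   using component_le_norm_cart[of "u s0" j] component_le_norm_cart[of u' j] component_le_norm_cart[of v' j] component_le_norm_cart[of "w s0" j] n1 A'
   by (auto simp: N_def)
  have N0: "0 <= N" by (simp add: N_def)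
  define RQ where "RQ = za' * (w s0 \<bullet> w s0) + zb' * (u s0 \<bullet> w s0)\<^sup>2 + 2 * zb s0 * (u s0 \<bullet> w s0) * (u' \<bullet> w s0)"
  define Ra where "Ra j = (u' $ j + v' $ j) / 2 + th' * u s0 $ j + th s0 * u' $ j" for j
  define Rs where "Rs j = (u' $ j + v' $ j) / 2 + xi' * u s0 $ j + xi s0 * u' $ j" for j
  define Rc where "Rc j = al' * w s0 $ j + be' * (u s0 \<bullet> w s0) * u s0 $ j + be s0 * (u' \<bullet> w s0) * u s0 $ j + be s0 * (u s0 \<bullet> w s0) * u' $ j" for j
  have ww2: "w s0 \<bullet> w s0 = N\<^sup>2" by (simp add: N_def power2_norm_eq_inner)
  have cs_sq: "abs ((u s0 \<bullet> w s0)\<^sup>2) <= N\<^sup>2" using cs by (simp add: abs_le_square_iff[symmetric])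
  have bRQ: "abs RQ <= H * N\<^sup>2"
  proof -
   have "abs (za' * (w s0 \<bullet> w s0)) <= C * N\<^sup>2" unfolding ww2 by (rule abs_mult_le[OF za(2)]) simp
   moreover have "abs (zb' * (u s0 \<bullet> w s0)\<^sup>2) <= C * N\<^sup>2" by (rule abs_mult_le[OF zb(2) cs_sq])
   moreover have "abs (2 * zb s0 * (u s0 \<bullet> w s0) * (u' \<bullet> w s0)) <= ((2 * C) * N) * (L * N)"
    using bd(6) by (intro abs_mult_le cs cs2) (auto simp: abs_mult)
   ultimately have "abs RQ <= C * N\<^sup>2 + C * N\<^sup>2 + ((2 * C) * N) * (L * N)" unfolding RQ_def by linarith
   also have "... = (2 * C + 2 * C * L) * N\<^sup>2" by (simp add: power2_eq_square algebra_simps)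
   also have "... <= H * N\<^sup>2" unfolding H_def using C0 L by (intro mult_right_mono) auto
   finally show ?thesis .
  qed
  have half: "abs ((u' $ j + v' $ j) / 2) <= L" for j using uj1(2,3)[of j] by (simp add: abs_le_iff)
  have bRa: "abs (Ra j) <= H" for j
  proof -
   have "abs (th' * u s0 $ j) <= C * 1" "abs (th s0 * u' $ j) <= C * L" by (rule abs_mult_le[OF th(2) uj1(1)], rule abs_mult_le[OF bd(3) uj1(2)])
   then have "abs (Ra j) <= L + C * 1 + C * L" using half[of j] unfolding Ra_def by linarith
   also have "... <= H" unfolding H_def using C0 L by auto
   finally show ?thesis .
  qed
  have bRs: "abs (Rs j) <= H" for j
  proof -
   have "abs (xi' * u s0 $ j) <= C * 1" "abs (xi s0 * u' $ j) <= C * L" by (rule abs_mult_le[OF xi(2) uj1(1)], rule abs_mult_le[OF bd(4) uj1(2)])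
   then have "abs (Rs j) <= L + C * 1 + C * L" using half[of j] unfolding Rs_def by linarith
   also have "... <= H" unfolding H_def using C0 L by auto
   finally show ?thesis .
  qed
  have bRc: "abs (Rc j) <= H * N" for j
  proof -
   have "abs (al' * w s0 $ j) <= C * N" by (rule abs_mult_le[OF al(2) uj1(4)])
   moreover have "abs (be' * (u s0 \<bullet> w s0) * u s0 $ j) <= (C * N) * 1" by (intro abs_mult_le be(2) cs uj1(1))
   moreover have "abs (be s0 * (u' \<bullet> w s0) * u s0 $ j) <= (C * (L * N)) * 1" by (intro abs_mult_le bd(2) cs2 uj1(1))
   moreover have "abs (be s0 * (u s0 \<bullet> w s0) * u' $ j) <= (C * N) * L" by (intro abs_mult_le bd(2) cs uj1(2))
   ultimately have "abs (Rc j) <= C * N + (C * N) * 1 + (C * (L * N)) * 1 + (C * N) * L" unfolding Rc_def by linarith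
   also have "... = (2 * C + 2 * C * L) * N" by (simp add: algebra_simps)
   also have "... <= H * N" unfolding H_def using C0 L N0 by (intro mult_right_mono) auto
   finally show ?thesis .
  qed
  define f g where "f = prof m \<eta>" and "g = prim m \<eta>"
  have fr: "((%s. f (\<rho> s)) has_real_derivative dprof m \<eta> (\<rho> s0) * \<rho>') (at s0 within S)" "((%s. f (\<sigma> s)) has_real_derivative dprof m \<eta> (\<sigma> s0) * \<sigma>') (at s0 within S)"
   unfolding f_def using A' by (auto intro!: DERIV_chain2[OF prof_deriv[OF eps]])
  have gr: "((%s. g (\<rho> s)) has_real_derivative f (\<rho> s0) * \<rho>') (at s0 within S)" "((%s. g (\<sigma> s)) has_real_derivative f (\<sigma> s0) * \<sigma>') (at s0 within S)"
   unfolding f_def g_def using A' by (auto intro!: DERIV_chain2[OF prim_deriv[OF eps]])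
  have AAd: "((%s. AA m \<eta> (\<rho> s) (\<sigma> s)) has_real_derivative AD m \<eta> (\<rho> s0) (\<sigma> s0) * \<rho>' + AD m \<eta> (\<sigma> s0) (\<rho> s0) * \<sigma>') (at s0 within S)"
   unfolding AA_def f_def[symmetric] g_def[symmetric]
   by (rule DERIV_cong[OF DERIV_mult[OF DERIV_diff[OF fr] DERIV_diff[OF gr]]]) (simp add: AD_def f_def g_def algebra_simps)
  have MMd: "((%s. MM m \<eta> (\<rho> s) (\<sigma> s)) has_real_derivative (AD m \<eta> (\<rho> s0) (\<sigma> s0) / 2 + f (\<rho> s0) * f (\<sigma> s0)) * \<rho>'
     + (- AD m \<eta> (\<sigma> s0) (\<rho> s0) / 2 - f (\<rho> s0) * f (\<sigma> s0)) * \<sigma>') (at s0 within S)"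
   unfolding MM_def f_def[symmetric] g_def[symmetric]
   by (rule DERIV_cong[OF DERIV_cdivide[OF DERIV_mult[OF DERIV_add[OF fr] DERIV_diff[OF gr]], of 2]]) (simp add: AD_def f_def g_def field_simps)
  have ffd: "((%s. f (\<rho> s) * f (\<sigma> s)) has_real_derivative (dprof m \<eta> (\<rho> s0) * f (\<sigma> s0)) * \<rho>' + (f (\<rho> s0) * dprof m \<eta> (\<sigma> s0)) * \<sigma>') (at s0 within S)"
   by (rule DERIV_cong[OF DERIV_mult[OF fr]]) (simp add: algebra_simps)
  have zz: "fz \<kappa> \<eta> (\<rho> s0) (u s0) (\<sigma> s0) (v s0) = za s0 *\<^sub>R w s0 + (zb s0 * (u s0 \<bullet> w s0)) *\<^sub>R u s0"
   by (simp add: fz_def za_def zb_def w_def)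
  have Qe: "fQ \<kappa> \<eta> (\<rho> s) (u s) (\<sigma> s) (v s) = za s * (w s \<bullet> w s) + zb s * (u s \<bullet> w s)\<^sup>2" for s
   by (simp add: fQ_def za_def zb_def w_def)
  have Qd: "((%s. fQ \<kappa> \<eta> (\<rho> s) (u s) (\<sigma> s) (v s)) has_real_derivative 2 * (fz \<kappa> \<eta> (\<rho> s0) (u s0) (\<sigma> s0) (v s0) \<bullet> w') + RQ) (at s0 within S)"
   unfolding Qe
   by (rule DERIV_cong[OF DERIV_add[OF DERIV_mult[OF za(1) ww] DERIV_mult[OF zb(1) DERIV_power[OF uw, of 2]]]])
    (simp add: zz RQ_def inner_add_left inner_commute algebra_simps power2_eq_square)
  have ce: "fc \<kappa> \<eta> (\<rho> s) (u s) (\<sigma> s) (v s) $ j = (1 + al s) * w s $ j + (be s * (u s \<bullet> w s)) * u s $ j" for s j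
   by (simp add: fc_def al_def be_def w_def)
  have cd: "((%s. fc \<kappa> \<eta> (\<rho> s) (u s) (\<sigma> s) (v s) $ j) has_real_derivative (1 + al s0) * w' $ j + be s0 * (u s0 \<bullet> w') * u s0 $ j + Rc j) (at s0 within S)" for j
   unfolding ce
   by (rule DERIV_cong[OF DERIV_add[OF DERIV_mult[OF DERIV_add[OF DERIV_const[of 1] al(1)] wj] DERIV_mult[OF DERIV_mult[OF be(1) uw] uj]]])
    (simp add: Rc_def algebra_simps)
  have Ud: "((%s. ((1 / 2) *\<^sub>R (u s + v s)) $ j + th s * u s $ j) has_real_derivative Ra j) (at s0 within S)" for j
   using DERIV_add[OF DERIV_cdivide[OF DERIV_add[OF uj[of j] vj[of j]], of 2] DERIV_mult[OF th(1) uj[of j]]]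
   by (simp add: Ra_def algebra_simps add_divide_distrib)
  have Vd: "((%s. ((1 / 2) *\<^sub>R (u s + v s)) $ j + xi s * u s $ j) has_real_derivative Rs j) (at s0 within S)" for j
   using DERIV_add[OF DERIV_cdivide[OF DERIV_add[OF uj[of j] vj[of j]], of 2] DERIV_mult[OF xi(1) uj[of j]]]
   by (simp add: Rs_def algebra_simps add_divide_distrib)
  have hf: "((%s. (1 / 2) * (f (\<rho> s) * f (\<sigma> s))) has_real_derivative (1 / 2) * ((dprof m \<eta> (\<rho> s0) * f (\<sigma> s0)) * \<rho>' + (f (\<rho> s0) * dprof m \<eta> (\<sigma> s0)) * \<sigma>')) (at s0 within S)"
   by (rule DERIV_cmult[OF ffd])
  have Ed: "((%s. energy \<kappa> m \<eta> (\<rho> s) (u s) (\<sigma> s) (v s)) has_real_derivative energy_rate \<kappa> m \<eta> (\<rho> s0) (u s0) (\<sigma> s0) (v s0) \<rho>' \<sigma>' w' RQ) (at s0 within S)"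
   unfolding energy_rate_def
   unfolding energy_def f_def[symmetric]
   by (rule DERIV_cong[OF DERIV_add[OF AAd DERIV_mult[OF hf Qd]]]) (simp add: add.assoc mult.commute)
  have Fd: "((%s. flux \<kappa> m \<eta> (\<rho> s) (u s) (\<sigma> s) (v s) j) has_real_derivative
    flux_rate \<kappa> m \<eta> (\<rho> s0) (u s0) (\<sigma> s0) (v s0) j \<rho>' \<sigma>' w' RQ (Ra j) (Rc j) (Rs j)) (at s0 within S)" for j
   unfolding flux_rate_def al_def[symmetric] be_def[symmetric]
   unfolding flux_def f_def[symmetric] th_def[symmetric] xi_def[symmetric]
  proof (rule DERIV_cong[OF DERIV_add[OF DERIV_add[OF DERIV_mult[OF Ud AAd] DERIV_mult[OF MMd cd]] DERIV_mult[OF DERIV_mult[OF hf Qd] Vd]]], goal_cases)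
   case 1
   have eq: "Ra * AAx + AAx' * U + (MM' * c + c' * M) + ((h' * Q + Q' * h) * V + Rs * (h * Q))
    = U * AAx' + AAx * Ra + MM' * c + M * c' + h' * Q * V + h * Q' * V + h * Q * Rs"
    for Ra AAx AAx' U MM' c c' M h' Q Q' h V Rs :: real by (simp add: algebra_simps)
   show ?case by (rule eq)
  qed
  show "\<exists>RQ Ra Rc Rs. abs RQ <= H * (norm (u s0 - v s0))\<^sup>2 & (\<forall>j. abs (Ra j) <= H & abs (Rc j) <= H * norm (u s0 - v s0) & abs (Rs j) <= H) &
   ((%s. energy \<kappa> m \<eta> (\<rho> s) (u s) (\<sigma> s) (v s)) has_real_derivative energy_rate \<kappa> m \<eta> (\<rho> s0) (u s0) (\<sigma> s0) (v s0) \<rho>' \<sigma>' (u' - v') RQ) (at s0 within S) &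
   (\<forall>j. ((%s. flux \<kappa> m \<eta> (\<rho> s) (u s) (\<sigma> s) (v s) j) has_real_derivative
    flux_rate \<kappa> m \<eta> (\<rho> s0) (u s0) (\<sigma> s0) (v s0) j \<rho>' \<sigma>' (u' - v') RQ (Ra j) (Rc j) (Rs j)) (at s0 within S))"
   using bRQ bRa bRc bRs Ed Fd unfolding N_def w_def w'_def
   by (intro exI[of _ RQ] exI[of _ Ra] exI[of _ Rc] exI[of _ Rs]) blast
 qed
qed

end

section \<open>The energy method on a cone\<close>

text \<open>The energy balance at a point, as an inequality: B bounds the production, and M is a bound for the
derivatives that serves only to justify the integrations. The derivatives may depend on the point in
any way.\<close>

definition balance_law :: "real => real => (real => real ^ 'd => real) => (real => 'd => real ^ 'd => real) => real => real => real => real ^ 'd => bool" where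
 "balance_law t0 t1 E F M B t x \<longleftrightarrow> (\<exists>e' f'. ((%s. E s x) has_real_derivative e') (at t within {t0..t1}) &
  (\<forall>j. ((%s. F t j (x + s *\<^sub>R axis j 1)) has_real_derivative f' j) (at 0)) &
  abs e' <= M & (\<forall>j. abs (f' j) <= M) & e' + (\<Sum>j\<in>UNIV. f' j) <= B)"

lemma balance_law_mono: "balance_law t0 t1 E F M B t x ==> M <= M' ==> B <= B' ==> balance_law t0 t1 E F M' B' t x"
 unfolding balance_law_def by (meson order_trans)

text \<open>A continuously differentiable weight supported in a backward cone of slope K; the smooth function
sqrt (1 + |x|^2) replaces the norm.\<close>

definition cone_weight :: "real => real => real => real => 'a::euclidean_space => real" where
 "cone_weight K R t0 t x = pos2 (R - K * (t - t0) - sqrt (1 + x \<bullet> x))"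
definition cone_slope :: "real => real => real => real => 'a::euclidean_space => real" where
 "cone_slope K R t0 t x = 2 * max 0 (R - K * (t - t0) - sqrt (1 + x \<bullet> x))"

lemma cone_time_deriv:
 "((%t. cone_weight K R t0 t x) has_real_derivative - K * cone_slope K R t0 t x) (at t within S)"
proof -
 have "((%t. R - K * (t - t0) - sqrt (1 + x \<bullet> x)) has_real_derivative - K) (at t within S)"
  by (auto intro!: derivative_eq_intros)
 from DERIV_chain2[OF pos2_deriv this] show ?thesis by (simp add: cone_weight_def[abs_def] cone_slope_def mult_ac)
qed

lemma cone_space_deriv:
 "((%\<sigma>. cone_weight K R t0 t (x + \<sigma> *\<^sub>R e)) has_real_derivative
  - cone_slope K R t0 t x * ((x \<bullet> e) / sqrt (1 + x \<bullet> x))) (at 0)"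
proof -
 have p: "0 < 1 + x \<bullet> x" by (simp add: add_pos_nonneg)
 have ex: "1 + (x + \<sigma> *\<^sub>R e) \<bullet> (x + \<sigma> *\<^sub>R e) = 1 + (x \<bullet> x) + 2 * (x \<bullet> e) * \<sigma> + (e \<bullet> e) * \<sigma>\<^sup>2" for \<sigma>
  by (simp add: inner_add_left inner_add_right inner_commute power2_eq_square algebra_simps)
 have q: "((%\<sigma>. 1 + (x + \<sigma> *\<^sub>R e) \<bullet> (x + \<sigma> *\<^sub>R e)) has_real_derivative 2 * (x \<bullet> e)) (at 0)"
  unfolding ex by (auto intro!: derivative_eq_intros)
 have sq: "((%\<sigma>. sqrt (1 + (x + \<sigma> *\<^sub>R e) \<bullet> (x + \<sigma> *\<^sub>R e))) has_real_derivative (x \<bullet> e) / sqrt (1 + x \<bullet> x)) (at 0)"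
 proof (rule DERIV_cong[OF DERIV_chain2[OF DERIV_real_sqrt q]])
  show "0 < 1 + (x + 0 *\<^sub>R e) \<bullet> (x + 0 *\<^sub>R e)" using p by simp
  show "inverse (sqrt (1 + (x + 0 *\<^sub>R e) \<bullet> (x + 0 *\<^sub>R e))) / 2 * (2 * (x \<bullet> e)) = (x \<bullet> e) / sqrt (1 + x \<bullet> x)"
   using p by (simp add: field_simps)
 qed
 have "((%\<sigma>. R - K * (t - t0) - sqrt (1 + (x + \<sigma> *\<^sub>R e) \<bullet> (x + \<sigma> *\<^sub>R e))) has_real_derivative 0 - ((x \<bullet> e) / sqrt (1 + x \<bullet> x))) (at 0)"
  by (intro DERIV_diff[OF DERIV_const] sq)
 from DERIV_chain2[OF pos2_deriv this] show ?thesis by (simp add: cone_weight_def[abs_def] cone_slope_def)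
qed

lemma sqrt_ge_norm: "norm x <= sqrt (1 + x \<bullet> x)"
 unfolding norm_eq_sqrt_inner by (rule real_sqrt_le_mono) simp

lemma cone_direction: "norm e = 1 ==> abs ((x \<bullet> e) / sqrt (1 + x \<bullet> x)) <= 1"
proof -
 assume e: "norm e = 1"
 have p: "0 < sqrt (1 + x \<bullet> x)" by (simp add: add_pos_nonneg)
 have "abs (x \<bullet> e) <= sqrt (1 + x \<bullet> x)" using Cauchy_Schwarz_ineq2[of x e] e sqrt_ge_norm[of x] by simp
 then show ?thesis using p by (simp add: abs_divide)
qed

lemma cone_bounds:
 assumes "0 <= K" "0 <= R" "t0 <= t"
 shows "0 <= cone_weight K R t0 t x" "cone_weight K R t0 t x <= R\<^sup>2" "0 <= cone_slope K R t0 t x" "cone_slope K R t0 t x <= 2 * R"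
  "R < norm x ==> cone_weight K R t0 t x = 0" "R < norm x ==> cone_slope K R t0 t x = 0"
proof -
 define u where "u = R - K * (t - t0) - sqrt (1 + x \<bullet> x)"
 have u: "u <= R - norm x" using assms sqrt_ge_norm[of x] mult_nonneg_nonneg[of K "t - t0"] unfolding u_def by linarith
 then have mu: "max 0 u <= R" using assms norm_ge_zero[of x] by linarith
 show "0 <= cone_weight K R t0 t x" "0 <= cone_slope K R t0 t x" by (auto simp: cone_weight_def cone_slope_def pos2_nonneg)
 show "cone_weight K R t0 t x <= R\<^sup>2" unfolding cone_weight_def u_def[symmetric] pos2_def by (rule power_mono[OF mu]) simp
 show "cone_slope K R t0 t x <= 2 * R" unfolding cone_slope_def u_def[symmetric] using mu by simp
 show "R < norm x ==> cone_weight K R t0 t x = 0" "R < norm x ==> cone_slope K R t0 t x = 0"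
  using u unfolding cone_weight_def cone_slope_def u_def[symmetric] by (auto simp: pos2_eq_0)
qed

lemma cone_weight_meas: "cone_weight K R t0 t \<in> borel_measurable lborel"
 unfolding cone_weight_def[abs_def] pos2_def by simp

text \<open>The flux is bounded by a multiple of the energy, so on a sufficiently steep cone the decrease of the
weight in time pays for the flux through its sides. What remains is Gronwall's inequality.\<close>

lemma energy_estimate:
 fixes E Et D :: "real => real ^ 'd => real" and Fl Fl' :: "real => 'd => real ^ 'd => real"
 assumes t01: "t0 < t1" and C: "0 <= C" and \<delta>: "0 <= \<delta>" and R: "0 <= R"
  and mE: "!!s. s \<in> {t0..t1} ==> E s \<in> borel_measurable lborel"
  and mF: "!!s j. s \<in> {t0..t1} ==> Fl s j \<in> borel_measurable lborel"
  and dE: "!!s x. s \<in> {t0..t1} ==> ((%s. E s x) has_real_derivative Et s x) (at s within {t0..t1})"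
  and dF: "!!s x j. s \<in> {t0..t1} ==> ((%\<sigma>. Fl s j (x + \<sigma> *\<^sub>R axis j 1)) has_real_derivative Fl' s j x) (at 0)"
  and bd: "!!s x. s \<in> {t0..t1} ==> abs (E s x) <= M" "!!s x. s \<in> {t0..t1} ==> abs (Et s x) <= M"
   "!!s j x. s \<in> {t0..t1} ==> abs (Fl s j x) <= M" "!!s j x. s \<in> {t0..t1} ==> abs (Fl' s j x) <= M"
  and coerc: "!!s x. s \<in> {t0..t1} ==> 0 <= D s x & D s x <= C * (E s x + \<delta>)"
  and flb: "!!s j x. s \<in> {t0..t1} ==> abs (Fl s j x) <= C * D s x"
  and law: "!!s x. s \<in> {t0..t1} ==> Et s x + (\<Sum>j\<in>UNIV. Fl' s j x) <= C * (D s x + \<delta>)"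
  and init: "!!x. E t0 x = 0"
  and s: "s \<in> {t0..t1}"
 defines "K \<equiv> real CARD('d) * C\<^sup>2"
 shows "(\<integral>x. cone_weight K R t0 s x * E s x \<partial>lborel)
  <= \<delta> * ((K * (2 * R) + (C\<^sup>2 + C) * R\<^sup>2) * measure lborel (cball 0 R :: (real ^ 'd) set)) * (s - t0) * exp (C\<^sup>2 * (s - t0))"
  and "integrable lborel (%x. cone_weight K R t0 s x * E s x)"
proof -
 have K: "0 <= K" by (simp add: K_def)
 have M: "0 <= M" using bd(1)[OF s, of undefined] by linarith
 define \<psi> where "\<psi> s x = cone_weight K R t0 s x" for s and x :: "real ^ 'd"
 define \<theta> where "\<theta> s x = cone_slope K R t0 s x" for s and x :: "real ^ 'd"
 define dir where "dir j x = (x \<bullet> axis j 1) / sqrt (1 + x \<bullet> x)" for j and x :: "real ^ 'd"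
 have dir1: "abs (dir j x) <= 1" for j x unfolding dir_def by (rule cone_direction) simp
 note B = cone_bounds[OF K R, where ?t0.0=t0 and 'a="real ^ 'd", folded \<psi>_def \<theta>_def]
 define Z where "Z = K * (2 * R) + (C\<^sup>2 + C) * R\<^sup>2"
 have Z: "0 <= Z" using K R C by (simp add: Z_def)
 define h where "h s x = \<psi> s x * E s x" for s x
 define h' where "h' s x = - K * \<theta> s x * E s x + Et s x * \<psi> s x" for s x
 define F' where "F' s j x = - \<theta> s x * dir j x * Fl s j x + Fl' s j x * \<psi> s x" for s j x
 define Kb where "Kb = R\<^sup>2 * M + K * (2 * R) * M + 2 * R * M"
 have psi: "abs (\<psi> s x) <= R\<^sup>2" "abs (\<theta> s x) <= 2 * R" if "s \<in> {t0..t1}" for s x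
  using B(1-4)[of s x] that by auto
 have nn: "0 <= R\<^sup>2 * M" "0 <= K * (2 * R) * M" "0 <= 2 * R * M" using M R K by auto
 have bh: "abs (h s x) <= Kb" if "s \<in> {t0..t1}" for s x
  using abs_mult_le[OF psi(1)[OF that, of x] bd(1)[OF that, of x]] nn unfolding h_def Kb_def by linarith
 have Kc: "abs (- K * \<theta> s x) <= K * (2 * R)" if "s \<in> {t0..t1}" for s x
  using abs_mult_le[of "- K" K "\<theta> s x" "2 * R", OF _ psi(2)[OF that, of x]] K by simp
 have bh': "abs (h' s x) <= Kb" if "s \<in> {t0..t1}" for s x
  using abs_mult_le[OF Kc[OF that, of x] bd(1)[OF that, of x]] abs_mult_le[OF bd(2)[OF that, of x] psi(1)[OF that, of x]] nn
  unfolding h'_def Kb_def by (simp add: mult.commute[of M])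
 have cd: "abs (- \<theta> s x * dir j x) <= 2 * R" if "s \<in> {t0..t1}" for s j x
  using abs_mult_le[OF psi(2)[OF that, of x] dir1[of j x]] by simp
 have bF: "abs (\<psi> s x * Fl s j x) <= Kb" if "s \<in> {t0..t1}" for s j x
  using abs_mult_le[OF psi(1)[OF that, of x] bd(3)[OF that, of j x]] nn unfolding Kb_def by linarith
 have bF': "abs (F' s j x) <= Kb" if "s \<in> {t0..t1}" for s j x
  using abs_mult_le[OF cd[OF that, where x=x and j=j] bd(3)[OF that, of j x]] abs_mult_le[OF bd(4)[OF that, of j x] psi(1)[OF that, of x]] nn
  unfolding F'_def Kb_def by (simp add: mult.commute[of M])
 have mh: "h s \<in> borel_measurable lborel" if "s \<in> {t0..t1}" for s
  unfolding h_def[abs_def] \<psi>_def using mE[OF that] cone_weight_meas by (intro borel_measurable_times)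
 have dh: "((%s. h s x) has_real_derivative h' s x) (at s within {t0..t1})" if "s \<in> {t0..t1}" for s x
  unfolding h_def h'_def \<psi>_def \<theta>_def by (rule DERIV_mult[OF cone_time_deriv dE[OF that]])
 have sh: "R < norm x ==> h s x = 0" if "s \<in> {t0..t1}" for s x using B(5)[of s x] that by (simp add: h_def)
 note leib = leibniz_rule_bounded[OF t01 _ mh dh bh bh' sh]
 have ibp: "integrable lborel (F' s j)" "(\<integral>x. F' s j x \<partial>lborel) = 0" if hs: "s \<in> {t0..t1}" for s j
 proof -
  have m: "(%x. \<psi> s x * Fl s j x) \<in> borel_measurable lborel"
   unfolding \<psi>_def using mF[OF hs] cone_weight_meas by (intro borel_measurable_times)
  have d: "((%\<sigma>. \<psi> s (x + \<sigma> *\<^sub>R axis j 1) * Fl s j (x + \<sigma> *\<^sub>R axis j 1)) has_real_derivative F' s j x) (at 0)" for x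
   using DERIV_mult[OF cone_space_deriv[of K R t0 s x "axis j 1"] dF[OF hs, of j x]]
   by (simp add: \<psi>_def \<theta>_def F'_def dir_def)
  have z: "R < norm x ==> \<psi> s x * Fl s j x = 0" for x using B(5)[of s x] hs by simp
  note ii = integral_directional_derivative_eq_0[OF m d bF[OF hs] bF'[OF hs] z]
  show "integrable lborel (F' s j)" "(\<integral>x. F' s j x \<partial>lborel) = 0" by (rule ii; assumption)+
 qed
 define vol where "vol = measure lborel (cball 0 R :: (real ^ 'd) set)"
 have int_ind: "integrable lborel (%x. indicator (cball 0 R :: (real ^ 'd) set) x :: real)"
  using emeasure_bounded_finite[OF bounded_cball, of "0 :: real ^ 'd" R] by (intro integrable_real_indicator) auto
 have ih: "integrable lborel (h s)" if "s \<in> {t0..t1}" for s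
  by (rule integrable_bounded_support[OF mh[OF that] bh[OF that] sh[OF that]])
 have le: "(\<integral>x. h' s x \<partial>lborel) <= C\<^sup>2 * (\<integral>x. h s x \<partial>lborel) + \<delta> * (Z * vol)" if hs: "s \<in> {t0..t1}" for s
 proof -
  have ih': "integrable lborel (h' s)" by (rule leib(2)[OF hs])
  have "(\<integral>x. h' s x \<partial>lborel) = (\<integral>x. h' s x + (\<Sum>j\<in>UNIV. F' s j x) \<partial>lborel)"
   using ih' ibp[OF hs] by (simp add: Bochner_Integration.integral_sum)
  also have "... <= (\<integral>x. C\<^sup>2 * h s x + \<delta> * Z * indicator (cball 0 R) x \<partial>lborel)"
  proof (rule integral_mono)
   show "integrable lborel (%x. h' s x + (\<Sum>j\<in>UNIV. F' s j x))"
    using ih' ibp(1)[OF hs] by (intro Bochner_Integration.integrable_add Bochner_Integration.integrable_sum)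
   show "integrable lborel (%x. C\<^sup>2 * h s x + \<delta> * Z * indicator (cball 0 R) x)"
    using ih[OF hs] int_ind by (intro Bochner_Integration.integrable_add integrable_mult_right) auto
   fix x
   have t: "t0 <= s" using hs by simp
   show "h' s x + (\<Sum>j\<in>UNIV. F' s j x) <= C\<^sup>2 * h s x + \<delta> * Z * indicator (cball 0 R) x"
   proof (cases "norm x <= R")
    case False
    then show ?thesis using B(5,6)[OF t, of x] by (simp add: h'_def F'_def h_def)
   next
    case True
    note P = B(1-4)[OF t, of x] and co = coerc[OF hs, of x]
    have f1: "- \<theta> s x * dir j x * Fl s j x <= \<theta> s x * (C * D s x)" for j
    proof -
     have "abs (- \<theta> s x * dir j x * Fl s j x) <= (\<theta> s x * 1) * (C * D s x)"
      using P dir1[of j x] by (intro abs_mult_le flb[OF hs]) (auto intro!: mult_left_le simp: abs_mult)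
     then show ?thesis by simp
    qed
    have "(\<Sum>j\<in>UNIV. - \<theta> s x * dir j x * Fl s j x) <= (\<Sum>j\<in>(UNIV::'d set). \<theta> s x * (C * D s x))"
     by (rule sum_mono) (rule f1)
    then have "(\<Sum>j\<in>UNIV. - \<theta> s x * dir j x * Fl s j x) <= real CARD('d) * \<theta> s x * C * D s x" by (simp add: mult_ac)
    also have "... <= real CARD('d) * \<theta> s x * C * (C * (E s x + \<delta>))" using co P C by (intro mult_left_mono) auto
    also have "... = K * \<theta> s x * E s x + \<delta> * (K * \<theta> s x)" by (simp add: K_def power2_eq_square algebra_simps)
    finally have 1: "(\<Sum>j\<in>UNIV. - \<theta> s x * dir j x * Fl s j x) <= K * \<theta> s x * E s x + \<delta> * (K * \<theta> s x)" .
    have "\<psi> s x * (Et s x + (\<Sum>j\<in>UNIV. Fl' s j x)) <= \<psi> s x * (C * (D s x + \<delta>))" using law[OF hs] P by (intro mult_left_mono) auto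
    also have "... <= \<psi> s x * (C * (C * (E s x + \<delta>) + \<delta>))" using co P C by (intro mult_left_mono add_right_mono) auto
    also have "... = C\<^sup>2 * h s x + \<delta> * ((C\<^sup>2 + C) * \<psi> s x)" by (simp add: h_def power2_eq_square algebra_simps)
    finally have 2: "\<psi> s x * (Et s x + (\<Sum>j\<in>UNIV. Fl' s j x)) <= C\<^sup>2 * h s x + \<delta> * ((C\<^sup>2 + C) * \<psi> s x)" .
    have "K * \<theta> s x + (C\<^sup>2 + C) * \<psi> s x <= Z" unfolding Z_def using P K C by (intro add_mono mult_left_mono) auto
    then have 3: "\<delta> * (K * \<theta> s x) + \<delta> * ((C\<^sup>2 + C) * \<psi> s x) <= \<delta> * Z" using \<delta> by (metis distrib_left mult_left_mono)
    have "h' s x + (\<Sum>j\<in>UNIV. F' s j x) = - K * \<theta> s x * E s x + (\<Sum>j\<in>UNIV. - \<theta> s x * dir j x * Fl s j x) + \<psi> s x * (Et s x + (\<Sum>j\<in>UNIV. Fl' s j x))"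
     by (simp add: h'_def F'_def sum.distrib sum_distrib_left sum_subtractf sum_negf algebra_simps)
    then show ?thesis using 1 2 3 True by (simp add: indicator_def)
   qed
  qed
  also have "... = C\<^sup>2 * (\<integral>x. h s x \<partial>lborel) + \<delta> * (Z * vol)"
   using ih[OF hs] int_ind by (simp add: vol_def)
  finally show ?thesis .
 qed
 have "(\<integral>x. h t0 x \<partial>lborel) <= 0" by (simp add: h_def init)
 from gronwall_linear[of t0 s t1 "C\<^sup>2" "\<delta> * (Z * vol)" "%s. \<integral>x. h s x \<partial>lborel" "%s. \<integral>x. h' s x \<partial>lborel", OF _ _ _ _ this leib(1) le]
 show "(\<integral>x. cone_weight K R t0 s x * E s x \<partial>lborel)
  <= \<delta> * ((K * (2 * R) + (C\<^sup>2 + C) * R\<^sup>2) * measure lborel (cball 0 R :: (real ^ 'd) set)) * (s - t0) * exp (C\<^sup>2 * (s - t0))"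
  using s \<delta> Z by (simp add: h_def \<psi>_def Z_def vol_def)
 show "integrable lborel (%x. cone_weight K R t0 s x * E s x)" using ih[OF s] by (simp add: h_def[abs_def] \<psi>_def)
qed

text \<open>If the distance were at least d on the ball, the energies would be bounded below there up to the
error \<delta>, and their weighted integrals would stay away from 0 as \<delta> tends to 0. Only the
energies are integrated, not the distance itself.\<close>

lemma energy_uniqueness:
 fixes D :: "real => real ^ 'd => real"
 assumes t01: "t0 < t1" and C: "0 < C"
  and fam: "!!\<delta>. 0 < \<delta> ==> \<exists>E F M.
   (\<forall>s\<in>{t0..t1}. E s \<in> borel_measurable lborel & (\<forall>j. F s j \<in> borel_measurable lborel)) &
   (\<forall>s\<in>{t0..t1}. \<forall>x. balance_law t0 t1 E F M (C * (D s x + \<delta>)) s x & abs (E s x) <= M & 0 <= D s x & D s x <= C * (E s x + \<delta>) &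
    (\<forall>j. abs (F s j x) <= M & abs (F s j x) <= C * D s x)) & (\<forall>x. E t0 x = 0)"
  and s: "s \<in> {t0..t1}" and \<rho>: "0 < \<rho>" and d: "0 < d"
 shows "\<exists>x\<in>ball x0 \<rho>. D s x < d"
proof (rule ccontr)
 assume "\<not> ?thesis"
 then have ge: "!!x. x \<in> ball x0 \<rho> ==> d <= D s x" by force
 define K where "K = real CARD('d) * C\<^sup>2"
 have K: "0 <= K" by (simp add: K_def)
 \<comment> \<open>The cone is so large that its weight is at least 1 on the ball up to time t1.\<close>
 define R where "R = K * (t1 - t0) + sqrt (1 + (norm x0 + \<rho>)\<^sup>2) + 1"
 have R: "0 <= R" unfolding R_def using K t01 by (intro add_nonneg_nonneg mult_nonneg_nonneg) auto
 define vb where "vb = measure lborel (ball x0 \<rho>)"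
 define vol where "vol = measure lborel (cball 0 R :: (real ^ 'd) set)"
 have vb: "0 < vb" using \<rho> content_ball_pos[of \<rho> x0] by (simp add: vb_def)
 define Q where "Q = ((K * (2 * R) + (C\<^sup>2 + C) * R\<^sup>2) * vol) * (s - t0) * exp (C\<^sup>2 * (s - t0)) + R\<^sup>2 * vol"
 have vol: "0 <= vol" by (simp add: vol_def)
 have Q: "0 <= Q" unfolding Q_def using K R C vol s by (intro add_nonneg_nonneg mult_nonneg_nonneg) auto
 have key: "(d / C) * vb <= \<delta> * Q" if \<delta>: "0 < \<delta>" for \<delta>
 proof -
  obtain E F M where meas: "\<forall>s\<in>{t0..t1}. E s \<in> borel_measurable lborel & (\<forall>j. F s j \<in> borel_measurable lborel)"
   and H: "\<forall>s\<in>{t0..t1}. \<forall>x. balance_law t0 t1 E F M (C * (D s x + \<delta>)) s x & abs (E s x) <= M & 0 <= D s x & D s x <= C * (E s x + \<delta>) &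
    (\<forall>j. abs (F s j x) <= M & abs (F s j x) <= C * D s x)"
   and init: "\<forall>x. E t0 x = 0" using fam[OF \<delta>] by blast
  define rates where "rates s x e' f' \<longleftrightarrow> ((%s. E s x) has_real_derivative e') (at s within {t0..t1}) &
   (\<forall>j. ((%\<sigma>. F s j (x + \<sigma> *\<^sub>R axis j 1)) has_real_derivative f' j) (at 0)) &
   abs e' <= M & (\<forall>j. abs (f' j) <= M) & e' + (\<Sum>j\<in>UNIV. f' j) <= C * (D s x + \<delta>)" for s x e' f'
  have "\<forall>s x. \<exists>e' f'. s \<in> {t0..t1} --> rates s x e' f'" using H unfolding balance_law_def rates_def by meson
  then obtain Et F' where "!!s x. s \<in> {t0..t1} ==> rates s x (Et s x) (F' s x)" by metis
  note rt = this[unfolded rates_def]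
  have est: "(\<integral>x. cone_weight K R t0 s x * E s x \<partial>lborel)
    <= \<delta> * ((K * (2 * R) + (C\<^sup>2 + C) * R\<^sup>2) * vol) * (s - t0) * exp (C\<^sup>2 * (s - t0))"
   and int: "integrable lborel (%x. cone_weight K R t0 s x * E s x)"
   unfolding K_def vol_def
   using energy_estimate[of t0 t1 C \<delta> R E F Et "%s j x. F' s x j" M D s] meas H init rt t01 C \<delta> R s by (auto simp: less_imp_le)
  have int_ind: "integrable lborel (%x. indicator (cball 0 R :: (real ^ 'd) set) x :: real)"
   using emeasure_bounded_finite[OF bounded_cball, of "0 :: real ^ 'd" R] by (intro integrable_real_indicator) auto
  have int_b: "integrable lborel (%x. indicator (ball x0 \<rho>) x :: real)"
   using emeasure_bounded_finite[OF bounded_ball, of x0 \<rho>] by (intro integrable_real_indicator) auto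
  have "(d / C) * vb - \<delta> * R\<^sup>2 * vol = (\<integral>x. d / C * indicator (ball x0 \<rho>) x - \<delta> * R\<^sup>2 * indicator (cball 0 R) x \<partial>lborel)"
   using int_ind int_b by (simp add: vb_def vol_def)
  also have "... <= (\<integral>x. cone_weight K R t0 s x * E s x \<partial>lborel)"
  proof (rule integral_mono[OF _ int])
   show "integrable lborel (%x. d / C * indicator (ball x0 \<rho>) x - \<delta> * R\<^sup>2 * indicator (cball 0 R) x)"
    using int_ind int_b by (intro Bochner_Integration.integrable_diff integrable_mult_right) auto
   fix x :: "real ^ 'd"
   note B = cone_bounds[OF K R, of t0 s x]
   have t: "t0 <= s" using s by simp
   have co: "0 <= D s x" "D s x <= C * (E s x + \<delta>)" using H s by auto
   have E1: "D s x / C - \<delta> <= E s x" using co(2) C by (simp add: field_simps)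
   show "d / C * indicator (ball x0 \<rho>) x - \<delta> * R\<^sup>2 * indicator (cball 0 R) x <= cone_weight K R t0 s x * E s x"
   proof (cases "x \<in> ball x0 \<rho>")
    case True
    have "norm x <= norm x0 + \<rho>" using True norm_triangle_ineq4[of x0 "x0 - x"] by (simp add: dist_norm)
    then have "sqrt (1 + x \<bullet> x) <= sqrt (1 + (norm x0 + \<rho>)\<^sup>2)"
     by (simp add: power2_norm_eq_inner[symmetric] power_mono)
    moreover have "K * (s - t0) <= K * (t1 - t0)" using K s by (intro mult_left_mono) auto
    ultimately have one: "1 <= cone_weight K R t0 s x" unfolding cone_weight_def R_def by (intro pos2_ge_1) linarith
    have nx: "norm x <= R" using B(5)[OF t] one by force
    have "d / C <= D s x / C" using ge[OF True] C by (simp add: divide_right_mono)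
    also have "... <= cone_weight K R t0 s x * (D s x / C)" using mult_right_mono[OF one, of "D s x / C"] co C by simp
    also have "... <= cone_weight K R t0 s x * (E s x + \<delta>)" using E1 B(1)[OF t] by (intro mult_left_mono) auto
    also have "... <= cone_weight K R t0 s x * E s x + R\<^sup>2 * \<delta>" using B(2)[OF t] \<delta> by (simp add: distrib_left)
    finally show ?thesis using True nx by (simp add: indicator_def mult.commute)
   next
    case False
    have "- \<delta> <= E s x" using E1 co C by (smt (verit) divide_nonneg_pos)
    then have "cone_weight K R t0 s x * (- \<delta>) <= cone_weight K R t0 s x * E s x" using B(1)[OF t] by (intro mult_left_mono)
    moreover have "- \<delta> * R\<^sup>2 * indicator (cball 0 R) x <= cone_weight K R t0 s x * (- \<delta>)"
     using B(2,5)[OF t] \<delta> by (auto simp: indicator_def mult.commute)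
    ultimately show ?thesis using False by simp
   qed
  qed
  finally have "(d / C) * vb <= \<delta> * R\<^sup>2 * vol + \<delta> * ((K * (2 * R) + (C\<^sup>2 + C) * R\<^sup>2) * vol) * (s - t0) * exp (C\<^sup>2 * (s - t0))"
   using est by linarith
  then show ?thesis by (simp add: Q_def algebra_simps)
 qed
 define X where "X = (d / C) * vb"
 have X: "0 < X" using d C vb by (simp add: X_def)
 have "X <= (X / (2 * (Q + 1))) * Q" using key[of "X / (2 * (Q + 1))", folded X_def] X Q by simp
 also have "... = X * (Q / (2 * (Q + 1)))" by simp
 also have "... < X * 1" using X Q by (intro mult_strict_left_mono) (auto simp: field_simps)
 finally show False by simp
qed

section \<open>Two reduced flows\<close>

text \<open>The reduced system at a point, with the derivatives of the solution as explicit data: rt, yt in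
time, p and Y j in space.\<close>

definition flow_at where
 "flow_at \<kappa> b L I r y rt yt p Y t x \<longleftrightarrow> y t x \<bullet> y t x <= b & isCont (y t) x &
  ((%s. r s x) has_real_derivative rt t x) (at t within I) &
  ((%s. y s x) has_vector_derivative yt t x) (at t within I) &
  (\<forall>j. ((%s. r t (x + s *\<^sub>R axis j 1)) has_real_derivative p t x $ j) (at 0)) &
  (\<forall>j. ((%s. y t (x + s *\<^sub>R axis j 1)) has_vector_derivative Y t j x) (at 0)) &
  abs (rt t x) <= L & norm (yt t x) <= L & norm (p t x) <= L & (\<forall>j. norm (Y t j x) <= L) &
  rt t x = - (1 + sc_t \<kappa> (r t x) (y t x \<bullet> y t x)) * (y t x \<bullet> p t x)
   - r t x * (sc_g \<kappa> (r t x) (y t x \<bullet> y t x) * (\<Sum>j\<in>UNIV. Y t j x $ j)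
     + sc_h \<kappa> (r t x) (y t x \<bullet> y t x) * (\<Sum>j\<in>UNIV. y t x $ j * (Y t j x \<bullet> y t x))) &
  yt t x = - ((1 + sc_s \<kappa> (r t x) (y t x \<bullet> y t x)) *\<^sub>R (\<Sum>j\<in>UNIV. y t x $ j *\<^sub>R Y t j x))
   - sc_eta \<kappa> (r t x) (y t x \<bullet> y t x) *\<^sub>R (p t x - (y t x \<bullet> p t x) *\<^sub>R (y t x :: real ^ 'd))"

definition reduced_flow where
 "reduced_flow \<kappa> b L t0 t1 r y rt yt p Y \<longleftrightarrow>
  (\<forall>t\<in>{t0..t1}. continuous_on UNIV (r t)) & (\<forall>x. continuous_on {t0..t1} (%t. r t x)) &
  (\<forall>t\<in>{t0..t1}. \<forall>x :: real ^ 'd. 0 <= r t x & r t x <= 1 / \<kappa>) &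
  (\<forall>t\<in>{t0..t1}. \<forall>x :: real ^ 'd. 0 < r t x --> flow_at \<kappa> b L {t0..t1} r y rt yt p Y t x)"

lemma reduced_flow_bounds:
 assumes "reduced_flow \<kappa> b L t0 t1 r y rt yt p Y" "t \<in> {t0..t1}"
 shows "continuous_on UNIV (r t)" "0 <= r t x" "r t x <= 1 / \<kappa>" "continuous_on {t0..t1} (%t. r t x)"
 using assms unfolding reduced_flow_def by auto

lemma reduced_flowD:
 assumes "reduced_flow \<kappa> b L t0 t1 r y rt yt p Y" "t \<in> {t0..t1}" "0 < r t x"
 shows "y t x \<bullet> y t x <= b" "isCont (y t) x"
  "((%s. r s x) has_real_derivative rt t x) (at t within {t0..t1})"
  "((%s. y s x) has_vector_derivative yt t x) (at t within {t0..t1})"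
  "((%s. r t (x + s *\<^sub>R axis j 1)) has_real_derivative p t x $ j) (at 0)"
  "((%s. y t (x + s *\<^sub>R axis j 1)) has_vector_derivative Y t j x) (at 0)"
  "abs (rt t x) <= L" "norm (yt t x) <= L" "norm (p t x) <= L" "norm (Y t j x) <= L"
  "rt t x = - (1 + sc_t \<kappa> (r t x) (y t x \<bullet> y t x)) * (y t x \<bullet> p t x)
     - r t x * (sc_g \<kappa> (r t x) (y t x \<bullet> y t x) * (\<Sum>j\<in>UNIV. Y t j x $ j)
       + sc_h \<kappa> (r t x) (y t x \<bullet> y t x) * (\<Sum>j\<in>UNIV. y t x $ j * (Y t j x \<bullet> y t x)))"
  "yt t x = - ((1 + sc_s \<kappa> (r t x) (y t x \<bullet> y t x)) *\<^sub>R (\<Sum>j\<in>UNIV. y t x $ j *\<^sub>R Y t j x))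
     - sc_eta \<kappa> (r t x) (y t x \<bullet> y t x) *\<^sub>R (p t x - (y t x \<bullet> p t x) *\<^sub>R y t x)"
 using assms unfolding reduced_flow_def flow_at_def by blast+

lemma dom_mono: "dominated S f g ==> S' \<subseteq> S ==> dominated S' f g"
 unfolding dominated_def by blast

text \<open>The vector z is the gradient of the quadratic form. Applying the symmetric matrix eta (I - a a^T) of
the momentum equation to it gives the velocity vector in the pressure flux, which is why the
pressure terms of the two equations combine into a divergence.\<close>

lemma energy_vector_identity:
 fixes a w P :: "real ^ 'd"
 assumes "eta \<noteq> 0" "a \<bullet> a < 1"
  and z: "z = ((1 + al) / eta) *\<^sub>R w + (((be + (1 + al)) / eta / (1 - a \<bullet> a)) * (a \<bullet> w)) *\<^sub>R a"
 shows "eta * (z \<bullet> P - (z \<bullet> a) * (a \<bullet> P)) = ((1 + al) *\<^sub>R w + (be * (a \<bullet> w)) *\<^sub>R a) \<bullet> P"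
proof -
 define e where "e = a \<bullet> a"
 define X where "X = a \<bullet> w"
 have e: "1 - e \<noteq> 0" using assms(2) by (simp add: e_def)
 have zP: "z \<bullet> P = (1 + al) / eta * (w \<bullet> P) + ((be + (1 + al)) / eta / (1 - e)) * X * (a \<bullet> P)"
  and za: "z \<bullet> a = (1 + al) / eta * X + ((be + (1 + al)) / eta / (1 - e)) * X * e"
  by (auto simp: z e_def X_def inner_add_left inner_add_right inner_commute algebra_simps)
 have "eta * (z \<bullet> P - (z \<bullet> a) * (a \<bullet> P)) = (1 + al) * (w \<bullet> P) + be * X * (a \<bullet> P)"
  unfolding zP za using assms(1) e by (simp add: divide_simps) (simp add: algebra_simps)
 then show ?thesis by (simp add: inner_add_left X_def)
qed

lemma norm_cubed_deriv:
 fixes w :: "real => 'a::real_inner"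
 assumes w: "(w has_vector_derivative w') (at s within S)"
 shows "((%s. norm (w s) ^ 3) has_real_derivative 3 * norm (w s) * (w s \<bullet> w')) (at s within S)"
proof -
 have d: "((%x. x * sqrt x) has_real_derivative 3 / 2 * sqrt x) (at x)" if x: "0 <= x" for x :: real
 proof (cases "x = 0")
  case True
  have "(%h::real. ((0 + h) * sqrt (0 + h) - 0 * sqrt 0) / h) \<midarrow>0\<rightarrow> 0 \<longleftrightarrow> (%h. sqrt h) \<midarrow>0\<rightarrow> 0"
   by (rule LIM_cong) auto
  moreover have "(%h. sqrt h) \<midarrow>0\<rightarrow> 0" using isCont_real_sqrt[of 0] by (simp add: isCont_def)
  ultimately show ?thesis using True by (simp add: DERIV_def)
 next
  case False
  then have "0 < x" using x by simp
  then show ?thesis by (auto intro!: derivative_eq_intros simp: field_simps)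
 qed
 have e: "norm (w s) ^ 3 = (w s \<bullet> w s) * sqrt (w s \<bullet> w s)" for s
  by (simp add: norm_eq_sqrt_inner[symmetric] power2_norm_eq_inner[symmetric] power3_eq_cube power2_eq_square)
 show ?thesis unfolding e
  by (rule DERIV_cong[OF DERIV_chain2[OF d inner_has_real_derivative[OF w w]]])
   (auto simp: norm_eq_sqrt_inner inner_commute)
qed

text \<open>Two solutions of the reduced system and a vector field N that is transversal to both of their free
boundaries, on a time interval on which this persists.\<close>

locale flow_pair =
 fixes \<kappa> m b L t0 t1 c0 \<rho>0 NB :: real
  and r1 r2 :: "real => real ^ 'd => real" and y1 y2 :: "real => real ^ 'd => real ^ 'd"
  and rt1 rt2 :: "real => real ^ 'd => real" and yt1 yt2 p1 p2 :: "real => real ^ 'd => real ^ 'd"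
  and Y1 Y2 :: "real => 'd => real ^ 'd => real ^ 'd" and N N' :: "'d => real ^ 'd => real"
 assumes \<kappa>: "0 < \<kappa>" and m: "0 < m" "\<kappa> = 1 / (2 * m)" and b: "0 <= b" "b < 1" and L: "0 <= L" and t01: "t0 < t1"
  and flow1: "reduced_flow \<kappa> b L t0 t1 r1 y1 rt1 yt1 p1 Y1" and flow2: "reduced_flow \<kappa> b L t0 t1 r2 y2 rt2 yt2 p2 Y2"
  and c0: "0 < c0" and \<rho>0: "0 < \<rho>0"
  and N: "!!j x. abs (N j x) <= NB" "!!j x. abs (N' j x) <= NB" "!!j. continuous_on UNIV (N j)"
   "!!j x. ((%s. N j (x + s *\<^sub>R axis j 1)) has_real_derivative N' j x) (at 0)"
  and transversal: "!!t x. t \<in> {t0..t1} ==> 0 < r1 t x ==> r1 t x <= \<rho>0 ==> c0 <= (\<Sum>j\<in>UNIV. p1 t x $ j * N j x)"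
   "!!t x. t \<in> {t0..t1} ==> 0 < r2 t x ==> r2 t x <= \<rho>0 ==> c0 <= (\<Sum>j\<in>UNIV. p2 t x $ j * N j x)"
begin

text \<open>An index consists of a cut-off scale, a time and a point where both fluids are present, so that
domination over S is uniform in the scale.\<close>

definition S :: "(real \<times> real \<times> (real ^ 'd)) set" where
 "S = {(\<eta>, t, x). 0 < \<eta> & t \<in> {t0..t1} & 0 < r1 t x & 0 < r2 t x}"

abbreviation (input) tm :: "real \<times> real \<times> (real ^ 'd) => real" where "tm i \<equiv> fst (snd i)"
abbreviation (input) ps :: "real \<times> real \<times> (real ^ 'd) => real ^ 'd" where "ps i \<equiv> snd (snd i)"
abbreviation (input) pt :: "(real => real ^ 'd => 'z) => real \<times> real \<times> (real ^ 'd) => 'z" where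
 "pt f i \<equiv> f (fst (snd i)) (snd (snd i))"

lemma SD:
 assumes "i \<in> S"
 shows "0 < fst i" "fst (snd i) \<in> {t0..t1}" "0 < pt r1 i" "0 < pt r2 i" "pt r1 i <= 1 / \<kappa>" "pt r2 i <= 1 / \<kappa>"
  "pt y1 i \<bullet> pt y1 i <= b" "pt y2 i \<bullet> pt y2 i <= b"
  "norm (pt p1 i) <= L" "norm (pt p2 i) <= L" "norm (pt yt1 i) <= L" "norm (pt yt2 i) <= L"
  "abs (pt rt1 i) <= L" "abs (pt rt2 i) <= L"
  "norm (Y1 (fst (snd i)) j (snd (snd i))) <= L" "norm (Y2 (fst (snd i)) j (snd (snd i))) <= L"
proof -
 have a: "0 < fst i" "fst (snd i) \<in> {t0..t1}" "0 < pt r1 i" "0 < pt r2 i" using assms by (auto simp: S_def)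
 note F1 = reduced_flowD[OF flow1 a(2,3)] and F2 = reduced_flowD[OF flow2 a(2,4)]
 show "0 < fst i" "fst (snd i) \<in> {t0..t1}" "0 < pt r1 i" "0 < pt r2 i" by (rule a)+
 show "pt r1 i <= 1 / \<kappa>" "pt r2 i <= 1 / \<kappa>"
  by (rule reduced_flow_bounds(3)[OF flow1 a(2)], rule reduced_flow_bounds(3)[OF flow2 a(2)])
 show "pt y1 i \<bullet> pt y1 i <= b" "pt y2 i \<bullet> pt y2 i <= b" by (rule F1(1), rule F2(1))
 show "norm (pt p1 i) <= L" "norm (pt p2 i) <= L" "norm (pt yt1 i) <= L" "norm (pt yt2 i) <= L"
  by (rule F1(9), rule F2(9), rule F1(8), rule F2(8))
 show "abs (pt rt1 i) <= L" "abs (pt rt2 i) <= L" by (rule F1(7), rule F2(7))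
 show "norm (Y1 (fst (snd i)) j (snd (snd i))) <= L" "norm (Y2 (fst (snd i)) j (snd (snd i))) <= L" by (rule F1(10), rule F2(10))
qed

lemma S_le: "i \<in> S ==> norm (pt y1 i) <= 1" "i \<in> S ==> norm (pt y2 i) <= 1"
 using SD(7,8)[of i] small_norm[OF \<kappa> b L m(1)] by auto

lemma e_lip: "i \<in> S ==> abs (pt y1 i \<bullet> pt y1 i - pt y2 i \<bullet> pt y2 i) <= 2 * norm (pt y1 i - pt y2 i)"
proof -
 assume i: "i \<in> S"
 have "pt y1 i \<bullet> pt y1 i - pt y2 i \<bullet> pt y2 i = (pt y1 i - pt y2 i) \<bullet> (pt y1 i + pt y2 i)"
  by (simp add: inner_add_right inner_diff_left inner_diff_right inner_commute)
 also have "abs ... <= norm (pt y1 i - pt y2 i) * norm (pt y1 i + pt y2 i)" by (rule Cauchy_Schwarz_ineq2)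
 also have "... <= norm (pt y1 i - pt y2 i) * 2"
  using S_le[OF i] norm_triangle_ineq[of "pt y1 i" "pt y2 i"] by (intro mult_left_mono) auto
 finally show ?thesis by simp
qed

abbreviation (input) co1 where "co1 c i \<equiv> c (pt r1 i) (pt y1 i \<bullet> pt y1 i)"
abbreviation (input) co2 where "co2 c i \<equiv> c (pt r2 i) (pt y2 i \<bullet> pt y2 i)"

lemma co_bdd: assumes "nice \<kappa> b c" shows "bounded_on S (%i. co1 c i)" "bounded_on S (%i. co2 c i)"
proof -
 obtain K where K: "0 <= K" "\<forall>r e. in_range \<kappa> b r e --> abs (c r e) <= K" using nice_bounded[OF assms] by blast
 show "bounded_on S (%i. co1 c i)" "bounded_on S (%i. co2 c i)"
  using K SD(3-8) by (auto intro!: domI[OF K(1)] simp: less_imp_le)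
qed

lemma co_small: assumes "nice \<kappa> b c" "!!f. 0 <= f ==> f <= b ==> c 0 f = 0"
 shows "dominated S (%i. co1 c i) (pt r1)" "dominated S (%i. co2 c i) (pt r2)"
proof -
 obtain K where K: "0 <= K" "\<forall>r f. in_range \<kappa> b r f --> abs (c r f) <= K * r"
  using vanishing_bound[OF \<kappa> b L m(1) assms] by blast
 show "dominated S (%i. co1 c i) (pt r1)" "dominated S (%i. co2 c i) (pt r2)"
  using K SD(3-8) by (auto intro!: domI[OF K(1)] simp: less_imp_le)
qed

lemma co_lip: assumes "nice \<kappa> b c"
 shows "dominated S (%i. co1 c i - co2 c i) (%i. abs (pt r1 i - pt r2 i) + norm (pt y1 i - pt y2 i))"
proof -
 obtain K where K: "0 <= K" "\<forall>r1 e1 r2 e2. in_range \<kappa> b r1 e1 & in_range \<kappa> b r2 e2 --> abs (c r1 e1 - c r2 e2) <= K * (abs (r1 - r2) + abs (e1 - e2))" using nice_lipschitz[OF assms] by blast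
 show ?thesis
 proof (rule domI[of "2 * K"])
  fix i assume i: "i \<in> S"
  have "abs (co1 c i - co2 c i) <= K * (abs (pt r1 i - pt r2 i) + abs (pt y1 i \<bullet> pt y1 i - pt y2 i \<bullet> pt y2 i))"
   using K(2) SD(3-8)[OF i] by (simp add: less_imp_le)
  also have "... <= K * (2 * (abs (pt r1 i - pt r2 i) + norm (pt y1 i - pt y2 i)))"
  proof (rule mult_left_mono[OF _ K(1)])
   show "abs (pt r1 i - pt r2 i) + abs (pt y1 i \<bullet> pt y1 i - pt y2 i \<bullet> pt y2 i)
     <= 2 * (abs (pt r1 i - pt r2 i) + norm (pt y1 i - pt y2 i))"
    unfolding distrib_left by (intro add_mono e_lip[OF i]) simp
  qed
  finally show "abs (co1 c i - co2 c i) <= 2 * K * (abs (pt r1 i - pt r2 i) + norm (pt y1 i - pt y2 i))" by (simp only: mult.assoc mult.left_commute[of 2 K])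
 qed (use K in simp)
qed

lemma co_lip_t: "dominated S (%i. co1 (sc_t \<kappa>) i - co2 (sc_t \<kappa>) i) (%i. abs (pt r1 i - pt r2 i) + pt r2 i * norm (pt y1 i - pt y2 i))"
proof -
 obtain K where K: "0 <= K" "\<forall>r1 e1 r2 e2. in_range \<kappa> b r1 e1 & in_range \<kappa> b r2 e2 --> abs (sc_t \<kappa> r1 e1 - sc_t \<kappa> r2 e2) <= K * (abs (r1 - r2) + r2 * abs (e1 - e2))" using t_lipschitz[OF \<kappa> b] by blast
 show ?thesis
 proof (rule domI[of "2 * K"])
  fix i assume i: "i \<in> S"
  have "abs (co1 (sc_t \<kappa>) i - co2 (sc_t \<kappa>) i) <= K * (abs (pt r1 i - pt r2 i) + pt r2 i * abs (pt y1 i \<bullet> pt y1 i - pt y2 i \<bullet> pt y2 i))"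
   using K(2) SD(3-8)[OF i] by (simp add: less_imp_le)
  also have "... <= K * (2 * (abs (pt r1 i - pt r2 i) + pt r2 i * norm (pt y1 i - pt y2 i)))"
  proof (rule mult_left_mono[OF _ K(1)])
   have "pt r2 i * abs (pt y1 i \<bullet> pt y1 i - pt y2 i \<bullet> pt y2 i) <= pt r2 i * (2 * norm (pt y1 i - pt y2 i))"
    using e_lip[OF i] SD(4)[OF i] by (intro mult_left_mono) auto
   then show "abs (pt r1 i - pt r2 i) + pt r2 i * abs (pt y1 i \<bullet> pt y1 i - pt y2 i \<bullet> pt y2 i)
     <= 2 * (abs (pt r1 i - pt r2 i) + pt r2 i * norm (pt y1 i - pt y2 i))"
    using abs_ge_zero[of "pt r1 i - pt r2 i"] by (simp add: algebra_simps)
  qed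
  finally show "abs (co1 (sc_t \<kappa>) i - co2 (sc_t \<kappa>) i) <= 2 * K * (abs (pt r1 i - pt r2 i) + pt r2 i * norm (pt y1 i - pt y2 i))" by (simp only: mult.assoc mult.left_commute[of 2 K])
 qed (use K in simp)
qed

lemma fields_bdd: "F \<in> fields \<kappa> ==> bounded_on S (%i. F (fst i) (pt r1 i) (pt y1 i) (pt r2 i))"
proof -
 assume F: "F \<in> fields \<kappa>"
 obtain C where C: "C \<ge> 0" "\<forall>\<eta> S s0 \<rho> \<sigma> (u :: real => real ^ 'd) v \<rho>' \<sigma>' u' v'. 0 < \<eta> & admissible \<kappa> b L S s0 \<rho> \<sigma> u v \<rho>' \<sigma>' u' v' -->
  (\<forall>F\<in>fields \<kappa>. abs (F \<eta> (\<rho> s0) (u s0) (\<sigma> s0)) <= C & (\<exists>D. ((%s. F \<eta> (\<rho> s) (u s) (\<sigma> s)) has_real_derivative D) (at s0 within S) & abs D <= C))"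
  using field_derivs[OF \<kappa> b L m(1)] by blast
 show ?thesis
 proof (rule domI[OF C(1)])
  fix i assume i: "i \<in> S"
  have "admissible \<kappa> b L UNIV 0 (%_. pt r1 i) (%_. pt r2 i) (%_. pt y1 i) (%_. pt y2 i) 0 0 0 0"
   using SD(3-8)[OF i] L by (simp add: admissible_def)
  then show "abs (F (fst i) (pt r1 i) (pt y1 i) (pt r2 i)) <= C * 1" using C(2) SD(1)[OF i] F by force
 qed
qed

lemma aw_le: "i \<in> S ==> abs (pt y1 i \<bullet> (pt y1 i - pt y2 i)) <= norm (pt y1 i - pt y2 i)"
 using Cauchy_Schwarz_ineq2[of "pt y1 i" "pt y1 i - pt y2 i"]
  mult_right_mono[OF S_le(1)[of i], of "norm (pt y1 i - pt y2 i)"] by simp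

definition ze where "ze i = fz \<kappa> (fst i) (pt r1 i) (pt y1 i) (pt r2 i) (pt y2 i)"
definition qe where "qe i = fQ \<kappa> (fst i) (pt r1 i) (pt y1 i) (pt r2 i) (pt y2 i)"

lemma ze_dom: "dominated S (%i. norm (ze i)) (%i. norm (pt y1 i - pt y2 i))"
 and qe_dom: "dominated S qe (%i. (norm (pt y1 i - pt y2 i))\<^sup>2)"
proof -
 define za where "za i = fza \<kappa> (fst i) (pt r1 i) (pt y1 i) (pt r2 i)" for i
 define zb where "zb i = fzb \<kappa> (fst i) (pt r1 i) (pt y1 i) (pt r2 i)" for i
 have d: "bounded_on S za" "bounded_on S zb" using fields_bdd[of "fza \<kappa>"] fields_bdd[of "fzb \<kappa>"] by (simp_all add: fields_def[OF \<kappa> b L m(1)] za_def[abs_def] zb_def[abs_def])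
 have w: "dominated S (%i. norm (pt y1 i - pt y2 i)) (%i. norm (pt y1 i - pt y2 i))" by (rule dom_refl) simp
 have aw: "dominated S (%i. pt y1 i \<bullet> (pt y1 i - pt y2 i)) (%i. norm (pt y1 i - pt y2 i))"
  by (rule domI[of 1]) (use aw_le in auto)
 have a: "bounded_on S (%i. norm (pt y1 i))" by (rule domI[of 1]) (use S_le in auto)
 show "dominated S (%i. norm (ze i)) (%i. norm (pt y1 i - pt y2 i))"
  unfolding ze_def fz_def za_def[symmetric] zb_def[symmetric]
  using dom_norm_scale[OF d(1) w] dom_norm_scale[OF dom_bdd[OF d(2) aw] a] by (intro dom_norm_add) auto
 show "dominated S qe (%i. (norm (pt y1 i - pt y2 i))\<^sup>2)"
  unfolding qe_def[abs_def] fQ_def za_def[symmetric] zb_def[symmetric] power2_eq_square power2_norm_eq_inner[symmetric]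
  using dom_bdd[OF d(1) dom_mult[OF w w]] dom_bdd[OF d(2) dom_mult[OF aw aw]] by (intro dom_add) auto
qed

sublocale ts: two_states S m "1 / \<kappa>" \<kappa> fst "pt r1" "pt r2" "pt y1" "pt y2" "pt p1" "pt p2" ze
 "%i j. Y1 (fst (snd i)) j (snd (snd i))" "%i j. Y2 (fst (snd i)) j (snd (snd i))"
 "co1 (sc_t \<kappa>)" "co2 (sc_t \<kappa>)" "co1 (sc_s \<kappa>)" "co2 (sc_s \<kappa>)" "co1 (sc_g \<kappa>)" "co2 (sc_g \<kappa>)"
 "co1 (sc_h \<kappa>)" "co2 (sc_h \<kappa>)" "co1 (sc_eta \<kappa>)" "co2 (sc_eta \<kappa>)"
proof
 note kb = \<kappa> b
 have g: "nice \<kappa> b (%r e. sc_g \<kappa> r e - \<kappa>)" by (intro nice_diff nice_g[OF kb] nice_const)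
 show "0 < m" "\<kappa> = 1 / (2 * m)" "0 <= 1 / \<kappa>" using m \<kappa> by auto
 show "!!i. i \<in> S ==> 0 < fst i & 0 < pt r1 i & pt r1 i <= 1 / \<kappa> & 0 < pt r2 i & pt r2 i <= 1 / \<kappa>"
  using SD(1,3-6) by blast
 show "bounded_on S (%i. norm (pt y1 i))" "bounded_on S (%i. norm (pt y2 i))"
  by (rule domI[of 1], use S_le in auto)+
 show "bounded_on S (%i. norm (pt p1 i))" "bounded_on S (%i. norm (pt p2 i))"
  "bounded_on S (%i. norm (Y1 (fst (snd i)) j (snd (snd i))))" "bounded_on S (%i. norm (Y2 (fst (snd i)) j (snd (snd i))))" for j
  by (rule domI[OF L], use SD(9,10,15,16) in auto)+
 show "dominated S (co1 (sc_t \<kappa>)) (pt r1)" "dominated S (co2 (sc_t \<kappa>)) (pt r2)"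
  by (rule co_small[OF nice_t[OF kb]]; simp add: at_vacuum[OF kb])+
 show "dominated S (co1 (sc_s \<kappa>)) (pt r1)" "dominated S (co2 (sc_s \<kappa>)) (pt r2)"
  by (rule co_small[OF nice_s[OF kb]]; simp add: at_vacuum[OF kb])+
 show "dominated S (co1 (sc_h \<kappa>)) (pt r1)" "dominated S (co2 (sc_h \<kappa>)) (pt r2)"
  by (rule co_small[OF nice_h[OF kb]]; simp add: at_vacuum[OF kb])+
 show "dominated S (%i. co1 (sc_g \<kappa>) i - \<kappa>) (pt r1)" "dominated S (%i. co2 (sc_g \<kappa>) i - \<kappa>) (pt r2)"
  by (rule co_small[OF g]; simp add: at_vacuum[OF kb])+
 show "bounded_on S (co1 (sc_eta \<kappa>))" "bounded_on S (co2 (sc_eta \<kappa>))" by (rule co_bdd[OF nice_eta[OF kb]])+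
 show "dominated S (%i. co1 (sc_t \<kappa>) i - co2 (sc_t \<kappa>) i) (%i. abs (pt r1 i - pt r2 i) + pt r2 i * norm (pt y1 i - pt y2 i))"
  by (rule co_lip_t)
 show "dominated S (%i. co1 (sc_s \<kappa>) i - co2 (sc_s \<kappa>) i) (%i. abs (pt r1 i - pt r2 i) + norm (pt y1 i - pt y2 i))"
  by (rule co_lip[OF nice_s[OF kb]])
 show "dominated S (%i. co1 (sc_g \<kappa>) i - co2 (sc_g \<kappa>) i) (%i. abs (pt r1 i - pt r2 i) + norm (pt y1 i - pt y2 i))"
  by (rule co_lip[OF nice_g[OF kb]])
 show "dominated S (%i. co1 (sc_h \<kappa>) i - co2 (sc_h \<kappa>) i) (%i. abs (pt r1 i - pt r2 i) + norm (pt y1 i - pt y2 i))"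
  by (rule co_lip[OF nice_h[OF kb]])
 show "dominated S (%i. co1 (sc_eta \<kappa>) i - co2 (sc_eta \<kappa>) i) (%i. abs (pt r1 i - pt r2 i) + norm (pt y1 i - pt y2 i))"
  by (rule co_lip[OF nice_eta[OF kb]])
 show "dominated S (%i. norm (ze i)) (%i. norm (pt y1 i - pt y2 i))" by (rule ze_dom)
qed

end

section \<open>The balance law where both fluids are present\<close>

context flow_pair begin

lemma W_eq: "ts.W i = norm (pt y1 i - pt y2 i)" and w_eq: "ts.w i = pt y1 i - pt y2 i"
 by (simp_all add: ts.W_def ts.w_def)

lemma Lq_bdd: "bounded_on S ts.Lq"
proof (rule domI[of "((2 / \<kappa>) powr m)\<^sup>2 * (2 / \<kappa>)"])
 fix i assume i: "i \<in> S"
 note P = SD(3-6)[OF i]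
 have "(pt r1 i + pt r2 i) powr m <= (2 / \<kappa>) powr m" using P m by (intro powr_mono2) auto
 then have 1: "((pt r1 i + pt r2 i) powr m)\<^sup>2 <= ((2 / \<kappa>) powr m)\<^sup>2" by (intro power_mono) auto
 have 2: "abs (pt r1 i - pt r2 i) <= 2 / \<kappa>" using P by (simp add: abs_le_iff)
 have "ts.Lq i <= ((2 / \<kappa>) powr m)\<^sup>2 * (2 / \<kappa>)" unfolding ts.Lq_def by (rule mult_mono[OF 1 2]) auto
 moreover have "0 <= ts.Lq i" by (simp add: ts.Lq_def)
 ultimately show "abs (ts.Lq i) <= ((2 / \<kappa>) powr m)\<^sup>2 * (2 / \<kappa>) * 1" by simp
qed (use \<kappa> in simp)

lemma Pm_bdd: "bounded_on S (%i. Pm m (pt r1 i) (pt r2 i))"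
proof (rule domI[of "((1 / \<kappa>) powr m)\<^sup>2"])
 fix i assume i: "i \<in> S"
 note P = SD(3-6)[OF i]
 have 1: "pt r1 i powr m <= (1 / \<kappa>) powr m" "pt r2 i powr m <= (1 / \<kappa>) powr m" using P m by (auto intro!: powr_mono2)
 have "Pm m (pt r1 i) (pt r2 i) <= ((1 / \<kappa>) powr m)\<^sup>2" unfolding Pm_def power2_eq_square by (rule mult_mono[OF 1]) auto
 then show "abs (Pm m (pt r1 i) (pt r2 i)) <= ((1 / \<kappa>) powr m)\<^sup>2 * 1" using Pm_nonneg[of m "pt r1 i" "pt r2 i"] by simp
qed simp

lemma AA_bdd: "bounded_on S (%i. AA m (fst i) (pt r1 i) (pt r2 i))"
proof (rule dom_trans[OF _ Lq_bdd], rule domI[of "4 * (m + 8)"])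
 fix i assume i: "i \<in> S"
 note P = SD(1-6)[OF i]
 have "abs (AA m (fst i) (pt r1 i) (pt r2 i)) <= 4 * (m + 8) * D1 m (pt r1 i) (pt r2 i)" using AA_bound[of "fst i" m "pt r1 i" "pt r2 i"] P m by simp
 also have "... <= 4 * (m + 8) * ts.Lq i" unfolding ts.Lq_def using D1_le_linear P m by (intro mult_left_mono) auto
 finally show "abs (AA m (fst i) (pt r1 i) (pt r2 i)) <= 4 * (m + 8) * ts.Lq i" .
qed (use m in simp)

text \<open>For a fixed cut-off scale the functions in question vanish where the density is at most that scale,
so a singular factor 1/r costs only a constant. These bounds depend on the scale and serve only to
justify integrations.\<close>

lemma cutoff_bdd:
 assumes "0 < \<eta>" "bounded_on S (%i. pt r i * f i)" "!!i. i \<in> S ==> pt r i <= fst i ==> f i = 0"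
 shows "bounded_on {i \<in> S. fst i = \<eta>} f"
proof -
 obtain c where c: "0 <= c" "!!i. i \<in> S ==> abs (pt r i * f i) <= c * 1" using assms(2) unfolding dominated_def by blast
 show ?thesis
 proof (rule domI[of "c / \<eta>"])
  fix i assume i: "i \<in> {i \<in> S. fst i = \<eta>}"
  show "abs (f i) <= c / \<eta> * 1"
  proof (cases "pt r i <= \<eta>")
   case True then show ?thesis using assms(1) assms(3)[of i] c(1) i by simp
  next
   case False
   have "\<eta> * abs (f i) <= abs (pt r i * f i)" unfolding abs_mult using False by (intro mult_right_mono) auto
   also have "... <= c" using c(2)[of i] i by simp
   finally show ?thesis using assms(1) by (simp add: field_simps)
  qed
 qed (use c assms in simp)
qed

lemma cutoff_zero:
 "i \<in> S ==> pt r1 i <= fst i ==> ts.A1 i = 0" "i \<in> S ==> pt r2 i <= fst i ==> ts.A2 i = 0"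
 "i \<in> S ==> pt r1 i <= fst i ==> ts.fp i = 0" "i \<in> S ==> pt r2 i <= fst i ==> ts.fq i = 0"
 using SD(1)[of i] by (auto simp: ts.A1_def ts.A2_def ts.fp_def ts.fq_def AD_def dprof_def prof_eq_0)

lemma cutoff_bounds:
 assumes "0 < \<eta>"
 shows "bounded_on {i \<in> S. fst i = \<eta>} ts.A1" "bounded_on {i \<in> S. fst i = \<eta>} ts.A2"
  "bounded_on {i \<in> S. fst i = \<eta>} ts.fp" "bounded_on {i \<in> S. fst i = \<eta>} ts.fq"
proof -
 have r: "dominated S (pt r1) (pt r1)" "dominated S (pt r2) (pt r2)" using SD(3,4) by (auto intro!: dom_refl simp: less_imp_le)
 show "bounded_on {i \<in> S. fst i = \<eta>} ts.A1"
  by (rule cutoff_bdd[OF assms dom_trans[OF ts.rA1 Lq_bdd] cutoff_zero(1)])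
 show "bounded_on {i \<in> S. fst i = \<eta>} ts.A2"
  by (rule cutoff_bdd[OF assms dom_trans[OF ts.sA2 Lq_bdd] cutoff_zero(2)])
 show "bounded_on {i \<in> S. fst i = \<eta>} ts.fp"
  by (rule cutoff_bdd[OF assms _ cutoff_zero(3)]) (use dom_trans[OF ts.fp_mult[OF r(1)] Pm_bdd] in \<open>simp_all add: mult.commute\<close>)
 show "bounded_on {i \<in> S. fst i = \<eta>} ts.fq"
  by (rule cutoff_bdd[OF assms _ cutoff_zero(4)]) (use dom_trans[OF ts.fq_mult[OF r(2)] Pm_bdd] in \<open>simp_all add: mult.commute\<close>)
qed

lemma al_eq: "fal \<kappa> (fst i) (pt r1 i) (pt y1 i) (pt r2 i) = ts.al i"
 and be_eq: "fbe \<kappa> (fst i) (pt r1 i) (pt y1 i) (pt r2 i) = ts.be i"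
 and th_eq: "fth \<kappa> (fst i) (pt r1 i) (pt y1 i) (pt r2 i) = ts.la i * co1 (sc_t \<kappa>) i"
 and xi_eq: "fxi \<kappa> (fst i) (pt r1 i) (pt y1 i) (pt r2 i) = ts.la i * co1 (sc_s \<kappa>) i"
 and cw_eq: "fc \<kappa> (fst i) (pt r1 i) (pt y1 i) (pt r2 i) (pt y2 i) = ts.cw i"
 by (simp_all add: fal_def fbe_def fth_def fxi_def fc_def ts.al_def ts.be_def ts.la_def ts.cw_def ts.w_def)

lemma zc:
 assumes i: "i \<in> S"
 shows "co1 (sc_eta \<kappa>) i * (ze i \<bullet> P - (ze i \<bullet> pt y1 i) * (pt y1 i \<bullet> P)) = ts.cw i \<bullet> P"
 unfolding ts.cw_def w_eq
proof (rule energy_vector_identity)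
 have e: "0 < co1 (sc_eta \<kappa>) i" using eta_pos[OF \<kappa> b] SD(3,5,7)[OF i] by (simp add: less_imp_le)
 then show "co1 (sc_eta \<kappa>) i \<noteq> 0" by simp
 show "pt y1 i \<bullet> pt y1 i < 1" using SD(7)[OF i] b by simp
 show "ze i = ((1 + ts.al i) / co1 (sc_eta \<kappa>) i) *\<^sub>R (pt y1 i - pt y2 i)
  + (((ts.be i + (1 + ts.al i)) / co1 (sc_eta \<kappa>) i / (1 - pt y1 i \<bullet> pt y1 i)) * (pt y1 i \<bullet> (pt y1 i - pt y2 i))) *\<^sub>R pt y1 i"
  by (simp add: ze_def fz_def fza_def fzb_def al_eq be_eq)
qed

definition enr where "enr \<eta> t x = energy \<kappa> m \<eta> (r1 t x) (y1 t x) (r2 t x) (y2 t x)"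
definition flx where "flx \<eta> t j x = flux \<kappa> m \<eta> (r1 t x) (y1 t x) (r2 t x) (y2 t x) j"

text \<open>The remainder estimate applies to all points at which both fluids are present at once, with one
constant for all cut-off scales.\<close>

lemma balance_positive:
 "\<exists>dE dF. (\<forall>i\<in>S. ((%s. enr (fst i) s (ps i)) has_real_derivative dE i) (at (tm i) within {t0..t1})) &
  (\<forall>i\<in>S. \<forall>j. ((%s. flx (fst i) (tm i) j (ps i + s *\<^sub>R axis j 1)) has_real_derivative dF i j) (at 0)) &
  dominated S (%i. dE i + (\<Sum>j\<in>UNIV. dF i j) + qe i / 4 * (ts.fp i * (ts.w i \<bullet> pt p1 i) - ts.fq i * (ts.w i \<bullet> pt p2 i))) ts.Er &
  (\<forall>\<eta>>0. bounded_on {i \<in> S. fst i = \<eta>} dE & (\<forall>j. bounded_on {i \<in> S. fst i = \<eta>} (%i. dF i j)))"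
proof -
 obtain C where C0: "0 <= C" and C: "\<forall>\<eta> S s0 \<rho> \<sigma> (u :: real => real ^ 'd) v \<rho>' \<sigma>' u' v'. 0 < \<eta> & admissible \<kappa> b L S s0 \<rho> \<sigma> u v \<rho>' \<sigma>' u' v' -->
  (\<exists>RQ Ra Rc Rs. abs RQ <= C * (norm (u s0 - v s0))\<^sup>2 & (\<forall>j. abs (Ra j) <= C & abs (Rc j) <= C * norm (u s0 - v s0) & abs (Rs j) <= C) &
   ((%s. energy \<kappa> m \<eta> (\<rho> s) (u s) (\<sigma> s) (v s)) has_real_derivative energy_rate \<kappa> m \<eta> (\<rho> s0) (u s0) (\<sigma> s0) (v s0) \<rho>' \<sigma>' (u' - v') RQ) (at s0 within S) &
   (\<forall>j. ((%s. flux \<kappa> m \<eta> (\<rho> s) (u s) (\<sigma> s) (v s) j) has_real_derivative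
    flux_rate \<kappa> m \<eta> (\<rho> s0) (u s0) (\<sigma> s0) (v s0) j \<rho>' \<sigma>' (u' - v') RQ (Ra j) (Rc j) (Rs j)) (at s0 within S)))"
  using energy_flux_derivs[OF \<kappa> b L m(1)] by blast
 define XE where "XE i q = ts.A1 i * pt rt1 i + ts.A2 i * pt rt2 i + (1 / 2) * (ts.fp i * pt rt1 i + ts.fq i * pt rt2 i) * qe i
    + (1 / 2) * ts.f12 i * (2 * (ze i \<bullet> (pt yt1 i - pt yt2 i)) + q)" for i q
 define Ya where "Ya i j = Y1 (tm i) j (ps i)" for i :: "real \<times> real \<times> (real ^ 'd)" and j
 define Yb where "Yb i j = Y2 (tm i) j (ps i)" for i :: "real \<times> real \<times> (real ^ 'd)" and j
 define XF where "XF i j q ra rc rs = (((1 / 2) *\<^sub>R (pt y1 i + pt y2 i)) $ j + ts.la i * co1 (sc_t \<kappa>) i * pt y1 i $ j) * (ts.A1 i * pt p1 i $ j + ts.A2 i * pt p2 i $ j)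
     + AA m (fst i) (pt r1 i) (pt r2 i) * ra
     + ((ts.A1 i / 2 + ts.f12 i) * pt p1 i $ j + (- ts.A2 i / 2 - ts.f12 i) * pt p2 i $ j) * ts.cw i $ j
     + ts.Mi i * ((1 + ts.al i) * (Ya i j - Yb i j) $ j + ts.be i * (pt y1 i \<bullet> (Ya i j - Yb i j)) * pt y1 i $ j + rc)
     + (1 / 2) * (ts.fp i * pt p1 i $ j + ts.fq i * pt p2 i $ j) * qe i * (((1 / 2) *\<^sub>R (pt y1 i + pt y2 i)) $ j + ts.la i * co1 (sc_s \<kappa>) i * pt y1 i $ j)
     + (1 / 2) * ts.f12 i * (2 * (ze i \<bullet> (Ya i j - Yb i j)) + q) * (((1 / 2) *\<^sub>R (pt y1 i + pt y2 i)) $ j + ts.la i * co1 (sc_s \<kappa>) i * pt y1 i $ j)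
     + (1 / 2) * ts.f12 i * qe i * rs" for i j q ra rc rs
 note rates = ts.A1_def ts.A2_def ts.fp_def ts.fq_def qe_def ts.f12_def ze_def ts.Mi_def
 have XE_rate: "energy_rate \<kappa> m (fst i) (pt r1 i) (pt y1 i) (pt r2 i) (pt y2 i) (pt rt1 i) (pt rt2 i) (pt yt1 i - pt yt2 i) q = XE i q"
  for i q by (simp add: energy_rate_def XE_def rates)
 have XF_rate: "flux_rate \<kappa> m (fst i) (pt r1 i) (pt y1 i) (pt r2 i) (pt y2 i) j (pt p1 i $ j) (pt p2 i $ j) (Ya i j - Yb i j) q ra rc rs
   = XF i j q ra rc rs" for i j q ra rc rs
  unfolding flux_rate_def XF_def rates al_eq be_eq th_eq xi_eq cw_eq by simp
 have "\<forall>i\<in>S. \<exists>q. abs q <= C * (ts.W i)\<^sup>2 & ((%s. enr (fst i) s (ps i)) has_real_derivative XE i q) (at (tm i) within {t0..t1})"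
 proof
  fix i assume i: "i \<in> S"
  note F1 = reduced_flowD[OF flow1 SD(2,3)[OF i]] and F2 = reduced_flowD[OF flow2 SD(2,4)[OF i]]
  have "0 < fst i & admissible \<kappa> b L {t0..t1} (tm i) (%s. r1 s (ps i)) (%s. r2 s (ps i)) (%s. y1 s (ps i)) (%s. y2 s (ps i))
    (pt rt1 i) (pt rt2 i) (pt yt1 i) (pt yt2 i)"
   using SD(1-8,11-14)[OF i] F1(3,4) F2(3,4) by (simp add: admissible_def)
  from C[rule_format, OF this] show "\<exists>q. abs q <= C * (ts.W i)\<^sup>2 & ((%s. enr (fst i) s (ps i)) has_real_derivative XE i q) (at (tm i) within {t0..t1})"
   unfolding enr_def XE_rate W_eq by blast
 qed
 from bchoice[OF this] obtain RQt where RQt: "!!i. i \<in> S ==> abs (RQt i) <= C * (ts.W i)\<^sup>2"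
  "!!i. i \<in> S ==> ((%s. enr (fst i) s (ps i)) has_real_derivative XE i (RQt i)) (at (tm i) within {t0..t1})" by blast
 define P where "P i j q ra rc rs \<longleftrightarrow> abs q <= C * (ts.W i)\<^sup>2 & abs ra <= C & abs rc <= C * ts.W i & abs rs <= C &
   ((%s. flx (fst i) (tm i) j (ps i + s *\<^sub>R axis j 1)) has_real_derivative XF i j q ra rc rs) (at 0)" for i j q ra rc rs
 have "\<exists>q ra rc rs. P i j q ra rc rs" if i: "i \<in> S" for i j
 proof -
  note F1 = reduced_flowD[OF flow1 SD(2,3)[OF i]] and F2 = reduced_flowD[OF flow2 SD(2,4)[OF i]]
  have pj: "abs (pt p1 i $ j) <= L" "abs (pt p2 i $ j) <= L"
   using SD(9,10)[OF i] component_le_norm_cart[of "pt p1 i" j] component_le_norm_cart[of "pt p2 i" j] by auto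
  define cr where "cr f s = (f (tm i) (ps i + s *\<^sub>R axis j 1))" for f :: "real => real ^ 'd => real" and s :: real
  define cv where "cv f s = (f (tm i) (ps i + s *\<^sub>R axis j 1))" for f :: "real => real ^ 'd => real ^ 'd" and s :: real
  have c0: "cr f 0 = pt f i" "cv g 0 = pt g i" for f g by (auto simp: cr_def cv_def)
  have ad: "0 < fst i & admissible \<kappa> b L UNIV 0 (cr r1) (cr r2) (cv y1) (cv y2) (pt p1 i $ j) (pt p2 i $ j) (Ya i j) (Yb i j)"
   unfolding admissible_def c0 unfolding cr_def[abs_def] cv_def[abs_def] Ya_def Yb_def
   using SD(1-8,15,16)[OF i] pj F1(5,6) F2(5,6) by simp
  from C[rule_format, OF ad, unfolded c0]
  obtain q Ra Rc Rs where q: "abs q <= C * (norm (pt y1 i - pt y2 i))\<^sup>2"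
   "\<forall>j. abs (Ra j) <= C & abs (Rc j) <= C * norm (pt y1 i - pt y2 i) & abs (Rs j) <= C"
   "\<forall>k. ((%s. flux \<kappa> m (fst i) (cr r1 s) (cv y1 s) (cr r2 s) (cv y2 s) k) has_real_derivative flux_rate \<kappa> m (fst i) (pt r1 i) (pt y1 i)
    (pt r2 i) (pt y2 i) k (pt p1 i $ j) (pt p2 i $ j) (Ya i j - Yb i j) q (Ra k) (Rc k) (Rs k)) (at 0)" by blast
  have "P i j q (Ra j) (Rc j) (Rs j)" unfolding P_def using q(1,2) q(3)[rule_format, of j, unfolded XF_rate] by (simp add: W_eq flx_def cr_def cv_def)
  then show ?thesis by blast
 qed
 then obtain RQ Ra Rc Rs where "!!i j. i \<in> S ==> P i j (RQ i j) (Ra i j) (Rc i j) (Rs i j)" by metis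
 note RR = this[unfolded P_def]
 have dR: "dominated S RQt (%i. (ts.W i)\<^sup>2)" "!!j. dominated S (%i. RQ i j) (%i. (ts.W i)\<^sup>2)" "!!j. dominated S (%i. Rc i j) ts.W"
  "!!j. bounded_on S (%i. Ra i j)" "!!j. bounded_on S (%i. Rs i j)"
  using RQt(1) RR by (auto intro!: domI[OF C0])
 have dQ: "dominated S qe (%i. (ts.W i)\<^sup>2)" using qe_dom by (simp add: W_eq)
 have rem: "dominated S (%i. XE i (RQt i) + (\<Sum>j\<in>UNIV. XF i j (RQ i j) (Ra i j) (Rc i j) (Rs i j))
   + qe i / 4 * (ts.fp i * (ts.w i \<bullet> pt p1 i) - ts.fq i * (ts.w i \<bullet> pt p2 i))) ts.Er"
  unfolding XE_def XF_def Ya_def Yb_def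
  by (rule ts.remainder_dominated[OF zc reduced_flowD(11)[OF flow1 SD(2,3)] reduced_flowD(11)[OF flow2 SD(2,4)]
     reduced_flowD(12)[OF flow1 SD(2,3)] reduced_flowD(12)[OF flow2 SD(2,4)] dQ dR])
 have bdd: "bounded_on {i \<in> S. fst i = \<eta>} (%i. XE i (RQt i))"
  "bounded_on {i \<in> S. fst i = \<eta>} (%i. XF i j (RQ i j) (Ra i j) (Rc i j) (Rs i j))" if eps: "0 < \<eta>" for \<eta> j
 proof -
  define S' where "S' = {i \<in> S. fst i = \<eta>}"
  have mo: "dominated S f g ==> dominated S' f g" for f g by (rule dom_mono) (auto simp: S'_def)
  note cu = cutoff_bounds[OF eps, folded S'_def]
  have W2: "bounded_on S (%i. (ts.W i)\<^sup>2)" using dom_bdd[OF ts.W_bdd ts.W_bdd] by (simp add: power2_eq_square)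
  have q1: "bounded_on S' qe" by (rule mo[OF dom_trans[OF dQ W2]])
  have rq: "bounded_on S' RQt" "bounded_on S' (%i. RQ i j)" "bounded_on S' (%i. Rc i j)"
   "bounded_on S' (%i. Ra i j)" "bounded_on S' (%i. Rs i j)"
   using dom_trans[OF dR(1) W2] dom_trans[OF dR(2) W2] dom_trans[OF dR(3) ts.W_bdd] dR(4,5) by (auto intro: mo)
  have f12: "bounded_on S' ts.f12" by (rule mo[OF dom_trans[OF ts.f12_Pm Pm_bdd]])
  have rt: "bounded_on S' (pt rt1)" "bounded_on S' (pt rt2)"
   "bounded_on S (%i. norm (pt yt1 i))" "bounded_on S (%i. norm (pt yt2 i))"
   using SD(11-14) by (auto intro!: domI[OF L] simp: S'_def)
  have zb: "bounded_on S (%i. norm (ze i))" by (rule dom_trans[OF ze_dom]) (use ts.W_bdd in \<open>simp add: W_eq[abs_def]\<close>)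
  have zt: "bounded_on S' (%i. ze i \<bullet> (pt yt1 i - pt yt2 i))"
   using dom_inner[OF zb dom_norm_diff[OF rt(3,4)]] by (auto intro: mo)
  show "bounded_on {i \<in> S. fst i = \<eta>} (%i. XE i (RQt i))"
   unfolding XE_def S'_def[symmetric] by (intro dom_add dom_bdd dom_const cu rt(1,2) q1 rq f12 zt)
  have YY: "bounded_on S (%i. norm (Ya i j - Yb i j))" unfolding Ya_def Yb_def by (intro dom_norm_diff ts.jac_bounds)
  have y: "bounded_on S' (%i. (Ya i j - Yb i j) $ j)" "bounded_on S' (%i. pt y1 i \<bullet> (Ya i j - Yb i j))" "bounded_on S' (%i. ze i \<bullet> (Ya i j - Yb i j))"
   by (rule mo[OF dom_nth[OF YY]], rule mo, use dom_inner[OF ts.vec_bounds(1) YY] in simp, rule mo, use dom_inner[OF zb YY] in simp)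
  have U: "bounded_on S' (%i. ((1 / 2) *\<^sub>R (pt y1 i + pt y2 i)) $ j)"
   by (rule mo, rule dom_cong[OF dom_bdd[OF dom_const[of _ "1 / 2"] dom_nth[OF dom_norm_add[OF ts.vec_bounds(1,2)], of j]]]) simp
  have nth: "bounded_on S' (%i. pt y1 i $ j)" "bounded_on S' (%i. pt p1 i $ j)" "bounded_on S' (%i. pt p2 i $ j)"
   using ts.vec_bounds by (auto intro!: mo dom_nth)
  have la: "bounded_on S' ts.la" "bounded_on S' (co1 (sc_t \<kappa>))" "bounded_on S' (co1 (sc_s \<kappa>))"
   "bounded_on S' ts.al" "bounded_on S' ts.be"
   by (intro mo ts.la_bdd co_bdd nice_t[OF \<kappa> b] nice_s[OF \<kappa> b] ts.alpha_beta)+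
  have cw: "bounded_on S' (%i. ts.cw i $ j)"
  proof -
   have "bounded_on S (%i. norm ((1 + ts.al i) *\<^sub>R ts.w i))"
    using dom_norm_scale[OF dom_add[OF dom_const ts.alpha_beta(5)] ts.w_bdd, of 1] by simp
   moreover have "bounded_on S (%i. norm ((ts.be i * (pt y1 i \<bullet> ts.w i)) *\<^sub>R pt y1 i))"
    using dom_norm_scale[OF dom_bdd[OF ts.alpha_beta(6) dom_inner[OF ts.vec_bounds(1) ts.w_bdd]] ts.vec_bounds(1)] by simp
   ultimately show ?thesis unfolding ts.cw_def by (intro mo dom_nth dom_norm_add)
  qed
  have am: "bounded_on S' (%i. AA m (fst i) (pt r1 i) (pt r2 i))" "bounded_on S' ts.Mi"
   by (intro mo AA_bdd dom_trans[OF ts.M_Lq Lq_bdd])+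
  have half: "bounded_on S' (%i. f i / 2)" if "bounded_on S' f" for f
   using dom_bdd[OF dom_const[of _ "1/2"] that] by simp
  show "bounded_on {i \<in> S. fst i = \<eta>} (%i. XF i j (RQ i j) (Ra i j) (Rc i j) (Rs i j))"
   unfolding XF_def S'_def[symmetric]
   by (intro dom_add dom_diff dom_bdd dom_minus dom_const half cu q1 rq f12 y U nth la cw am)
 qed
 show ?thesis
  by (rule exI[of _ "%i. XE i (RQt i)"], rule exI[of _ "%i j. XF i j (RQ i j) (Ra i j) (Rc i j) (Rs i j)"])
   (use RQt RR rem bdd in blast)
qed

text \<open>The flux that absorbs the cubic term.\<close>

definition hardy where
 "hardy \<eta> t j x = prof m \<eta> (r1 t x) * prof m \<eta> (r2 t x) * norm (y1 t x - y2 t x) ^ 3 * N j x"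

text \<open>The divergence of this flux is positive up to terms controlled by the distance. Away from the
boundary, where N need not be transversal, the density is bounded below and f' is controlled by f.\<close>

lemma hardy_positive:
 "\<exists>dH C. 0 <= C & (\<forall>i\<in>S. \<forall>j. ((%s. hardy (fst i) (tm i) j (ps i + s *\<^sub>R axis j 1)) has_real_derivative dH i j) (at 0)) &
  (\<forall>i\<in>S. c0 * ((ts.fp i + ts.fq i) * ts.W i ^ 3) <= (\<Sum>j\<in>UNIV. dH i j) + C * ts.Er i) &
  (\<forall>\<eta>>0. \<forall>j. bounded_on {i \<in> S. fst i = \<eta>} (%i. dH i j))"
proof -
 define Yw where "Yw i j = Y1 (tm i) j (ps i) - Y2 (tm i) j (ps i)" for i :: "real \<times> real \<times> (real ^ 'd)" and j
 define Ni where "Ni i j = N j (ps i)" for i :: "real \<times> real \<times> (real ^ 'd)" and j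
 define Ni' where "Ni' i j = N' j (ps i)" for i :: "real \<times> real \<times> (real ^ 'd)" and j
 define dH where "dH i j = (ts.fp i * pt p1 i $ j + ts.fq i * pt p2 i $ j) * ts.W i ^ 3 * Ni i j
   + ts.f12 i * ((3 * ts.W i * (ts.w i \<bullet> Yw i j)) * Ni i j + ts.W i ^ 3 * Ni' i j)" for i j
 have NB: "0 <= NB" using N(1)[of undefined undefined] by linarith
 have YY: "bounded_on S (%i. norm (Yw i j))" for j unfolding Yw_def by (intro dom_norm_diff ts.jac_bounds)
 have NN: "bounded_on S (%i. Ni i j)" "bounded_on S (%i. Ni' i j)" for j
  using N(1,2) by (auto intro!: domI[OF NB] simp: Ni_def Ni'_def)
 have der: "((%s. hardy (fst i) (tm i) j (ps i + s *\<^sub>R axis j 1)) has_real_derivative dH i j) (at 0)" if i: "i \<in> S" for i j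
 proof -
  note F1 = reduced_flowD[OF flow1 SD(2,3)[OF i]] and F2 = reduced_flowD[OF flow2 SD(2,4)[OF i]]
  define x where "x = ps i"
  define t where "t = tm i"
  note fo = x_def[symmetric] t_def[symmetric]
  have f1: "((%s. prof m (fst i) (r1 t (x + s *\<^sub>R axis j 1))) has_real_derivative dprof m (fst i) (r1 t x) * p1 t x $ j) (at 0)"
   using DERIV_chain2[OF prof_deriv[OF SD(1)[OF i]] F1(5)[of j, unfolded fo]] by simp
  have f2: "((%s. prof m (fst i) (r2 t (x + s *\<^sub>R axis j 1))) has_real_derivative dprof m (fst i) (r2 t x) * p2 t x $ j) (at 0)"
   using DERIV_chain2[OF prof_deriv[OF SD(1)[OF i]] F2(5)[of j, unfolded fo]] by simp
  have w3: "((%s. norm (y1 t (x + s *\<^sub>R axis j 1) - y2 t (x + s *\<^sub>R axis j 1)) ^ 3) has_real_derivative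
    3 * norm (y1 t x - y2 t x) * ((y1 t x - y2 t x) \<bullet> (Y1 t j x - Y2 t j x))) (at 0)"
   using norm_cubed_deriv[OF has_vector_derivative_diff[OF F1(6)[of j, unfolded fo] F2(6)[of j, unfolded fo]]] by simp
  show ?thesis unfolding hardy_def fo
   by (rule DERIV_cong[OF DERIV_mult[OF DERIV_mult[OF DERIV_mult[OF f1 f2] w3] N(4)[of j x]]])
    (simp add: dH_def ts.fp_def ts.fq_def ts.f12_def ts.W_def ts.w_def Yw_def Ni_def Ni'_def fo algebra_simps)
 qed
 define rest where "rest i = ts.f12 i * (\<Sum>j\<in>UNIV. (3 * ts.W i * (ts.w i \<bullet> Yw i j)) * Ni i j + ts.W i ^ 3 * Ni' i j)" for i
 have W0: "dominated S ts.W ts.W" by (rule dom_refl) (rule ts.W_nonneg)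
 have rest: "dominated S rest ts.Er"
  unfolding rest_def
 proof (rule ts.f12_W2, rule dom_sum)
  fix j
  have 1: "dominated S (%i. (3 * ts.W i * (ts.w i \<bullet> Yw i j)) * Ni i j) (%i. (ts.W i)\<^sup>2)"
   unfolding power2_eq_square by (intro dom_bdd2[OF dom_mult[OF dom_bdd[OF dom_const W0] ts.w_inner(1)[OF YY]] NN(1)])
  have 2: "dominated S (%i. ts.W i ^ 3 * Ni' i j) (%i. (ts.W i)\<^sup>2)"
   using dom_bdd2[OF dom_bdd[OF ts.W_bdd dom_mult[OF W0 W0]] NN(2)] by (simp add: power3_eq_cube power2_eq_square mult.assoc)
  show "dominated S (%i. (3 * ts.W i * (ts.w i \<bullet> Yw i j)) * Ni i j + ts.W i ^ 3 * Ni' i j) (%i. (ts.W i)\<^sup>2)"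
   by (rule dom_add[OF 1 2])
 qed simp
 have sumdH: "(\<Sum>j\<in>UNIV. dH i j) = ts.fp i * (\<Sum>j\<in>UNIV. pt p1 i $ j * Ni i j) * ts.W i ^ 3 + ts.fq i * (\<Sum>j\<in>UNIV. pt p2 i $ j * Ni i j) * ts.W i ^ 3 + rest i" for i
  by (simp add: dH_def rest_def sum.distrib sum_distrib_left sum_distrib_right algebra_simps)
 define K where "K = c0 + real CARD('d) * (L * NB)"
 have K0: "0 <= K" using c0 L NB by (simp add: K_def)
 have pN: "abs (\<Sum>j\<in>UNIV. p $ j * Ni i j) <= real CARD('d) * (L * NB)" if "norm p <= L" for p and i :: "real \<times> real \<times> (real ^ 'd)"
 proof -
  have "abs (p $ j * Ni i j) <= L * NB" for j
   unfolding abs_mult Ni_def using N(1) component_le_norm_cart[of p j] that L by (intro mult_mono) auto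
  then have "(\<Sum>j\<in>UNIV. abs (p $ j * Ni i j)) <= real (card (UNIV :: 'd set)) * (L * NB)" by (intro sum_bounded_above)
  then show ?thesis using sum_abs[of "%j. p $ j * Ni i j" UNIV] by linarith
 qed
 have r: "dominated S (pt r1) (pt r1)" "dominated S (pt r2) (pt r2)" using SD(3,4) by (auto intro!: dom_refl simp: less_imp_le)
 have W3: "dominated S (%i. ts.W i ^ 3) (%i. (ts.W i)\<^sup>2)"
  using dom_bdd[OF ts.W_bdd dom_mult[OF W0 W0]] by (simp add: power3_eq_cube power2_eq_square mult.assoc)
 obtain k1 where k1: "0 <= k1" "!!i. i \<in> S ==> abs (ts.W i ^ 3 * (ts.fp i * pt r1 i)) <= k1 * ts.Er i"
  using ts.Q_mult[OF W3 ts.fp_mult[OF r(1)]] unfolding dominated_def by blast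
 obtain k2 where k2: "0 <= k2" "!!i. i \<in> S ==> abs (ts.W i ^ 3 * (ts.fq i * pt r2 i)) <= k2 * ts.Er i"
  using ts.Q_mult[OF W3 ts.fq_mult[OF r(2)]] unfolding dominated_def by blast
 obtain k3 where k3: "0 <= k3" "!!i. i \<in> S ==> abs (rest i) <= k3 * ts.Er i"
  using rest unfolding dominated_def by blast
 have fpos: "0 <= ts.fp i" "0 <= ts.fq i" if "i \<in> S" for i
  using dprof_nonneg[of "fst i" m] SD(1)[OF that] m prof_nonneg by (auto simp: ts.fp_def ts.fq_def)
 have gain: "c0 * (f * w) <= f * X * w + K / \<rho>0 * E" 
  if "0 <= f" "0 <= w" "abs X <= real CARD('d) * (L * NB)" "r <= \<rho>0 --> c0 <= X" "w * (f * r) <= E" "0 <= E" for f w X r E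
 proof (cases "r <= \<rho>0")
  case True
  have "c0 * (f * w) <= X * (f * w)" using that True by (intro mult_right_mono) auto
  then show ?thesis using K0 \<rho>0 that by (simp add: mult_ac add_increasing2)
 next
  case False
  have "(c0 - X) * (f * w) <= K * (f * w)" unfolding K_def using that by (intro mult_right_mono) auto
  also have "... = K / \<rho>0 * (w * (f * \<rho>0))" using \<rho>0 by simp
  also have "... <= K / \<rho>0 * (w * (f * r))" using False that K0 \<rho>0 by (intro mult_left_mono) auto
  also have "... <= K / \<rho>0 * E" using that K0 \<rho>0 by (intro mult_left_mono) auto
  finally show ?thesis by (simp add: algebra_simps)
 qed
 define C where "C = K / \<rho>0 * k1 + K / \<rho>0 * k2 + k3"
 have C: "0 <= C" using K0 \<rho>0 k1 k2 k3 by (simp add: C_def)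
 have est: "c0 * ((ts.fp i + ts.fq i) * ts.W i ^ 3) <= (\<Sum>j\<in>UNIV. dH i j) + C * ts.Er i" if i: "i \<in> S" for i
 proof -
  have w: "0 <= ts.W i ^ 3" using ts.W_nonneg by simp
  have E: "0 <= ts.Er i" using ts.Er_nonneg i by blast
  have g1: "c0 * (ts.fp i * ts.W i ^ 3) <= ts.fp i * (\<Sum>j\<in>UNIV. pt p1 i $ j * Ni i j) * ts.W i ^ 3 + K / \<rho>0 * (k1 * ts.Er i)"
   by (rule gain[of _ _ _ "pt r1 i"]) (use fpos[OF i] w pN[OF SD(9)[OF i]] transversal(1)[OF SD(2,3)[OF i]] k1(2)[OF i] k1(1) E in \<open>auto simp: Ni_def\<close>)
  have g2: "c0 * (ts.fq i * ts.W i ^ 3) <= ts.fq i * (\<Sum>j\<in>UNIV. pt p2 i $ j * Ni i j) * ts.W i ^ 3 + K / \<rho>0 * (k2 * ts.Er i)"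
   by (rule gain[of _ _ _ "pt r2 i"]) (use fpos[OF i] w pN[OF SD(10)[OF i]] transversal(2)[OF SD(2,4)[OF i]] k2(2)[OF i] k2(1) E in \<open>auto simp: Ni_def\<close>)
  have "c0 * ((ts.fp i + ts.fq i) * ts.W i ^ 3) = c0 * (ts.fp i * ts.W i ^ 3) + c0 * (ts.fq i * ts.W i ^ 3)" by (simp add: algebra_simps)
  moreover have "C * ts.Er i = K / \<rho>0 * (k1 * ts.Er i) + K / \<rho>0 * (k2 * ts.Er i) + k3 * ts.Er i" by (simp add: C_def algebra_simps)
  moreover have "- rest i <= k3 * ts.Er i" using k3(2)[OF i] by linarith
  ultimately show ?thesis using g1 g2 unfolding sumdH by linarith
 qed
 have bdd: "bounded_on {i \<in> S. fst i = \<eta>} (%i. dH i j)" if eps: "0 < \<eta>" for \<eta> j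
 proof -
  define S' where "S' = {i \<in> S. fst i = \<eta>}"
  have mo: "dominated S f g ==> dominated S' f g" for f g by (rule dom_mono) (auto simp: S'_def)
  note cu = cutoff_bounds[OF eps, folded S'_def]
  have W1: "bounded_on S' (%i. ts.W i ^ 3)"
   using mo[OF dom_bdd[OF ts.W_bdd dom_bdd[OF ts.W_bdd ts.W_bdd]]] by (simp add: power3_eq_cube mult.assoc)
  have f12: "bounded_on S' ts.f12" by (rule mo[OF dom_trans[OF ts.f12_Pm Pm_bdd]])
  have nth: "bounded_on S' (%i. pt p1 i $ j)" "bounded_on S' (%i. pt p2 i $ j)"
   using ts.vec_bounds by (auto intro!: mo dom_nth)
  have wy: "bounded_on S' (%i. ts.w i \<bullet> Yw i j)" by (rule mo[OF dom_trans[OF ts.w_inner(1)[OF YY] ts.W_bdd]])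
  show ?thesis unfolding dH_def S'_def[symmetric]
   by (intro dom_add dom_bdd dom_const cu nth W1 f12 wy mo[OF NN(1)] mo[OF NN(2)] mo[OF ts.W_bdd])
 qed
 show ?thesis by (rule exI[of _ dH], rule exI[of _ C]) (use C der est bdd in blast)
qed

end

section \<open>The balance law of a single fluid\<close>

lemma energy_vacuum:
 assumes "0 < \<eta>" "s <= \<eta>"
 shows "energy \<kappa> m \<eta> r a s b = AA m \<eta> r 0" "flux \<kappa> m \<eta> r a s b j = AA m \<eta> r 0 * a $ j"
  "energy \<kappa> m \<eta> s b r a = AA m \<eta> r 0" "flux \<kappa> m \<eta> s b r a j = AA m \<eta> r 0 * a $ j"
 using assms by (auto simp: energy_def flux_def AA_def MM_def fc_def fal_def fbe_def fth_def lam_eq_0 prof_eq_0 prim_eq_0 field_simps)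

lemma AA_deriv:
 assumes "0 < \<eta>" "(r has_real_derivative r') (at s within S)"
 shows "((%s. AA m \<eta> (r s) 0) has_real_derivative AD m \<eta> (r s) 0 * r') (at s within S)"
proof -
 have "((%s. (prof m \<eta> (r s) - prof m \<eta> 0) * (prim m \<eta> (r s) - prim m \<eta> 0)) has_real_derivative
  (dprof m \<eta> (r s) * r' - 0) * (prim m \<eta> (r s) - prim m \<eta> 0) + (prof m \<eta> (r s) * r' - 0) * (prof m \<eta> (r s) - prof m \<eta> 0)) (at s within S)"
  using assms by (intro DERIV_mult DERIV_diff DERIV_const DERIV_chain2[OF prof_deriv] DERIV_chain2[OF prim_deriv])
 then show ?thesis unfolding AA_def by (rule DERIV_cong) (simp add: AD_def algebra_simps)
qed

lemma eventually_small:
 assumes "(f \<longlongrightarrow> (0::real)) F" "0 < \<eta>"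
 shows "\<forall>\<^sub>F x in F. f x <= \<eta>"
 using order_tendstoD(2)[OF assms] by eventually_elim simp

lemma time_tendsto:
 "reduced_flow \<kappa> b L t0 t1 r y rt yt p Y ==> t \<in> {t0..t1} ==> ((%s. r s x) \<longlongrightarrow> r t x) (at t within {t0..t1})"
 using reduced_flow_bounds(4)[of \<kappa> b L t0 t1 r y rt yt p Y t x] by (simp add: continuous_on_def)

lemma space_tendsto:
 assumes "reduced_flow \<kappa> b L t0 t1 r y rt yt p Y" "t \<in> {t0..t1}"
 shows "isCont (r t) x" "((%s. r t (x + s *\<^sub>R e)) \<longlongrightarrow> r t x) (at 0)"
proof -
 show c: "isCont (r t) x" using reduced_flow_bounds(1)[OF assms] by (simp add: continuous_on_eq_continuous_at)
 have "((%s. x + s *\<^sub>R e) \<longlongrightarrow> x + 0 *\<^sub>R e) (at 0)" by (intro tendsto_intros)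
 then show "((%s. r t (x + s *\<^sub>R e)) \<longlongrightarrow> r t x) (at 0)" using isCont_tendsto_compose[OF c, of "%s. x + s *\<^sub>R e" "at 0"] by simp
qed

lemma nice_isCont:
 assumes c: "nice \<kappa> b c" and f: "reduced_flow \<kappa> b L t0 t1 r y rt yt p Y" and t: "t \<in> {t0..t1}" and x: "0 < r t x"
 shows "isCont (%x. c (r t x) (y t x \<bullet> y t x)) x"
proof -
 obtain K where K: "0 <= K" "\<forall>r1 e1 r2 e2. in_range \<kappa> b r1 e1 & in_range \<kappa> b r2 e2 --> abs (c r1 e1 - c r2 e2) <= K * (abs (r1 - r2) + abs (e1 - e2))" using nice_lipschitz[OF c] by blast
 note cr = space_tendsto(1)[OF f t, of x] and cy = reduced_flowD(2)[OF f t x]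
 have cy': "((%z. y t z) \<longlongrightarrow> y t x) (at x)" using cy by (simp add: isCont_def)
 have cr': "(r t \<longlongrightarrow> r t x) (at x)" using cr by (simp add: isCont_def)
 have "((%z. K * (abs (r t z - r t x) + abs (y t z \<bullet> y t z - y t x \<bullet> y t x))) \<longlongrightarrow> K * (abs (r t x - r t x) + abs (y t x \<bullet> y t x - y t x \<bullet> y t x))) (at x)"
  by (intro tendsto_intros cr' cy')
 then have lim: "((%z. K * (abs (r t z - r t x) + abs (y t z \<bullet> y t z - y t x \<bullet> y t x))) \<longlongrightarrow> 0) (at x)" by simp
 have ev: "\<forall>\<^sub>F z in at x. norm (c (r t z) (y t z \<bullet> y t z) - c (r t x) (y t x \<bullet> y t x)) <= K * (abs (r t z - r t x) + abs (y t z \<bullet> y t z - y t x \<bullet> y t x))"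
  using order_tendstoD(1)[OF cr' x]
 proof eventually_elim
  fix z assume z: "0 < r t z"
  show "norm (c (r t z) (y t z \<bullet> y t z) - c (r t x) (y t x \<bullet> y t x)) <= K * (abs (r t z - r t x) + abs (y t z \<bullet> y t z - y t x \<bullet> y t x))"
   using K(2)[rule_format, of "r t z" "y t z \<bullet> y t z" "r t x" "y t x \<bullet> y t x"] reduced_flow_bounds(2,3)[OF f t] reduced_flowD(1)[OF f t] x z by simp
 qed
 have "((%z. c (r t z) (y t z \<bullet> y t z) - c (r t x) (y t x \<bullet> y t x)) \<longlongrightarrow> 0) (at x)"
  by (rule Lim_null_comparison[OF ev lim])
 then show ?thesis unfolding isCont_def by (rule LIM_zero_cancel)
qed

text \<open>Where one density vanishes, by continuity it stays below the cut-off scale nearby, so all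
derivatives of the cut-off quantities are those of the other fluid.\<close>

lemma balance_law_near_vacuum:
 assumes f: "reduced_flow \<kappa> b L t0 t1 r y rt yt p Y" and t: "t \<in> {t0..t1}" and r0: "r t x = 0" and eps: "0 < \<eta>"
  and E: "!!s z. r s z <= \<eta> ==> E s z = E' s z" and F: "!!s z j. r s z <= \<eta> ==> F s j z = F' s j z"
  and law: "balance_law t0 t1 E' F' M B t x"
 shows "balance_law t0 t1 E F M B t x"
proof -
 have e1: "\<forall>\<^sub>F s in at t within {t0..t1}. E s x = E' s x"
  using eventually_small[OF time_tendsto[OF f t, of x, unfolded r0] eps] by eventually_elim (rule E)
 have e2: "\<forall>\<^sub>F s in at 0. F t j (x + s *\<^sub>R axis j 1) = F' t j (x + s *\<^sub>R axis j 1)" for j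
  using eventually_small[OF space_tendsto(2)[OF f t, of x "axis j 1", unfolded r0] eps] by eventually_elim (rule F)
 have "r t x <= \<eta>" using r0 eps by simp
 then show ?thesis using law unfolding balance_law_def
  by (simp add: has_field_derivative_cong_eventually[OF e1] has_field_derivative_cong_eventually[OF e2] E F)
qed

text \<open>For a single fluid the energy is f g with flux f g y, and the leading terms cancel in r_t +
y.\<nabla>r = O(r).\<close>

lemma one_phase:
 assumes f: "reduced_flow \<kappa> b L t0 t1 r y rt yt p Y" and \<kappa>: "0 < \<kappa>" and b: "0 <= b" "b < 1" and L: "0 <= L" and m: "0 < m"
 shows "\<exists>C\<ge>0. \<forall>\<eta>>0. \<exists>M. \<forall>t\<in>{t0..t1}. \<forall>x :: real ^ 'd.
  balance_law t0 t1 (%t x. AA m \<eta> (r t x) 0) (%t j x. AA m \<eta> (r t x) 0 * y t x $ j) M (C * D1 m (r t x) 0) t x"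
proof -
 obtain K1 where K1: "0 <= K1" "\<forall>r f. in_range \<kappa> b r f --> abs (sc_t \<kappa> r f) <= K1 * r"
  using vanishing_bound[OF \<kappa> b L m nice_t[OF \<kappa> b]] at_vacuum(4)[OF \<kappa> b] by blast
 obtain K2 where K2: "0 <= K2" "\<forall>r e. in_range \<kappa> b r e --> abs (sc_g \<kappa> r e) <= K2" using nice_bounded[OF nice_g[OF \<kappa> b]] by blast
 obtain K3 where K3: "0 <= K3" "\<forall>r e. in_range \<kappa> b r e --> abs (sc_h \<kappa> r e) <= K3" using nice_bounded[OF nice_h[OF \<kappa> b]] by blast
 define dL where "dL = real CARD('d) * L"
 have dL: "0 <= dL" using L by (simp add: dL_def)
 define K where "K = K1 * L + K2 * dL + K3 * dL"
 have K: "0 <= K" using K1 K2 K3 L dL by (simp add: K_def)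
 define C where "C = 5 * (m + 8) * K + 4 * (m + 8) * dL"
 have C: "0 <= C" using K dL m by (simp add: C_def)
 show ?thesis
 proof (rule exI[of _ C], rule conjI[OF C], intro allI impI)
  fix \<eta> :: real assume eps: "0 < \<eta>"
  define Bm where "Bm = ((1 / \<kappa>) powr m)\<^sup>2 * (1 / \<kappa>)"
  have Bm: "0 <= Bm" using \<kappa> by (simp add: Bm_def)
  define M where "M = 5 * (m + 8) * Bm / \<eta> * L + 4 * (m + 8) * Bm * L"
  have M: "0 <= M" "5 * (m + 8) * Bm / \<eta> * L <= M" using m Bm eps L by (auto simp: M_def)
  show "\<exists>M. \<forall>t\<in>{t0..t1}. \<forall>x :: real ^ 'd.
   balance_law t0 t1 (%t x. AA m \<eta> (r t x) 0) (%t j x. AA m \<eta> (r t x) 0 * y t x $ j) M (C * D1 m (r t x) 0) t x"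
  proof (rule exI[of _ M], intro ballI allI)
   fix t x assume t: "t \<in> {t0..t1}"
   note B = reduced_flow_bounds(2,3)[OF f t, of x]
   show "balance_law t0 t1 (%t x. AA m \<eta> (r t x) 0) (%t j x. AA m \<eta> (r t x) 0 * y t x $ j) M (C * D1 m (r t x) 0) t x"
   proof (cases "0 < r t x")
    case False
    then have r0: "r t x = 0" using B(1) by simp
    have z: "AA m \<eta> s 0 = 0" if "s <= \<eta>" for s using that eps by (simp add: AA_def prof_eq_0 prim_eq_0)
    have "balance_law t0 t1 (%_ _. 0) (%_ _ _. 0) M (C * D1 m (r t x) 0) t x"
     unfolding balance_law_def by (rule exI[of _ 0], rule exI[of _ "%_. 0"]) (use M r0 in \<open>simp add: D1_def\<close>)
    then show ?thesis by (rule balance_law_near_vacuum[OF f t r0 eps, rotated 2]) (simp_all add: z)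
   next
    case True
    note F = reduced_flowD[OF f t True]
    define rr where "rr = r t x"
    define a where "a = y t x"
    have rb: "0 < rr" "0 <= rr" "rr <= 1 / \<kappa>" using True B by (auto simp: rr_def)
    have a1: "norm a <= 1" using small_norm[OF \<kappa> b L m F(1)] by (simp add: a_def)
    have e: "0 <= a \<bullet> a" "a \<bullet> a <= b" using F(1) by (auto simp: a_def)
    have D1e: "D1 m rr 0 = (rr powr m)\<^sup>2 * rr" using rb by (simp add: D1_def power2_eq_square)
    have D1B: "D1 m rr 0 <= Bm" unfolding D1e Bm_def using rb m by (intro mult_mono power_mono powr_mono2) auto
    have D10: "0 <= D1 m rr 0" using rb by (simp add: D1_nonneg)
    have ADb: "abs (rr * AD m \<eta> rr 0) <= 5 * (m + 8) * D1 m rr 0" using AD_bound[OF eps m, of rr 0] rb by (simp add: D1e)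
    have AAb: "abs (AA m \<eta> rr 0) <= 4 * (m + 8) * D1 m rr 0" using AA_bound[OF eps m, of rr 0] rb by simp
    have ADM: "abs (AD m \<eta> rr 0) <= 5 * (m + 8) * Bm / \<eta>"
    proof (cases "rr <= \<eta>")
     case True then show ?thesis using eps m Bm by (simp add: AD_def dprof_def prof_eq_0)
    next
     case False
     have "\<eta> * abs (AD m \<eta> rr 0) <= abs (rr * AD m \<eta> rr 0)" unfolding abs_mult using False by (intro mult_right_mono) auto
     also have "... <= 5 * (m + 8) * Bm" by (rule order_trans[OF ADb mult_left_mono[OF D1B]]) (use m in simp)
     finally show ?thesis using eps by (simp add: field_simps)
    qed
    have AAM: "abs (AA m \<eta> rr 0) <= 4 * (m + 8) * Bm" by (rule order_trans[OF AAb mult_left_mono[OF D1B]]) (use m in simp)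
    define P where "P = p t x"
    define e' where "e' = AD m \<eta> rr 0 * rt t x"
    define f' where "f' j = AD m \<eta> rr 0 * P $ j * a $ j + Y t j x $ j * AA m \<eta> rr 0" for j
    have d1: "((%s. AA m \<eta> (r s x) 0) has_real_derivative e') (at t within {t0..t1})"
     unfolding e'_def rr_def by (rule AA_deriv[OF eps F(3)])
    have d2: "((%s. AA m \<eta> (r t (x + s *\<^sub>R axis j 1)) 0 * y t (x + s *\<^sub>R axis j 1) $ j) has_real_derivative f' j) (at 0)" for j
     using DERIV_mult[OF AA_deriv[OF eps F(5)[of j]] nth_has_real_derivative[OF F(6)[of j], of j]] by (simp add: f'_def rr_def a_def P_def)
    have PL: "abs (P $ j) <= L" "abs (a $ j) <= 1" "abs (Y t j x $ j) <= L" for j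
     using component_le_norm_cart[of P j] component_le_norm_cart[of a j] component_le_norm_cart[of "Y t j x" j] F(9) F(10)[of j] a1 by (auto simp: P_def)
    have eM: "abs e' <= M" using abs_mult_le[OF ADM F(7)] M by (simp add: e'_def)
    have fM: "abs (f' j) <= M" for j
     using abs_mult_le[OF abs_mult_le[OF ADM PL(1)[of j]] PL(2)[of j]] abs_mult_le[OF PL(3)[of j] AAM] unfolding f'_def M_def by (simp add: mult.commute[of L])
    have ap: "abs (a \<bullet> P) <= L" using Cauchy_Schwarz_ineq2[of a P] mult_mono[OF a1 F(9)] L by (simp add: P_def)
    have sY: "abs (\<Sum>j\<in>UNIV. Y t j x $ j) <= dL"
    proof -
     have "(\<Sum>j\<in>UNIV. abs (Y t j x $ j)) <= real (card (UNIV :: 'd set)) * L" using PL by (intro sum_bounded_above) auto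
     then show ?thesis unfolding dL_def by (rule order_trans[OF sum_abs])
    qed
    have saY: "abs (\<Sum>j\<in>UNIV. a $ j * (Y t j x \<bullet> a)) <= dL"
    proof -
     have "abs (Y t j x \<bullet> a) <= L" for j
      using Cauchy_Schwarz_ineq2[of "Y t j x" a] mult_mono[OF F(10)[of j] a1] L by simp
     then have "abs (a $ j * (Y t j x \<bullet> a)) <= 1 * L" for j by (intro abs_mult_le PL)
     then have "(\<Sum>j\<in>UNIV. abs (a $ j * (Y t j x \<bullet> a))) <= real (card (UNIV :: 'd set)) * L" by (intro sum_bounded_above) simp
     then show ?thesis unfolding dL_def by (rule order_trans[OF sum_abs])
    qed
    have rest: "abs (rt t x + a \<bullet> P) <= K * rr"
    proof -
     have eq: "rt t x + a \<bullet> P = - (sc_t \<kappa> rr (a \<bullet> a) * (a \<bullet> P)) - rr * (sc_g \<kappa> rr (a \<bullet> a) * (\<Sum>j\<in>UNIV. Y t j x $ j) + sc_h \<kappa> rr (a \<bullet> a) * (\<Sum>j\<in>UNIV. a $ j * (Y t j x \<bullet> a)))"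
      unfolding F(11) by (simp add: rr_def a_def P_def algebra_simps)
     have 1: "abs (sc_t \<kappa> rr (a \<bullet> a) * (a \<bullet> P)) <= K1 * rr * L" using K1(2) rb e by (intro abs_mult_le ap) auto
     have 2: "abs (sc_g \<kappa> rr (a \<bullet> a) * (\<Sum>j\<in>UNIV. Y t j x $ j)) <= K2 * dL" using K2(2) rb e by (intro abs_mult_le sY) auto
     have 3: "abs (sc_h \<kappa> rr (a \<bullet> a) * (\<Sum>j\<in>UNIV. a $ j * (Y t j x \<bullet> a))) <= K3 * dL" using K3(2) rb e by (intro abs_mult_le saY) auto
     have "abs (rr * (sc_g \<kappa> rr (a \<bullet> a) * (\<Sum>j\<in>UNIV. Y t j x $ j) + sc_h \<kappa> rr (a \<bullet> a) * (\<Sum>j\<in>UNIV. a $ j * (Y t j x \<bullet> a)))) <= rr * (K2 * dL + K3 * dL)"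
      using 2 3 rb by (intro abs_mult_le) auto
     then have "abs (rt t x + a \<bullet> P) <= K1 * rr * L + rr * (K2 * dL + K3 * dL)" using 1 unfolding eq by linarith
     then show ?thesis by (simp add: K_def algebra_simps)
    qed
    have "e' + (\<Sum>j\<in>UNIV. f' j) = AD m \<eta> rr 0 * (rt t x + a \<bullet> P) + AA m \<eta> rr 0 * (\<Sum>j\<in>UNIV. Y t j x $ j)"
     by (simp add: e'_def f'_def sum.distrib sum_distrib_left inner_vec_def algebra_simps)
    also have "... <= 5 * (m + 8) * D1 m rr 0 * K + 4 * (m + 8) * D1 m rr 0 * dL"
    proof (rule add_mono)
     have "AD m \<eta> rr 0 * (rt t x + a \<bullet> P) <= abs (AD m \<eta> rr 0) * abs (rt t x + a \<bullet> P)" by (metis abs_ge_self abs_mult)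
     also have "... <= abs (AD m \<eta> rr 0) * (K * rr)" using rest by (intro mult_left_mono) auto
     also have "... = abs (rr * AD m \<eta> rr 0) * K" using rb by (simp add: abs_mult)
     also have "... <= 5 * (m + 8) * D1 m rr 0 * K" using ADb K by (intro mult_right_mono) auto
     finally show "AD m \<eta> rr 0 * (rt t x + a \<bullet> P) <= 5 * (m + 8) * D1 m rr 0 * K" .
     show "AA m \<eta> rr 0 * (\<Sum>j\<in>UNIV. Y t j x $ j) <= 4 * (m + 8) * D1 m rr 0 * dL" using abs_mult_le[OF AAb sY] by linarith
    qed
    also have "... = C * D1 m rr 0" by (simp add: C_def algebra_simps)
    finally have law: "e' + (\<Sum>j\<in>UNIV. f' j) <= C * D1 m (r t x) 0" by (simp add: rr_def)
    show ?thesis unfolding balance_law_def by (rule exI[of _ e'], rule exI[of _ f']) (use d1 d2 eM fM law in blast)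
   qed
  qed
 qed
qed

lemma one_phase_cont:
 assumes f: "reduced_flow \<kappa> b L t0 t1 r y rt yt p Y" and t: "t \<in> {t0..t1}" and eps: "0 < \<eta>"
 shows "isCont (%x. AA m \<eta> (r t x) 0) x" "isCont (%x. AA m \<eta> (r t x) 0 * y t x $ j) x"
proof -
 note cr = space_tendsto(1)[OF f t, of x]
 have cp: "isCont (%x. prof m \<eta> (r t x)) x" by (rule isCont_o2[OF cr DERIV_isCont[OF prof_deriv[OF eps]]])
 have cg: "isCont (%x. prim m \<eta> (r t x)) x" by (rule isCont_o2[OF cr DERIV_isCont[OF prim_deriv[OF eps]]])
 show 1: "isCont (%x. AA m \<eta> (r t x) 0) x" unfolding AA_def by (intro continuous_intros cp cg)
 show "isCont (%x. AA m \<eta> (r t x) 0 * y t x $ j) x"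
 proof (cases "0 < r t x")
  case True
  show ?thesis by (intro isCont_mult 1 isCont_vec_nth reduced_flowD(2)[OF f t True])
 next
  case False
  then have r0: "r t x = 0" using reduced_flow_bounds(2)[OF f t, of x] by simp
  have "\<forall>\<^sub>F z in nhds x. r t z < \<eta>"
   using order_tendstoD(2)[OF tendsto_at_iff_tendsto_nhds[THEN iffD1, OF cr[unfolded isCont_def]], of \<eta>] r0 eps by simp
  then have "\<forall>\<^sub>F z in nhds x. AA m \<eta> (r t z) 0 * y t z $ j = 0"
   by eventually_elim (use eps in \<open>simp add: AA_def prof_eq_0 prim_eq_0\<close>)
  from isCont_cong[OF this] show ?thesis by simp
 qed
qed

section \<open>Absorbing the cubic term; coercivity\<close>

context flow_pair begin

definition total_flux where "total_flux cH \<eta> t j x = flx \<eta> t j x - cH * hardy \<eta> t j x"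

text \<open>The constant cH is chosen such that the gain of the transversal flux exceeds the cubic term.\<close>

lemma law_positive:
 "\<exists>cH C. 0 <= cH & 0 <= C & (\<forall>\<eta>>0. \<exists>M. \<forall>t x. (\<eta>, t, x) \<in> S -->
  balance_law t0 t1 (enr \<eta>) (total_flux cH \<eta>) M (C * ts.Er (\<eta>, t, x)) t x)"
proof -
 obtain dE dF where E: "!!i. i \<in> S ==> ((%s. enr (fst i) s (ps i)) has_real_derivative dE i) (at (tm i) within {t0..t1})"
  and F: "!!i j. i \<in> S ==> ((%s. flx (fst i) (tm i) j (snd (snd i) + s *\<^sub>R axis j 1)) has_real_derivative dF i j) (at 0)"
  and rem: "dominated S (%i. dE i + (\<Sum>j\<in>UNIV. dF i j) + qe i / 4 * (ts.fp i * (ts.w i \<bullet> pt p1 i) - ts.fq i * (ts.w i \<bullet> pt p2 i))) ts.Er"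
  and bE: "!!\<eta>. 0 < \<eta> ==> bounded_on {i \<in> S. fst i = \<eta>} dE"
  and bF: "!!\<eta> j. 0 < \<eta> ==> bounded_on {i \<in> S. fst i = \<eta>} (%i. dF i j)"
  using balance_positive by blast
 obtain dH Ch where Ch: "0 <= Ch"
  and H: "!!i j. i \<in> S ==> ((%s. hardy (fst i) (tm i) j (snd (snd i) + s *\<^sub>R axis j 1)) has_real_derivative dH i j) (at 0)"
  and gain: "!!i. i \<in> S ==> c0 * ((ts.fp i + ts.fq i) * ts.W i ^ 3) <= (\<Sum>j\<in>UNIV. dH i j) + Ch * ts.Er i"
  and bH: "!!\<eta> j. 0 < \<eta> ==> bounded_on {i \<in> S. fst i = \<eta>} (%i. dH i j)"
  using hardy_positive by blast
 obtain k where k: "0 <= k" "!!i. i \<in> S ==> abs (dE i + (\<Sum>j\<in>UNIV. dF i j) + qe i / 4 * (ts.fp i * (ts.w i \<bullet> pt p1 i) - ts.fq i * (ts.w i \<bullet> pt p2 i))) <= k * ts.Er i"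
  using rem unfolding dominated_def by blast
 obtain q where q: "0 <= q" "!!i. i \<in> S ==> abs (qe i) <= q * (ts.W i)\<^sup>2" using qe_dom unfolding dominated_def W_eq by blast
 define cH where "cH = q * L / 4 / c0"
 have cH: "0 <= cH" using q L c0 by (simp add: cH_def)
 have est: "dE i + (\<Sum>j\<in>UNIV. dF i j - cH * dH i j) <= (k + cH * Ch) * ts.Er i" if i: "i \<in> S" for i
 proof -
  have fpos: "0 <= ts.fp i" "0 <= ts.fq i"
   using dprof_nonneg[of "fst i" m] SD(1)[OF i] m prof_nonneg by (auto simp: ts.fp_def ts.fq_def)
  have wp: "abs (ts.w i \<bullet> pt p1 i) <= ts.W i * L" "abs (ts.w i \<bullet> pt p2 i) <= ts.W i * L"
   using Cauchy_Schwarz_ineq2[of "ts.w i" "pt p1 i"] Cauchy_Schwarz_ineq2[of "ts.w i" "pt p2 i"]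
    mult_left_mono[OF SD(9)[OF i], of "ts.W i"] mult_left_mono[OF SD(10)[OF i], of "ts.W i"] ts.W_nonneg[of i]
   by (auto simp: ts.W_def)
  have "abs (ts.fp i * (ts.w i \<bullet> pt p1 i)) <= ts.fp i * (ts.W i * L)" "abs (ts.fq i * (ts.w i \<bullet> pt p2 i)) <= ts.fq i * (ts.W i * L)"
   using wp fpos by (auto simp: abs_mult intro: mult_left_mono)
  then have "abs (ts.fp i * (ts.w i \<bullet> pt p1 i) - ts.fq i * (ts.w i \<bullet> pt p2 i)) <= (ts.fp i + ts.fq i) * (ts.W i * L)"
   unfolding distrib_right by (rule order_trans[OF abs_triangle_ineq4 add_mono])
  then have "abs (qe i) * abs (ts.fp i * (ts.w i \<bullet> pt p1 i) - ts.fq i * (ts.w i \<bullet> pt p2 i)) <= (q * (ts.W i)\<^sup>2) * ((ts.fp i + ts.fq i) * (ts.W i * L))"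
   using q(2)[OF i] q(1) by (intro mult_mono) auto
  also have "... = q * L * ((ts.fp i + ts.fq i) * ts.W i ^ 3)" by (simp add: power2_eq_square power3_eq_cube)
  finally have "abs (qe i / 4 * (ts.fp i * (ts.w i \<bullet> pt p1 i) - ts.fq i * (ts.w i \<bullet> pt p2 i))) <= q * L / 4 * ((ts.fp i + ts.fq i) * ts.W i ^ 3)"
   by (simp add: abs_mult)
  also have "... = cH * (c0 * ((ts.fp i + ts.fq i) * ts.W i ^ 3))" using c0 by (simp add: cH_def)
  also have "... <= cH * ((\<Sum>j\<in>UNIV. dH i j) + Ch * ts.Er i)" by (rule mult_left_mono[OF gain[OF i] cH])
  finally have "- (qe i / 4 * (ts.fp i * (ts.w i \<bullet> pt p1 i) - ts.fq i * (ts.w i \<bullet> pt p2 i))) <= cH * (\<Sum>j\<in>UNIV. dH i j) + cH * Ch * ts.Er i"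
   by (simp add: distrib_left mult.assoc)
  moreover have "(\<Sum>j\<in>UNIV. dF i j - cH * dH i j) = (\<Sum>j\<in>UNIV. dF i j) - cH * (\<Sum>j\<in>UNIV. dH i j)"
   by (simp add: sum_subtractf sum_distrib_left)
  moreover have "(k + cH * Ch) * ts.Er i = k * ts.Er i + cH * Ch * ts.Er i" by (simp add: distrib_right)
  ultimately show ?thesis using k(2)[OF i] by linarith
 qed
 have dFH: "((%s. flx (fst i) (tm i) j (snd (snd i) + s *\<^sub>R axis j 1)
     - cH * hardy (fst i) (tm i) j (snd (snd i) + s *\<^sub>R axis j 1)) has_real_derivative dF i j - cH * dH i j) (at 0)" if "i \<in> S" for i j
  using F[OF that, of j] H[OF that, of j] by (intro DERIV_diff DERIV_cmult)
 have "\<exists>M. \<forall>t x. (\<eta>, t, x) \<in> S --> balance_law t0 t1 (enr \<eta>) (total_flux cH \<eta>) M ((k + cH * Ch) * ts.Er (\<eta>, t, x)) t x" if e: "0 < \<eta>" for \<eta>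
 proof -
  define S' where "S' = {i \<in> S. fst i = \<eta>}"
  have bFH: "bounded_on S' (%i. dF i j - cH * dH i j)" for j
   unfolding S'_def using bF[OF e] bH[OF e] by (intro dom_diff dom_bdd dom_const)
  obtain M0 where M0: "0 <= M0" "!!i. i \<in> S' ==> abs (dE i) <= M0 * 1" using bE[OF e] unfolding dominated_def S'_def by blast
  have "\<exists>c. 0 <= c & (\<forall>i\<in>S'. abs (dF i j - cH * dH i j) <= c * 1)" for j using bFH unfolding dominated_def by blast
  then obtain c where c: "!!j. 0 <= c j" "!!i j. i \<in> S' ==> abs (dF i j - cH * dH i j) <= c j * 1" by metis
  define M where "M = M0 + (\<Sum>j\<in>UNIV. c j)"
  have sf: "0 <= (\<Sum>j\<in>UNIV. c j)" "c j <= (\<Sum>j\<in>UNIV. c j)" for j using c(1) by (auto intro!: sum_nonneg member_le_sum)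
  have M: "M0 <= M" "c j <= M" for j using sf(1) sf(2)[of j] M0(1) unfolding M_def by linarith+
  have "balance_law t0 t1 (enr \<eta>) (total_flux cH \<eta>) M ((k + cH * Ch) * ts.Er (\<eta>, t, x)) t x" if i: "(\<eta>, t, x) \<in> S" for t x
  proof -
   have i': "(\<eta>, t, x) \<in> S'" using i by (simp add: S'_def)
   have bd: "abs (dE (\<eta>, t, x)) <= M" "abs (dF (\<eta>, t, x) j - cH * dH (\<eta>, t, x) j) <= M" for j
    using M0(2)[OF i'] c(2)[OF i', of j] M(1) M(2)[of j] by linarith+
   show ?thesis unfolding balance_law_def total_flux_def
    by (rule exI[of _ "dE (\<eta>, t, x)"], rule exI[of _ "%j. dF (\<eta>, t, x) j - cH * dH (\<eta>, t, x) j"])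
     (use E[OF i] dFH[OF i] est[OF i] bd in simp)
  qed
  then show ?thesis by blast
 qed
 then show ?thesis by (intro exI[of _ cH] exI[of _ "k + cH * Ch"]) (use cH k(1) Ch in simp)
qed

definition dst where "dst t x = DD m (r1 t x) (r2 t x) (norm (y1 t x - y2 t x))"

lemma rb: "t \<in> {t0..t1} ==> 0 <= r1 t x" "t \<in> {t0..t1} ==> r1 t x <= 1 / \<kappa>"
 "t \<in> {t0..t1} ==> 0 <= r2 t x" "t \<in> {t0..t1} ==> r2 t x <= 1 / \<kappa>"
 using reduced_flow_bounds(2,3)[OF flow1] reduced_flow_bounds(2,3)[OF flow2] by auto

lemma dst_nonneg: "t \<in> {t0..t1} ==> 0 <= dst t x" using rb by (simp add: dst_def DD_nonneg)

lemma dst_vacuum: "t \<in> {t0..t1} ==> r2 t x = 0 ==> dst t x = D1 m (r1 t x) 0"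
 "t \<in> {t0..t1} ==> r1 t x = 0 ==> dst t x = D1 m (r2 t x) 0"
 by (auto simp: dst_def DD_def Pm_def D1_commute)

lemma vacuum_values:
 assumes "0 < \<eta>"
 shows "r2 t x <= \<eta> ==> enr \<eta> t x = AA m \<eta> (r1 t x) 0" "r2 t x <= \<eta> ==> flx \<eta> t j x = AA m \<eta> (r1 t x) 0 * y1 t x $ j"
  "r1 t x <= \<eta> ==> enr \<eta> t x = AA m \<eta> (r2 t x) 0" "r1 t x <= \<eta> ==> flx \<eta> t j x = AA m \<eta> (r2 t x) 0 * y2 t x $ j"
  "r1 t x <= \<eta> \<or> r2 t x <= \<eta> ==> hardy \<eta> t j x = 0"
 using assms by (auto simp: enr_def flx_def hardy_def energy_vacuum prof_eq_0)

lemma bounds_positive: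
 "\<exists>C\<ge>0. \<forall>i\<in>S. abs (enr (fst i) (tm i) (ps i)) <= C * pt dst i &
  (\<forall>j. abs (flx (fst i) (tm i) j (ps i)) <= C * pt dst i & abs (hardy (fst i) (tm i) j (ps i)) <= C * pt dst i) &
  pt dst i <= C"
proof -
 have De: "pt dst i = DD m (pt r1 i) (pt r2 i) (ts.W i)" for i by (simp add: dst_def W_eq)
 have AD: "dominated S (%i. AA m (fst i) (pt r1 i) (pt r2 i)) (pt dst)"
 proof (rule domI[of "4 * (m + 8)"])
  fix i assume i: "i \<in> S"
  have "abs (AA m (fst i) (pt r1 i) (pt r2 i)) <= 4 * (m + 8) * D1 m (pt r1 i) (pt r2 i)"
   using AA_bound[of "fst i" m "pt r1 i" "pt r2 i"] SD(1-4)[OF i] m by simp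
  also have "... <= 4 * (m + 8) * pt dst i" unfolding De using m D1_le_DD by (intro mult_left_mono) auto
  finally show "abs (AA m (fst i) (pt r1 i) (pt r2 i)) <= 4 * (m + 8) * pt dst i" .
 qed (use m in simp)
 have PW: "dominated S (%i. Pm m (pt r1 i) (pt r2 i) * (ts.W i)\<^sup>2) (pt dst)"
  by (rule domI[of 1]) (use Pm_le_DD SD(3,4) Pm_nonneg De in \<open>auto simp: less_imp_le\<close>)
 have fW: "dominated S f (%i. (ts.W i)\<^sup>2) ==> dominated S (%i. ts.f12 i * f i) (pt dst)" for f
  by (rule dom_trans[OF dom_mult[OF ts.f12_Pm] PW])
 have dQ: "dominated S (%i. ts.f12 i * qe i) (pt dst)" using fW qe_dom by (simp add: W_eq)
 have LW: "dominated S (%i. ts.Lq i * ts.W i) (pt dst)" unfolding De[abs_def] by (rule ts.Lq_D)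
 have W0: "dominated S ts.W ts.W" by (rule dom_refl) (rule ts.W_nonneg)
 have cw: "dominated S (%i. ts.cw i $ j) ts.W" for j
 proof -
  have "dominated S (%i. norm ((1 + ts.al i) *\<^sub>R ts.w i)) ts.W"
   using dom_norm_scale[OF dom_add[OF dom_const ts.alpha_beta(5)] ts.w_W, of 1] by simp
  moreover have "dominated S (%i. norm ((ts.be i * (pt y1 i \<bullet> ts.w i)) *\<^sub>R pt y1 i)) ts.W"
   using dom_norm_scale[OF dom_bdd[OF ts.alpha_beta(6) dom_inner[OF ts.vec_bounds(1) ts.w_W]] ts.vec_bounds(1)] by simp
  ultimately show ?thesis unfolding ts.cw_def by (intro dom_nth dom_norm_add)
 qed
 have U: "bounded_on S (%i. ((1 / 2) *\<^sub>R (pt y1 i + pt y2 i)) $ j)" for j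
  by (rule dom_cong[OF dom_bdd[OF dom_const[of _ "1 / 2"] dom_nth[OF dom_norm_add[OF ts.vec_bounds(1,2)], of j]]]) simp
 have la: "bounded_on S (%i. ts.la i * co1 (sc_t \<kappa>) i * pt y1 i $ j)" "bounded_on S (%i. ts.la i * co1 (sc_s \<kappa>) i * pt y1 i $ j)" for j
  by (intro dom_bdd ts.la_bdd co_bdd nice_t[OF \<kappa> b] nice_s[OF \<kappa> b] dom_nth ts.vec_bounds)+
 have E: "dominated S (%i. enr (fst i) (tm i) (ps i)) (pt dst)"
  by (rule dom_cong[OF dom_add[OF AD dom_bdd[OF dom_const[of _ "1/2"] dQ]]]) (simp add: enr_def energy_def ts.f12_def qe_def)
 have F: "dominated S (%i. flx (fst i) (tm i) j (ps i)) (pt dst)" for j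
  by (rule dom_cong[OF dom_add[OF dom_add[OF dom_bdd[OF dom_add[OF U[of j] la(1)[of j]] AD]
      dom_trans[OF dom_mult[OF ts.M_Lq cw[of j]] LW]] dom_bdd2[OF dom_bdd[OF dom_const[of _ "1/2"] dQ] dom_add[OF U[of j] la(2)[of j]]]]])
   (simp add: flx_def flux_def th_eq xi_eq cw_eq ts.f12_def qe_def ts.Mi_def)
 have W3: "dominated S (%i. ts.W i ^ 3) (%i. (ts.W i)\<^sup>2)"
  using dom_bdd[OF ts.W_bdd dom_mult[OF W0 W0]] by (simp add: power3_eq_cube power2_eq_square mult.assoc)
 have NN: "bounded_on S (%i. N j (ps i))" for j
  using N(1)[of j] N(1)[of undefined undefined] by (intro domI[of NB]) (auto intro: order_trans[OF abs_ge_zero])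
 have H: "dominated S (%i. hardy (fst i) (tm i) j (ps i)) (pt dst)" for j
  by (rule dom_cong[OF dom_bdd2[OF fW[OF W3] NN[of j]]]) (simp add: hardy_def ts.f12_def W_eq)
 have D: "bounded_on S (pt dst)"
 proof -
  have "dominated S (%i. D1 m (pt r1 i) (pt r2 i)) ts.Lq"
   by (rule domI[of 1]) (use D1_nonneg D1_le_linear SD(3,4) in \<open>auto simp: ts.Lq_def less_imp_le\<close>)
  moreover have "bounded_on S (%i. Pm m (pt r1 i) (pt r2 i) * (ts.W i)\<^sup>2)"
   unfolding power2_eq_square by (intro dom_bdd Pm_bdd ts.W_bdd)
  ultimately show ?thesis unfolding De DD_def using Lq_bdd by (intro dom_add) (auto intro: dom_trans)
 qed
 obtain c1 where c1: "0 <= c1" "!!i. i \<in> S ==> abs (enr (fst i) (tm i) (ps i)) <= c1 * pt dst i" using E unfolding dominated_def by blast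
 have "\<forall>j. \<exists>c. 0 <= c & (\<forall>i\<in>S. abs (flx (fst i) (tm i) j (ps i)) <= c * pt dst i)" using F unfolding dominated_def by blast
 then obtain c2 where c2: "!!j. 0 <= c2 j" "!!i j. i \<in> S ==> abs (flx (fst i) (tm i) j (ps i)) <= c2 j * pt dst i" by metis
 have "\<forall>j. \<exists>c. 0 <= c & (\<forall>i\<in>S. abs (hardy (fst i) (tm i) j (ps i)) <= c * pt dst i)" using H unfolding dominated_def by blast
 then obtain c3 where c3: "!!j. 0 <= c3 j" "!!i j. i \<in> S ==> abs (hardy (fst i) (tm i) j (ps i)) <= c3 j * pt dst i" by metis
 obtain c4 where c4: "0 <= c4" "!!i. i \<in> S ==> abs (pt dst i) <= c4 * 1" using D unfolding dominated_def by blast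
 define C where "C = c1 + (\<Sum>j\<in>UNIV. c2 j) + (\<Sum>j\<in>UNIV. c3 j) + c4"
 have s: "0 <= (\<Sum>j\<in>UNIV. c2 j)" "0 <= (\<Sum>j\<in>UNIV. c3 j)" "c2 j <= (\<Sum>j\<in>UNIV. c2 j)" "c3 j <= (\<Sum>j\<in>UNIV. c3 j)" for j
  using c2(1) c3(1) by (auto intro!: sum_nonneg member_le_sum)
 have le: "c1 <= C" "c2 j <= C" "c3 j <= C" "c4 <= C" for j
  using s(1,2) s(3,4)[of j] c1(1) c4(1) unfolding C_def by linarith+
 show ?thesis
 proof (rule exI[of _ C], intro conjI ballI allI)
  show "0 <= C" using le(1) c1(1) by linarith
  fix i j assume i: "i \<in> S"
  have d: "0 <= pt dst i" by (rule dst_nonneg[OF SD(2)[OF i]])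
  show "abs (enr (fst i) (tm i) (ps i)) <= C * pt dst i" by (rule order_trans[OF c1(2)[OF i] mult_right_mono[OF le(1) d]])
  show "abs (flx (fst i) (tm i) j (ps i)) <= C * pt dst i" by (rule order_trans[OF c2(2)[OF i] mult_right_mono[OF le(2) d]])
  show "abs (hardy (fst i) (tm i) j (ps i)) <= C * pt dst i" by (rule order_trans[OF c3(2)[OF i] mult_right_mono[OF le(3) d]])
  show "pt dst i <= C" using c4(2)[OF i] le(4) by linarith
 qed
qed

text \<open>The coefficient 1 + fal interpolates between 1 and g / \<kappa>, and both are positive.\<close>

lemma quadratic_coercive: "\<exists>c>0. \<forall>i\<in>S. c * (ts.W i)\<^sup>2 <= qe i"
proof -
 obtain K1 where K1: "0 <= K1" "\<forall>r e. in_range \<kappa> b r e --> abs (sc_eta \<kappa> r e) <= K1" using nice_bounded[OF nice_eta[OF \<kappa> b]] by blast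
 obtain K2 where K2: "0 <= K2" "\<forall>r e. in_range \<kappa> b r e --> abs (1 / sc_g \<kappa> r e) <= K2" using nice_bounded[OF nice_inv_g[OF \<kappa> b]] by blast
 \<comment> \<open>A common lower bound for both ends of the interpolation.\<close>
 define \<mu> where "\<mu> = min 1 (1 / ((K2 + 1) * \<kappa>))"
 have \<mu>: "0 < \<mu>" using K2 \<kappa> by (simp add: \<mu>_def)
 show ?thesis
 proof (rule exI[of _ "\<mu> / (K1 + 1)"], intro conjI ballI)
  show "0 < \<mu> / (K1 + 1)" using \<mu> K1 by simp
  fix i assume i: "i \<in> S"
  note P = SD(3-8)[OF i]
  define g where "g = co1 (sc_g \<kappa>) i"
  define eta where "eta = co1 (sc_eta \<kappa>) i"
  have eta: "0 < eta" "eta <= K1 + 1"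
   using eta_pos[OF \<kappa> b, of "pt r1 i" "pt y1 i \<bullet> pt y1 i"] K1(2)[rule_format, of "pt r1 i" "pt y1 i \<bullet> pt y1 i"] P by (auto simp: eta_def)
  have g: "0 < g" "1 / g <= K2 + 1"
   using g_pos[OF \<kappa> b, of "pt r1 i" "pt y1 i \<bullet> pt y1 i"] K2(2)[rule_format, of "pt r1 i" "pt y1 i \<bullet> pt y1 i"] P by (auto simp: g_def)
  have "1 / (K2 + 1) <= g" using g K2(1) by (simp add: field_simps)
  from divide_right_mono[OF this, of \<kappa>] have "1 / (K2 + 1) / \<kappa> <= g / \<kappa>" using \<kappa> by simp
  then have gm: "\<mu> <= g / \<kappa>" by (simp add: \<mu>_def)
  note la = ts.la_bounds(1,2)[OF i]
  have "\<mu> = (1 - ts.la i) * \<mu> + ts.la i * \<mu>" by (simp add: algebra_simps)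
  also have "... <= (1 - ts.la i) * 1 + ts.la i * (g / \<kappa>)" using la gm by (intro add_mono mult_left_mono) (auto simp: \<mu>_def)
  also have "... = 1 + ts.al i" by (simp add: ts.al_def g_def algebra_simps)
  finally have al: "\<mu> <= 1 + ts.al i" .
  have be: "0 <= ts.be i" using la(1) h_nonneg[OF \<kappa> b, of "pt r1 i" "pt y1 i \<bullet> pt y1 i"] P \<kappa> by (simp add: ts.be_def)
  have za: "\<mu> / (K1 + 1) <= fza \<kappa> (fst i) (pt r1 i) (pt y1 i) (pt r2 i)"
  proof -
   have "\<mu> / (K1 + 1) <= (1 + ts.al i) / eta" using al eta \<mu> by (intro frac_le) auto
   then show ?thesis by (simp add: fza_def al_eq eta_def)
  qed
  have zb: "0 <= fzb \<kappa> (fst i) (pt r1 i) (pt y1 i) (pt r2 i)"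
   unfolding fzb_def al_eq be_eq eta_def[symmetric] using al be \<mu> eta P b by (intro mult_nonneg_nonneg) auto
  have "\<mu> / (K1 + 1) * (ts.W i)\<^sup>2 <= fza \<kappa> (fst i) (pt r1 i) (pt y1 i) (pt r2 i) * (ts.W i)\<^sup>2" using za by (intro mult_right_mono) auto
  also have "... <= qe i" using zb by (simp add: qe_def fQ_def W_eq power2_norm_eq_inner)
  finally show "\<mu> / (K1 + 1) * (ts.W i)\<^sup>2 <= qe i" .
 qed
qed

lemma err_le: "0 < \<eta> ==> \<eta> <= 1 ==> err m \<eta> <= \<eta> powr m"
proof -
 assume e: "0 < \<eta>" "\<eta> <= 1"
 have p: "\<eta> powr m <= 1" using e m by (simp add: powr_le1)
 have "(\<eta> powr m * \<eta>) * \<eta> powr m <= (1 * 1) * \<eta> powr m" using e p by (intro mult_right_mono mult_mono) auto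
 then show ?thesis by (simp add: err_def power2_eq_square mult_ac)
qed

text \<open>The energy controls the distance except for what the cut-off removes, which is of order \<eta>^m.\<close>

lemma coercive:
 "\<exists>C>0. \<forall>\<eta> t x. 0 < \<eta> & \<eta> <= 1 & t \<in> {t0..t1} --> dst t x <= C * (enr \<eta> t x + \<eta> powr m)"
proof -
 obtain c where c: "0 < c" "!!i. i \<in> S ==> c * (ts.W i)\<^sup>2 <= qe i" using quadratic_coercive by blast
 define a1 where "a1 = 4 * (4 powr m)\<^sup>2 / m"
 define a2 where "a2 = 8 * (8 powr m)\<^sup>2"
 define a3 where "a3 = 2 powr m * (1 / \<kappa>) powr m"
 have a: "0 <= a1" "0 <= a2" "0 <= a3" using m by (auto simp: a1_def a2_def a3_def)
 define C where "C = a1 + 2 / c + a2 + 4 * a3 + 1"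
 have C: "0 < C" using a c by (simp add: C_def add_nonneg_pos)
 have d1: "D1 m r s <= a1 * AA m \<eta> r s + a2 * \<eta> powr m" if "0 < \<eta>" "\<eta> <= 1" "0 <= r" "0 <= s" for \<eta> r s
 proof -
  have "D1 m r s <= a1 * AA m \<eta> r s + a2 * err m \<eta>" unfolding a1_def a2_def using D1_coercive[OF that(1) m(1) that(3,4)] by simp
  also have "... <= a1 * AA m \<eta> r s + a2 * \<eta> powr m" using err_le[OF that(1,2)] a by (intro add_left_mono mult_left_mono)
  finally show ?thesis .
 qed
 have AA0: "0 <= AA m \<eta> r s" if "0 < \<eta>" for \<eta> r s
 proof (cases "r <= s")
  case True
  show ?thesis unfolding AA_def using prof_mono[OF that m(1) True] prim_mono[OF that True] by (intro mult_nonpos_nonpos) auto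
 next
  case False
  then have "s <= r" by simp
  then show ?thesis unfolding AA_def using prof_mono[OF that m(1)] prim_mono[OF that] by (intro mult_nonneg_nonneg) auto
 qed
 have deg: "D1 m r 0 <= C * (AA m \<eta> r 0 + \<eta> powr m)" if "0 < \<eta>" "\<eta> <= 1" "0 <= r" for \<eta> r
 proof -
  have "D1 m r 0 <= a1 * AA m \<eta> r 0 + a2 * \<eta> powr m" using d1[OF that] by simp
  also have "... <= C * AA m \<eta> r 0 + C * \<eta> powr m" using a c AA0[OF that(1)] by (intro add_mono mult_right_mono) (auto simp: C_def)
  finally show ?thesis by (simp add: distrib_left)
 qed
 show ?thesis
 proof (rule exI[of _ C], rule conjI[OF C], intro allI impI)
  fix \<eta> t :: real and x assume H: "0 < \<eta> & \<eta> <= 1 & t \<in> {t0..t1}"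
  then have t: "t \<in> {t0..t1}" and e: "0 < \<eta>" "\<eta> <= 1" by auto
  consider "r1 t x = 0" | "r2 t x = 0" | "0 < r1 t x" "0 < r2 t x" using rb[OF t, of x] by linarith
  then show "dst t x <= C * (enr \<eta> t x + \<eta> powr m)"
  proof cases
   case 1 then show ?thesis using deg[OF e, of "r2 t x"] rb[OF t, of x] e by (simp add: dst_vacuum(2)[OF t] vacuum_values(3))
  next
   case 2 then show ?thesis using deg[OF e, of "r1 t x"] rb[OF t, of x] e by (simp add: dst_vacuum(1)[OF t] vacuum_values(1))
  next
   case 3
   define i where "i = (\<eta>, t, x)"
   have i: "i \<in> S" using 3 t e by (simp add: i_def S_def)
   have pt: "fst i = \<eta>" "fst (snd i) = t" "snd (snd i) = x" by (auto simp: i_def)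
   have W2: "ts.W i <= 2" using S_le[OF i] norm_triangle_ineq4[of "pt y1 i" "pt y2 i"] by (simp add: W_eq)
   then have W4: "(ts.W i)\<^sup>2 <= 4" using power_mono[OF W2 ts.W_nonneg, of 2] by simp
   have f0: "0 <= ts.f12 i" by (simp add: ts.f12_def prof_nonneg)
   have "Pm m (r1 t x) (r2 t x) <= ts.f12 i + a3 * \<eta> powr m"
    using Pm_le_prof[OF m(1) e(1), of "r1 t x" "r2 t x" "1 / \<kappa>"] rb[OF t, of x] by (simp add: ts.f12_def pt a3_def)
   then have "Pm m (r1 t x) (r2 t x) * (ts.W i)\<^sup>2 <= (ts.f12 i + a3 * \<eta> powr m) * (ts.W i)\<^sup>2" by (intro mult_right_mono) auto
   also have "... <= ts.f12 i * (ts.W i)\<^sup>2 + a3 * \<eta> powr m * 4" unfolding distrib_right using W4 a by (intro add_left_mono mult_left_mono) auto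
   also have "... <= ts.f12 i * (qe i / c) + a3 * \<eta> powr m * 4"
    using c(2)[OF i] c(1) f0 by (intro add_right_mono mult_left_mono) (auto simp: field_simps)
   finally have P: "Pm m (r1 t x) (r2 t x) * (ts.W i)\<^sup>2 <= (2 / c) * ((1 / 2) * ts.f12 i * qe i) + 4 * a3 * \<eta> powr m" by simp
   have q0: "0 <= (1 / 2) * ts.f12 i * qe i"
   proof -
    have "0 <= c * (ts.W i)\<^sup>2" using c(1) by simp
    then have "0 <= qe i" using c(2)[OF i] by linarith
    then show ?thesis using f0 by simp
   qed
   have en: "enr \<eta> t x = AA m \<eta> (r1 t x) (r2 t x) + (1 / 2) * ts.f12 i * qe i" by (simp add: enr_def energy_def ts.f12_def qe_def pt)
   have "dst t x = D1 m (r1 t x) (r2 t x) + Pm m (r1 t x) (r2 t x) * (ts.W i)\<^sup>2" by (simp add: dst_def DD_def W_eq pt)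
   also have "... <= (a1 * AA m \<eta> (r1 t x) (r2 t x) + a2 * \<eta> powr m) + ((2 / c) * ((1 / 2) * ts.f12 i * qe i) + 4 * a3 * \<eta> powr m)"
    using d1[OF e, of "r1 t x" "r2 t x"] rb[OF t, of x] P by (intro add_mono) auto
   also have "... = a1 * AA m \<eta> (r1 t x) (r2 t x) + (2 / c) * ((1 / 2) * ts.f12 i * qe i) + (a2 + 4 * a3) * \<eta> powr m" by (simp add: algebra_simps)
   also have "... <= C * AA m \<eta> (r1 t x) (r2 t x) + C * ((1 / 2) * ts.f12 i * qe i) + C * \<eta> powr m"
    using a c(1) AA0[OF e(1)] q0 by (intro add_mono mult_right_mono) (auto simp: C_def)
   finally show ?thesis unfolding en by (simp add: distrib_left)
  qed
 qed
qed

end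

section \<open>Uniqueness for the reduced system\<close>

context flow_pair begin

lemma uniform_bounds:
 "\<exists>C\<ge>0. \<forall>\<eta> t x. 0 < \<eta> & t \<in> {t0..t1} --> abs (enr \<eta> t x) <= C * dst t x &
  (\<forall>j. abs (flx \<eta> t j x) <= C * dst t x & abs (hardy \<eta> t j x) <= C * dst t x) & dst t x <= C"
proof -
 obtain C where C: "0 <= C" "!!i. i \<in> S ==> abs (enr (fst i) (fst (snd i)) (snd (snd i))) <= C * pt dst i &
  (\<forall>j. abs (flx (fst i) (fst (snd i)) j (snd (snd i))) <= C * pt dst i & abs (hardy (fst i) (fst (snd i)) j (snd (snd i))) <= C * pt dst i) &
  pt dst i <= C" using bounds_positive by blast
 define B where "B = ((1 / \<kappa>) powr m)\<^sup>2 * (1 / \<kappa>)"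
 have B: "0 <= B" using \<kappa> by (simp add: B_def)
 define K where "K = C + 4 * (m + 8) + B"
 have K: "C <= K" "4 * (m + 8) <= K" "B <= K" "0 <= K" using C(1) B m by (auto simp: K_def)
 have AAb: "abs (AA m \<eta> r 0) <= K * D1 m r 0" if "0 < \<eta>" "0 <= r" for \<eta> r
  using AA_bound[OF that(1) m(1) that(2), of 0] mult_right_mono[OF K(2) D1_nonneg[OF that(2), of 0 m]] by simp
 have AAy: "abs (AA m \<eta> (r t x) 0 * y t x $ j) <= K * D1 m (r t x) 0"
  if f: "reduced_flow \<kappa> b L t0 t1 r y rt yt p Y" and "0 < \<eta>" "t \<in> {t0..t1}" for \<eta> t x j r rt and y yt p :: "real => real ^ 'd => real ^ 'd" and Y
 proof (cases "0 < r t x")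
  case True
  have "abs (y t x $ j) <= 1" using component_le_norm_cart[of "y t x" j] small_norm[OF \<kappa> b L m(1) reduced_flowD(1)[OF f that(3) True]] by linarith
  then have "abs (AA m \<eta> (r t x) 0 * y t x $ j) <= abs (AA m \<eta> (r t x) 0) * 1" unfolding abs_mult by (intro mult_left_mono) auto
  then show ?thesis using AAb[OF that(2), of "r t x"] True by linarith
 next
  case False
  then have "r t x = 0" using reduced_flow_bounds(2)[OF f that(3), of x] by simp
  then show ?thesis by (simp add: AA_def D1_def)
 qed
 have D1B: "D1 m r 0 <= K" if "0 <= r" "r <= 1 / \<kappa>" for r
 proof -
  have "D1 m r 0 = (r powr m)\<^sup>2 * r" using that by (simp add: D1_def power2_eq_square)
  also have "... <= B" unfolding B_def using that m by (intro mult_mono power_mono powr_mono2) auto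
  finally show ?thesis using K by linarith
 qed
 show ?thesis
 proof (rule exI[of _ K], rule conjI[OF K(4)], intro allI impI)
  fix \<eta> t :: real and x assume "0 < \<eta> & t \<in> {t0..t1}"
  then have e: "0 < \<eta>" and t: "t \<in> {t0..t1}" by auto
  consider "r1 t x = 0" | "r2 t x = 0" | "0 < r1 t x" "0 < r2 t x" using rb[OF t, of x] by linarith
  then show "abs (enr \<eta> t x) <= K * dst t x &
  (\<forall>j. abs (flx \<eta> t j x) <= K * dst t x & abs (hardy \<eta> t j x) <= K * dst t x) & dst t x <= K"
  proof cases
   case 1
   then show ?thesis using AAb[OF e, of "r2 t x"] AAy[OF flow2 e t, of x] D1B[of "r2 t x"] rb[OF t, of x] e K(4)
    by (simp add: dst_vacuum(2)[OF t] vacuum_values(3,4,5) D1_nonneg)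
  next
   case 2
   then show ?thesis using AAb[OF e, of "r1 t x"] AAy[OF flow1 e t, of x] D1B[of "r1 t x"] rb[OF t, of x] e K(4)
    by (simp add: dst_vacuum(1)[OF t] vacuum_values(1,2,5) D1_nonneg)
  next
   case 3
   have i: "(\<eta>, t, x) \<in> S" using 3 t e by (simp add: S_def)
   have le: "C * dst t x <= K * dst t x" by (rule mult_right_mono[OF K(1) dst_nonneg[OF t]])
   have bd: "abs (enr \<eta> t x) <= C * dst t x" "abs (flx \<eta> t j x) <= C * dst t x" "abs (hardy \<eta> t j x) <= C * dst t x" "dst t x <= C" for j
    using C(2)[OF i, unfolded fst_conv snd_conv] by (blast+)
   show ?thesis
    by (intro conjI allI order_trans[OF bd(1) le] order_trans[OF bd(2) le] order_trans[OF bd(3) le] order_trans[OF bd(4) K(1)])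
  qed
 qed
qed

text \<open>The space is covered by the points where one of the densities vanishes and those where both are
positive.\<close>

lemma law:
 "\<exists>cH C. 0 <= cH & 0 <= C & (\<forall>\<eta>. 0 < \<eta> & \<eta> <= 1 --> (\<exists>M. \<forall>t\<in>{t0..t1}. \<forall>x.
  balance_law t0 t1 (enr \<eta>) (total_flux cH \<eta>) M (C * (dst t x + \<eta> powr m)) t x))"
proof -
 obtain cH C where cH: "0 <= cH" and C: "0 <= C"
  and pos: "!!\<eta>. 0 < \<eta> ==> \<exists>M. \<forall>t x. (\<eta>, t, x) \<in> S --> balance_law t0 t1 (enr \<eta>) (total_flux cH \<eta>) M (C * ts.Er (\<eta>, t, x)) t x"
  using law_positive by blast
 obtain C1 where C1: "0 <= C1" and O1: "\<forall>\<eta>>0. \<exists>M. \<forall>t\<in>{t0..t1}. \<forall>x.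
  balance_law t0 t1 (%t x. AA m \<eta> (r1 t x) 0) (%t j x. AA m \<eta> (r1 t x) 0 * y1 t x $ j) M (C1 * D1 m (r1 t x) 0) t x"
  using one_phase[OF flow1 \<kappa> b L m(1)] by blast
 obtain C2 where C2: "0 <= C2" and O2: "\<forall>\<eta>>0. \<exists>M. \<forall>t\<in>{t0..t1}. \<forall>x.
  balance_law t0 t1 (%t x. AA m \<eta> (r2 t x) 0) (%t j x. AA m \<eta> (r2 t x) 0 * y2 t x $ j) M (C2 * D1 m (r2 t x) 0) t x"
  using one_phase[OF flow2 \<kappa> b L m(1)] by blast
 define K where "K = C + C1 + C2"
 have K: "C <= K" "C1 <= K" "C2 <= K" "0 <= K" using C C1 C2 by (auto simp: K_def)
 show ?thesis
 proof (rule exI[of _ cH], rule exI[of _ K], rule conjI[OF cH], rule conjI[OF K(4)], intro allI impI)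
  fix \<eta> :: real assume "0 < \<eta> & \<eta> <= 1"
  then have e: "0 < \<eta>" "\<eta> <= 1" by auto
  obtain M0 where M0: "!!t x. (\<eta>, t, x) \<in> S ==> balance_law t0 t1 (enr \<eta>) (total_flux cH \<eta>) M0 (C * ts.Er (\<eta>, t, x)) t x" using pos[OF e(1)] by blast
  obtain M1 where M1: "!!t x. t \<in> {t0..t1} ==>
   balance_law t0 t1 (%t x. AA m \<eta> (r1 t x) 0) (%t j x. AA m \<eta> (r1 t x) 0 * y1 t x $ j) M1 (C1 * D1 m (r1 t x) 0) t x" using O1 e(1) by blast
  obtain M2 where M2: "!!t x. t \<in> {t0..t1} ==>
   balance_law t0 t1 (%t x. AA m \<eta> (r2 t x) 0) (%t j x. AA m \<eta> (r2 t x) 0 * y2 t x $ j) M2 (C2 * D1 m (r2 t x) 0) t x" using O2 e(1) by blast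
  define M where "M = max M0 (max M1 M2)"
  have "balance_law t0 t1 (enr \<eta>) (total_flux cH \<eta>) M (K * (dst t x + \<eta> powr m)) t x" if t: "t \<in> {t0..t1}" for t x
  proof -
   have le: "c * dst t x <= K * (dst t x + \<eta> powr m)" if "c <= K" for c
    using mult_right_mono[OF that dst_nonneg[OF t, of x]] K(4) by (simp add: distrib_left add_increasing2)
   consider "r1 t x = 0" | "r2 t x = 0" | "0 < r1 t x" "0 < r2 t x" using rb[OF t, of x] by linarith
   then show ?thesis
   proof cases
    case 1
    have "balance_law t0 t1 (enr \<eta>) (total_flux cH \<eta>) M2 (C2 * D1 m (r2 t x) 0) t x"
     by (rule balance_law_near_vacuum[OF flow1 t 1 e(1) _ _ M2[OF t]]) (simp_all add: vacuum_values(3-5)[OF e(1)] total_flux_def)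
    then show ?thesis by (rule balance_law_mono) (use le[OF K(3)] in \<open>simp_all add: M_def dst_vacuum(2)[OF t 1]\<close>)
   next
    case 2
    have "balance_law t0 t1 (enr \<eta>) (total_flux cH \<eta>) M1 (C1 * D1 m (r1 t x) 0) t x"
     by (rule balance_law_near_vacuum[OF flow2 t 2 e(1) _ _ M1[OF t]]) (simp_all add: vacuum_values(1,2,5)[OF e(1)] total_flux_def)
    then show ?thesis by (rule balance_law_mono) (use le[OF K(2)] in \<open>simp_all add: M_def dst_vacuum(1)[OF t 2]\<close>)
   next
    case 3
    have i: "(\<eta>, t, x) \<in> S" using 3 t e by (simp add: S_def)
    have "ts.Er (\<eta>, t, x) <= dst t x + \<eta> powr m" using err_le[OF e] by (simp add: ts.Er_def dst_def W_eq)
    then have "C * ts.Er (\<eta>, t, x) <= K * (dst t x + \<eta> powr m)"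
     using K(1,4) C ts.Er_nonneg[OF i] by (intro mult_mono) auto
    then show ?thesis by (rule balance_law_mono[OF M0[OF i], rotated]) (simp add: M_def)
   qed
  qed
  then show "\<exists>M. \<forall>t\<in>{t0..t1}. \<forall>x. balance_law t0 t1 (enr \<eta>) (total_flux cH \<eta>) M (K * (dst t x + \<eta> powr m)) t x" by blast
 qed
qed

text \<open>The velocities are continuous only inside their fluids, but the energy and the fluxes do not see
them where the density is below the cut-off scale.\<close>

lemma space_cont:
 assumes t: "t \<in> {t0..t1}" and e: "0 < \<eta>"
 shows "isCont (enr \<eta> t) x" "isCont (flx \<eta> t j) x" "isCont (hardy \<eta> t j) x"
proof -
 note c1 = space_tendsto(1)[OF flow1 t] and c2 = space_tendsto(1)[OF flow2 t]
 have near: "\<forall>\<^sub>F z in nhds x. r z <= \<eta>" if "isCont r x" "r x = (0::real)" for r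
  using order_tendstoD(2)[OF tendsto_at_iff_tendsto_nhds[THEN iffD1, OF that(1)[unfolded isCont_def]], of \<eta>] that(2) e
  by (auto elim: eventually_mono)
 have "isCont (enr \<eta> t) x & isCont (flx \<eta> t j) x & isCont (hardy \<eta> t j) x"
 proof -
  consider "r1 t x = 0" | "r2 t x = 0" | "0 < r1 t x" "0 < r2 t x" using rb[OF t, of x] by linarith
  then show ?thesis
  proof cases
   case 1
   note nr = near[OF c1[of x] 1]
   have "\<forall>\<^sub>F z in nhds x. enr \<eta> t z = AA m \<eta> (r2 t z) 0" using nr by eventually_elim (rule vacuum_values(3)[OF e])
   moreover have "\<forall>\<^sub>F z in nhds x. flx \<eta> t j z = AA m \<eta> (r2 t z) 0 * y2 t z $ j" using nr by eventually_elim (rule vacuum_values(4)[OF e])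
   moreover have "\<forall>\<^sub>F z in nhds x. hardy \<eta> t j z = 0" using nr by eventually_elim (simp add: vacuum_values(5)[OF e])
   ultimately show ?thesis using one_phase_cont(1)[OF flow2 t e, where m=m and x=x] one_phase_cont(2)[OF flow2 t e, where m=m and x=x and j=j] by (simp add: isCont_cong)
  next
   case 2
   note nr = near[OF c2[of x] 2]
   have "\<forall>\<^sub>F z in nhds x. enr \<eta> t z = AA m \<eta> (r1 t z) 0" using nr by eventually_elim (rule vacuum_values(1)[OF e])
   moreover have "\<forall>\<^sub>F z in nhds x. flx \<eta> t j z = AA m \<eta> (r1 t z) 0 * y1 t z $ j" using nr by eventually_elim (rule vacuum_values(2)[OF e])
   moreover have "\<forall>\<^sub>F z in nhds x. hardy \<eta> t j z = 0" using nr by eventually_elim (simp add: vacuum_values(5)[OF e])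
   ultimately show ?thesis using one_phase_cont(1)[OF flow1 t e, where m=m and x=x] one_phase_cont(2)[OF flow1 t e, where m=m and x=x and j=j] by (simp add: isCont_cong)
  next
   case 3
   note F1 = reduced_flowD[OF flow1 t 3(1)] and F2 = reduced_flowD[OF flow2 t 3(2)]
   have f: "isCont (%z. prof m \<eta> (r1 t z)) x" "isCont (%z. prof m \<eta> (r2 t z)) x"
    "isCont (%z. prim m \<eta> (r1 t z)) x" "isCont (%z. prim m \<eta> (r2 t z)) x" "isCont (%z. cut \<eta> (r1 t z)) x" "isCont (%z. cut \<eta> (r2 t z)) x"
    by (rule isCont_o2[OF c1 DERIV_isCont[OF prof_deriv[OF e]]] isCont_o2[OF c2 DERIV_isCont[OF prof_deriv[OF e]]]
      isCont_o2[OF c1 DERIV_isCont[OF prim_deriv[OF e]]] isCont_o2[OF c2 DERIV_isCont[OF prim_deriv[OF e]]]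
      isCont_o2[OF c1 DERIV_isCont[OF cut_deriv]] isCont_o2[OF c2 DERIV_isCont[OF cut_deriv]])+
   have la: "isCont (%z. lam \<eta> (r1 t z) (r2 t z)) x" unfolding lam_def by (intro continuous_intros c1 c2 f) (use 3 in auto)
   have sc: "isCont (%z. sc_g \<kappa> (r1 t z) (y1 t z \<bullet> y1 t z)) x" "isCont (%z. sc_h \<kappa> (r1 t z) (y1 t z \<bullet> y1 t z)) x"
    "isCont (%z. sc_t \<kappa> (r1 t z) (y1 t z \<bullet> y1 t z)) x" "isCont (%z. sc_s \<kappa> (r1 t z) (y1 t z \<bullet> y1 t z)) x"
    "isCont (%z. 1 / sc_eta \<kappa> (r1 t z) (y1 t z \<bullet> y1 t z)) x"
    by (rule nice_isCont[OF _ flow1 t 3(1)], rule nice_g[OF \<kappa> b] nice_h[OF \<kappa> b] nice_t[OF \<kappa> b] nice_s[OF \<kappa> b] nice_inv_eta[OF \<kappa> b])+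
   have k0: "\<kappa> \<noteq> 0" using \<kappa> by simp
   have be: "1 - y1 t x \<bullet> y1 t x \<noteq> 0" using F1(1) b by simp
   have fld: "isCont (%z. fal \<kappa> \<eta> (r1 t z) (y1 t z) (r2 t z)) x" "isCont (%z. fbe \<kappa> \<eta> (r1 t z) (y1 t z) (r2 t z)) x"
    "isCont (%z. fth \<kappa> \<eta> (r1 t z) (y1 t z) (r2 t z)) x" "isCont (%z. fxi \<kappa> \<eta> (r1 t z) (y1 t z) (r2 t z)) x"
    unfolding fal_def fbe_def fth_def fxi_def by (intro continuous_intros la sc k0)+
   have Q: "isCont (%z. fQ \<kappa> \<eta> (r1 t z) (y1 t z) (r2 t z) (y2 t z)) x"
    unfolding fQ_def fza_def fzb_def by (intro continuous_intros fld sc F1(2) F2(2) be)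
   have E: "isCont (enr \<eta> t) x" unfolding enr_def[abs_def] energy_def AA_def by (intro continuous_intros f Q)
   have cc: "isCont (%z. fc \<kappa> \<eta> (r1 t z) (y1 t z) (r2 t z) (y2 t z) $ j) x"
    unfolding fc_def by (intro isCont_vec_nth continuous_intros fld F1(2) F2(2))
   have U: "isCont (%z. ((1 / 2) *\<^sub>R (y1 t z + y2 t z)) $ j) x" by (intro isCont_vec_nth continuous_intros F1(2) F2(2))
   have yj: "isCont (%z. y1 t z $ j) x" by (rule isCont_vec_nth[OF F1(2)])
   have AM: "isCont (%z. AA m \<eta> (r1 t z) (r2 t z)) x" "isCont (%z. MM m \<eta> (r1 t z) (r2 t z)) x"
    unfolding AA_def MM_def by (intro continuous_intros f; simp)+
   have F: "isCont (flx \<eta> t j) x" unfolding flx_def[abs_def] flux_def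
    by (intro continuous_add continuous_mult continuous_const AM f Q cc U yj fld)
   have Nc: "isCont (N j) x" using N(3) by (simp add: continuous_on_eq_continuous_at)
   have H: "isCont (hardy \<eta> t j) x" unfolding hardy_def[abs_def] by (intro continuous_intros f F1(2) F2(2) Nc)
   show ?thesis using E F H by blast
  qed
 qed
 then show "isCont (enr \<eta> t) x" "isCont (flx \<eta> t j) x" "isCont (hardy \<eta> t j) x" by auto
qed

lemma initially_zero:
 assumes "!!x. r1 t0 x = r2 t0 x" "!!x. 0 < r1 t0 x ==> y1 t0 x = y2 t0 x" and e: "0 < \<eta>"
 shows "enr \<eta> t0 x = 0"
proof (cases "0 < r1 t0 x")
 case True
 then show ?thesis using assms(1)[of x] assms(2)[of x] by (simp add: enr_def energy_def AA_def fQ_def)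
next
 case False
 then have "r1 t0 x <= \<eta>" "r2 t0 x <= \<eta>" using assms(1)[of x] e by auto
 then show ?thesis using e by (simp add: enr_def energy_def AA_def prof_eq_0)
qed

text \<open>The initial energies are 0 because the initial data agree, so the energy method applies.\<close>

lemma distance_small_somewhere:
 assumes init: "!!x. r1 t0 x = r2 t0 x" "!!x. 0 < r1 t0 x ==> y1 t0 x = y2 t0 x"
  and t: "t \<in> {t0..t1}" and \<rho>: "0 < \<rho>" and d: "0 < d"
 shows "\<exists>x\<in>ball x0 \<rho>. dst t x < d"
proof -
 obtain Cb where Cb: "0 <= Cb" "!!\<eta> t x. 0 < \<eta> ==> t \<in> {t0..t1} ==> abs (enr \<eta> t x) <= Cb * dst t x &
  (\<forall>j. abs (flx \<eta> t j x) <= Cb * dst t x & abs (hardy \<eta> t j x) <= Cb * dst t x) & dst t x <= Cb" using uniform_bounds by blast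
 obtain Cc where Cc: "0 < Cc" "!!\<eta> t x. 0 < \<eta> ==> \<eta> <= 1 ==> t \<in> {t0..t1} ==> dst t x <= Cc * (enr \<eta> t x + \<eta> powr m)"
  using coercive by blast
 obtain cH Cl where cH: "0 <= cH" and Cl: "0 <= Cl" and lw: "!!\<eta>. 0 < \<eta> ==> \<eta> <= 1 ==> \<exists>M. \<forall>t\<in>{t0..t1}. \<forall>x.
  balance_law t0 t1 (enr \<eta>) (total_flux cH \<eta>) M (Cl * (dst t x + \<eta> powr m)) t x" using law by blast
 define C where "C = (Cb + cH * Cb) + Cc + Cl"
 have C: "0 < C" "Cb + cH * Cb <= C" "Cc <= C" "Cl <= C" using Cb(1) Cc(1) Cl mult_nonneg_nonneg[OF cH Cb(1)] unfolding C_def by linarith+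
 show ?thesis
 proof (rule energy_uniqueness[OF t01 C(1) _ t \<rho> d])
  fix \<delta> :: real assume \<delta>: "0 < \<delta>"
  \<comment> \<open>The cut-off error \<eta>^m is then at most \<delta>.\<close>
  define \<eta> where "\<eta> = min 1 (\<delta> powr (1 / m))"
  have e: "0 < \<eta>" "\<eta> <= 1" using \<delta> by (auto simp: \<eta>_def)
  have em: "\<eta> powr m <= \<delta>"
  proof -
   have "\<eta> powr m <= (\<delta> powr (1 / m)) powr m" using e m by (intro powr_mono2) (auto simp: \<eta>_def)
   then show ?thesis using m \<delta> by (simp add: powr_powr)
  qed
  obtain M where M: "!!s x. s \<in> {t0..t1} ==> balance_law t0 t1 (enr \<eta>) (total_flux cH \<eta>) M (Cl * (dst s x + \<eta> powr m)) s x" using lw[OF e] by blast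
  define Fl where "Fl = total_flux cH \<eta>"
  define M' where "M' = abs M + C * C"
  have flb: "abs (Fl s j x) <= C * dst s x" if s: "s \<in> {t0..t1}" for s j x
  proof -
   have "abs (flx \<eta> s j x) <= Cb * dst s x" "abs (hardy \<eta> s j x) <= Cb * dst s x" using Cb(2)[OF e(1) s, of x] by auto
   then have "abs (flx \<eta> s j x) + abs (cH * hardy \<eta> s j x) <= Cb * dst s x + cH * (Cb * dst s x)"
    unfolding abs_mult using cH by (intro add_mono mult_mono) auto
   also have "... = (Cb + cH * Cb) * dst s x" by (simp add: algebra_simps)
   also have "... <= C * dst s x" by (rule mult_right_mono[OF C(2) dst_nonneg[OF s]])
   finally show ?thesis unfolding Fl_def total_flux_def by linarith
  qed
  have CbC: "Cb <= C" using C(2) Cb(1) cH mult_nonneg_nonneg[OF cH Cb(1)] by linarith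
  have dC: "C * dst s x <= C * C" if s: "s \<in> {t0..t1}" for s x
   using Cb(2)[OF e(1) s, of x] CbC C(1) by (intro mult_left_mono) auto
  have enb: "abs (enr \<eta> s x) <= C * C" if s: "s \<in> {t0..t1}" for s x
   using Cb(2)[OF e(1) s, of x] mult_right_mono[OF CbC dst_nonneg[OF s, of x]] dC[OF s, of x] by linarith
  have meas: "f \<in> borel_measurable lborel" if "!!x. isCont f x" for f :: "real ^ 'd => real"
   using borel_measurable_continuous_onI[of f] that by (simp add: continuous_at_imp_continuous_on)
  have coer: "dst s x <= C * (enr \<eta> s x + \<delta>)" if s: "s \<in> {t0..t1}" for s x
  proof -
   have 1: "dst s x <= Cc * (enr \<eta> s x + \<eta> powr m)" by (rule Cc(2)[OF e s])
   have "0 <= Cc * (enr \<eta> s x + \<eta> powr m)" using 1 dst_nonneg[OF s, of x] by linarith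
   then have 2: "0 <= enr \<eta> s x + \<eta> powr m" using Cc(1) by (simp add: zero_le_mult_iff)
   have "Cc * (enr \<eta> s x + \<eta> powr m) <= C * (enr \<eta> s x + \<delta>)" using em 2 C(1,3) by (intro mult_mono) auto
   then show ?thesis using 1 by linarith
  qed
  show "\<exists>E F M. (\<forall>s\<in>{t0..t1}. E s \<in> borel_measurable lborel & (\<forall>j. F s j \<in> borel_measurable lborel)) &
   (\<forall>s\<in>{t0..t1}. \<forall>x. balance_law t0 t1 E F M (C * (dst s x + \<delta>)) s x & abs (E s x) <= M & 0 <= dst s x & dst s x <= C * (E s x + \<delta>) &
    (\<forall>j. abs (F s j x) <= M & abs (F s j x) <= C * dst s x)) & (\<forall>x. E t0 x = 0)"
  proof (rule exI[of _ "enr \<eta>"], rule exI[of _ Fl], rule exI[of _ M'], intro conjI ballI allI)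
   fix s x j assume s: "s \<in> {t0..t1}"
   show "enr \<eta> s \<in> borel_measurable lborel" by (rule meas[OF space_cont(1)[OF s e(1)]])
   show "Fl s j \<in> borel_measurable lborel" unfolding Fl_def total_flux_def[abs_def]
    by (rule meas) (intro continuous_intros space_cont[OF s e(1)])
   have "Cl * (dst s x + \<eta> powr m) <= C * (dst s x + \<delta>)" using em C(1,4) dst_nonneg[OF s, of x] by (intro mult_mono) auto
   then show "balance_law t0 t1 (enr \<eta>) Fl M' (C * (dst s x + \<delta>)) s x" unfolding Fl_def
    by (rule balance_law_mono[OF M[OF s], rotated]) (simp add: M'_def add_increasing2 C(1) less_imp_le)
   show "abs (enr \<eta> s x) <= M'" using enb[OF s, of x] by (simp add: M'_def)
   show "abs (Fl s j x) <= M'" using flb[OF s, of j x] dC[OF s, of x] by (simp add: M'_def)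
   show "0 <= dst s x" "dst s x <= C * (enr \<eta> s x + \<delta>)" "abs (Fl s j x) <= C * dst s x"
    by (rule dst_nonneg[OF s], rule coer[OF s], rule flb[OF s])
  qed (rule initially_zero[OF init e(1)])
 qed
qed

text \<open>Smallness somewhere in every ball suffices because each part of the distance is continuous at the
points where it would be positive.\<close>

theorem unique:
 assumes init: "!!x. r1 t0 x = r2 t0 x" "!!x. 0 < r1 t0 x ==> y1 t0 x = y2 t0 x" and t: "t \<in> {t0..t1}"
 shows "r1 t x = r2 t x" and "0 < r1 t x ==> y1 t x = y2 t x"
proof -
 have no: False if g: "isCont g x" "0 < g x" "!!z. g z <= dst t z" for g
 proof -
  have "\<forall>\<^sub>F z in nhds x. g x / 2 < g z"
   by (rule order_tendstoD(1)[OF tendsto_at_iff_tendsto_nhds[THEN iffD1, OF g(1)[unfolded isCont_def]]]) (use g(2) in simp)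
  then obtain \<rho> where \<rho>: "0 < \<rho>" "!!z. dist z x < \<rho> ==> g x / 2 < g z" unfolding eventually_nhds_metric by blast
  obtain z where z: "z \<in> ball x \<rho>" "dst t z < g x / 2" using distance_small_somewhere[OF init t \<rho>(1), of "g x / 2" x] g(2) by auto
  then show False using \<rho>(2)[of z] g(3)[of z] by (simp add: dist_commute)
 qed
 note c1 = space_tendsto(1)[OF flow1 t, of x] and c2 = space_tendsto(1)[OF flow2 t, of x]
 show eq: "r1 t x = r2 t x"
 proof (rule ccontr)
  assume ne: "r1 t x \<noteq> r2 t x"
  then have pos: "0 < r1 t x + r2 t x" using rb[OF t, of x] by linarith
  have "isCont (%z. D1 m (r1 t z) (r2 t z)) x" unfolding D1_def
   by (intro continuous_intros c1 c2 continuous_at_within_powr) (use pos in auto)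
  moreover have "0 < D1 m (r1 t x) (r2 t x)" using pos ne by (simp add: D1_def)
  moreover have "D1 m (r1 t z) (r2 t z) <= dst t z" for z by (simp add: dst_def D1_le_DD)
  ultimately show False by (rule no)
 qed
 show "y1 t x = y2 t x" if pos: "0 < r1 t x"
 proof (rule ccontr)
  assume ne: "y1 t x \<noteq> y2 t x"
  have pos2: "0 < r2 t x" using pos eq by simp
  have "isCont (%z. Pm m (r1 t z) (r2 t z) * (norm (y1 t z - y2 t z))\<^sup>2) x" unfolding Pm_def
   by (intro continuous_intros c1 c2 continuous_at_within_powr reduced_flowD(2)[OF flow1 t pos] reduced_flowD(2)[OF flow2 t pos2]) (use pos pos2 in auto)
  moreover have "0 < Pm m (r1 t x) (r2 t x) * (norm (y1 t x - y2 t x))\<^sup>2" using pos pos2 ne by (simp add: Pm_def)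
  moreover have "Pm m (r1 t z) (r2 t z) * (norm (y1 t z - y2 t z))\<^sup>2 <= dst t z" for z
   unfolding dst_def by (rule Pm_le_DD) (use rb[OF t, of z] in auto)
  ultimately show False by (rule no)
 qed
qed

end

section \<open>Reduction of the Euler system\<close>

definition ga :: "real ^ 'd => real" where "ga v = sqrt (1 + v \<bullet> v)"
definition yv :: "real ^ 'd => real ^ 'd" where "yv v = (1 / ga v) *\<^sub>R v"
text \<open>The derivative of yv at v in direction u.\<close>

definition PY :: "real ^ 'd => real ^ 'd => real ^ 'd" where "PY v u = (1 / ga v) *\<^sub>R (u - (yv v \<bullet> u) *\<^sub>R yv v)"

lemma ga_sq: "(ga v)\<^sup>2 = 1 + v \<bullet> v" by (simp add: ga_def)
lemma ga_ge: "1 <= ga v" by (simp add: ga_def)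
lemma ga_pos: "0 < ga v" using ga_ge[of v] by linarith
lemma v_eq: "v = ga v *\<^sub>R yv v" using ga_pos[of v] by (simp add: yv_def)
lemma yv_nth: "v $ i = ga v * yv v $ i" using ga_pos[of v] by (simp add: yv_def)
lemma yv_sq: "yv v \<bullet> yv v = (v \<bullet> v) / (ga v)\<^sup>2" by (simp add: yv_def power2_eq_square)
lemma yv_defect: "1 - yv v \<bullet> yv v = 1 / (ga v)\<^sup>2"
proof -
 have "0 < 1 + v \<bullet> v" by (simp add: add_pos_nonneg)
 then show ?thesis unfolding yv_sq ga_sq by (simp add: field_simps)
qed
lemma yv_lt: "yv v \<bullet> yv v < 1" using yv_defect[of v] ga_pos[of v] by (smt (verit) divide_pos_pos zero_less_power)
lemma yv_le: assumes "norm v <= V" shows "yv v \<bullet> yv v <= V\<^sup>2 / (1 + V\<^sup>2)"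
proof -
 have "v \<bullet> v <= V\<^sup>2" using power_mono[OF assms, of 2] by (simp add: power2_norm_eq_inner)
 then have "1 / (1 + V\<^sup>2) <= 1 / (1 + v \<bullet> v)" by (intro divide_left_mono) (auto intro!: add_pos_nonneg mult_pos_pos)
 moreover have "V\<^sup>2 / (1 + V\<^sup>2) = 1 - 1 / (1 + V\<^sup>2)"
 proof -
  have "0 < 1 + V\<^sup>2" by (simp add: add_pos_nonneg)
  then show ?thesis by (simp add: field_simps)
 qed
 ultimately show ?thesis using yv_defect[of v] unfolding ga_sq by linarith
qed
lemma yv_gam: "sc_gam (yv v \<bullet> yv v) = ga v"
 using ga_pos[of v] unfolding sc_gam_def yv_defect by (simp add: real_sqrt_divide)
lemma yv_ratio: "(yv v \<bullet> yv v) / (1 - yv v \<bullet> yv v) = v \<bullet> v"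
 using ga_pos[of v] unfolding yv_defect by (simp add: yv_sq)
lemma yv_inj: "yv v = yv w ==> v = w"
 using v_eq[of v] v_eq[of w] yv_gam[of v] yv_gam[of w] by metis

lemma sc_coeffs:
 "sc_v0 \<kappa> r (yv v \<bullet> yv v) = vel0 \<kappa> r v" "sc_a0 \<kappa> r (yv v \<bullet> yv v) = coeff_a0 \<kappa> r v" "sc_a1 \<kappa> r (yv v \<bullet> yv v) = coeff_a1 \<kappa> r v"
proof -
 show 1: "sc_v0 \<kappa> r (yv v \<bullet> yv v) = vel0 \<kappa> r v" by (simp add: sc_v0_def vel0_def yv_ratio power2_norm_eq_inner)
 show 2: "sc_a0 \<kappa> r (yv v \<bullet> yv v) = coeff_a0 \<kappa> r v" by (simp add: sc_a0_def coeff_a0_def 1 yv_ratio power2_norm_eq_inner)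
 show "sc_a1 \<kappa> r (yv v \<bullet> yv v) = coeff_a1 \<kappa> r v" by (simp add: sc_a1_def coeff_a1_def 1 2)
qed

lemma yv_deriv:
 assumes v: "(v has_vector_derivative v') (at s within S)"
 shows "((%s. yv (v s)) has_vector_derivative PY (v s) v') (at s within S)"
proof -
 have p: "0 < 1 + v s \<bullet> v s" by (simp add: add_pos_nonneg)
 note g0 = ga_pos[of "v s"]
 have "((%s. 1 + v s \<bullet> v s) has_real_derivative 0 + (v s \<bullet> v' + v' \<bullet> v s)) (at s within S)"
  by (intro DERIV_add DERIV_const inner_has_real_derivative v)
 from DERIV_chain2[OF DERIV_real_sqrt[OF p] this]
 have g: "((%s. ga (v s)) has_real_derivative (v s \<bullet> v') / ga (v s)) (at s within S)"
  unfolding ga_def by (rule DERIV_cong) (simp add: inner_commute field_simps)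
 have "((%s. 1 / ga (v s)) has_real_derivative - ((v s \<bullet> v') / ga (v s) / (ga (v s))\<^sup>2)) (at s within S)"
  by (rule DERIV_cong[OF DERIV_divide[OF DERIV_const g]]) (use g0 in \<open>auto simp: power2_eq_square\<close>)
 from has_vector_derivative_scaleR[OF this v]
 have "((%s. yv (v s)) has_vector_derivative (1 / ga (v s)) *\<^sub>R v' + (- ((v s \<bullet> v') / ga (v s) / (ga (v s))\<^sup>2)) *\<^sub>R v s) (at s within S)"
  by (simp add: yv_def)
 moreover have "(1 / ga (v s)) *\<^sub>R v' + (- ((v s \<bullet> v') / ga (v s) / (ga (v s))\<^sup>2)) *\<^sub>R v s = PY (v s) v'"
  by (simp add: PY_def yv_def scaleR_diff_right power2_eq_square)
 ultimately show ?thesis by simp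
qed

lemma PY_norm: "norm (PY v u) <= 2 * norm u"
proof -
 have y1: "norm (yv v) <= 1" using yv_lt[of v] by (simp add: norm_eq_sqrt_inner)
 have "abs (yv v \<bullet> u) <= norm u" using Cauchy_Schwarz_ineq2[of "yv v" u] mult_right_mono[OF y1, of "norm u"] by simp
 then have "norm ((yv v \<bullet> u) *\<^sub>R yv v) <= norm u * 1" unfolding norm_scaleR using y1 by (intro mult_mono) auto
 then have "norm (u - (yv v \<bullet> u) *\<^sub>R yv v) <= 2 * norm u" using norm_triangle_ineq4[of u "(yv v \<bullet> u) *\<^sub>R yv v"] by linarith
 moreover have "norm (PY v u) <= 1 * norm (u - (yv v \<bullet> u) *\<^sub>R yv v)"
  unfolding PY_def norm_scaleR using ga_ge[of v] by (intro mult_right_mono) auto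
 ultimately show ?thesis by linarith
qed

text \<open>Recovers the derivatives of v from those of y, to rewrite the divergence terms of the density
equation.\<close>

lemma PY_inverse:
 "yv v \<bullet> PY v u = (yv v \<bullet> u) / (ga v) ^ 3"
 "u = ga v *\<^sub>R (PY v u + ((ga v)\<^sup>2 * (yv v \<bullet> PY v u)) *\<^sub>R yv v)"
proof -
 note g = ga_pos[of v]
 have "yv v \<bullet> PY v u = (1 / ga v) * ((yv v \<bullet> u) * (1 - yv v \<bullet> yv v))" by (simp add: PY_def inner_diff_right algebra_simps)
 then show 1: "yv v \<bullet> PY v u = (yv v \<bullet> u) / (ga v) ^ 3" unfolding yv_defect by (simp add: power2_eq_square power3_eq_cube)
 have "ga v *\<^sub>R (PY v u + ((ga v)\<^sup>2 * (yv v \<bullet> PY v u)) *\<^sub>R yv v) = (u - (yv v \<bullet> u) *\<^sub>R yv v) + (ga v * ((ga v)\<^sup>2 * ((yv v \<bullet> u) / (ga v) ^ 3))) *\<^sub>R yv v"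
  unfolding 1 using g by (simp add: PY_def scaleR_add_right)
 also have "ga v * ((ga v)\<^sup>2 * ((yv v \<bullet> u) / (ga v) ^ 3)) = yv v \<bullet> u" using g by (simp add: power2_eq_square power3_eq_cube)
 finally show "u = ga v *\<^sub>R (PY v u + ((ga v)\<^sup>2 * (yv v \<bullet> PY v u)) *\<^sub>R yv v)" by simp
qed

lemma PY_linear: "PY v (a + b) = PY v a + PY v b" "PY v (c *\<^sub>R a) = c *\<^sub>R PY v a" "PY v (\<Sum>i\<in>A. f i) = (\<Sum>i\<in>A. PY v (f i))" "PY v (- a) = - PY v a"
proof -
 show a: "PY v (a + b) = PY v a + PY v b" for a b
  by (simp add: PY_def inner_add_right scaleR_add_left scaleR_add_right scaleR_diff_right)
 show s: "PY v (c *\<^sub>R a) = c *\<^sub>R PY v a" for c a by (simp add: PY_def scaleR_diff_right mult_ac)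
 have "linear (PY v)" by (rule linearI) (auto simp: a s)
 then show "PY v (\<Sum>i\<in>A. f i) = (\<Sum>i\<in>A. PY v (f i))" by (rule linear_sum)
 show "PY v (- a) = - PY v a" using s[of "-1" a] by simp
qed

lemma vel0_pos: assumes "0 < \<kappa>" "0 <= r" shows "0 < vel0 \<kappa> r v" "(vel0 \<kappa> r v)\<^sup>2 = ang \<kappa> r powr (2 + 2 / \<kappa>) + v \<bullet> v"
proof -
 have "0 < ang \<kappa> r" using assms by (simp add: ang_def add_pos_nonneg)
 then have "0 < ang \<kappa> r powr (2 + 2 / \<kappa>)" by simp
 then have p: "0 < ang \<kappa> r powr (2 + 2 / \<kappa>) + v \<bullet> v" by (simp add: add_pos_nonneg)
 then show "0 < vel0 \<kappa> r v" "(vel0 \<kappa> r v)\<^sup>2 = ang \<kappa> r powr (2 + 2 / \<kappa>) + v \<bullet> v" by (simp_all add: vel0_def power2_norm_eq_inner)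
qed

text \<open>The rank-one part of the matrix G, expressed in y, contributes only through y.(Dy) y, and its
coefficient vanishes with the density.\<close>

lemma reduce_continuity:
 fixes v p :: "real ^ 'd" and V :: "'d => real ^ 'd"
 assumes \<kappa>: "0 < \<kappa>" and r: "0 <= r"
  and eq: "rt + (\<Sum>i\<in>UNIV. (v $ i / vel0 \<kappa> r v) *\<^sub>R p $ i) + r * (\<Sum>i\<in>UNIV. \<Sum>j\<in>UNIV. coeff_G \<kappa> r v i j * V i $ j)
    + r * coeff_a1 \<kappa> r v * (\<Sum>i\<in>UNIV. v $ i * p $ i) = 0"
 defines "y \<equiv> yv v" and "Y \<equiv> %j. PY v (V j)"
 shows "rt = - (1 + sc_t \<kappa> r (y \<bullet> y)) * (y \<bullet> p)
   - r * (sc_g \<kappa> r (y \<bullet> y) * (\<Sum>j\<in>UNIV. Y j $ j) + sc_h \<kappa> r (y \<bullet> y) * (\<Sum>j\<in>UNIV. y $ j * (Y j \<bullet> y)))"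
proof -
 define g where "g = ga v"
 define v0 where "v0 = vel0 \<kappa> r v"
 define D where "D = (\<Sum>j\<in>UNIV. Y j $ j)"
 define X where "X = (\<Sum>j\<in>UNIV. y $ j * (Y j \<bullet> y))"
 define Kc where "Kc = \<kappa> * ang \<kappa> r / (coeff_a0 \<kappa> r v * v0)"
 have g: "0 < g" by (simp add: g_def ga_pos)
 have v0: "0 < v0" using vel0_pos(1)[OF \<kappa> r] by (simp add: v0_def)
 have vi: "v $ i = g * y $ i" for i unfolding g_def y_def by (rule yv_nth)
 have v: "v = g *\<^sub>R y" by (simp add: g_def y_def v_eq[symmetric])
 have S1: "(\<Sum>i\<in>UNIV. (v $ i / v0) *\<^sub>R p $ i) = g / v0 * (y \<bullet> p)" by (simp add: vi inner_vec_def sum_distrib_left mult_ac)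
 have S3: "(\<Sum>i\<in>UNIV. v $ i * p $ i) = g * (y \<bullet> p)" by (simp add: vi inner_vec_def sum_distrib_left mult_ac)
 have Vi: "V i = g *\<^sub>R (Y i + (g\<^sup>2 * (y \<bullet> Y i)) *\<^sub>R y)" for i unfolding g_def Y_def y_def by (rule PY_inverse(2))
 have "g\<^sup>2 * (y \<bullet> y) = v \<bullet> v" unfolding y_def g_def yv_sq using ga_pos[of v] by simp
 then have ge: "1 + g\<^sup>2 * (y \<bullet> y) = g\<^sup>2" by (simp add: g_def ga_sq)
 have vV: "v \<bullet> V i = g ^ 4 * (Y i \<bullet> y)" for i
 proof -
  have "v \<bullet> V i = g * (g * ((y \<bullet> Y i) * (1 + g\<^sup>2 * (y \<bullet> y))))" unfolding v Vi[of i] by (simp add: inner_add_right algebra_simps)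
  then show ?thesis unfolding ge by (simp add: inner_commute power2_eq_square power4_eq_xxxx mult_ac)
 qed
 have G: "(\<Sum>i\<in>UNIV. \<Sum>j\<in>UNIV. coeff_G \<kappa> r v i j * V i $ j) = Kc * (g * D + g ^ 3 * X - g ^ 5 * X / v0\<^sup>2)"
 proof -
  have row: "(\<Sum>j\<in>UNIV. coeff_G \<kappa> r v i j * V i $ j) = Kc * (V i $ i - v $ i * (v \<bullet> V i) / v0\<^sup>2)" for i
  proof -
   have "coeff_G \<kappa> r v i j * V i $ j = Kc * ((if i = j then V i $ j else 0) - v $ i / v0\<^sup>2 * (v $ j * V i $ j))" for j
    by (simp add: coeff_G_def Kc_def v0_def algebra_simps)
   then have "(\<Sum>j\<in>UNIV. coeff_G \<kappa> r v i j * V i $ j) = Kc * ((\<Sum>j\<in>UNIV. if i = j then V i $ j else 0) - v $ i / v0\<^sup>2 * (\<Sum>j\<in>UNIV. v $ j * V i $ j))"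
    by (simp only: sum_distrib_left sum_subtractf right_diff_distrib)
   also have "... = Kc * (V i $ i - v $ i * (v \<bullet> V i) / v0\<^sup>2)" by (simp add: inner_vec_def)
   finally show ?thesis .
  qed
  have d: "V i $ i = g * Y i $ i + g ^ 3 * (y $ i * (Y i \<bullet> y))" for i
   by (subst Vi) (simp add: inner_commute algebra_simps power2_eq_square power3_eq_cube)
  have q: "v $ i * (v \<bullet> V i) / v0\<^sup>2 = g ^ 5 / v0\<^sup>2 * (y $ i * (Y i \<bullet> y))" for i
   unfolding vV vi by (simp add: mult_ac) (simp add: eval_nat_numeral)
  show ?thesis unfolding row unfolding q d by (simp add: D_def X_def sum_distrib_left sum_divide_distrib sum.distrib sum_subtractf algebra_simps)
 qed
 have e1: "sc_gam (y \<bullet> y) = g" by (simp add: y_def g_def yv_gam)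
 have e2: "sc_v0 \<kappa> r (y \<bullet> y) = v0" "sc_a0 \<kappa> r (y \<bullet> y) = coeff_a0 \<kappa> r v" "sc_a1 \<kappa> r (y \<bullet> y) = coeff_a1 \<kappa> r v"
  unfolding y_def v0_def by (rule sc_coeffs)+
 have t: "1 + sc_t \<kappa> r (y \<bullet> y) = g / v0 + r * (coeff_a1 \<kappa> r v * g)" by (simp add: sc_t_def sc_s_def e1 e2)
 have gg: "sc_g \<kappa> r (y \<bullet> y) = Kc * g" by (simp add: sc_g_def e1 e2 Kc_def)
 have A: "ang \<kappa> r powr (2 + 2 / \<kappa>) - 1 = v0\<^sup>2 - g\<^sup>2" using vel0_pos(2)[OF \<kappa> r, of v] ga_sq[of v] by (simp add: v0_def g_def)
 have h: "sc_h \<kappa> r (y \<bullet> y) = Kc * (g ^ 3 - g ^ 5 / v0\<^sup>2)"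
  unfolding sc_h_def e1 e2 gg A using v0 by (simp add: field_simps) (simp add: eval_nat_numeral algebra_simps)
 have "rt = - (g / v0 * (y \<bullet> p)) - r * (Kc * (g * D + g ^ 3 * X - g ^ 5 * X / v0\<^sup>2)) - r * coeff_a1 \<kappa> r v * (g * (y \<bullet> p))"
  using eq unfolding v0_def[symmetric] S1 S3 G by linarith
 then show ?thesis unfolding t gg h D_def[symmetric] X_def[symmetric] by (simp add: algebra_simps)
qed

lemma reduce_momentum:
 fixes v p vt :: "real ^ 'd" and V :: "'d => real ^ 'd"
 assumes \<kappa>: "0 < \<kappa>" and r: "0 <= r"
  and eq: "vt + (\<Sum>i\<in>UNIV. (v $ i / vel0 \<kappa> r v) *\<^sub>R V i) + coeff_a2 \<kappa> r v *\<^sub>R p = 0"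
 defines "y \<equiv> yv v" and "Y \<equiv> %j. PY v (V j)"
 shows "PY v vt = - ((1 + sc_s \<kappa> r (y \<bullet> y)) *\<^sub>R (\<Sum>j\<in>UNIV. y $ j *\<^sub>R Y j)) - sc_eta \<kappa> r (y \<bullet> y) *\<^sub>R (p - (y \<bullet> p) *\<^sub>R y)"
proof -
 have vi: "v $ i = ga v * y $ i" for i unfolding y_def by (rule yv_nth)
 have e1: "sc_gam (y \<bullet> y) = ga v" by (simp add: y_def yv_gam)
 have e2: "sc_v0 \<kappa> r (y \<bullet> y) = vel0 \<kappa> r v" unfolding y_def by (rule sc_coeffs)
 have "vt = - ((\<Sum>i\<in>UNIV. (v $ i / vel0 \<kappa> r v) *\<^sub>R V i) + coeff_a2 \<kappa> r v *\<^sub>R p)" using eq by (simp only: eq_neg_iff_add_eq_0 add.assoc)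
 then have "PY v vt = PY v (- ((\<Sum>i\<in>UNIV. (v $ i / vel0 \<kappa> r v) *\<^sub>R V i) + coeff_a2 \<kappa> r v *\<^sub>R p))" by (rule arg_cong)
 also have "... = - (\<Sum>i\<in>UNIV. (v $ i / vel0 \<kappa> r v) *\<^sub>R Y i) - coeff_a2 \<kappa> r v *\<^sub>R PY v p"
  by (simp only: PY_linear Y_def) simp
 also have "(\<Sum>i\<in>UNIV. (v $ i / vel0 \<kappa> r v) *\<^sub>R Y i) = (1 + sc_s \<kappa> r (y \<bullet> y)) *\<^sub>R (\<Sum>j\<in>UNIV. y $ j *\<^sub>R Y j)"
  by (simp add: sc_s_def e1 e2 scaleR_sum_right vi)
 also have "coeff_a2 \<kappa> r v *\<^sub>R PY v p = sc_eta \<kappa> r (y \<bullet> y) *\<^sub>R (p - (y \<bullet> p) *\<^sub>R y)"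
  unfolding sc_eta_def e1 e2 unfolding coeff_a2_def PY_def y_def by simp
 finally show ?thesis .
qed

lemma differentiable_axis:
 fixes f :: "real ^ 'd => 'b::real_normed_vector"
 assumes "f differentiable (at x)"
 shows "((%s. f (x + s *\<^sub>R axis j 1)) has_vector_derivative partial_deriv j f x) (at 0)"
proof -
 have f: "(f has_derivative frechet_derivative f (at x)) (at (x + 0 *\<^sub>R axis j 1))" using assms by (simp add: frechet_derivative_works)
 have l: "((%s. x + s *\<^sub>R axis j 1) has_derivative (%s. s *\<^sub>R axis j 1)) (at 0)" by (auto intro!: derivative_eq_intros)
 have lin: "linear (frechet_derivative f (at x))" using assms by (rule linear_frechet_derivative)
 show ?thesis unfolding has_vector_derivative_def partial_deriv_def
  using has_derivative_compose[OF l f] by (simp add: linear_scale[OF lin])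
qed

lemma grad_has_derivative:
 fixes f :: "real ^ 'd => real"
 assumes "f differentiable (at x)"
 shows "(f has_derivative (%h. grad f x \<bullet> h)) (at x)"
proof -
 have lin: "linear (frechet_derivative f (at x))" using assms by (rule linear_frechet_derivative)
 have "frechet_derivative f (at x) h = grad f x \<bullet> h" for h
 proof -
  have "frechet_derivative f (at x) h = frechet_derivative f (at x) (\<Sum>i\<in>UNIV. h $ i *\<^sub>R axis i 1)" 
   using basis_expansion[of h] by (simp add: scalar_mult_eq_scaleR)
  also have "... = (\<Sum>i\<in>UNIV. h $ i * partial_deriv i f x)" by (simp add: linear_sum[OF lin] linear_scale[OF lin] partial_deriv_def)
  also have "... = grad f x \<bullet> h" by (simp add: inner_vec_def grad_def mult.commute)
  finally show ?thesis .
 qed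
 then have "frechet_derivative f (at x) = (%h. grad f x \<bullet> h)" by blast
 then show ?thesis using assms by (metis frechet_derivative_works)
qed

section \<open>From local to global uniqueness\<close>

lemma reduced_flow_time_lipschitz:
 assumes f: "reduced_flow \<kappa> b L t0 t1 r y rt yt p Y" and t: "t \<in> {t0..t1}" and L: "0 <= L"
 shows "abs (r t x - r t0 x) <= L * (t - t0)"
proof (rule lipschitz_of_positive_part)
 show "t0 <= t" "0 <= L" using t L by auto
 show "continuous_on {t0..t} (%t. r t x)" using reduced_flow_bounds(4)[OF f t, of x] by (rule continuous_on_subset) (use t in auto)
 show "0 <= r s x" if "s \<in> {t0..t}" for s using reduced_flow_bounds(2)[OF f, of s x] that t by auto
 fix s assume s: "t0 < s" "s < t" "0 < r s x"
 have s': "s \<in> {t0..t1}" using s t by auto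
 have "at s within {t0..t1} = at s" using s t by (intro at_within_Icc_at) auto
 then show "\<exists>D. ((%t. r t x) has_real_derivative D) (at s) & abs D <= L"
  using reduced_flowD(3,7)[OF f s' s(3)] by auto
qed

lemma sum_Basis_axis:
 fixes f :: "real ^ 'd => real"
 shows "(\<Sum>e\<in>Basis. f e) = (\<Sum>j\<in>UNIV. f (axis j 1))"
proof -
 have "(Basis :: (real ^ 'd) set) = range (%j. axis j 1)" by (auto simp: Basis_vec_def)
 moreover have "inj (%j. axis j 1 :: real ^ 'd)" by (auto simp: inj_on_def axis_eq_axis)
 ultimately show ?thesis using sum.reindex[of "%j. axis j 1 :: real ^ 'd" UNIV f] by (simp add: o_def)
qed

text \<open>The field N is built from the common initial density. Both densities change by at most L \<tau> in a
time \<tau>, and so do their Steklov averages, so N remains transversal to both boundaries for a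
time that depends only on the constants.\<close>

lemma local_uniqueness:
 assumes \<kappa>: "0 < \<kappa>" and b: "0 <= b" "b < 1" and L: "0 <= L" and C: "1 <= C" and K: "0 <= K"
 shows "\<exists>\<tau>>0. \<forall>t0 t1 r1 r2 (y1 :: real => real ^ 'd => real ^ 'd) y2 rt1 rt2 yt1 yt2 p1 p2 Y1 Y2.
  t0 < t1 & t1 - t0 <= \<tau> & reduced_flow \<kappa> b L t0 t1 r1 y1 rt1 yt1 p1 Y1 & reduced_flow \<kappa> b L t0 t1 r2 y2 rt2 yt2 p2 Y2 &
  (\<forall>t\<in>{t0..t1}. vacuum_profile C K (1 / \<kappa>) (r1 t) (p1 t) & vacuum_profile C K (1 / \<kappa>) (r2 t) (p2 t)) &
  (\<forall>x. r1 t0 x = r2 t0 x & (0 < r1 t0 x --> y1 t0 x = y2 t0 x)) -->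
  (\<forall>t\<in>{t0..t1}. \<forall>x. r1 t x = r2 t x & (0 < r1 t x --> y1 t x = y2 t x))"
proof -
 have B: "0 <= 1 / \<kappa>" using \<kappa> by simp
 obtain h \<rho> c where h: "0 < h" and \<rho>: "0 < \<rho>" and c: "0 < c" and tr: "!!(r :: real ^ 'd => real) p x. vacuum_profile C K (1 / \<kappa>) r p ==> 0 < r x ==> r x <= \<rho> ==>
   c <= (\<Sum>e\<in>Basis. (p x \<bullet> e) * stek h r e x)" using transversal_field_exists[OF C K B] by blast
 define d where "d = real CARD('d)"
 have d: "0 <= d" by (simp add: d_def)
 \<comment> \<open>During this time the change of the Steklov averages uses up at most half of the transversality.\<close>
 define \<tau> where "\<tau> = c / (4 * d * L\<^sup>2 * h + 1)"
 have den: "0 < 4 * d * L\<^sup>2 * h + 1" using d h by (simp add: add_nonneg_pos)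
 have \<tau>: "0 < \<tau>" using c den by (simp add: \<tau>_def)
 have \<tau>2: "d * (L * (2 * (L * \<tau>) * h)) <= c / 2"
 proof -
  have "(4 * d * L\<^sup>2 * h + 1) * \<tau> = c" using den by (simp add: \<tau>_def)
  then have "4 * d * L\<^sup>2 * h * \<tau> <= c" using \<tau> by (simp add: algebra_simps)
  then show ?thesis by (simp add: power2_eq_square mult_ac)
 qed
 show ?thesis
 proof (rule exI[of _ \<tau>], rule conjI[OF \<tau>], intro allI impI)
  fix t0 t1 :: real and r1 r2 and y1 y2 :: "real => real ^ 'd => real ^ 'd" and rt1 rt2 yt1 yt2 p1 p2 Y1 Y2
  assume H: "t0 < t1 & t1 - t0 <= \<tau> & reduced_flow \<kappa> b L t0 t1 r1 y1 rt1 yt1 p1 Y1 & reduced_flow \<kappa> b L t0 t1 r2 y2 rt2 yt2 p2 Y2 &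
  (\<forall>t\<in>{t0..t1}. vacuum_profile C K (1 / \<kappa>) (r1 t) (p1 t) & vacuum_profile C K (1 / \<kappa>) (r2 t) (p2 t)) &
  (\<forall>x. r1 t0 x = r2 t0 x & (0 < r1 t0 x --> y1 t0 x = y2 t0 x))"
  then have t01: "t0 < t1" and dt: "t1 - t0 <= \<tau>" and f1: "reduced_flow \<kappa> b L t0 t1 r1 y1 rt1 yt1 p1 Y1" and f2: "reduced_flow \<kappa> b L t0 t1 r2 y2 rt2 yt2 p2 Y2"
   and v1: "!!t. t \<in> {t0..t1} ==> vacuum_profile C K (1 / \<kappa>) (r1 t) (p1 t)" and v2: "!!t. t \<in> {t0..t1} ==> vacuum_profile C K (1 / \<kappa>) (r2 t) (p2 t)"
   and i1: "!!x. r1 t0 x = r2 t0 x" and i2: "!!x. 0 < r1 t0 x ==> y1 t0 x = y2 t0 x" by blast+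
  have s0: "t0 \<in> {t0..t1}" using t01 by simp
  define r0 where "r0 = r1 t0"
  have r0': "r0 = r2 t0" using i1 by (auto simp: r0_def)
  have cont0: "continuous_on UNIV r0" unfolding r0_def by (rule reduced_flow_bounds(1)[OF f1 s0])
  have b0: "0 <= r0 x" "r0 x <= 1 / \<kappa>" for x unfolding r0_def by (rule reduced_flow_bounds(2)[OF f1 s0], rule reduced_flow_bounds(3)[OF f1 s0])
  define N where "N j x = stek h r0 (axis j 1) x" for j and x :: "real ^ 'd"
  define N' where "N' j x = r0 (x + h *\<^sub>R axis j 1) + r0 (x - h *\<^sub>R axis j 1) - 2 * r0 x" for j and x :: "real ^ 'd"
  define NB where "NB = 2 * (1 / \<kappa>) * h + 2 * (1 / \<kappa>)"
  have Nd: "((%s. N j (x + s *\<^sub>R axis j 1)) has_real_derivative N' j x) (at 0)" for j x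
   unfolding N_def N'_def by (rule stek_deriv[OF cont0 h])
  have NBd: "abs (N j x) <= NB" for j x
  proof -
   have "abs (N j x) <= 2 * (1 / \<kappa>) * h" unfolding N_def by (rule stek_bound[OF cont0]) (use b0 h in auto)
   then show ?thesis unfolding NB_def using B by linarith
  qed
  have NB'd: "abs (N' j x) <= NB" for j x
  proof -
   have "abs (N' j x) <= 2 * (1 / \<kappa>)" unfolding N'_def using b0[of "x + h *\<^sub>R axis j 1"] b0[of "x - h *\<^sub>R axis j 1"] b0[of x] by linarith
   moreover have "0 <= 2 * (1 / \<kappa>) * h" using B h by simp
   ultimately show ?thesis unfolding NB_def by linarith
  qed
  define G where "G = grad_bound C K (1 / \<kappa>)"
  have vp0: "vacuum_profile C K (1 / \<kappa>) r0 (p1 t0)" unfolding r0_def by (rule v1[OF s0])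
  have lip0: "abs (r0 y - r0 x) <= G * norm (y - x)" for x y unfolding G_def by (rule r_lipschitz[OF vp0 C K B])
  have G: "0 <= G" unfolding G_def by (rule grad_bound_nonneg[OF vp0 C K B])
  have Nc: "continuous_on UNIV (N j)" for j
  proof (rule lipschitz_on_continuous_on[of "2 * G * h"], rule lipschitz_onI)
   fix x x'
   have "abs (stek h r0 (axis j 1) x - stek h r0 (axis j 1) x') <= 2 * (G * norm (x - x')) * h"
   proof (rule stek_diff[OF cont0 cont0])
    fix s assume "s \<in> {0..h}"
    show "abs (r0 (x + s *\<^sub>R axis j 1) - r0 (x' + s *\<^sub>R axis j 1)) <= G * norm (x - x') & abs (r0 (x - s *\<^sub>R axis j 1) - r0 (x' - s *\<^sub>R axis j 1)) <= G * norm (x - x')"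
     using lip0[of "x + s *\<^sub>R axis j 1" "x' + s *\<^sub>R axis j 1"] lip0[of "x - s *\<^sub>R axis j 1" "x' - s *\<^sub>R axis j 1"] by simp
   qed (use h in simp)
   then show "dist (N j x) (N j x') <= 2 * G * h * dist x x'" by (simp add: N_def dist_norm mult_ac)
  qed (use G h in simp)
  have trans: "c / 2 <= (\<Sum>j\<in>UNIV. p t x $ j * N j x)"
   if f: "reduced_flow \<kappa> b L t0 t1 r y rt yt p Y" and vp: "vacuum_profile C K (1 / \<kappa>) (r t) (p t)" and e: "r t0 = r0"
    and t: "t \<in> {t0..t1}" and x: "0 < r t x" "r t x <= \<rho>" for r rt Y t x and y yt p :: "real => real ^ 'd => real ^ 'd"
  proof -
   have close: "abs (r t z - r0 z) <= L * \<tau>" for z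
   proof -
    have "abs (r t z - r0 z) <= L * (t - t0)" using reduced_flow_time_lipschitz[OF f t L, of z] by (simp add: e)
    also have "... <= L * \<tau>" using dt t L by (intro mult_left_mono) auto
    finally show ?thesis .
   qed
   have sd: "abs (stek h (r t) (axis j 1) x - N j x) <= 2 * (L * \<tau>) * h" for j
    unfolding N_def by (rule stek_diff[OF reduced_flow_bounds(1)[OF f t] cont0]) (use h close in auto)
   have pj: "abs (p t x $ j) <= L" for j using component_le_norm_cart[of "p t x" j] reduced_flowD(9)[OF f t x(1)] by linarith
   have "abs (p t x $ j * (stek h (r t) (axis j 1) x - N j x)) <= L * (2 * (L * \<tau>) * h)" for j
    unfolding abs_mult using pj sd L by (intro mult_mono) auto
   then have "(\<Sum>j\<in>UNIV. p t x $ j * (stek h (r t) (axis j 1) x - N j x)) <= (\<Sum>j\<in>(UNIV :: 'd set). L * (2 * (L * \<tau>) * h))"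
    by (intro sum_mono) (meson abs_le_D1)
   also have "... = d * (L * (2 * (L * \<tau>) * h))" by (simp add: d_def)
   also have "... <= c / 2" by (rule \<tau>2)
   finally have 1: "(\<Sum>j\<in>UNIV. p t x $ j * (stek h (r t) (axis j 1) x - N j x)) <= c / 2" .
   have "c <= (\<Sum>j\<in>UNIV. p t x $ j * stek h (r t) (axis j 1) x)"
    using tr[OF vp x] unfolding sum_Basis_axis by (simp add: inner_axis)
   also have "... = (\<Sum>j\<in>UNIV. p t x $ j * (stek h (r t) (axis j 1) x - N j x)) + (\<Sum>j\<in>UNIV. p t x $ j * N j x)"
    by (simp add: sum.distrib[symmetric] algebra_simps)
   finally show ?thesis using 1 by linarith
  qed
  interpret fp: flow_pair \<kappa> "1 / (2 * \<kappa>)" b L t0 t1 "c / 2" \<rho> NB r1 r2 y1 y2 rt1 rt2 yt1 yt2 p1 p2 Y1 Y2 N N'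
  proof
   show "0 < \<kappa>" "0 < 1 / (2 * \<kappa>)" "\<kappa> = 1 / (2 * (1 / (2 * \<kappa>)))" "0 <= b" "b < 1" "0 <= L" "t0 < t1" "0 < c / 2" "0 < \<rho>"
    using \<kappa> b L t01 c \<rho> by auto
   show "reduced_flow \<kappa> b L t0 t1 r1 y1 rt1 yt1 p1 Y1" "reduced_flow \<kappa> b L t0 t1 r2 y2 rt2 yt2 p2 Y2" by (rule f1, rule f2)
   show "abs (N j x) <= NB" "abs (N' j x) <= NB" "continuous_on UNIV (N j)" "((%s. N j (x + s *\<^sub>R axis j 1)) has_real_derivative N' j x) (at 0)" for j x
    by (rule NBd, rule NB'd, rule Nc, rule Nd)
   show "c / 2 <= (\<Sum>j\<in>UNIV. p1 t x $ j * N j x)" if "t \<in> {t0..t1}" "0 < r1 t x" "r1 t x <= \<rho>" for t x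
    by (rule trans[OF f1 v1[OF that(1)] _ that]) (simp add: r0_def)
   show "c / 2 <= (\<Sum>j\<in>UNIV. p2 t x $ j * N j x)" if "t \<in> {t0..t1}" "0 < r2 t x" "r2 t x <= \<rho>" for t x
    by (rule trans[OF f2 v2[OF that(1)] _ that]) (simp add: r0')
  qed
  show "\<forall>t\<in>{t0..t1}. \<forall>x. r1 t x = r2 t x & (0 < r1 t x --> y1 t x = y2 t x)"
   using fp.unique[OF i1 i2] by blast
 qed
qed

text \<open>One constant B for all bounds, monotone in B, so that it can be chosen for two solutions at once.\<close>

definition bounded_solution where
 "bounded_solution \<kappa> T T' B r v \<longleftrightarrow> is_solution \<kappa> T r v & T' \<in> {0..<T} & (\<forall>t\<in>{0..T'}. vacuum_profile B B (1 / \<kappa>) (r t) (grad (r t)) &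
  (\<forall>x :: real ^ 'd. 0 < r t x --> norm (v t x) <= B & (\<forall>i. norm (partial_deriv i (v t) x) <= B)))"

lemma solution_bounds:
 assumes \<kappa>: "0 < \<kappa>" and sol: "is_solution \<kappa> T r v" and v: "velocity_C1 T r v" and g: "gradient_tilde_C_half T r" and T': "T' \<in> {0..<T}"
 shows "\<exists>B0. \<forall>B\<ge>B0. bounded_solution \<kappa> T T' B r v"
proof -
 have sub: "t \<in> {0..<T}" if "t \<in> {0..T'}" for t using that T' by auto
 define M where "M = (SUP t\<in>{0..T'}. C1_norm (fluid_domain r t) (v t))"
 have M: "M < \<infinity>" using v T' unfolding velocity_C1_def M_def by blast
 define V where "V = enn2real M"
 have VM: "ennreal V = M" unfolding V_def using M by simp
 have V0: "0 <= V" by (simp add: V_def)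
 have C1: "C1_norm (fluid_domain r t) (v t) <= ennreal V" if "t \<in> {0..T'}" for t
  unfolding VM M_def using that by (intro SUP_upper)
 have vb: "norm (v t x) <= V" "norm (partial_deriv i (v t) x) <= V" if t: "t \<in> {0..T'}" and x: "0 < r t x" for t x i
 proof -
  have xd: "x \<in> fluid_domain r t" using x by (simp add: fluid_domain_def)
  have "ennreal (norm (v t x)) <= (SUP x\<in>fluid_domain r t. ennreal (norm (v t x)))" using xd by (intro SUP_upper)
  also have "... <= C1_norm (fluid_domain r t) (v t)" unfolding C1_norm_def by simp
  finally have "ennreal (norm (v t x)) <= ennreal V" using C1[OF t] by (rule order_trans)
  then show "norm (v t x) <= V" using V0 by simp
  have "ennreal (norm (partial_deriv i (v t) x)) <= (SUP x\<in>fluid_domain r t. ennreal (norm (partial_deriv i (v t) x)))" using xd by (intro SUP_upper)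
  also have "... <= (\<Sum>i\<in>UNIV. SUP x\<in>fluid_domain r t. ennreal (norm (partial_deriv i (v t) x)))" by (rule member_le_sum) auto
  also have "... <= C1_norm (fluid_domain r t) (v t)" unfolding C1_norm_def by simp
  finally have "ennreal (norm (partial_deriv i (v t) x)) <= ennreal V" using C1[OF t] by (rule order_trans)
  then show "norm (partial_deriv i (v t) x) <= V" using V0 by simp
 qed
 define H where "H = (SUP t\<in>{0..T'}. tilde_C_half_seminorm (fluid_domain r t) (r t) (grad (r t)))"
 have H: "H < \<infinity>" using g T' unfolding gradient_tilde_C_half_def H_def by blast
 define K where "K = enn2real H"
 have KH: "ennreal K = H" unfolding K_def using H by simp
 have K0: "0 <= K" by (simp add: K_def)
 have hol: "norm (grad (r t) x - grad (r t) y) <= K * (sqrt (r t x) + sqrt (r t y) + sqrt (norm (x - y)))"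
  if t: "t \<in> {0..T'}" and xy: "0 < r t x" "0 < r t y" for t x y
 proof -
  define D where "D = sqrt (r t x) + sqrt (r t y) + sqrt (norm (x - y))"
  have D: "0 < D" using xy by (simp add: D_def add_pos_nonneg add_pos_pos)
  have "ennreal (norm (grad (r t) x - grad (r t) y) / D) <= tilde_C_half_seminorm (fluid_domain r t) (r t) (grad (r t))"
   unfolding tilde_C_half_seminorm_def D_def
   by (rule SUP_upper2[of "(x, y)"]) (use xy in \<open>auto simp: fluid_domain_def\<close>)
  also have "... <= H" unfolding H_def using t by (intro SUP_upper)
  finally have "norm (grad (r t) x - grad (r t) y) / D <= K" unfolding KH[symmetric] using K0 by simp
  then show ?thesis using D by (simp add: D_def[symmetric] pos_divide_le_eq)
 qed
 obtain C0 where C0: "0 < C0" "!!t x. t \<in> {0..T'} ==> x \<in> fluid_domain r t ==>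
    r t x <= C0 * infdist x (free_boundary r t) & infdist x (free_boundary r t) <= C0 * r t x"
  using sol T' unfolding is_solution_def physical_vacuum_def by meson
 have vp: "vacuum_profile B B (1 / \<kappa>) (r t) (grad (r t))" if t: "t \<in> {0..T'}" and B: "K <= B" "C0 <= B" for t B
 proof -
  have ct: "continuous_on ({0..<T} \<times> UNIV) (%(t, x). r t x)" using sol by (simp add: is_solution_def)
  have "continuous_on UNIV (%x. case (t, x) of (t, x) => r t x)"
   by (rule continuous_on_compose2[OF ct]) (use sub[OF t] in \<open>auto intro!: continuous_intros\<close>)
  then have c: "continuous_on UNIV (r t)" by simp
  have rbd: "0 <= r t x" "r t x <= 1 / \<kappa>" for x
   using sol sub[OF t] \<kappa> unfolding is_solution_def by (auto simp: zero_le_mult_iff field_simps less_imp_le dest!: bspec[of _ _ t] spec[of _ x])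
  have df: "(r t has_derivative (%h. grad (r t) x \<bullet> h)) (at x)" if "0 < r t x" for x
   using sol sub[OF t] that unfolding is_solution_def fluid_domain_def by (intro grad_has_derivative) auto
  have d: "r t x <= B * infdist x (frontier {x. 0 < r t x})" "infdist x (frontier {x. 0 < r t x}) <= B * r t x" if "0 < r t x" for x
   using C0(2)[OF t, of x] that mult_right_mono[OF B(2) infdist_nonneg] mult_right_mono[OF B(2), of "r t x"]
   unfolding fluid_domain_def free_boundary_def by (auto intro: order_trans)
  have h: "norm (grad (r t) x - grad (r t) y) <= B * (sqrt (r t x) + sqrt (r t y) + sqrt (norm (x - y)))" if "0 < r t x" "0 < r t y" for x y
   using that by (intro order_trans[OF hol[OF t that]] mult_right_mono B) (auto intro!: add_nonneg_nonneg)
  show ?thesis unfolding vacuum_profile_def using c rbd df h d by blast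
 qed
 have "bounded_solution \<kappa> T T' B r v" if "V + K + C0 <= B" for B
 proof -
  have le: "V <= B" "K <= B" "C0 <= B" using that V0 K0 C0(1) by linarith+
  show ?thesis unfolding bounded_solution_def
   using sol T' vp[OF _ le(2,3)] order_trans[OF vb(1) le(1)] order_trans[OF vb(2) le(1)] by blast
 qed
 then show ?thesis by blast
qed

abbreviation (input) solution_flow where
 "solution_flow \<kappa> B L T r v t0 t1 \<equiv> reduced_flow \<kappa> (B\<^sup>2 / (1 + B\<^sup>2)) L t0 t1 r (%t x. yv (v t x)) (time_deriv T r)
  (%t x. PY (v t x) (time_deriv T v t x)) (%t x. grad (r t) x) (%t j x. PY (v t x) (partial_deriv j (v t) x))"

text \<open>The time derivatives are bounded because the equations express them by the spatial derivatives.\<close>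

lemma solution_reduced:
 assumes \<kappa>: "0 < \<kappa>" and V: "1 <= V"
 shows "\<exists>L\<ge>0. \<forall>T T' t0 t1 r (v :: real => real ^ 'd => real ^ 'd).
  bounded_solution \<kappa> T T' V r v & 0 <= t0 & t0 < t1 & t1 <= T' --> solution_flow \<kappa> V L T r v t0 t1"
proof -
 define b where "b = V\<^sup>2 / (1 + V\<^sup>2)"
 have vpos: "0 < 1 + V\<^sup>2" by (simp add: add_pos_nonneg)
 have b: "0 <= b" "b < 1" using vpos by (auto simp: b_def)
 have B: "0 <= 1 / \<kappa>" using \<kappa> by simp
 define G where "G = grad_bound V V (1 / \<kappa>)"
 define dY where "dY = real CARD('d) * (2 * V)"
 have dY: "0 <= dY" using V by (simp add: dY_def)
 have G: "0 <= G" using V B by (simp add: G_def grad_bound_def)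
 obtain K1 where K1: "0 <= K1" "\<forall>r e. in_range \<kappa> b r e --> abs (sc_t \<kappa> r e) <= K1" using nice_bounded[OF nice_t[OF \<kappa> b]] by blast
 obtain K2 where K2: "0 <= K2" "\<forall>r e. in_range \<kappa> b r e --> abs (sc_g \<kappa> r e) <= K2" using nice_bounded[OF nice_g[OF \<kappa> b]] by blast
 obtain K3 where K3: "0 <= K3" "\<forall>r e. in_range \<kappa> b r e --> abs (sc_h \<kappa> r e) <= K3" using nice_bounded[OF nice_h[OF \<kappa> b]] by blast
 obtain K4 where K4: "0 <= K4" "\<forall>r e. in_range \<kappa> b r e --> abs (sc_s \<kappa> r e) <= K4" using nice_bounded[OF nice_s[OF \<kappa> b]] by blast
 obtain K5 where K5: "0 <= K5" "\<forall>r e. in_range \<kappa> b r e --> abs (sc_eta \<kappa> r e) <= K5" using nice_bounded[OF nice_eta[OF \<kappa> b]] by blast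
 define L1 where "L1 = (1 + K1) * G + (1 / \<kappa>) * (K2 * dY + K3 * dY)"
 define L2 where "L2 = (1 + K4) * dY + K5 * (2 * G)"
 define L where "L = L1 + L2 + G + 2 * V"
 have L12: "0 <= L1" "0 <= L2" unfolding L1_def L2_def using K1 K2 K3 K4 K5 G dY B by (auto intro!: add_nonneg_nonneg mult_nonneg_nonneg)
 have L: "L1 <= L" "L2 <= L" "G <= L" "2 * V <= L" "0 <= L" using L12 G V by (auto simp: L_def)
 have "solution_flow \<kappa> V L T r v t0 t1" if bs: "bounded_solution \<kappa> T T' V r v" and tt: "0 <= t0" "t0 < t1" "t1 <= T'"
  for T T' t0 t1 r and v :: "real => real ^ 'd => real ^ 'd"
 proof -
  have sol: "is_solution \<kappa> T r v" and T': "T' \<in> {0..<T}" and vp: "!!t. t \<in> {0..T'} ==> vacuum_profile V V (1 / \<kappa>) (r t) (grad (r t))"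
   and vb: "!!t x. t \<in> {0..T'} ==> 0 < r t x ==> norm (v t x) <= V & (\<forall>i. norm (partial_deriv i (v t) x) <= V)"
   using bs unfolding bounded_solution_def by auto
  have ct: "continuous_on ({0..<T} \<times> UNIV) (%(t, x). r t x)" using sol by (simp add: is_solution_def)
  have "continuous_on {t0..t1} (%t. case (t, x) of (t, x) => r t x)" for x
   by (rule continuous_on_compose2[OF ct]) (use tt T' in \<open>auto intro!: continuous_intros\<close>)
  then have rc: "continuous_on {t0..t1} (%t. r t x)" for x by simp
  have sub: "{t0..t1} \<subseteq> {0..<T}" using tt T' by auto
  have fl: "flow_at \<kappa> b L {t0..t1} r (%t x. yv (v t x)) (time_deriv T r) (%t x. PY (v t x) (time_deriv T v t x)) (%t x. grad (r t) x)
    (%t j x. PY (v t x) (partial_deriv j (v t) x)) t x" if "t \<in> {t0..t1}" and x: "0 < r t x" for t x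
  proof -
   have t: "t \<in> {0..T'}" "t \<in> {0..<T}" using tt T' that(1) by auto
   have xd: "x \<in> fluid_domain r t" using x by (simp add: fluid_domain_def)
   have dr: "r t differentiable (at x)" and dv: "v t differentiable (at x)" and tr: "(%s. r s x) differentiable (at t within {0..<T})"
    and tv: "(%s. v s x) differentiable (at t within {0..<T})" and ce: "continuity_eq \<kappa> T r v t x" and me: "momentum_eq \<kappa> T r v t x"
    using sol t(2) xd unfolding is_solution_def by blast+
   define a where "a = yv (v t x)"
   define Y where "Y j = PY (v t x) (partial_deriv j (v t) x)" for j
   define P where "P = grad (r t) x"
   have rbd: "0 <= r t x" "r t x <= 1 / \<kappa>" using vp[OF t(1)] by (auto simp: vacuum_profile_def)
   have ab: "a \<bullet> a <= b" unfolding a_def b_def by (rule yv_le) (use vb[OF t(1) x] in simp)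
   have a1: "norm a <= 1" using ab b by (simp add: norm_eq_sqrt_inner)
   have PG: "norm P <= G" unfolding P_def G_def by (rule gradient_bounded[OF vp[OF t(1)] V _ B x]) (use V in simp)
   have YV: "norm (Y j) <= 2 * V" for j
    using PY_norm[of "v t x" "partial_deriv j (v t) x"] vb[OF t(1) x] unfolding Y_def by (smt (verit))
   have eqr: "time_deriv T r t x = - (1 + sc_t \<kappa> (r t x) (a \<bullet> a)) * (a \<bullet> P)
     - r t x * (sc_g \<kappa> (r t x) (a \<bullet> a) * (\<Sum>j\<in>UNIV. Y j $ j) + sc_h \<kappa> (r t x) (a \<bullet> a) * (\<Sum>j\<in>UNIV. a $ j * (Y j \<bullet> a)))"
    unfolding a_def Y_def P_def
    by (rule reduce_continuity[OF \<kappa> rbd(1)]) (use ce in \<open>simp add: continuity_eq_def material_deriv_def grad_def\<close>)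
   have "time_deriv T v t x + (\<Sum>i\<in>UNIV. (v t x $ i / vel0 \<kappa> (r t x) (v t x)) *\<^sub>R partial_deriv i (v t) x) + coeff_a2 \<kappa> (r t x) (v t x) *\<^sub>R grad (r t) x = 0"
    using me by (simp add: momentum_eq_def material_deriv_def grad_def vec_eq_iff)
   from reduce_momentum[OF \<kappa> rbd(1) this]
   have eqv: "PY (v t x) (time_deriv T v t x) = - ((1 + sc_s \<kappa> (r t x) (a \<bullet> a)) *\<^sub>R (\<Sum>j\<in>UNIV. a $ j *\<^sub>R Y j)) - sc_eta \<kappa> (r t x) (a \<bullet> a) *\<^sub>R (P - (a \<bullet> P) *\<^sub>R a)"
    by (simp add: a_def Y_def P_def)
   have e0: "0 <= a \<bullet> a" by simp
   have aP: "abs (a \<bullet> P) <= G" using Cauchy_Schwarz_ineq2[of a P] mult_mono[OF a1 PG] by simp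
   have aj: "abs (a $ j) <= 1" "abs (Y j $ j) <= 2 * V" for j using component_le_norm_cart[of a j] component_le_norm_cart[of "Y j" j] a1 YV[of j] by auto
   have Ya: "abs (Y j \<bullet> a) <= 2 * V" for j using Cauchy_Schwarz_ineq2[of "Y j" a] mult_mono[OF YV[of j] a1] V by simp
   have s1: "abs (\<Sum>j\<in>UNIV. Y j $ j) <= dY"
    unfolding dY_def by (rule order_trans[OF sum_abs]) (rule sum_bounded_above, rule aj)
   have s2: "abs (\<Sum>j\<in>UNIV. a $ j * (Y j \<bullet> a)) <= dY"
    unfolding dY_def by (rule order_trans[OF sum_abs]) (rule sum_bounded_above, use abs_mult_le[OF aj(1) Ya] in simp)
   have s3: "norm (\<Sum>j\<in>UNIV. a $ j *\<^sub>R Y j) <= dY"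
    unfolding dY_def by (rule order_trans[OF norm_sum]) (rule sum_bounded_above, use mult_mono[OF aj(1) YV] in simp)
   have Lr: "abs (time_deriv T r t x) <= L"
   proof -
    have "abs (1 + sc_t \<kappa> (r t x) (a \<bullet> a)) <= 1 + K1" using K1(2)[rule_format, of "r t x" "a \<bullet> a"] rbd ab by simp
    then have 1: "abs ((1 + sc_t \<kappa> (r t x) (a \<bullet> a)) * (a \<bullet> P)) <= (1 + K1) * G" by (rule abs_mult_le[OF _ aP])
    have 2: "abs (sc_g \<kappa> (r t x) (a \<bullet> a) * (\<Sum>j\<in>UNIV. Y j $ j)) <= K2 * dY" using K2(2) rbd ab by (intro abs_mult_le s1) auto
    have 3: "abs (sc_h \<kappa> (r t x) (a \<bullet> a) * (\<Sum>j\<in>UNIV. a $ j * (Y j \<bullet> a))) <= K3 * dY" using K3(2) rbd ab by (intro abs_mult_le s2) auto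
    have "abs (sc_g \<kappa> (r t x) (a \<bullet> a) * (\<Sum>j\<in>UNIV. Y j $ j) + sc_h \<kappa> (r t x) (a \<bullet> a) * (\<Sum>j\<in>UNIV. a $ j * (Y j \<bullet> a))) <= K2 * dY + K3 * dY" using 2 3 by linarith
    then have 4: "abs (r t x * (sc_g \<kappa> (r t x) (a \<bullet> a) * (\<Sum>j\<in>UNIV. Y j $ j) + sc_h \<kappa> (r t x) (a \<bullet> a) * (\<Sum>j\<in>UNIV. a $ j * (Y j \<bullet> a)))) <= (1 / \<kappa>) * (K2 * dY + K3 * dY)"
     by (rule abs_mult_le[rotated]) (use rbd in simp)
    have "abs (time_deriv T r t x) <= L1" unfolding eqr L1_def using 1 4 by linarith
    then show ?thesis using L by linarith
   qed
   have Lv: "norm (PY (v t x) (time_deriv T v t x)) <= L"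
   proof -
    have "abs (1 + sc_s \<kappa> (r t x) (a \<bullet> a)) <= 1 + K4" using K4(2)[rule_format, of "r t x" "a \<bullet> a"] rbd ab by simp
    then have 1: "norm ((1 + sc_s \<kappa> (r t x) (a \<bullet> a)) *\<^sub>R (\<Sum>j\<in>UNIV. a $ j *\<^sub>R Y j)) <= (1 + K4) * dY"
     unfolding norm_scaleR using K4(1) by (intro mult_mono s3) auto
    have "norm ((a \<bullet> P) *\<^sub>R a) <= G * 1" unfolding norm_scaleR using aP a1 G by (intro mult_mono) auto
    then have "norm (P - (a \<bullet> P) *\<^sub>R a) <= 2 * G" using norm_triangle_ineq4[of P "(a \<bullet> P) *\<^sub>R a"] PG by linarith
    then have 2: "norm (sc_eta \<kappa> (r t x) (a \<bullet> a) *\<^sub>R (P - (a \<bullet> P) *\<^sub>R a)) <= K5 * (2 * G)"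
     unfolding norm_scaleR using K5 rbd ab by (intro mult_mono) auto
    have "norm (PY (v t x) (time_deriv T v t x)) <= L2" unfolding eqv L2_def
     by (rule order_trans[OF norm_triangle_ineq4]) (use 1 2 in simp)
    then show ?thesis using L by linarith
   qed
   have yc: "isCont (%x. yv (v t x)) x"
   proof -
    have "isCont (v t) x" using dv by (rule differentiable_imp_continuous_within)
    then show ?thesis unfolding yv_def ga_def
     by (intro continuous_intros) (use ga_pos[of "v t x"] in \<open>simp_all add: ga_def\<close>)
   qed
   have d1: "((%s. r s x) has_real_derivative time_deriv T r t x) (at t within {t0..t1})"
    unfolding has_real_derivative_iff_has_vector_derivative time_deriv_def
    by (rule has_vector_derivative_within_subset[OF _ sub]) (use tr in \<open>simp add: vector_derivative_works\<close>)
   have d2: "((%s. v s x) has_vector_derivative time_deriv T v t x) (at t within {t0..t1})"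
    unfolding time_deriv_def
    by (rule has_vector_derivative_within_subset[OF _ sub]) (use tv in \<open>simp add: vector_derivative_works\<close>)
   have d3: "((%s. r t (x + s *\<^sub>R axis j 1)) has_real_derivative grad (r t) x $ j) (at 0)" for j
    unfolding has_real_derivative_iff_has_vector_derivative using differentiable_axis[OF dr, of j] by (simp add: grad_def)
   have d4: "((%s. yv (v t (x + s *\<^sub>R axis j 1))) has_vector_derivative PY (v t x) (partial_deriv j (v t) x)) (at 0)" for j
    using yv_deriv[OF differentiable_axis[OF dv, of j]] by simp
   have LP: "norm P <= L" "norm (Y j) <= L" for j using PG YV[of j] L by auto
   show ?thesis unfolding flow_at_def
    unfolding a_def[symmetric] Y_def[symmetric] P_def[symmetric]
    by (intro conjI allI ab yc[folded a_def] d1 yv_deriv[OF d2] d3[folded P_def] d4[folded Y_def] Lr Lv LP eqr eqv)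
  qed
  show ?thesis using rc fl vp tt unfolding reduced_flow_def b_def[symmetric] vacuum_profile_def by simp
 qed
 then show ?thesis using L(5) by blast
qed

text \<open>Uniform bounds are available up to any time T' < T. They determine the length of the steps in which
uniqueness propagates from 0 to T'.\<close>

theorem theorem1p1:
 fixes \<kappa> T :: real
  and r_init :: "real ^ 'd \<Rightarrow> real" and v_init :: "real ^ 'd \<Rightarrow> real ^ 'd"
  and r1 r2 :: "real \<Rightarrow> real ^ 'd \<Rightarrow> real"
  and v1 v2 :: "real \<Rightarrow> real ^ 'd \<Rightarrow> real ^ 'd"
 assumes "\<kappa> > 0" and "T > 0"
  and "is_solution \<kappa> T r1 v1" and "has_initial_data r1 v1 r_init v_init"
  and "velocity_C1 T r1 v1" and "gradient_tilde_C_half T r1"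
  and "is_solution \<kappa> T r2 v2" and "has_initial_data r2 v2 r_init v_init"
  and "velocity_C1 T r2 v2" and "gradient_tilde_C_half T r2"
 shows "\<forall>t\<in>{0..<T}. (\<forall>x. r1 t x = r2 t x) \<and>
      fluid_domain r1 t = fluid_domain r2 t \<and>
      (\<forall>x\<in>fluid_domain r1 t. v1 t x = v2 t x)"
proof -
 define agree where "agree t \<longleftrightarrow> (\<forall>x. r1 t x = r2 t x & (0 < r1 t x --> yv (v1 t x) = yv (v2 t x)))" for t
 have init: "agree 0"
  using assms(4,8) unfolding agree_def has_initial_data_def fluid_domain_def by auto
 have main: "agree t" if t: "0 < t" "t < T" for t
 proof -
  define T' where "T' = t"
  have T': "T' \<in> {0..<T}" using t by (simp add: T'_def)
  obtain B1 B2 where B12: "!!B. B1 <= B ==> bounded_solution \<kappa> T T' B r1 v1" "!!B. B2 <= B ==> bounded_solution \<kappa> T T' B r2 v2"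
   using solution_bounds[OF assms(1,3,5,6) T'] solution_bounds[OF assms(1,7,9,10) T'] by blast
  define B where "B = max 1 (max B1 B2)"
  have B: "1 <= B" and bs: "bounded_solution \<kappa> T T' B r1 v1" "bounded_solution \<kappa> T T' B r2 v2" using B12 by (auto simp: B_def)
  obtain L where L: "0 <= L" and fl: "!!t0 t1 r (v :: real => real ^ 'd => real ^ 'd).
   bounded_solution \<kappa> T T' B r v ==> 0 <= t0 ==> t0 < t1 ==> t1 <= T' ==> solution_flow \<kappa> B L T r v t0 t1"
   using solution_reduced[OF assms(1) B] by blast
  define b where "b = B\<^sup>2 / (1 + B\<^sup>2)"
  have "0 < 1 + B\<^sup>2" by (simp add: add_pos_nonneg)
  then have con: "0 <= b" "b < 1" "0 <= B" using B by (auto simp: b_def)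
  note f1 = fl[OF bs(1), folded b_def] and f2 = fl[OF bs(2), folded b_def]
  have vp: "vacuum_profile B B (1 / \<kappa>) (r1 t) (grad (r1 t)) & vacuum_profile B B (1 / \<kappa>) (r2 t) (grad (r2 t))" if "t \<in> {0..T'}" for t
   using bs that unfolding bounded_solution_def by blast
  obtain \<tau> where \<tau>: "0 < \<tau>" and step: "!!t0 t1 r1 r2 (y1 :: real => real ^ 'd => real ^ 'd) y2 rt1 rt2 yt1 yt2 p1 p2 Y1 Y2.
  t0 < t1 & t1 - t0 <= \<tau> & reduced_flow \<kappa> b L t0 t1 r1 y1 rt1 yt1 p1 Y1 & reduced_flow \<kappa> b L t0 t1 r2 y2 rt2 yt2 p2 Y2 &
  (\<forall>t\<in>{t0..t1}. vacuum_profile B B (1 / \<kappa>) (r1 t) (p1 t) & vacuum_profile B B (1 / \<kappa>) (r2 t) (p2 t)) &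
  (\<forall>x. r1 t0 x = r2 t0 x & (0 < r1 t0 x --> y1 t0 x = y2 t0 x)) ==>
  (\<forall>t\<in>{t0..t1}. \<forall>x. r1 t x = r2 t x & (0 < r1 t x --> y1 t x = y2 t x))"
   using local_uniqueness[OF assms(1) con(1,2) L B con(3)] by blast
  have next_step: "agree s" if a: "agree t0" and t0: "0 <= t0" and s: "t0 <= s" "s - t0 <= \<tau>" "s <= T'" for t0 s
  proof (cases "t0 = s")
   case True then show ?thesis using a by simp
  next
   case False
   then have lt: "t0 < s" using s by simp
   have "\<forall>t\<in>{t0..s}. \<forall>x. r1 t x = r2 t x & (0 < r1 t x --> yv (v1 t x) = yv (v2 t x))"
    by (rule step, intro conjI, rule lt, rule s(2), rule f1[OF t0 lt s(3)], rule f2[OF t0 lt s(3)])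
     (use vp t0 s a in \<open>auto simp: agree_def\<close>)
   then show ?thesis using lt by (simp add: agree_def)
  qed
  have ind: "\<forall>s. 0 <= s & s <= T' & s <= real n * \<tau> --> agree s" for n
  proof (induction n)
   case 0
   show ?case using init by auto
  next
   case (Suc n)
   show ?case
   proof (intro allI impI)
    fix s assume s: "0 <= s & s <= T' & s <= real (Suc n) * \<tau>"
    \<comment> \<open>The start of the last step is truncated at the initial time.\<close>
    define t0 where "t0 = max 0 (s - \<tau>)"
    have "t0 <= real n * \<tau>" using s \<tau> by (auto simp: t0_def algebra_simps)
    moreover have "0 <= t0" "t0 <= s" "s - t0 <= \<tau>" using s \<tau> by (auto simp: t0_def)
    ultimately show "agree s" using next_step[of t0 s] Suc s by (auto simp: t0_def)
   qed
  qed
  obtain n where "T' < real n * \<tau>" using reals_Archimedean3[OF \<tau>] by blast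
  then show "agree t" using ind[of n] t by (auto simp: T'_def)
 qed
 show ?thesis
 proof
  fix t assume "t \<in> {0..<T}"
  then have a: "agree t" using init main[of t] by (cases "t = 0") auto
  have r: "r1 t x = r2 t x" for x using a by (simp add: agree_def)
  have "v1 t x = v2 t x" if "x \<in> fluid_domain r1 t" for x
   by (rule yv_inj) (use a that in \<open>simp add: agree_def fluid_domain_def\<close>)
  with r show "(\<forall>x. r1 t x = r2 t x) & fluid_domain r1 t = fluid_domain r2 t & (\<forall>x\<in>fluid_domain r1 t. v1 t x = v2 t x)"
   by (simp add: fluid_domain_def)
 qed
qed

end
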